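(* The strict 2-equivalence $\mathbf{PreCwA}\simeq\mathbf{PreNM}$ given by the strict 2-functors $P:\mathbf{PreCwA}\to\mathbf{PreNM}$ and $C:\mathbf{PreNM}\to\mathbf{PreCwA}$ restricts to a strict 2-equivalence $\mathbf{CwA}\simeq\mathbf{NM}$ between the strict 2-category of small categories with attributes and the strict 2-category of small natural models.
   Context: **Strict 2-equivalence**: strict 2-functors that are mutually inverse up to strict 2-natural isomorphism. **Display categories.** A display category $\mathbf{C}$ is a category (also denoted $\mathbf{C}$) with a class $\mathcal{D}_{\mathbf{C}}$ of morphisms, called displays, such that every display $p:E\to B$ has, along every $f:A\to B$, a pullback $f^*p:f^*E\to A$ that is a display, and $\mathcal{D}_{\mathbf{C}}$ is closed under composition with isomorphisms. A choice of such pullbacks is fixed. $\mathcal{D}_{\mathbf{C}}$ also denotes the $\mathbf{C}$-indexed category (pseudofunctor $\mathbf{C}^{\mathrm{op}}\to\mathbf{Cat}$) whose value at $A$ is the full subcategory of $\mathbf{C}/A$ on displays, with reindexing by chosen pullbacks; $(\mathcal{D}_\bullet)_{\mathbf{C}}(A)$ is the category of pairs $(p,s)$ of a display $p$ with codomain $A$ and a section $s$ of $p$, and $\varpi_{\mathbf{C}}:(\mathcal{D}_\bullet)_{\mathbf{C}}\to\mathcal{D}_{\mathbf{C}}$ is the forgetful $\mathbf{C}$-indexed functor. A display functor takes displays to displays and pullbacks of displays to pullbacks of displays; it induces $\mathcal{D}_F:\mathcal{D}_{\mathbf{C}}\to F^*\mathcal{D}_{\mathbf{D}}$, $p\mapsto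 Fp$. A natural transformation $\alpha:F\Rightarrow G$ induces $\mathcal{D}_\alpha:\mathcal{D}_F\Rightarrow\alpha^*\mathcal{D}_{\mathbf{D}}\circ\mathcal{D}_G$ with component at $p:E\to B$ the map $(\mathcal{D}_\alpha)_p:Fp\to(\alpha_B)^*(Gp)$ over $FB$ induced by $\alpha_E$ and $Fp$. **Pre-CwAs.** A small pre-CwA $\mathbf{C}$ is a small display category $\mathbf{C}$, a small strict $\mathbf{C}$-indexed category $\mathbf{Tp}_{\mathbf{C}}:\mathbf{C}^{\mathrm{op}}\to\mathbf{Cat}$ (strict functor), and a $\mathbf{C}$-indexed functor (pseudonatural) $\mathrm{comp}_{\mathbf{C}}:\mathbf{Tp}_{\mathbf{C}}\to\mathcal{D}_{\mathbf{C}}$, with pseudonaturality isomorphisms $(\rho_u)_A:u^*\mathrm{comp}_{\mathbf{C}}(A)\cong\mathrm{comp}_{\mathbf{C}}(A[u])$, where $A[u]=\mathbf{Tp}_{\mathbf{C}}(u)(A)$. A morphism $F:\mathbf{C}\to\mathbf{D}$ is a display functor $F$, a strictly natural $\mathbf{Tp}_F:\mathbf{Tp}_{\mathbf{C}}\to F^*\mathbf{Tp}_{\mathbf{D}}$ and a $\mathbf{C}$-indexed natural transformation $\tau_F:\mathcal{D}_F\circ\mathrm{comp}_{\mathbf{C}}\Rightarrow F^*\mathrm{comp}_{\mathbf{D}}\circ\mathbf{Tp}_F$. A 2-morphism $\alpha:F\Rightarrow G$ is a natural transformation $\alpha$ and a $\mathbf{C}$-indexed natural transformation $\mathbf{Tp}_\alpha:\mathbf{Tp}_F\Rightarrow\alpha^*\mathbf{Tp}_{\mathbf{D}}\circ\mathbf{Tp}_G$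 (components $\alpha_A:FA\to(GA)[\alpha_\Gamma]$) such that $\mathrm{comp}_{\mathbf{D}}(\alpha_A)\circ(\tau_F)_A=(\rho_{\alpha_\Gamma})_{GA}\circ(\alpha_\Gamma)^*(\tau_G)_A\circ(\mathcal{D}_\alpha)_{\mathrm{comp}_{\mathbf{C}}(A)}$ for all $A\in\mathbf{Tp}_{\mathbf{C}}(\Gamma)$. This gives the strict 2-category $\mathbf{PreCwA}$. A small CwA is a small pre-CwA with $\mathrm{comp}_{\mathbf{C}}$ a $\mathbf{C}$-indexed equivalence; a morphism of small CwAs is a morphism of pre-CwAs with $\tau_F$ invertible; $\mathbf{CwA}$ is the strict sub-2-category of $\mathbf{PreCwA}$ on these objects and morphisms (all 2-morphisms). **Pre-natural models.** A small pre-natural model $\mathbf{C}$ is a small display category $\mathbf{C}$ with small strict $\mathbf{C}$-indexed categories $\mathbf{Tp}_{\mathbf{C}},\mathbf{Tm}_{\mathbf{C}}$ and strictly natural $p_{\mathbf{C}}:\mathbf{Tm}_{\mathbf{C}}\to\mathbf{Tp}_{\mathbf{C}}$ with discrete opfibration components that is representable: for $A\in\mathbf{Tp}_{\mathbf{C}}(\Gamma)$ the presheaf $\Delta\mapsto\{(u:\Delta\to\Gamma,t\in\mathbf{Tm}_{\mathbf{C}}(\Delta)):p_{\mathbf{C}}(t)=A[u]\}$ over $\Gamma$ is represented by a (chosen) display $p_A:\Gamma.A\to\Gamma$ with universal element $v_A$. The induced $\mathbf{C}$-indexed functor $\mathrm{comp}_{\mathbf{C}}:\mathbf{Tp}_{\mathbf{C}}\to\mathcal{D}_{\mathbf{C}}$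 sends $A$ to $p_A$ and $f:A\to B$ to the map $\Gamma.f:\Gamma.A\to\Gamma.B$ over $\Gamma$ with $v_B[\Gamma.f]$ the codomain of the unique lift of $f[p_A]$ with domain $v_A$. A morphism $F$ is a display functor with strictly natural $\mathbf{Tp}_F:\mathbf{Tp}_{\mathbf{C}}\to F^*\mathbf{Tp}_{\mathbf{D}}$, $\mathbf{Tm}_F:\mathbf{Tm}_{\mathbf{C}}\to F^*\mathbf{Tm}_{\mathbf{D}}$ commuting with $p_{\mathbf{C}},F^*p_{\mathbf{D}}$; it induces $\tau_F:\mathcal{D}_F\circ\mathrm{comp}_{\mathbf{C}}\Rightarrow F^*\mathrm{comp}_{\mathbf{D}}\circ\mathbf{Tp}_F$, where $(\tau_F)_A:F(\Gamma.A)\to F\Gamma.FA$ is the map over $F\Gamma$ with $v_{FA}[(\tau_F)_A]=Fv_A$. A 2-morphism $\alpha:F\Rightarrow G$ is a natural transformation with $\mathbf{C}$-indexed natural transformations $\mathbf{Tp}_\alpha:\mathbf{Tp}_F\Rightarrow\alpha^*\mathbf{Tp}_{\mathbf{D}}\circ\mathbf{Tp}_G$, $\mathbf{Tm}_\alpha:\mathbf{Tm}_F\Rightarrow\alpha^*\mathbf{Tm}_{\mathbf{D}}\circ\mathbf{Tm}_G$ satisfying $p_{\mathbf{D}}(\alpha_t)=\alpha_{p_{\mathbf{C}}(t)}$. This gives $\mathbf{PreNM}$. A small natural model is a small pre-natural model with $\mathrm{comp}_{\mathbf{C}}$ a $\mathbf{C}$-indexed equivalence; a morphism of small natural models is a morphism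 of pre-natural models with $\tau_F$ invertible; $\mathbf{NM}$ is the corresponding strict sub-2-category of $\mathbf{PreNM}$ (all 2-morphisms). **The 2-functors.** $P$ replaces $\mathrm{comp}_{\mathbf{C}}$ by the strict 2-pullback $p_{\mathbf{C}}:\mathbf{Tm}_{\mathbf{C}}\to\mathbf{Tp}_{\mathbf{C}}$ of $\varpi_{\mathbf{C}}$ along $\mathrm{comp}_{\mathbf{C}}$ (so objects of $\mathbf{Tm}_{\mathbf{C}}(\Gamma)$ are pairs of $A\in\mathbf{Tp}_{\mathbf{C}}(\Gamma)$ and a section of $\mathrm{comp}_{\mathbf{C}}(A)$), replaces $\tau_F$ by the induced $\mathbf{Tm}_F$, and adjoins to $\mathbf{Tp}_\alpha$ the unique induced $\mathbf{Tm}_\alpha$. $C$ replaces $p_{\mathbf{C}}$ by the induced $\mathrm{comp}_{\mathbf{C}}$, replaces $\mathbf{Tm}_F$ by the induced $\tau_F$, and forgets $\mathbf{Tm}_\alpha$. These are inverse strict 2-equivalences. *)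

theory Defs
  imports Main "HOL-Library.FuncSet"
begin

section \<open>Categories, functors and natural transformations\<close>

text \<open>
  The record operations are total HOL functions, so they carry irrelevant values outside their
  intended domains. The structural predicates below ignore these values. The functions
  \<open>cat_norm\<close>, \<open>fnc_norm\<close>, etc. set them all to \<open>undefined\<close>;
  the objects, 1-cells and 2-cells of the 2-categories at the end are required to be fixed by
  normalisation, so that HOL equality coincides with mathematical equality.
\<close>

record ('o, 'a) cat =
  obs :: "'o set"
  ars :: "'a set"
  src :: "'a \<Rightarrow> 'o"
  tgt :: "'a \<Rightarrow> 'o"
  idn :: "'o \<Rightarrow> 'a"
  cmp :: "'a \<Rightarrow> 'a \<Rightarrow> 'a"  \<comment> \<open>\<open>cmp C g f\<close> is \<open>g\<close> after \<open>f\<close>\<close>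

definition hom :: "('o, 'a, 'z) cat_scheme \<Rightarrow> 'o \<Rightarrow> 'o \<Rightarrow> 'a set" where
  "hom C A B = {f \<in> ars C. src C f = A \<and> tgt C f = B}"

locale category =
  fixes C :: "('o, 'a, 'z) cat_scheme"
  assumes src_ob: "f \<in> ars C \<Longrightarrow> src C f \<in> obs C"
    and tgt_ob: "f \<in> ars C \<Longrightarrow> tgt C f \<in> obs C"
    and idn_hom: "A \<in> obs C \<Longrightarrow> idn C A \<in> hom C A A"
    and cmp_hom: "f \<in> hom C A B \<Longrightarrow> g \<in> hom C B D \<Longrightarrow> cmp C g f \<in> hom C A D"
    and idn_left: "f \<in> hom C A B \<Longrightarrow> cmp C (idn C B) f = f"
    and idn_right: "f \<in> hom C A B \<Longrightarrow> cmp C f (idn C A) = f"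
    and cmp_assoc: "f \<in> hom C A B \<Longrightarrow> g \<in> hom C B D \<Longrightarrow> h \<in> hom C D E \<Longrightarrow>
      cmp C h (cmp C g f) = cmp C (cmp C h g) f"

definition cat_norm :: "('o, 'a, 'z) cat_scheme \<Rightarrow> ('o, 'a, 'z) cat_scheme" where
  "cat_norm C = C\<lparr>
     src := restrict (src C) (ars C),
     tgt := restrict (tgt C) (ars C),
     idn := restrict (idn C) (obs C),
     cmp := (\<lambda>g f. if g \<in> ars C \<and> f \<in> ars C \<and> src C g = tgt C f
                   then cmp C g f else undefined)\<rparr>"

definition inverse_ars :: "('o, 'a, 'z) cat_scheme \<Rightarrow> 'a \<Rightarrow> 'a \<Rightarrow> bool" where
  "inverse_ars C f g \<longleftrightarrow> f \<in> ars C \<and> g \<in> hom C (tgt C f) (src C f) \<and>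
     cmp C g f = idn C (src C f) \<and> cmp C f g = idn C (tgt C f)"

definition is_iso :: "('o, 'a, 'z) cat_scheme \<Rightarrow> 'a \<Rightarrow> bool" where
  "is_iso C f \<longleftrightarrow> (\<exists>g. inverse_ars C f g)"

definition inv_ar :: "('o, 'a, 'z) cat_scheme \<Rightarrow> 'a \<Rightarrow> 'a" where
  "inv_ar C f = (THE g. inverse_ars C f g)"

definition full_sub :: "('o, 'a, 'z) cat_scheme \<Rightarrow> 'o set \<Rightarrow> ('o, 'a, 'z) cat_scheme" where
  "full_sub C S = C\<lparr>obs := obs C \<inter> S, ars := {f \<in> ars C. src C f \<in> S \<and> tgt C f \<in> S}\<rparr>"

definition prod_cat ::
  "('o, 'a) cat \<Rightarrow> ('p, 'b) cat \<Rightarrow> ('o \<times> 'p, 'a \<times> 'b) cat" where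
  "prod_cat C D = \<lparr>
     obs = obs C \<times> obs D,
     ars = ars C \<times> ars D,
     src = (\<lambda>(f, g). (src C f, src D g)),
     tgt = (\<lambda>(f, g). (tgt C f, tgt D g)),
     idn = (\<lambda>(A, B). (idn C A, idn D B)),
     cmp = (\<lambda>(f', g') (f, g). (cmp C f' f, cmp D g' g))\<rparr>"

record ('o, 'a, 'p, 'b) fnc =
  fo :: "'o \<Rightarrow> 'p"
  fa :: "'a \<Rightarrow> 'b"

locale is_functor = Dom: category C + Cod: category D
  for C :: "('o, 'a, 'z) cat_scheme" and D :: "('p, 'b, 'y) cat_scheme" +
  fixes F :: "('o, 'a, 'p, 'b) fnc"
  assumes map_ob: "A \<in> obs C \<Longrightarrow> fo F A \<in> obs D"
    and map_hom: "f \<in> hom C A B \<Longrightarrow> fa F f \<in> hom D (fo F A) (fo F B)"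
    and map_idn: "A \<in> obs C \<Longrightarrow> fa F (idn C A) = idn D (fo F A)"
    and map_cmp: "f \<in> hom C A B \<Longrightarrow> g \<in> hom C B E \<Longrightarrow>
      fa F (cmp C g f) = cmp D (fa F g) (fa F f)"

definition fid :: "('o, 'a, 'o, 'a) fnc" where
  "fid = \<lparr>fo = (\<lambda>A. A), fa = (\<lambda>f. f)\<rparr>"

definition fcomp ::
  "('p, 'b, 'q, 'c) fnc \<Rightarrow> ('o, 'a, 'p, 'b) fnc \<Rightarrow> ('o, 'a, 'q, 'c) fnc" where
  "fcomp G F = \<lparr>fo = (\<lambda>A. fo G (fo F A)), fa = (\<lambda>f. fa G (fa F f))\<rparr>"

definition fnc_norm ::
  "('o, 'a, 'z) cat_scheme \<Rightarrow> ('o, 'a, 'p, 'b) fnc \<Rightarrow> ('o, 'a, 'p, 'b) fnc" where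
  "fnc_norm C F = \<lparr>fo = restrict (fo F) (obs C), fa = restrict (fa F) (ars C)\<rparr>"

locale nat_trans = F: is_functor C D F + G: is_functor C D G
  for C :: "('o, 'a, 'z) cat_scheme" and D :: "('p, 'b, 'y) cat_scheme" and F and G +
  fixes \<alpha> :: "'o \<Rightarrow> 'b"
  assumes component: "A \<in> obs C \<Longrightarrow> \<alpha> A \<in> hom D (fo F A) (fo G A)"
    and naturality: "f \<in> hom C A B \<Longrightarrow> cmp D (\<alpha> B) (fa F f) = cmp D (fa G f) (\<alpha> A)"

locale nat_iso = nat_trans +
  assumes component_iso: "A \<in> obs C \<Longrightarrow> is_iso D (\<alpha> A)"

locale discrete_opfibration = is_functor +
  assumes unique_lift: "x \<in> obs C \<Longrightarrow> f \<in> ars D \<Longrightarrow> src D f = fo F x \<Longrightarrow>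
    \<exists>!k. k \<in> ars C \<and> src C k = x \<and> fa F k = f"

definition dlift :: "('o, 'a, 'z) cat_scheme \<Rightarrow> ('o, 'a, 'p, 'b) fnc \<Rightarrow> 'b \<Rightarrow> 'o \<Rightarrow> 'a" where
  "dlift C F f x = (THE k. k \<in> ars C \<and> src C k = x \<and> fa F k = f)"


section \<open>Indexed categories\<close>

text \<open>
  A pseudofunctor from the opposite of \<open>C\<close> to categories. For \<open>A\<close> over
  \<open>\<Gamma>\<close>, the unitor is \<open>un \<Gamma> A : A \<rightarrow> A[id]\<close> and the
  compositor is \<open>cm u v A : A[u][v] \<rightarrow> A[u \<circ> v]\<close>.
\<close>

record ('o, 'a, 'fo, 'fa) icat =
  fib :: "'o \<Rightarrow> ('fo, 'fa) cat"
  ri :: "'a \<Rightarrow> ('fo, 'fa, 'fo, 'fa) fnc"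
  un :: "'o \<Rightarrow> 'fo \<Rightarrow> 'fa"
  cm :: "'a \<Rightarrow> 'a \<Rightarrow> 'fo \<Rightarrow> 'fa"

locale indexed_category = category C
  for C :: "('o, 'a, 'z) cat_scheme" +
  fixes E :: "('o, 'a, 'fo, 'fa) icat"
  assumes fib_cat: "\<Gamma> \<in> obs C \<Longrightarrow> category (fib E \<Gamma>)"
    and ri_functor: "u \<in> hom C \<Delta> \<Gamma> \<Longrightarrow> is_functor (fib E \<Gamma>) (fib E \<Delta>) (ri E u)"
    and un_iso: "\<Gamma> \<in> obs C \<Longrightarrow>
      nat_iso (fib E \<Gamma>) (fib E \<Gamma>) fid (ri E (idn C \<Gamma>)) (un E \<Gamma>)"
    and cm_iso: "u \<in> hom C \<Delta> \<Gamma> \<Longrightarrow> v \<in> hom C \<Theta> \<Delta> \<Longrightarrow>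
      nat_iso (fib E \<Gamma>) (fib E \<Theta>) (fcomp (ri E v) (ri E u)) (ri E (cmp C u v)) (cm E u v)"
    and cm_un_left: "u \<in> hom C \<Delta> \<Gamma> \<Longrightarrow> A \<in> obs (fib E \<Gamma>) \<Longrightarrow>
      cmp (fib E \<Delta>) (cm E (idn C \<Gamma>) u A) (fa (ri E u) (un E \<Gamma> A))
        = idn (fib E \<Delta>) (fo (ri E u) A)"
    and cm_un_right: "u \<in> hom C \<Delta> \<Gamma> \<Longrightarrow> A \<in> obs (fib E \<Gamma>) \<Longrightarrow>
      cmp (fib E \<Delta>) (cm E u (idn C \<Delta>) A) (un E \<Delta> (fo (ri E u) A))
        = idn (fib E \<Delta>) (fo (ri E u) A)"
    and cm_assoc: "u \<in> hom C \<Delta> \<Gamma> \<Longrightarrow> v \<in> hom C \<Theta> \<Delta> \<Longrightarrow> w \<in> hom C \<Xi> \<Theta> \<Longrightarrow>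
      A \<in> obs (fib E \<Gamma>) \<Longrightarrow>
      cmp (fib E \<Xi>) (cm E (cmp C u v) w A) (fa (ri E w) (cm E u v A))
        = cmp (fib E \<Xi>) (cm E u (cmp C v w) A) (cm E v w (fo (ri E u) A))"

text \<open>
  Strict functors to categories: the unitors and compositors are identities. With the typing
  of these components this forces \<open>A[id] = A\<close> and \<open>A[u][v] = A[u \<circ> v]\<close>.
\<close>

locale strict_indexed_category = indexed_category +
  assumes un_strict: "\<Gamma> \<in> obs C \<Longrightarrow> A \<in> obs (fib E \<Gamma>) \<Longrightarrow> un E \<Gamma> A = idn (fib E \<Gamma>) A"
    and cm_strict: "u \<in> hom C \<Delta> \<Gamma> \<Longrightarrow> v \<in> hom C \<Theta> \<Delta> \<Longrightarrow> A \<in> obs (fib E \<Gamma>) \<Longrightarrow>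
      cm E u v A = idn (fib E \<Theta>) (fo (ri E (cmp C u v)) A)"

definition icat_norm ::
  "('o, 'a, 'z) cat_scheme \<Rightarrow> ('o, 'a, 'fo, 'fa) icat \<Rightarrow> ('o, 'a, 'fo, 'fa) icat" where
  "icat_norm C E = \<lparr>
     fib = restrict (\<lambda>\<Gamma>. cat_norm (fib E \<Gamma>)) (obs C),
     ri = restrict (\<lambda>u. fnc_norm (fib E (tgt C u)) (ri E u)) (ars C),
     un = restrict (\<lambda>\<Gamma>. restrict (un E \<Gamma>) (obs (fib E \<Gamma>))) (obs C),
     cm = (\<lambda>u v. if u \<in> ars C \<and> v \<in> ars C \<and> src C u = tgt C v
                 then restrict (cm E u v) (obs (fib E (tgt C u))) else undefined)\<rparr>"

text \<open>
  Indexed functors are pseudonatural transformations, with pseudonaturality isomorphisms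
  \<open>ps H u A : (H A)[u] \<rightarrow> H (A[u])\<close>.
\<close>

record ('o, 'a, 'fo, 'fa, 'go, 'ga) ifun =
  cp :: "'o \<Rightarrow> ('fo, 'fa, 'go, 'ga) fnc"
  ps :: "'a \<Rightarrow> 'fo \<Rightarrow> 'ga"

locale indexed_functor = Dom: indexed_category C E + Cod: indexed_category C E'
  for C :: "('o, 'a, 'z) cat_scheme"
    and E :: "('o, 'a, 'fo, 'fa) icat" and E' :: "('o, 'a, 'go, 'ga) icat" +
  fixes H :: "('o, 'a, 'fo, 'fa, 'go, 'ga) ifun"
  assumes cp_functor: "\<Gamma> \<in> obs C \<Longrightarrow> is_functor (fib E \<Gamma>) (fib E' \<Gamma>) (cp H \<Gamma>)"
    and ps_iso: "u \<in> hom C \<Delta> \<Gamma> \<Longrightarrow>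
      nat_iso (fib E \<Gamma>) (fib E' \<Delta>) (fcomp (ri E' u) (cp H \<Gamma>)) (fcomp (cp H \<Delta>) (ri E u)) (ps H u)"
    and ps_un: "\<Gamma> \<in> obs C \<Longrightarrow> A \<in> obs (fib E \<Gamma>) \<Longrightarrow>
      cmp (fib E' \<Gamma>) (ps H (idn C \<Gamma>) A) (un E' \<Gamma> (fo (cp H \<Gamma>) A)) = fa (cp H \<Gamma>) (un E \<Gamma> A)"
    and ps_cm: "u \<in> hom C \<Delta> \<Gamma> \<Longrightarrow> v \<in> hom C \<Theta> \<Delta> \<Longrightarrow> A \<in> obs (fib E \<Gamma>) \<Longrightarrow>
      cmp (fib E' \<Theta>) (ps H (cmp C u v) A) (cm E' u v (fo (cp H \<Gamma>) A))
        = cmp (fib E' \<Theta>) (fa (cp H \<Theta>) (cm E u v A))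
            (cmp (fib E' \<Theta>) (ps H v (fo (ri E u) A)) (fa (ri E' v) (ps H u A)))"

locale strictly_natural_functor = indexed_functor +
  assumes ps_strict: "u \<in> hom C \<Delta> \<Gamma> \<Longrightarrow> A \<in> obs (fib E \<Gamma>) \<Longrightarrow>
    ps H u A = idn (fib E' \<Delta>) (fo (cp H \<Delta>) (fo (ri E u) A))"

definition ifun_norm ::
  "('o, 'a, 'z) cat_scheme \<Rightarrow> ('o, 'a, 'fo, 'fa) icat \<Rightarrow>
   ('o, 'a, 'fo, 'fa, 'go, 'ga) ifun \<Rightarrow> ('o, 'a, 'fo, 'fa, 'go, 'ga) ifun" where
  "ifun_norm C E H = \<lparr>
     cp = restrict (\<lambda>\<Gamma>. fnc_norm (fib E \<Gamma>) (cp H \<Gamma>)) (obs C),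
     ps = restrict (\<lambda>u. restrict (ps H u) (obs (fib E (tgt C u)))) (ars C)\<rparr>"

definition iid ::
  "('o, 'a, 'z) cat_scheme \<Rightarrow> ('o, 'a, 'fo, 'fa) icat \<Rightarrow> ('o, 'a, 'fo, 'fa, 'fo, 'fa) ifun" where
  "iid C E = \<lparr>cp = (\<lambda>\<Gamma>. fid), ps = (\<lambda>u A. idn (fib E (src C u)) (fo (ri E u) A))\<rparr>"

text \<open>\<open>icomp C E'' K H\<close> is \<open>K\<close> after \<open>H\<close>, where \<open>E''\<close> is the codomain of \<open>K\<close>.\<close>

definition icomp ::
  "('o, 'a, 'z) cat_scheme \<Rightarrow> ('o, 'a, 'ho, 'ha) icat \<Rightarrow> ('o, 'a, 'go, 'ga, 'ho, 'ha) ifun \<Rightarrow>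
   ('o, 'a, 'fo, 'fa, 'go, 'ga) ifun \<Rightarrow> ('o, 'a, 'fo, 'fa, 'ho, 'ha) ifun" where
  "icomp C E'' K H = \<lparr>
     cp = (\<lambda>\<Gamma>. fcomp (cp K \<Gamma>) (cp H \<Gamma>)),
     ps = (\<lambda>u A. cmp (fib E'' (src C u))
             (fa (cp K (src C u)) (ps H u A)) (ps K u (fo (cp H (tgt C u)) A)))\<rparr>"

text \<open>Indexed natural transformations are modifications.\<close>

locale indexed_nat_trans = Dom: indexed_functor C E E' H + Cod: indexed_functor C E E' K
  for C :: "('o, 'a, 'z) cat_scheme"
    and E :: "('o, 'a, 'fo, 'fa) icat" and E' :: "('o, 'a, 'go, 'ga) icat" and H and K +
  fixes \<mu> :: "'o \<Rightarrow> 'fo \<Rightarrow> 'ga"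
  assumes component_nat: "\<Gamma> \<in> obs C \<Longrightarrow>
      nat_trans (fib E \<Gamma>) (fib E' \<Gamma>) (cp H \<Gamma>) (cp K \<Gamma>) (\<mu> \<Gamma>)"
    and modification: "u \<in> hom C \<Delta> \<Gamma> \<Longrightarrow> A \<in> obs (fib E \<Gamma>) \<Longrightarrow>
      cmp (fib E' \<Delta>) (\<mu> \<Delta> (fo (ri E u) A)) (ps H u A)
        = cmp (fib E' \<Delta>) (ps K u A) (fa (ri E' u) (\<mu> \<Gamma> A))"

definition itrans_norm ::
  "('o, 'a, 'z) cat_scheme \<Rightarrow> ('o, 'a, 'fo, 'fa) icat \<Rightarrow> ('o \<Rightarrow> 'fo \<Rightarrow> 'ga) \<Rightarrow> 'o \<Rightarrow> 'fo \<Rightarrow> 'ga" where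
  "itrans_norm C E \<mu> = restrict (\<lambda>\<Gamma>. restrict (\<mu> \<Gamma>) (obs (fib E \<Gamma>))) (obs C)"

definition invertible_itrans ::
  "('o, 'a, 'z) cat_scheme \<Rightarrow> ('o, 'a, 'fo, 'fa) icat \<Rightarrow> ('o, 'a, 'go, 'ga) icat \<Rightarrow>
   ('o, 'a, 'fo, 'fa, 'go, 'ga) ifun \<Rightarrow> ('o, 'a, 'fo, 'fa, 'go, 'ga) ifun \<Rightarrow>
   ('o \<Rightarrow> 'fo \<Rightarrow> 'ga) \<Rightarrow> bool" where
  "invertible_itrans C E E' H K \<mu> \<longleftrightarrow> indexed_nat_trans C E E' H K \<mu> \<and>
     (\<exists>\<nu>. indexed_nat_trans C E E' K H \<nu> \<and>
       (\<forall>\<Gamma> \<in> obs C. \<forall>A \<in> obs (fib E \<Gamma>).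
          cmp (fib E' \<Gamma>) (\<nu> \<Gamma> A) (\<mu> \<Gamma> A) = idn (fib E' \<Gamma>) (fo (cp H \<Gamma>) A) \<and>
          cmp (fib E' \<Gamma>) (\<mu> \<Gamma> A) (\<nu> \<Gamma> A) = idn (fib E' \<Gamma>) (fo (cp K \<Gamma>) A)))"

definition indexed_equivalence ::
  "('o, 'a, 'z) cat_scheme \<Rightarrow> ('o, 'a, 'fo, 'fa) icat \<Rightarrow> ('o, 'a, 'go, 'ga) icat \<Rightarrow>
   ('o, 'a, 'fo, 'fa, 'go, 'ga) ifun \<Rightarrow> bool" where
  "indexed_equivalence C E E' H \<longleftrightarrow> indexed_functor C E E' H \<and>
     (\<exists>K \<mu> \<nu>. indexed_functor C E' E K \<and>
        invertible_itrans C E E (iid C E) (icomp C E K H) \<mu> \<and>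
        invertible_itrans C E' E' (icomp C E' H K) (iid C E') \<nu>)"

definition bc :: "('o, 'a, 'p, 'b) fnc \<Rightarrow> ('p, 'b, 'fo, 'fa) icat \<Rightarrow> ('o, 'a, 'fo, 'fa) icat" where
  "bc F E = \<lparr>
     fib = (\<lambda>\<Gamma>. fib E (fo F \<Gamma>)),
     ri = (\<lambda>u. ri E (fa F u)),
     un = (\<lambda>\<Gamma>. un E (fo F \<Gamma>)),
     cm = (\<lambda>u v. cm E (fa F u) (fa F v))\<rparr>"

definition bcf ::
  "('o, 'a, 'p, 'b) fnc \<Rightarrow> ('p, 'b, 'fo, 'fa, 'go, 'ga) ifun \<Rightarrow> ('o, 'a, 'fo, 'fa, 'go, 'ga) ifun" where
  "bcf F H = \<lparr>cp = (\<lambda>\<Gamma>. cp H (fo F \<Gamma>)), ps = (\<lambda>u. ps H (fa F u))\<rparr>"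

text \<open>
  For \<open>\<alpha> : F \<Rightarrow> G\<close>, the indexed functor \<open>\<alpha>* E : G* E \<rightarrow> F* E\<close>,
  reindexing along the components of \<open>\<alpha>\<close>. Its structure map at
  \<open>u : \<Delta> \<rightarrow> \<Gamma>\<close> is the canonical isomorphism between
  \<open>A[\<alpha> \<Gamma>][F u]\<close> and \<open>A[G u][\<alpha> \<Delta>]\<close>.
\<close>

definition astar ::
  "('o, 'a, 'z) cat_scheme \<Rightarrow> ('o, 'a, 'p, 'b) fnc \<Rightarrow> ('o, 'a, 'p, 'b) fnc \<Rightarrow> ('o \<Rightarrow> 'b) \<Rightarrow>
   ('p, 'b, 'fo, 'fa) icat \<Rightarrow> ('o, 'a, 'fo, 'fa, 'fo, 'fa) ifun" where
  "astar C F G \<alpha> E = \<lparr>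
     cp = (\<lambda>\<Gamma>. ri E (\<alpha> \<Gamma>)),
     ps = (\<lambda>u A. let K = fib E (fo F (src C u)) in
             cmp K (inv_ar K (cm E (fa G u) (\<alpha> (src C u)) A)) (cm E (\<alpha> (tgt C u)) (fa F u) A))\<rparr>"


section \<open>Display categories\<close>

text \<open>\<open>pb C f p\<close> is the chosen pullback of \<open>p\<close> along \<open>f\<close>; \<open>pt C f p\<close> is the map above \<open>f\<close>.\<close>

record ('o, 'a) dcat = "('o, 'a) cat" +
  dsp :: "'a set"
  pb :: "'a \<Rightarrow> 'a \<Rightarrow> 'a"
  pt :: "'a \<Rightarrow> 'a \<Rightarrow> 'a"

definition is_pullback ::
  "('o, 'a, 'z) cat_scheme \<Rightarrow> 'a \<Rightarrow> 'a \<Rightarrow> 'a \<Rightarrow> 'a \<Rightarrow> bool" where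
  "is_pullback C p f p' f' \<longleftrightarrow>
     p \<in> ars C \<and> f \<in> ars C \<and> tgt C p = tgt C f \<and>
     p' \<in> ars C \<and> tgt C p' = src C f \<and>
     f' \<in> hom C (src C p') (src C p) \<and>
     cmp C p f' = cmp C f p' \<and>
     (\<forall>X x y. x \<in> hom C X (src C f) \<and> y \<in> hom C X (src C p) \<and> cmp C f x = cmp C p y \<longrightarrow>
        (\<exists>!k. k \<in> hom C X (src C p') \<and> cmp C p' k = x \<and> cmp C f' k = y))"

definition pb_pair ::
  "('o, 'a, 'z) cat_scheme \<Rightarrow> 'a \<Rightarrow> 'a \<Rightarrow> 'a \<Rightarrow> 'a \<Rightarrow> 'a" where
  "pb_pair C p' f' x y =
     (THE k. k \<in> hom C (src C x) (src C p') \<and> cmp C p' k = x \<and> cmp C f' k = y)"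

locale display_category = category C
  for C :: "('o, 'a, 'z) dcat_scheme" +
  assumes dsp_ars: "dsp C \<subseteq> ars C"
    and pb_dsp: "p \<in> dsp C \<Longrightarrow> f \<in> ars C \<Longrightarrow> tgt C f = tgt C p \<Longrightarrow> pb C f p \<in> dsp C"
    and pb_pullback: "p \<in> dsp C \<Longrightarrow> f \<in> ars C \<Longrightarrow> tgt C f = tgt C p \<Longrightarrow>
      is_pullback C p f (pb C f p) (pt C f p)"
    and dsp_iso_right: "p \<in> dsp C \<Longrightarrow> is_iso C i \<Longrightarrow> tgt C i = src C p \<Longrightarrow> cmp C p i \<in> dsp C"
    and dsp_iso_left: "p \<in> dsp C \<Longrightarrow> is_iso C i \<Longrightarrow> src C i = tgt C p \<Longrightarrow> cmp C i p \<in> dsp C"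

definition dcat_norm :: "('o, 'a) dcat \<Rightarrow> ('o, 'a) dcat" where
  "dcat_norm C = (cat_norm C)\<lparr>
     pb := (\<lambda>f p. if f \<in> ars C \<and> p \<in> dsp C \<and> tgt C f = tgt C p then pb C f p else undefined),
     pt := (\<lambda>f p. if f \<in> ars C \<and> p \<in> dsp C \<and> tgt C f = tgt C p then pt C f p else undefined)\<rparr>"

text \<open>A morphism \<open>p \<rightarrow> q\<close> of the slice is \<open>(p, q, h)\<close> with \<open>q \<circ> h = p\<close>.\<close>

definition slice :: "('o, 'a, 'z) cat_scheme \<Rightarrow> 'o \<Rightarrow> ('a, 'a \<times> 'a \<times> 'a) cat" where
  "slice C B = \<lparr>
     obs = {p \<in> ars C. tgt C p = B},
     ars = {(p, q, h). p \<in> ars C \<and> tgt C p = B \<and> q \<in> ars C \<and> tgt C q = B \<and>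
                       h \<in> hom C (src C p) (src C q) \<and> cmp C q h = p},
     src = (\<lambda>(p, q, h). p),
     tgt = (\<lambda>(p, q, h). q),
     idn = (\<lambda>p. (p, p, idn C (src C p))),
     cmp = (\<lambda>(q', r, k) (p, q, h). (p, r, cmp C k h))\<rparr>"

definition und :: "'a \<times> 'a \<times> 'a \<Rightarrow> 'a" where
  "und = (\<lambda>(p, q, h). h)"

definition dfib :: "('o, 'a, 'z) dcat_scheme \<Rightarrow> 'o \<Rightarrow> ('a, 'a \<times> 'a \<times> 'a) cat" where
  "dfib C \<Gamma> = full_sub (slice C \<Gamma>) (dsp C)"

definition dic :: "('o, 'a, 'z) dcat_scheme \<Rightarrow> ('o, 'a, 'a, 'a \<times> 'a \<times> 'a) icat" where
  "dic C = \<lparr>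
     fib = dfib C,
     ri = (\<lambda>u. \<lparr>
       fo = (\<lambda>p. pb C u p),
       fa = (\<lambda>(p, q, h). (pb C u p, pb C u q,
              pb_pair C (pb C u q) (pt C u q) (pb C u p) (cmp C h (pt C u p))))\<rparr>),
     un = (\<lambda>\<Gamma> p. let i = idn C \<Gamma> in
            (p, pb C i p, pb_pair C (pb C i p) (pt C i p) p (idn C (src C p)))),
     cm = (\<lambda>u v p. let q = pb C u p; r = pb C v q; w = cmp C u v in
            (r, pb C w p, pb_pair C (pb C w p) (pt C w p) r (cmp C (pt C u p) (pt C v q))))\<rparr>"

definition sfib ::
  "('o, 'a, 'z) dcat_scheme \<Rightarrow> 'o \<Rightarrow> ('a \<times> 'a, ('a \<times> 'a) \<times> ('a \<times> 'a) \<times> 'a) cat" where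
  "sfib C \<Gamma> = (let S = {(p, s). p \<in> obs (dfib C \<Gamma>) \<and> s \<in> hom C \<Gamma> (src C p) \<and>
                             cmp C p s = idn C \<Gamma>} in \<lparr>
     obs = S,
     ars = {((p, s), (q, t), h). (p, s) \<in> S \<and> (q, t) \<in> S \<and> (p, q, h) \<in> ars (dfib C \<Gamma>) \<and>
                                 cmp C h s = t},
     src = (\<lambda>(x, y, h). x),
     tgt = (\<lambda>(x, y, h). y),
     idn = (\<lambda>(p, s). ((p, s), (p, s), idn C (src C p))),
     cmp = (\<lambda>(y', z, k) (x, y, h). (x, z, cmp C k h))\<rparr>)"

definition section_pb :: "('o, 'a, 'z) dcat_scheme \<Rightarrow> 'a \<Rightarrow> 'a \<times> 'a \<Rightarrow> 'a \<times> 'a" where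
  "section_pb C u = (\<lambda>(p, s).
     (pb C u p, pb_pair C (pb C u p) (pt C u p) (idn C (src C u)) (cmp C s u)))"

definition sic ::
  "('o, 'a, 'z) dcat_scheme \<Rightarrow> ('o, 'a, 'a \<times> 'a, ('a \<times> 'a) \<times> ('a \<times> 'a) \<times> 'a) icat" where
  "sic C = \<lparr>
     fib = sfib C,
     ri = (\<lambda>u. \<lparr>
       fo = section_pb C u,
       fa = (\<lambda>(x, y, h). (section_pb C u x, section_pb C u y,
              und (fa (ri (dic C) u) (fst x, fst y, h))))\<rparr>),
     un = (\<lambda>\<Gamma> x. (x, section_pb C (idn C \<Gamma>) x, und (un (dic C) \<Gamma> (fst x)))),
     cm = (\<lambda>u v x. (section_pb C v (section_pb C u x), section_pb C (cmp C u v) x,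
            und (cm (dic C) u v (fst x))))\<rparr>"

definition varpi ::
  "('o, 'a, 'z) dcat_scheme \<Rightarrow>
   ('o, 'a, 'a \<times> 'a, ('a \<times> 'a) \<times> ('a \<times> 'a) \<times> 'a, 'a, 'a \<times> 'a \<times> 'a) ifun" where
  "varpi C = \<lparr>
     cp = (\<lambda>\<Gamma>. \<lparr>fo = fst, fa = (\<lambda>(x, y, h). (fst x, fst y, h))\<rparr>),
     ps = (\<lambda>u x. idn (dfib C (src C u)) (pb C u (fst x)))\<rparr>"

locale display_functor = is_functor C D F + Dom: display_category C + Cod: display_category D
  for C :: "('o, 'a, 'z) dcat_scheme" and D :: "('p, 'b, 'y) dcat_scheme" and F +
  assumes map_dsp: "p \<in> dsp C \<Longrightarrow> fa F p \<in> dsp D"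
    and map_pullback: "p \<in> dsp C \<Longrightarrow> is_pullback C p f p' f' \<Longrightarrow>
      is_pullback D (fa F p) (fa F f) (fa F p') (fa F f')"

text \<open>
  The indexed functor between displays induced by \<open>F\<close>; its structure maps are the
  canonical comparisons from the chosen pullback of \<open>F p\<close> along \<open>F u\<close> to
  the image of the chosen pullback of \<open>p\<close> along \<open>u\<close>.
\<close>

definition dfun ::
  "('o, 'a, 'z) dcat_scheme \<Rightarrow> ('p, 'b, 'y) dcat_scheme \<Rightarrow> ('o, 'a, 'p, 'b) fnc \<Rightarrow>
   ('o, 'a, 'a, 'a \<times> 'a \<times> 'a, 'b, 'b \<times> 'b \<times> 'b) ifun" where
  "dfun C D F = \<lparr>
     cp = (\<lambda>\<Gamma>. \<lparr>fo = fa F, fa = (\<lambda>(p, q, h). (fa F p, fa F q, fa F h))\<rparr>),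
     ps = (\<lambda>u p. let q = pb D (fa F u) (fa F p) in
            (q, fa F (pb C u p),
             pb_pair D (fa F (pb C u p)) (fa F (pt C u p)) q (pt D (fa F u) (fa F p))))\<rparr>"

definition dalpha ::
  "('o, 'a, 'z) dcat_scheme \<Rightarrow> ('p, 'b, 'y) dcat_scheme \<Rightarrow> ('o, 'a, 'p, 'b) fnc \<Rightarrow>
   ('o, 'a, 'p, 'b) fnc \<Rightarrow> ('o \<Rightarrow> 'b) \<Rightarrow> 'a \<Rightarrow> 'b \<times> 'b \<times> 'b" where
  "dalpha C D F G \<alpha> p = (let a = \<alpha> (tgt C p); q = pb D a (fa G p) in
     (fa F p, q, pb_pair D q (pt D a (fa G p)) (fa F p) (\<alpha> (src C p))))"


section \<open>Strict 2-categories\<close>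

text \<open>
  Strict 2-categories are given by hom-categories, whose objects are the 1-cells and whose
  arrows are the 2-cells. \<open>t_cmp\<close> and \<open>t_cmp2\<close> are the actions of horizontal
  composition on 1-cells and 2-cells.
\<close>

record ('o, 'm, 'c) tcat =
  t_ob :: "'o set"
  t_hom :: "'o \<Rightarrow> 'o \<Rightarrow> ('m, 'c) cat"
  t_id :: "'o \<Rightarrow> 'm"
  t_cmp :: "'o \<Rightarrow> 'o \<Rightarrow> 'o \<Rightarrow> 'm \<Rightarrow> 'm \<Rightarrow> 'm"
  t_cmp2 :: "'o \<Rightarrow> 'o \<Rightarrow> 'o \<Rightarrow> 'c \<Rightarrow> 'c \<Rightarrow> 'c"

abbreviation t_id2 :: "('o, 'm, 'c) tcat \<Rightarrow> 'o \<Rightarrow> 'o \<Rightarrow> 'm \<Rightarrow> 'c" where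
  "t_id2 T X Y F \<equiv> idn (t_hom T X Y) F"

locale strict_2category =
  fixes T :: "('o, 'm, 'c) tcat"
  assumes hom_cat: "X \<in> t_ob T \<Longrightarrow> Y \<in> t_ob T \<Longrightarrow> category (t_hom T X Y)"
    and id_ob: "X \<in> t_ob T \<Longrightarrow> t_id T X \<in> obs (t_hom T X X)"
    and cmp_functor: "X \<in> t_ob T \<Longrightarrow> Y \<in> t_ob T \<Longrightarrow> Z \<in> t_ob T \<Longrightarrow>
      is_functor (prod_cat (t_hom T Y Z) (t_hom T X Y)) (t_hom T X Z)
        \<lparr>fo = (\<lambda>(G, F). t_cmp T X Y Z G F), fa = (\<lambda>(\<beta>, \<alpha>). t_cmp2 T X Y Z \<beta> \<alpha>)\<rparr>"
    and unit_left: "X \<in> t_ob T \<Longrightarrow> Y \<in> t_ob T \<Longrightarrow> F \<in> obs (t_hom T X Y) \<Longrightarrow>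
      t_cmp T X Y Y (t_id T Y) F = F"
    and unit_right: "X \<in> t_ob T \<Longrightarrow> Y \<in> t_ob T \<Longrightarrow> F \<in> obs (t_hom T X Y) \<Longrightarrow>
      t_cmp T X X Y F (t_id T X) = F"
    and assoc: "W \<in> t_ob T \<Longrightarrow> X \<in> t_ob T \<Longrightarrow> Y \<in> t_ob T \<Longrightarrow> Z \<in> t_ob T \<Longrightarrow>
      F \<in> obs (t_hom T W X) \<Longrightarrow> G \<in> obs (t_hom T X Y) \<Longrightarrow> H \<in> obs (t_hom T Y Z) \<Longrightarrow>
      t_cmp T W Y Z H (t_cmp T W X Y G F) = t_cmp T W X Z (t_cmp T X Y Z H G) F"
    and unit2_left: "X \<in> t_ob T \<Longrightarrow> Y \<in> t_ob T \<Longrightarrow> \<alpha> \<in> ars (t_hom T X Y) \<Longrightarrow>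
      t_cmp2 T X Y Y (t_id2 T Y Y (t_id T Y)) \<alpha> = \<alpha>"
    and unit2_right: "X \<in> t_ob T \<Longrightarrow> Y \<in> t_ob T \<Longrightarrow> \<alpha> \<in> ars (t_hom T X Y) \<Longrightarrow>
      t_cmp2 T X X Y \<alpha> (t_id2 T X X (t_id T X)) = \<alpha>"
    and assoc2: "W \<in> t_ob T \<Longrightarrow> X \<in> t_ob T \<Longrightarrow> Y \<in> t_ob T \<Longrightarrow> Z \<in> t_ob T \<Longrightarrow>
      \<alpha> \<in> ars (t_hom T W X) \<Longrightarrow> \<beta> \<in> ars (t_hom T X Y) \<Longrightarrow> \<gamma> \<in> ars (t_hom T Y Z) \<Longrightarrow>
      t_cmp2 T W Y Z \<gamma> (t_cmp2 T W X Y \<beta> \<alpha>) = t_cmp2 T W X Z (t_cmp2 T X Y Z \<gamma> \<beta>) \<alpha>"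

definition sub_2cat ::
  "('o, 'm, 'c) tcat \<Rightarrow> ('o \<Rightarrow> bool) \<Rightarrow> ('o \<Rightarrow> 'o \<Rightarrow> 'm \<Rightarrow> bool) \<Rightarrow> ('o, 'm, 'c) tcat" where
  "sub_2cat T P Q = T\<lparr>
     t_ob := {X \<in> t_ob T. P X},
     t_hom := (\<lambda>X Y. full_sub (t_hom T X Y) {F. Q X Y F})\<rparr>"

record ('o, 'm, 'c, 'p, 'n, 'd) tfun =
  tf_ob :: "'o \<Rightarrow> 'p"
  tf_hom :: "'o \<Rightarrow> 'o \<Rightarrow> ('m, 'c, 'n, 'd) fnc"

locale strict_2functor = Dom: strict_2category T + Cod: strict_2category T'
  for T :: "('o, 'm, 'c) tcat" and T' :: "('p, 'n, 'd) tcat" +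
  fixes P :: "('o, 'm, 'c, 'p, 'n, 'd) tfun"
  assumes map_ob: "X \<in> t_ob T \<Longrightarrow> tf_ob P X \<in> t_ob T'"
    and map_hom: "X \<in> t_ob T \<Longrightarrow> Y \<in> t_ob T \<Longrightarrow>
      is_functor (t_hom T X Y) (t_hom T' (tf_ob P X) (tf_ob P Y)) (tf_hom P X Y)"
    and map_id: "X \<in> t_ob T \<Longrightarrow> fo (tf_hom P X X) (t_id T X) = t_id T' (tf_ob P X)"
    and map_cmp: "X \<in> t_ob T \<Longrightarrow> Y \<in> t_ob T \<Longrightarrow> Z \<in> t_ob T \<Longrightarrow>
      F \<in> obs (t_hom T X Y) \<Longrightarrow> G \<in> obs (t_hom T Y Z) \<Longrightarrow>
      fo (tf_hom P X Z) (t_cmp T X Y Z G F) =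
        t_cmp T' (tf_ob P X) (tf_ob P Y) (tf_ob P Z) (fo (tf_hom P Y Z) G) (fo (tf_hom P X Y) F)"
    and map_cmp2: "X \<in> t_ob T \<Longrightarrow> Y \<in> t_ob T \<Longrightarrow> Z \<in> t_ob T \<Longrightarrow>
      \<alpha> \<in> ars (t_hom T X Y) \<Longrightarrow> \<beta> \<in> ars (t_hom T Y Z) \<Longrightarrow>
      fa (tf_hom P X Z) (t_cmp2 T X Y Z \<beta> \<alpha>) =
        t_cmp2 T' (tf_ob P X) (tf_ob P Y) (tf_ob P Z) (fa (tf_hom P Y Z) \<beta>) (fa (tf_hom P X Y) \<alpha>)"

definition tf_id :: "('o, 'm, 'c, 'o, 'm, 'c) tfun" where
  "tf_id = \<lparr>tf_ob = (\<lambda>X. X), tf_hom = (\<lambda>X Y. fid)\<rparr>"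

definition tf_comp ::
  "('p, 'n, 'd, 'q, 'k, 'e) tfun \<Rightarrow> ('o, 'm, 'c, 'p, 'n, 'd) tfun \<Rightarrow> ('o, 'm, 'c, 'q, 'k, 'e) tfun" where
  "tf_comp Q P = \<lparr>
     tf_ob = (\<lambda>X. tf_ob Q (tf_ob P X)),
     tf_hom = (\<lambda>X Y. fcomp (tf_hom Q (tf_ob P X) (tf_ob P Y)) (tf_hom P X Y))\<rparr>"

locale strict_2nat = Dom: strict_2functor T T' P + Cod: strict_2functor T T' Q
  for T :: "('o, 'm, 'c) tcat" and T' :: "('p, 'n, 'd) tcat" and P and Q +
  fixes \<eta> :: "'o \<Rightarrow> 'n"
  assumes component: "X \<in> t_ob T \<Longrightarrow> \<eta> X \<in> obs (t_hom T' (tf_ob P X) (tf_ob Q X))"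
    and natural1: "X \<in> t_ob T \<Longrightarrow> Y \<in> t_ob T \<Longrightarrow> F \<in> obs (t_hom T X Y) \<Longrightarrow>
      t_cmp T' (tf_ob P X) (tf_ob P Y) (tf_ob Q Y) (\<eta> Y) (fo (tf_hom P X Y) F) =
      t_cmp T' (tf_ob P X) (tf_ob Q X) (tf_ob Q Y) (fo (tf_hom Q X Y) F) (\<eta> X)"
    and natural2: "X \<in> t_ob T \<Longrightarrow> Y \<in> t_ob T \<Longrightarrow> \<alpha> \<in> ars (t_hom T X Y) \<Longrightarrow>
      t_cmp2 T' (tf_ob P X) (tf_ob P Y) (tf_ob Q Y)
        (t_id2 T' (tf_ob P Y) (tf_ob Q Y) (\<eta> Y)) (fa (tf_hom P X Y) \<alpha>) =
      t_cmp2 T' (tf_ob P X) (tf_ob Q X) (tf_ob Q Y)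
        (fa (tf_hom Q X Y) \<alpha>) (t_id2 T' (tf_ob P X) (tf_ob Q X) (\<eta> X))"

definition t_iso :: "('o, 'm, 'c) tcat \<Rightarrow> 'o \<Rightarrow> 'o \<Rightarrow> 'm \<Rightarrow> bool" where
  "t_iso T X Y F \<longleftrightarrow> F \<in> obs (t_hom T X Y) \<and>
     (\<exists>G \<in> obs (t_hom T Y X). t_cmp T X Y X G F = t_id T X \<and> t_cmp T Y X Y F G = t_id T Y)"

locale strict_2nat_iso = strict_2nat +
  assumes component_iso: "X \<in> t_ob T \<Longrightarrow> t_iso T' (tf_ob P X) (tf_ob Q X) (\<eta> X)"

locale strict_2equivalence = P: strict_2functor T T' P + Q: strict_2functor T' T Q
  for T :: "('o, 'm, 'c) tcat" and T' :: "('p, 'n, 'd) tcat" and P and Q +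
  fixes \<eta> :: "'o \<Rightarrow> 'm" and \<epsilon> :: "'p \<Rightarrow> 'n"
  assumes unit: "strict_2nat_iso T T tf_id (tf_comp Q P) \<eta>"
    and counit: "strict_2nat_iso T' T' (tf_comp P Q) tf_id \<epsilon>"


section \<open>Smallness\<close>

text \<open>
  All data of small structures are elements of a type \<open>'u\<close> that codes ordered pairs.
  Smallness of a set is an arbitrary predicate closed under subsets and binary products (so,
  for example, the sets of any Grothendieck universe, or all sets of elements of an
  infinite type).
\<close>

record 'u universe =
  small :: "'u set \<Rightarrow> bool"
  enc :: "'u \<Rightarrow> 'u \<Rightarrow> 'u"

locale is_universe =
  fixes U :: "'u universe"
  assumes enc_inject: "enc U x y = enc U x' y' \<longleftrightarrow> x = x' \<and> y = y'"
    and small_subset: "small U S \<Longrightarrow> R \<subseteq> S \<Longrightarrow> small U R"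
    and small_prod: "small U S \<Longrightarrow> small U R \<Longrightarrow> small U {enc U x y |x y. x \<in> S \<and> y \<in> R}"

definition small_cat :: "'u universe \<Rightarrow> ('u, 'u, 'z) cat_scheme \<Rightarrow> bool" where
  "small_cat U C \<longleftrightarrow> small U (obs C) \<and> small U (ars C)"

definition small_icat ::
  "'u universe \<Rightarrow> ('u, 'u, 'z) cat_scheme \<Rightarrow> ('u, 'u, 'u, 'u) icat \<Rightarrow> bool" where
  "small_icat U C E \<longleftrightarrow> (\<forall>\<Gamma> \<in> obs C. small_cat U (fib E \<Gamma>))"


section \<open>Pre-categories with attributes\<close>

record 'u precwa =
  c_base :: "('u, 'u) dcat"
  c_tp :: "('u, 'u, 'u, 'u) icat"
  c_comp :: "('u, 'u, 'u, 'u, 'u, 'u \<times> 'u \<times> 'u) ifun"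

definition is_precwa :: "'u universe \<Rightarrow> 'u precwa \<Rightarrow> bool" where
  "is_precwa U X \<longleftrightarrow>
     display_category (c_base X) \<and> small_cat U (c_base X) \<and>
     strict_indexed_category (c_base X) (c_tp X) \<and> small_icat U (c_base X) (c_tp X) \<and>
     indexed_functor (c_base X) (c_tp X) (dic (c_base X)) (c_comp X) \<and>
     dcat_norm (c_base X) = c_base X \<and>
     icat_norm (c_base X) (c_tp X) = c_tp X \<and>
     ifun_norm (c_base X) (c_tp X) (c_comp X) = c_comp X"

record 'u cwa_mor =
  cm_base :: "('u, 'u, 'u, 'u) fnc"
  cm_tp :: "('u, 'u, 'u, 'u, 'u, 'u) ifun"
  cm_tau :: "'u \<Rightarrow> 'u \<Rightarrow> 'u \<times> 'u \<times> 'u"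

text \<open>The source and target of \<open>\<tau>\<close>, for a display functor \<open>F\<close> with action \<open>K\<close> on types.\<close>

definition tau_src ::
  "'u precwa \<Rightarrow> 'u precwa \<Rightarrow> ('u, 'u, 'u, 'u) fnc \<Rightarrow>
   ('u, 'u, 'u, 'u, 'u, 'u \<times> 'u \<times> 'u) ifun" where
  "tau_src X Y F =
     icomp (c_base X) (bc F (dic (c_base Y))) (dfun (c_base X) (c_base Y) F) (c_comp X)"

definition tau_tgt ::
  "'u precwa \<Rightarrow> 'u precwa \<Rightarrow> ('u, 'u, 'u, 'u) fnc \<Rightarrow> ('u, 'u, 'u, 'u, 'u, 'u) ifun \<Rightarrow>
   ('u, 'u, 'u, 'u, 'u, 'u \<times> 'u \<times> 'u) ifun" where
  "tau_tgt X Y F K = icomp (c_base X) (bc F (dic (c_base Y))) (bcf F (c_comp Y)) K"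

definition is_cwa_mor :: "'u precwa \<Rightarrow> 'u precwa \<Rightarrow> 'u cwa_mor \<Rightarrow> bool" where
  "is_cwa_mor X Y F \<longleftrightarrow>
     display_functor (c_base X) (c_base Y) (cm_base F) \<and>
     strictly_natural_functor (c_base X) (c_tp X) (bc (cm_base F) (c_tp Y)) (cm_tp F) \<and>
     indexed_nat_trans (c_base X) (c_tp X) (bc (cm_base F) (dic (c_base Y)))
       (tau_src X Y (cm_base F)) (tau_tgt X Y (cm_base F) (cm_tp F)) (cm_tau F) \<and>
     fnc_norm (c_base X) (cm_base F) = cm_base F \<and>
     ifun_norm (c_base X) (c_tp X) (cm_tp F) = cm_tp F \<and>
     itrans_norm (c_base X) (c_tp X) (cm_tau F) = cm_tau F"

definition cwa_id :: "'u precwa \<Rightarrow> 'u cwa_mor" where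
  "cwa_id X = \<lparr>
     cm_base = fnc_norm (c_base X) fid,
     cm_tp = ifun_norm (c_base X) (c_tp X) (iid (c_base X) (c_tp X)),
     cm_tau = itrans_norm (c_base X) (c_tp X)
       (\<lambda>\<Gamma> A. idn (dfib (c_base X) \<Gamma>) (fo (cp (c_comp X) \<Gamma>) A))\<rparr>"

text \<open>The action on types of a composite: \<open>F* (Tp G)\<close> after \<open>Tp F\<close>.\<close>

definition tp_comp ::
  "('u, 'u, 'z) cat_scheme \<Rightarrow> ('u, 'u, 'u, 'u) icat \<Rightarrow> ('u, 'u, 'u, 'u) icat \<Rightarrow>
   ('u, 'u, 'u, 'u) fnc \<Rightarrow> ('u, 'u, 'u, 'u, 'u, 'u) ifun \<Rightarrow>
   ('u, 'u, 'u, 'u) fnc \<Rightarrow> ('u, 'u, 'u, 'u, 'u, 'u) ifun \<Rightarrow> ('u, 'u, 'u, 'u, 'u, 'u) ifun" where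
  "tp_comp C E E'' G K F H = ifun_norm C E (icomp C (bc F (bc G E'')) (bcf F K) H)"

definition cwa_cmp ::
  "'u precwa \<Rightarrow> 'u precwa \<Rightarrow> 'u precwa \<Rightarrow> 'u cwa_mor \<Rightarrow> 'u cwa_mor \<Rightarrow> 'u cwa_mor" where
  "cwa_cmp X Y Z G F = \<lparr>
     cm_base = fnc_norm (c_base X) (fcomp (cm_base G) (cm_base F)),
     cm_tp = tp_comp (c_base X) (c_tp X) (c_tp Z) (cm_base G) (cm_tp G) (cm_base F) (cm_tp F),
     cm_tau = itrans_norm (c_base X) (c_tp X) (\<lambda>\<Gamma> A.
       let \<Gamma>' = fo (cm_base F) \<Gamma>; A' = fo (cp (cm_tp F) \<Gamma>) A in
       cmp (dfib (c_base Z) (fo (cm_base G) \<Gamma>'))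
         (cm_tau G \<Gamma>' A')
         (fa (cp (dfun (c_base Y) (c_base Z) (cm_base G)) \<Gamma>') (cm_tau F \<Gamma> A)))\<rparr>"

record 'u cwa_cell =
  cc_src :: "'u cwa_mor"
  cc_tgt :: "'u cwa_mor"
  cc_base :: "'u \<Rightarrow> 'u"
  cc_tp :: "'u \<Rightarrow> 'u \<Rightarrow> 'u"

text \<open>
  Transformations \<open>H \<Rightarrow> \<alpha>* E' \<circ> K\<close> over \<open>\<alpha> : F \<Rightarrow> G\<close>,
  with components \<open>H A \<rightarrow> (K A)[\<alpha> \<Gamma>]\<close>, and their operations
  when \<open>E'\<close> is strict.
\<close>

definition trans_over ::
  "('u, 'u, 'z) cat_scheme \<Rightarrow> ('u, 'u, 'u, 'u) icat \<Rightarrow> ('u, 'u, 'u, 'u) icat \<Rightarrow>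
   ('u, 'u, 'u, 'u) fnc \<Rightarrow> ('u, 'u, 'u, 'u) fnc \<Rightarrow> ('u \<Rightarrow> 'u) \<Rightarrow>
   ('u, 'u, 'u, 'u, 'u, 'u) ifun \<Rightarrow> ('u, 'u, 'u, 'u, 'u, 'u) ifun \<Rightarrow> ('u \<Rightarrow> 'u \<Rightarrow> 'u) \<Rightarrow> bool" where
  "trans_over C E E' F G \<alpha> H K \<mu> \<longleftrightarrow>
     indexed_nat_trans C E (bc F E') H (icomp C (bc F E') (astar C F G \<alpha> E') K) \<mu> \<and>
     itrans_norm C E \<mu> = \<mu>"

definition trans_id ::
  "('u, 'u, 'z) cat_scheme \<Rightarrow> ('u, 'u, 'u, 'u) icat \<Rightarrow> ('u, 'u, 'u, 'u) icat \<Rightarrow>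
   ('u, 'u, 'u, 'u) fnc \<Rightarrow> ('u, 'u, 'u, 'u, 'u, 'u) ifun \<Rightarrow> 'u \<Rightarrow> 'u \<Rightarrow> 'u" where
  "trans_id C E E' F H = itrans_norm C E (\<lambda>\<Gamma> A. idn (fib E' (fo F \<Gamma>)) (fo (cp H \<Gamma>) A))"

text \<open>\<open>A \<mapsto> \<nu> A[\<alpha> \<Gamma>] \<circ> \<mu> A\<close>, for \<open>\<mu>\<close> over \<open>\<alpha> : F \<Rightarrow> G\<close>.\<close>

definition trans_vcmp ::
  "('u, 'u, 'z) cat_scheme \<Rightarrow> ('u, 'u, 'u, 'u) icat \<Rightarrow> ('u, 'u, 'u, 'u) icat \<Rightarrow>
   ('u, 'u, 'u, 'u) fnc \<Rightarrow> ('u \<Rightarrow> 'u) \<Rightarrow> ('u \<Rightarrow> 'u \<Rightarrow> 'u) \<Rightarrow> ('u \<Rightarrow> 'u \<Rightarrow> 'u) \<Rightarrow> 'u \<Rightarrow> 'u \<Rightarrow> 'u" where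
  "trans_vcmp C E E' F \<alpha> \<nu> \<mu> = itrans_norm C E (\<lambda>\<Gamma> A.
     cmp (fib E' (fo F \<Gamma>)) (fa (ri E' (\<alpha> \<Gamma>)) (\<nu> \<Gamma> A)) (\<mu> \<Gamma> A))"

text \<open>
  For \<open>\<mu>\<close> over \<open>\<alpha> : F \<Rightarrow> F'\<close> (with target \<open>H'\<close> on types) and
  \<open>\<nu>\<close> over \<open>\<beta> : G \<Rightarrow> G'\<close> (with source \<open>K\<close> on types):
  \<open>A \<mapsto> \<nu> (H' A)[G (\<alpha> \<Gamma>)] \<circ> K (\<mu> A)\<close>.
\<close>

definition trans_hcmp ::
  "('u, 'u, 'z) cat_scheme \<Rightarrow> ('u, 'u, 'u, 'u) icat \<Rightarrow> ('u, 'u, 'u, 'u) icat \<Rightarrow>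
   ('u, 'u, 'u, 'u) fnc \<Rightarrow> ('u, 'u, 'u, 'u) fnc \<Rightarrow> ('u \<Rightarrow> 'u) \<Rightarrow> ('u, 'u, 'u, 'u, 'u, 'u) ifun \<Rightarrow>
   ('u, 'u, 'u, 'u) fnc \<Rightarrow> ('u, 'u, 'u, 'u, 'u, 'u) ifun \<Rightarrow>
   ('u \<Rightarrow> 'u \<Rightarrow> 'u) \<Rightarrow> ('u \<Rightarrow> 'u \<Rightarrow> 'u) \<Rightarrow> 'u \<Rightarrow> 'u \<Rightarrow> 'u" where
  "trans_hcmp C E E'' F F' \<alpha> H' G K \<nu> \<mu> = itrans_norm C E (\<lambda>\<Gamma> A.
     cmp (fib E'' (fo G (fo F \<Gamma>)))
       (fa (ri E'' (fa G (\<alpha> \<Gamma>))) (\<nu> (fo F' \<Gamma>) (fo (cp H' \<Gamma>) A)))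
       (fa (cp K (fo F \<Gamma>)) (\<mu> \<Gamma> A)))"

definition base_id :: "('u, 'u, 'z) cat_scheme \<Rightarrow> ('u, 'u, 'y) cat_scheme \<Rightarrow> ('u, 'u, 'u, 'u) fnc \<Rightarrow> 'u \<Rightarrow> 'u" where
  "base_id C D F = restrict (\<lambda>\<Gamma>. idn D (fo F \<Gamma>)) (obs C)"

definition base_vcmp ::
  "('u, 'u, 'z) cat_scheme \<Rightarrow> ('u, 'u, 'y) cat_scheme \<Rightarrow> ('u \<Rightarrow> 'u) \<Rightarrow> ('u \<Rightarrow> 'u) \<Rightarrow> 'u \<Rightarrow> 'u" where
  "base_vcmp C D \<beta> \<alpha> = restrict (\<lambda>\<Gamma>. cmp D (\<beta> \<Gamma>) (\<alpha> \<Gamma>)) (obs C)"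

definition base_hcmp ::
  "('u, 'u, 'z) cat_scheme \<Rightarrow> ('u, 'u, 'y) cat_scheme \<Rightarrow>
   ('u, 'u, 'u, 'u) fnc \<Rightarrow> ('u, 'u, 'u, 'u) fnc \<Rightarrow> ('u \<Rightarrow> 'u) \<Rightarrow> ('u \<Rightarrow> 'u) \<Rightarrow> 'u \<Rightarrow> 'u" where
  "base_hcmp C D F' G \<beta> \<alpha> = restrict (\<lambda>\<Gamma>. cmp D (\<beta> (fo F' \<Gamma>)) (fa G (\<alpha> \<Gamma>))) (obs C)"

definition is_cwa_cell :: "'u precwa \<Rightarrow> 'u precwa \<Rightarrow> 'u cwa_cell \<Rightarrow> bool" where
  "is_cwa_cell X Y a \<longleftrightarrow> (let F = cc_src a; G = cc_tgt a; \<alpha> = cc_base a in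
     is_cwa_mor X Y F \<and> is_cwa_mor X Y G \<and>
     nat_trans (c_base X) (c_base Y) (cm_base F) (cm_base G) \<alpha> \<and>
     restrict \<alpha> (obs (c_base X)) = \<alpha> \<and>
     trans_over (c_base X) (c_tp X) (c_tp Y) (cm_base F) (cm_base G) \<alpha> (cm_tp F) (cm_tp G) (cc_tp a) \<and>
     (\<forall>\<Gamma> \<in> obs (c_base X). \<forall>A \<in> obs (fib (c_tp X) \<Gamma>).
        let K = dfib (c_base Y) (fo (cm_base F) \<Gamma>) in
        cmp K (fa (cp (c_comp Y) (fo (cm_base F) \<Gamma>)) (cc_tp a \<Gamma> A)) (cm_tau F \<Gamma> A) =
        cmp K (ps (c_comp Y) (\<alpha> \<Gamma>) (fo (cp (cm_tp G) \<Gamma>) A))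
          (cmp K (fa (ri (dic (c_base Y)) (\<alpha> \<Gamma>)) (cm_tau G \<Gamma> A))
            (dalpha (c_base X) (c_base Y) (cm_base F) (cm_base G) \<alpha> (fo (cp (c_comp X) \<Gamma>) A)))))"

definition cwa_hom :: "'u precwa \<Rightarrow> 'u precwa \<Rightarrow> ('u cwa_mor, 'u cwa_cell) cat" where
  "cwa_hom X Y = \<lparr>
     obs = {F. is_cwa_mor X Y F},
     ars = {a. is_cwa_cell X Y a},
     src = cc_src,
     tgt = cc_tgt,
     idn = (\<lambda>F. \<lparr>cc_src = F, cc_tgt = F,
       cc_base = base_id (c_base X) (c_base Y) (cm_base F),
       cc_tp = trans_id (c_base X) (c_tp X) (c_tp Y) (cm_base F) (cm_tp F)\<rparr>),
     cmp = (\<lambda>b a. \<lparr>cc_src = cc_src a, cc_tgt = cc_tgt b,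
       cc_base = base_vcmp (c_base X) (c_base Y) (cc_base b) (cc_base a),
       cc_tp = trans_vcmp (c_base X) (c_tp X) (c_tp Y) (cm_base (cc_src a))
                 (cc_base a) (cc_tp b) (cc_tp a)\<rparr>)\<rparr>"

definition cwa_cmp2 ::
  "'u precwa \<Rightarrow> 'u precwa \<Rightarrow> 'u precwa \<Rightarrow> 'u cwa_cell \<Rightarrow> 'u cwa_cell \<Rightarrow> 'u cwa_cell" where
  "cwa_cmp2 X Y Z b a = \<lparr>
     cc_src = cwa_cmp X Y Z (cc_src b) (cc_src a),
     cc_tgt = cwa_cmp X Y Z (cc_tgt b) (cc_tgt a),
     cc_base = base_hcmp (c_base X) (c_base Z) (cm_base (cc_tgt a)) (cm_base (cc_src b))
                 (cc_base b) (cc_base a),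
     cc_tp = trans_hcmp (c_base X) (c_tp X) (c_tp Z) (cm_base (cc_src a)) (cm_base (cc_tgt a))
               (cc_base a) (cm_tp (cc_tgt a)) (cm_base (cc_src b)) (cm_tp (cc_src b))
               (cc_tp b) (cc_tp a)\<rparr>"

definition PreCwA :: "'u universe \<Rightarrow> ('u precwa, 'u cwa_mor, 'u cwa_cell) tcat" where
  "PreCwA U = \<lparr>
     t_ob = {X. is_precwa U X},
     t_hom = cwa_hom,
     t_id = cwa_id,
     t_cmp = cwa_cmp,
     t_cmp2 = cwa_cmp2\<rparr>"

definition is_cwa :: "'u precwa \<Rightarrow> bool" where
  "is_cwa X \<longleftrightarrow> indexed_equivalence (c_base X) (c_tp X) (dic (c_base X)) (c_comp X)"

definition tau_invertible :: "'u precwa \<Rightarrow> 'u precwa \<Rightarrow> 'u cwa_mor \<Rightarrow> bool" where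
  "tau_invertible X Y F \<longleftrightarrow>
     invertible_itrans (c_base X) (c_tp X) (bc (cm_base F) (dic (c_base Y)))
       (tau_src X Y (cm_base F)) (tau_tgt X Y (cm_base F) (cm_tp F)) (cm_tau F)"

definition CwA :: "'u universe \<Rightarrow> ('u precwa, 'u cwa_mor, 'u cwa_cell) tcat" where
  "CwA U = sub_2cat (PreCwA U) is_cwa tau_invertible"


section \<open>Pre-natural models\<close>

text \<open>\<open>n_ext \<Gamma> A\<close> is the display of \<open>\<Gamma>.A\<close>, and \<open>n_var \<Gamma> A\<close> is the universal element.\<close>

record 'u prenm =
  n_base :: "('u, 'u) dcat"
  n_tp :: "('u, 'u, 'u, 'u) icat"
  n_tm :: "('u, 'u, 'u, 'u) icat"
  n_proj :: "('u, 'u, 'u, 'u, 'u, 'u) ifun"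
  n_ext :: "'u \<Rightarrow> 'u \<Rightarrow> 'u"
  n_var :: "'u \<Rightarrow> 'u \<Rightarrow> 'u"

text \<open>
  The display \<open>p\<close> over \<open>\<Gamma>\<close> represents, with universal element \<open>v\<close>, the
  presheaf of pairs of \<open>u : \<Delta> \<rightarrow> \<Gamma>\<close> and a term over \<open>\<Delta>\<close> of type
  \<open>A[u]\<close>.
\<close>

definition represents :: "'u prenm \<Rightarrow> 'u \<Rightarrow> 'u \<Rightarrow> 'u \<Rightarrow> 'u \<Rightarrow> bool" where
  "represents N \<Gamma> A p v \<longleftrightarrow> (let C = n_base N in
     p \<in> dsp C \<and> tgt C p = \<Gamma> \<and>
     v \<in> obs (fib (n_tm N) (src C p)) \<and>
     fo (cp (n_proj N) (src C p)) v = fo (ri (n_tp N) p) A \<and>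
     (\<forall>\<Delta> u t. u \<in> hom C \<Delta> \<Gamma> \<and> t \<in> obs (fib (n_tm N) \<Delta>) \<and>
        fo (cp (n_proj N) \<Delta>) t = fo (ri (n_tp N) u) A \<longrightarrow>
        (\<exists>!k. k \<in> hom C \<Delta> (src C p) \<and> cmp C p k = u \<and> fo (ri (n_tm N) k) v = t)))"

definition is_prenm :: "'u universe \<Rightarrow> 'u prenm \<Rightarrow> bool" where
  "is_prenm U N \<longleftrightarrow> (let C = n_base N in
     display_category C \<and> small_cat U C \<and>
     strict_indexed_category C (n_tp N) \<and> small_icat U C (n_tp N) \<and>
     strict_indexed_category C (n_tm N) \<and> small_icat U C (n_tm N) \<and>
     strictly_natural_functor C (n_tm N) (n_tp N) (n_proj N) \<and>
     (\<forall>\<Gamma> \<in> obs C. discrete_opfibration (fib (n_tm N) \<Gamma>) (fib (n_tp N) \<Gamma>) (cp (n_proj N) \<Gamma>)) \<and>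
     (\<forall>\<Gamma> \<in> obs C. \<forall>A \<in> obs (fib (n_tp N) \<Gamma>). represents N \<Gamma> A (n_ext N \<Gamma> A) (n_var N \<Gamma> A)) \<and>
     dcat_norm C = C \<and>
     icat_norm C (n_tp N) = n_tp N \<and>
     icat_norm C (n_tm N) = n_tm N \<and>
     ifun_norm C (n_tm N) (n_proj N) = n_proj N \<and>
     itrans_norm C (n_tp N) (n_ext N) = n_ext N \<and>
     itrans_norm C (n_tp N) (n_var N) = n_var N)"

text \<open>The map \<open>k\<close> into \<open>\<Gamma>.A\<close> over \<open>u\<close> with \<open>v[k] = t\<close>.\<close>

definition ext_pair :: "'u prenm \<Rightarrow> 'u \<Rightarrow> 'u \<Rightarrow> 'u \<Rightarrow> 'u \<Rightarrow> 'u" where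
  "ext_pair N \<Gamma> A u t = (let C = n_base N; p = n_ext N \<Gamma> A in
     THE k. k \<in> hom C (src C u) (src C p) \<and> cmp C p k = u \<and>
            fo (ri (n_tm N) k) (n_var N \<Gamma> A) = t)"

definition nm_comp :: "'u prenm \<Rightarrow> ('u, 'u, 'u, 'u, 'u, 'u \<times> 'u \<times> 'u) ifun" where
  "nm_comp N = (let C = n_base N in ifun_norm C (n_tp N) \<lparr>
     cp = (\<lambda>\<Gamma>. \<lparr>
       fo = n_ext N \<Gamma>,
       fa = (\<lambda>f. let A = src (fib (n_tp N) \<Gamma>) f; B = tgt (fib (n_tp N) \<Gamma>) f;
                     p = n_ext N \<Gamma> A; \<Theta> = src C p in
              (p, n_ext N \<Gamma> B,
               ext_pair N \<Gamma> B p
                 (tgt (fib (n_tm N) \<Theta>)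
                   (dlift (fib (n_tm N) \<Theta>) (cp (n_proj N) \<Theta>) (fa (ri (n_tp N) p) f) (n_var N \<Gamma> A)))))\<rparr>),
     ps = (\<lambda>u A. let p = n_ext N (tgt C u) A; q = pb C u p; B = fo (ri (n_tp N) u) A in
             (q, n_ext N (src C u) B,
              ext_pair N (src C u) B q (fo (ri (n_tm N) (pt C u p)) (n_var N (tgt C u) A))))\<rparr>)"

record 'u nm_mor =
  nm_base :: "('u, 'u, 'u, 'u) fnc"
  nm_tp :: "('u, 'u, 'u, 'u, 'u, 'u) ifun"
  nm_tm :: "('u, 'u, 'u, 'u, 'u, 'u) ifun"

definition is_nm_mor :: "'u prenm \<Rightarrow> 'u prenm \<Rightarrow> 'u nm_mor \<Rightarrow> bool" where
  "is_nm_mor N M F \<longleftrightarrow>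
     display_functor (n_base N) (n_base M) (nm_base F) \<and>
     strictly_natural_functor (n_base N) (n_tp N) (bc (nm_base F) (n_tp M)) (nm_tp F) \<and>
     strictly_natural_functor (n_base N) (n_tm N) (bc (nm_base F) (n_tm M)) (nm_tm F) \<and>
     (\<forall>\<Gamma> \<in> obs (n_base N). \<forall>t \<in> obs (fib (n_tm N) \<Gamma>).
        fo (cp (nm_tp F) \<Gamma>) (fo (cp (n_proj N) \<Gamma>) t) =
        fo (cp (n_proj M) (fo (nm_base F) \<Gamma>)) (fo (cp (nm_tm F) \<Gamma>) t)) \<and>
     (\<forall>\<Gamma> \<in> obs (n_base N). \<forall>k \<in> ars (fib (n_tm N) \<Gamma>).
        fa (cp (nm_tp F) \<Gamma>) (fa (cp (n_proj N) \<Gamma>) k) =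
        fa (cp (n_proj M) (fo (nm_base F) \<Gamma>)) (fa (cp (nm_tm F) \<Gamma>) k)) \<and>
     fnc_norm (n_base N) (nm_base F) = nm_base F \<and>
     ifun_norm (n_base N) (n_tp N) (nm_tp F) = nm_tp F \<and>
     ifun_norm (n_base N) (n_tm N) (nm_tm F) = nm_tm F"

definition nm_tau :: "'u prenm \<Rightarrow> 'u prenm \<Rightarrow> 'u nm_mor \<Rightarrow> 'u \<Rightarrow> 'u \<Rightarrow> 'u \<times> 'u \<times> 'u" where
  "nm_tau N M F = itrans_norm (n_base N) (n_tp N) (\<lambda>\<Gamma> A.
     let p = n_ext N \<Gamma> A; \<Gamma>' = fo (nm_base F) \<Gamma>; A' = fo (cp (nm_tp F) \<Gamma>) A in
     (fa (nm_base F) p, n_ext M \<Gamma>' A',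
      ext_pair M \<Gamma>' A' (fa (nm_base F) p) (fo (cp (nm_tm F) (src (n_base N) p)) (n_var N \<Gamma> A))))"

definition nm_id :: "'u prenm \<Rightarrow> 'u nm_mor" where
  "nm_id N = \<lparr>
     nm_base = fnc_norm (n_base N) fid,
     nm_tp = ifun_norm (n_base N) (n_tp N) (iid (n_base N) (n_tp N)),
     nm_tm = ifun_norm (n_base N) (n_tm N) (iid (n_base N) (n_tm N))\<rparr>"

definition nm_cmp ::
  "'u prenm \<Rightarrow> 'u prenm \<Rightarrow> 'u prenm \<Rightarrow> 'u nm_mor \<Rightarrow> 'u nm_mor \<Rightarrow> 'u nm_mor" where
  "nm_cmp N M L G F = \<lparr>
     nm_base = fnc_norm (n_base N) (fcomp (nm_base G) (nm_base F)),
     nm_tp = tp_comp (n_base N) (n_tp N) (n_tp L) (nm_base G) (nm_tp G) (nm_base F) (nm_tp F),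
     nm_tm = tp_comp (n_base N) (n_tm N) (n_tm L) (nm_base G) (nm_tm G) (nm_base F) (nm_tm F)\<rparr>"

record 'u nm_cell =
  nc_src :: "'u nm_mor"
  nc_tgt :: "'u nm_mor"
  nc_base :: "'u \<Rightarrow> 'u"
  nc_tp :: "'u \<Rightarrow> 'u \<Rightarrow> 'u"
  nc_tm :: "'u \<Rightarrow> 'u \<Rightarrow> 'u"

definition is_nm_cell :: "'u prenm \<Rightarrow> 'u prenm \<Rightarrow> 'u nm_cell \<Rightarrow> bool" where
  "is_nm_cell N M a \<longleftrightarrow> (let F = nc_src a; G = nc_tgt a; \<alpha> = nc_base a in
     is_nm_mor N M F \<and> is_nm_mor N M G \<and>
     nat_trans (n_base N) (n_base M) (nm_base F) (nm_base G) \<alpha> \<and>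
     restrict \<alpha> (obs (n_base N)) = \<alpha> \<and>
     trans_over (n_base N) (n_tp N) (n_tp M) (nm_base F) (nm_base G) \<alpha> (nm_tp F) (nm_tp G) (nc_tp a) \<and>
     trans_over (n_base N) (n_tm N) (n_tm M) (nm_base F) (nm_base G) \<alpha> (nm_tm F) (nm_tm G) (nc_tm a) \<and>
     (\<forall>\<Gamma> \<in> obs (n_base N). \<forall>t \<in> obs (fib (n_tm N) \<Gamma>).
        fa (cp (n_proj M) (fo (nm_base F) \<Gamma>)) (nc_tm a \<Gamma> t) =
        nc_tp a \<Gamma> (fo (cp (n_proj N) \<Gamma>) t)))"

definition nm_hom :: "'u prenm \<Rightarrow> 'u prenm \<Rightarrow> ('u nm_mor, 'u nm_cell) cat" where
  "nm_hom N M = \<lparr>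
     obs = {F. is_nm_mor N M F},
     ars = {a. is_nm_cell N M a},
     src = nc_src,
     tgt = nc_tgt,
     idn = (\<lambda>F. \<lparr>nc_src = F, nc_tgt = F,
       nc_base = base_id (n_base N) (n_base M) (nm_base F),
       nc_tp = trans_id (n_base N) (n_tp N) (n_tp M) (nm_base F) (nm_tp F),
       nc_tm = trans_id (n_base N) (n_tm N) (n_tm M) (nm_base F) (nm_tm F)\<rparr>),
     cmp = (\<lambda>b a. \<lparr>nc_src = nc_src a, nc_tgt = nc_tgt b,
       nc_base = base_vcmp (n_base N) (n_base M) (nc_base b) (nc_base a),
       nc_tp = trans_vcmp (n_base N) (n_tp N) (n_tp M) (nm_base (nc_src a))
                 (nc_base a) (nc_tp b) (nc_tp a),
       nc_tm = trans_vcmp (n_base N) (n_tm N) (n_tm M) (nm_base (nc_src a))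
                 (nc_base a) (nc_tm b) (nc_tm a)\<rparr>)\<rparr>"

definition nm_cmp2 ::
  "'u prenm \<Rightarrow> 'u prenm \<Rightarrow> 'u prenm \<Rightarrow> 'u nm_cell \<Rightarrow> 'u nm_cell \<Rightarrow> 'u nm_cell" where
  "nm_cmp2 N M L b a = \<lparr>
     nc_src = nm_cmp N M L (nc_src b) (nc_src a),
     nc_tgt = nm_cmp N M L (nc_tgt b) (nc_tgt a),
     nc_base = base_hcmp (n_base N) (n_base L) (nm_base (nc_tgt a)) (nm_base (nc_src b))
                 (nc_base b) (nc_base a),
     nc_tp = trans_hcmp (n_base N) (n_tp N) (n_tp L) (nm_base (nc_src a)) (nm_base (nc_tgt a))
               (nc_base a) (nm_tp (nc_tgt a)) (nm_base (nc_src b)) (nm_tp (nc_src b))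
               (nc_tp b) (nc_tp a),
     nc_tm = trans_hcmp (n_base N) (n_tm N) (n_tm L) (nm_base (nc_src a)) (nm_base (nc_tgt a))
               (nc_base a) (nm_tm (nc_tgt a)) (nm_base (nc_src b)) (nm_tm (nc_src b))
               (nc_tm b) (nc_tm a)\<rparr>"

definition PreNM :: "'u universe \<Rightarrow> ('u prenm, 'u nm_mor, 'u nm_cell) tcat" where
  "PreNM U = \<lparr>
     t_ob = {N. is_prenm U N},
     t_hom = nm_hom,
     t_id = nm_id,
     t_cmp = nm_cmp,
     t_cmp2 = nm_cmp2\<rparr>"


section \<open>The 2-functor from pre-natural models to pre-CwAs\<close>

definition C_ob :: "'u prenm \<Rightarrow> 'u precwa" where
  "C_ob N = \<lparr>c_base = n_base N, c_tp = n_tp N, c_comp = nm_comp N\<rparr>"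

definition C_mor :: "'u prenm \<Rightarrow> 'u prenm \<Rightarrow> 'u nm_mor \<Rightarrow> 'u cwa_mor" where
  "C_mor N M F = \<lparr>cm_base = nm_base F, cm_tp = nm_tp F, cm_tau = nm_tau N M F\<rparr>"

definition C_cell :: "'u prenm \<Rightarrow> 'u prenm \<Rightarrow> 'u nm_cell \<Rightarrow> 'u cwa_cell" where
  "C_cell N M a = \<lparr>
     cc_src = C_mor N M (nc_src a),
     cc_tgt = C_mor N M (nc_tgt a),
     cc_base = nc_base a,
     cc_tp = nc_tp a\<rparr>"

definition C_functor ::
  "('u prenm, 'u nm_mor, 'u nm_cell, 'u precwa, 'u cwa_mor, 'u cwa_cell) tfun" where
  "C_functor = \<lparr>
     tf_ob = C_ob,
     tf_hom = (\<lambda>N M. \<lparr>fo = C_mor N M, fa = C_cell N M\<rparr>)\<rparr>"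

definition is_nm :: "'u prenm \<Rightarrow> bool" where
  "is_nm N \<longleftrightarrow> indexed_equivalence (n_base N) (n_tp N) (dic (n_base N)) (nm_comp N)"

definition nm_tau_invertible :: "'u prenm \<Rightarrow> 'u prenm \<Rightarrow> 'u nm_mor \<Rightarrow> bool" where
  "nm_tau_invertible N M F \<longleftrightarrow>
     invertible_itrans (n_base N) (n_tp N) (bc (nm_base F) (dic (n_base M)))
       (icomp (n_base N) (bc (nm_base F) (dic (n_base M)))
          (dfun (n_base N) (n_base M) (nm_base F)) (nm_comp N))
       (icomp (n_base N) (bc (nm_base F) (dic (n_base M)))
          (bcf (nm_base F) (nm_comp M)) (nm_tp F))
       (nm_tau N M F)"

definition NM :: "'u universe \<Rightarrow> ('u prenm, 'u nm_mor, 'u nm_cell) tcat" where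
  "NM U = sub_2cat (PreNM U) is_nm nm_tau_invertible"


section \<open>The 2-functor from pre-CwAs to pre-natural models\<close>

text \<open>
  The strict pullback of \<open>K : E'' \<rightarrow> E'\<close> along \<open>H : E \<rightarrow> E'\<close>, for
  \<open>E\<close> strict and \<open>K\<close> strictly natural with discrete opfibration components. The
  reindexing of \<open>(A, x)\<close> along \<open>u\<close> transports \<open>x[u]\<close>, which lies over
  \<open>(H A)[u]\<close>, along the structure isomorphism \<open>(H A)[u] \<rightarrow> H (A[u])\<close>.
\<close>

definition ipull_push ::
  "('o, 'a, 'z) cat_scheme \<Rightarrow> ('o, 'a, 'fo, 'fa) icat \<Rightarrow> ('o, 'a, 'ko, 'ka) icat \<Rightarrow>
   ('o, 'a, 'fo, 'fa, 'go, 'ga) ifun \<Rightarrow> ('o, 'a, 'ko, 'ka, 'go, 'ga) ifun \<Rightarrow>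
   'a \<Rightarrow> 'fo \<times> 'ko \<Rightarrow> 'fo \<times> 'ko" where
  "ipull_push C E E'' H K u = (\<lambda>(A, x).
     (fo (ri E u) A,
      tgt (fib E'' (src C u))
        (dlift (fib E'' (src C u)) (cp K (src C u)) (ps H u A) (fo (ri E'' u) x))))"

definition ipull_fib ::
  "('o, 'a, 'fo, 'fa) icat \<Rightarrow> ('o, 'a, 'ko, 'ka) icat \<Rightarrow>
   ('o, 'a, 'fo, 'fa, 'go, 'ga) ifun \<Rightarrow> ('o, 'a, 'ko, 'ka, 'go, 'ga) ifun \<Rightarrow>
   'o \<Rightarrow> ('fo \<times> 'ko, 'fa \<times> 'ka) cat" where
  "ipull_fib E E'' H K \<Gamma> = (prod_cat (fib E \<Gamma>) (fib E'' \<Gamma>))\<lparr>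
     obs := {(A, x). A \<in> obs (fib E \<Gamma>) \<and> x \<in> obs (fib E'' \<Gamma>) \<and>
                     fo (cp H \<Gamma>) A = fo (cp K \<Gamma>) x},
     ars := {(f, k). f \<in> ars (fib E \<Gamma>) \<and> k \<in> ars (fib E'' \<Gamma>) \<and>
                     fa (cp H \<Gamma>) f = fa (cp K \<Gamma>) k}\<rparr>"

definition ipull ::
  "('o, 'a, 'z) cat_scheme \<Rightarrow> ('o, 'a, 'fo, 'fa) icat \<Rightarrow> ('o, 'a, 'ko, 'ka) icat \<Rightarrow>
   ('o, 'a, 'fo, 'fa, 'go, 'ga) ifun \<Rightarrow> ('o, 'a, 'ko, 'ka, 'go, 'ga) ifun \<Rightarrow>
   ('o, 'a, 'fo \<times> 'ko, 'fa \<times> 'ka) icat" where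
  "ipull C E E'' H K = \<lparr>
     fib = ipull_fib E E'' H K,
     ri = (\<lambda>u. \<lparr>
       fo = ipull_push C E E'' H K u,
       fa = (\<lambda>(f, k). let f' = fa (ri E u) f;
                 x = snd (ipull_push C E E'' H K u (src (fib E (tgt C u)) f, src (fib E'' (tgt C u)) k)) in
              (f', dlift (fib E'' (src C u)) (cp K (src C u)) (fa (cp H (src C u)) f') x))\<rparr>),
     un = (\<lambda>\<Gamma> X. idn (ipull_fib E E'' H K \<Gamma>) X),
     cm = (\<lambda>u v X. idn (ipull_fib E E'' H K (src C v)) (ipull_push C E E'' H K (cmp C u v) X))\<rparr>"

text \<open>Transport of an indexed category along injective codings of objects and arrows.\<close>

definition icat_code ::
  "('o, 'a, 'z) cat_scheme \<Rightarrow> ('fo \<Rightarrow> 'go) \<Rightarrow> ('fa \<Rightarrow> 'ga) \<Rightarrow>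
   ('o, 'a, 'fo, 'fa) icat \<Rightarrow> ('o, 'a, 'go, 'ga) icat" where
  "icat_code C eo ea E = (let
       do = (\<lambda>\<Gamma>. inv_into (obs (fib E \<Gamma>)) eo);
       da = (\<lambda>\<Gamma>. inv_into (ars (fib E \<Gamma>)) ea) in \<lparr>
     fib = (\<lambda>\<Gamma>. \<lparr>
       obs = eo ` obs (fib E \<Gamma>),
       ars = ea ` ars (fib E \<Gamma>),
       src = (\<lambda>k. eo (src (fib E \<Gamma>) (da \<Gamma> k))),
       tgt = (\<lambda>k. eo (tgt (fib E \<Gamma>) (da \<Gamma> k))),
       idn = (\<lambda>x. ea (idn (fib E \<Gamma>) (do \<Gamma> x))),
       cmp = (\<lambda>l k. ea (cmp (fib E \<Gamma>) (da \<Gamma> l) (da \<Gamma> k)))\<rparr>),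
     ri = (\<lambda>u. \<lparr>
       fo = (\<lambda>x. eo (fo (ri E u) (do (tgt C u) x))),
       fa = (\<lambda>k. ea (fa (ri E u) (da (tgt C u) k)))\<rparr>),
     un = (\<lambda>\<Gamma> x. ea (un E \<Gamma> (do \<Gamma> x))),
     cm = (\<lambda>u v x. ea (cm E u v (do (tgt C u) x)))\<rparr>)"

text \<open>
  The pullback of \<open>varpi\<close> along comprehension. An object \<open>(A, (p, s))\<close> of it has
  \<open>p = comp A\<close>, so it is coded by \<open>A\<close> and \<open>s\<close>; an arrow
  \<open>(f, ((p, s), (q, t), h))\<close> has \<open>(p, q, h) = comp f\<close>, so it is coded by
  \<open>f\<close>, \<open>s\<close> and \<open>t\<close>.
\<close>

definition P_pull ::
  "'u precwa \<Rightarrow> ('u, 'u, 'u \<times> 'u \<times> 'u, 'u \<times> ('u \<times> 'u) \<times> ('u \<times> 'u) \<times> 'u) icat" where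
  "P_pull X = ipull (c_base X) (c_tp X) (sic (c_base X)) (c_comp X) (varpi (c_base X))"

definition enc_ob :: "'u universe \<Rightarrow> 'u \<times> 'u \<times> 'u \<Rightarrow> 'u" where
  "enc_ob U = (\<lambda>(A, p, s). enc U A s)"

definition enc_ar :: "'u universe \<Rightarrow> 'u \<times> ('u \<times> 'u) \<times> ('u \<times> 'u) \<times> 'u \<Rightarrow> 'u" where
  "enc_ar U = (\<lambda>(f, (p, s), (q, t), h). enc U f (enc U s t))"

definition dec_ob :: "'u universe \<Rightarrow> 'u precwa \<Rightarrow> 'u \<Rightarrow> 'u \<Rightarrow> 'u \<times> 'u \<times> 'u" where
  "dec_ob U X \<Gamma> = inv_into (obs (fib (P_pull X) \<Gamma>)) (enc_ob U)"

definition dec_ar ::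
  "'u universe \<Rightarrow> 'u precwa \<Rightarrow> 'u \<Rightarrow> 'u \<Rightarrow> 'u \<times> ('u \<times> 'u) \<times> ('u \<times> 'u) \<times> 'u" where
  "dec_ar U X \<Gamma> = inv_into (ars (fib (P_pull X) \<Gamma>)) (enc_ar U)"

definition P_tm :: "'u universe \<Rightarrow> 'u precwa \<Rightarrow> ('u, 'u, 'u, 'u) icat" where
  "P_tm U X = icat_norm (c_base X) (icat_code (c_base X) (enc_ob U) (enc_ar U) (P_pull X))"

definition P_proj :: "'u universe \<Rightarrow> 'u precwa \<Rightarrow> ('u, 'u, 'u, 'u, 'u, 'u) ifun" where
  "P_proj U X = ifun_norm (c_base X) (P_tm U X) \<lparr>
     cp = (\<lambda>\<Gamma>. \<lparr>fo = (\<lambda>x. fst (dec_ob U X \<Gamma> x)), fa = (\<lambda>k. fst (dec_ar U X \<Gamma> k))\<rparr>),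
     ps = (\<lambda>u x. idn (fib (c_tp X) (src (c_base X) u))
                   (fo (ri (c_tp X) u) (fst (dec_ob U X (tgt (c_base X) u) x))))\<rparr>"

text \<open>
  The universal element of \<open>p = comp A\<close>: the diagonal section of the pullback of
  \<open>p\<close> along itself, transported along \<open>p* (comp A) \<cong> comp (A[p])\<close>.
\<close>

definition P_var :: "'u universe \<Rightarrow> 'u precwa \<Rightarrow> 'u \<Rightarrow> 'u \<Rightarrow> 'u" where
  "P_var U X \<Gamma> A = (let C = c_base X; p = fo (cp (c_comp X) \<Gamma>) A; i = idn C (src C p);
       B = fo (ri (c_tp X) p) A in
     enc_ob U (B, fo (cp (c_comp X) (src C p)) B,
       cmp C (und (ps (c_comp X) p A)) (pb_pair C (pb C p p) (pt C p p) i i)))"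

definition P_ob :: "'u universe \<Rightarrow> 'u precwa \<Rightarrow> 'u prenm" where
  "P_ob U X = \<lparr>
     n_base = c_base X,
     n_tp = c_tp X,
     n_tm = P_tm U X,
     n_proj = P_proj U X,
     n_ext = itrans_norm (c_base X) (c_tp X) (\<lambda>\<Gamma> A. fo (cp (c_comp X) \<Gamma>) A),
     n_var = itrans_norm (c_base X) (c_tp X) (P_var U X)\<rparr>"

text \<open>
  \<open>(A, (p, s))\<close> is sent to \<open>F A\<close> with the section \<open>\<tau> A \<circ> F s\<close>. The action
  on arrows and the components over a 2-cell are determined by unique lifting.
\<close>

definition P_tm_ob :: "'u universe \<Rightarrow> 'u precwa \<Rightarrow> 'u precwa \<Rightarrow> 'u cwa_mor \<Rightarrow> 'u \<Rightarrow> 'u \<Rightarrow> 'u" where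
  "P_tm_ob U X Y F \<Gamma> x = (let (A, p, s) = dec_ob U X \<Gamma> x; B = fo (cp (cm_tp F) \<Gamma>) A in
     enc_ob U (B, fo (cp (c_comp Y) (fo (cm_base F) \<Gamma>)) B,
       cmp (c_base Y) (und (cm_tau F \<Gamma> A)) (fa (cm_base F) s)))"

definition P_mor :: "'u universe \<Rightarrow> 'u precwa \<Rightarrow> 'u precwa \<Rightarrow> 'u cwa_mor \<Rightarrow> 'u nm_mor" where
  "P_mor U X Y F = \<lparr>
     nm_base = cm_base F,
     nm_tp = cm_tp F,
     nm_tm = ifun_norm (c_base X) (P_tm U X) \<lparr>
       cp = (\<lambda>\<Gamma>. let \<Gamma>' = fo (cm_base F) \<Gamma> in \<lparr>
         fo = P_tm_ob U X Y F \<Gamma>,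
         fa = (\<lambda>k. dlift (fib (P_tm U Y) \<Gamma>') (cp (P_proj U Y) \<Gamma>')
                 (fa (cp (cm_tp F) \<Gamma>) (fa (cp (P_proj U X) \<Gamma>) k))
                 (P_tm_ob U X Y F \<Gamma> (src (fib (P_tm U X) \<Gamma>) k)))\<rparr>),
       ps = (\<lambda>u x. idn (fib (P_tm U Y) (fo (cm_base F) (src (c_base X) u)))
              (P_tm_ob U X Y F (src (c_base X) u) (fo (ri (P_tm U X) u) x)))\<rparr>\<rparr>"

definition P_cell :: "'u universe \<Rightarrow> 'u precwa \<Rightarrow> 'u precwa \<Rightarrow> 'u cwa_cell \<Rightarrow> 'u nm_cell" where
  "P_cell U X Y a = \<lparr>
     nc_src = P_mor U X Y (cc_src a),
     nc_tgt = P_mor U X Y (cc_tgt a),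
     nc_base = cc_base a,
     nc_tp = cc_tp a,
     nc_tm = itrans_norm (c_base X) (P_tm U X) (\<lambda>\<Gamma> x.
       let \<Gamma>' = fo (cm_base (cc_src a)) \<Gamma> in
       dlift (fib (P_tm U Y) \<Gamma>') (cp (P_proj U Y) \<Gamma>')
         (cc_tp a \<Gamma> (fo (cp (P_proj U X) \<Gamma>) x))
         (P_tm_ob U X Y (cc_src a) \<Gamma> x))\<rparr>"

definition P_functor ::
  "'u universe \<Rightarrow> ('u precwa, 'u cwa_mor, 'u cwa_cell, 'u prenm, 'u nm_mor, 'u nm_cell) tfun" where
  "P_functor U = \<lparr>
     tf_ob = P_ob U,
     tf_hom = (\<lambda>X Y. \<lparr>fo = P_mor U X Y, fa = P_cell U X Y\<rparr>)\<rparr>"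

end

theory Submission
  imports Defs
begin

text \<open>
  The 2-functor \<open>C\<close> is bijective on 1-cells and on 2-cells. A morphism into \<open>\<Gamma>.A\<close> is
  determined by its composite with the display and by the term it pulls back from the universal
  element, so the component \<open>\<tau> A\<close> of a morphism \<open>F\<close> is the same datum as a term
  \<open>w A\<close> over \<open>F(\<Gamma>.A)\<close> of type \<open>(F A)[F p]\<close>, and the action of \<open>F\<close> on terms
  is recovered as \<open>t \<mapsto> (w A)[F s]\<close>, where \<open>s\<close> is the section of \<open>\<Gamma>.A\<close>
  classifying \<open>t\<close>; 2-cells on terms are recovered by unique lifting. Since moreover
  \<open>C (P X) = X\<close> holds strictly and \<open>P\<close> is on morphisms the inverse of \<open>C\<close>, all
  2-categorical laws transfer from pre-natural models to pre-CwAs, the unit is the identity, and the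
  counit at \<open>N\<close> is the unique 1-cell from \<open>P (C N)\<close> to \<open>N\<close> that \<open>C\<close> sends to
  the identity. The conditions cutting out CwAs and natural models correspond under \<open>C\<close> by
  definition, so the same argument applies to the sub-2-categories.
\<close>

section \<open>Categories, functors and transformations\<close>

text \<open>The 2-category laws are checked for pre-natural models because there a cell consists,
  over a common base, of two strict pieces of data, on types and on terms, linked only through the
  projection. \<open>strict_mor\<close> and \<open>strict_trans\<close> turn their coherence into
  equations, and the same lemmas serve both pieces.

  The obstacle is comprehension, which is only pseudonatural: chosen pullbacks compose up to
  isomorphism, and display functors preserve them up to a comparison. These isomorphisms enter the
  axioms of \<tau> and of 2-cells of pre-CwAs. Each such axiom equates maps into some extension;
  evaluated at the universal element it becomes an equation between terms, whose reindexing is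
  strict. \<open>tau_iff\<close> and \<open>cell_iff\<close> are these translations.

  Conversely, \<open>P_ob\<close> has to produce strict reindexing of sections. Through the
  pseudonaturality map a section of \<open>comp (A[u])\<close> is the same as a lift of
  \<open>u\<close> through \<open>comp A\<close>, and on lifts reindexing is precomposition;
  \<open>sh\<close> is this correspondence. The counit is not an identity because the terms of
  \<open>P_ob U (C_ob N)\<close> are coded sections rather than the terms of
  \<open>N\<close>.\<close>

declare hom_def [simp]

context category
begin

text \<open>In the identity laws the object is a variable constrained by \<open>tgt C f = A\<close>
  or \<open>src C f = A\<close>, so the rules fire as soon as the ends are provably equal. The last
  rule brackets composites to the right, the normal form used throughout.\<close>

lemma ars_simps [simp]:
  "f \<in> ars C \<Longrightarrow> src C f \<in> obs C"
  "f \<in> ars C \<Longrightarrow> tgt C f \<in> obs C"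
  "A \<in> obs C \<Longrightarrow> idn C A \<in> ars C"
  "A \<in> obs C \<Longrightarrow> src C (idn C A) = A"
  "A \<in> obs C \<Longrightarrow> tgt C (idn C A) = A"
  "g \<in> ars C \<Longrightarrow> f \<in> ars C \<Longrightarrow> src C g = tgt C f \<Longrightarrow> cmp C g f \<in> ars C"
  "g \<in> ars C \<Longrightarrow> f \<in> ars C \<Longrightarrow> src C g = tgt C f \<Longrightarrow> src C (cmp C g f) = src C f"
  "g \<in> ars C \<Longrightarrow> f \<in> ars C \<Longrightarrow> src C g = tgt C f \<Longrightarrow> tgt C (cmp C g f) = tgt C g"
  "f \<in> ars C \<Longrightarrow> tgt C f = A \<Longrightarrow> cmp C (idn C A) f = f"
  "f \<in> ars C \<Longrightarrow> src C f = A \<Longrightarrow> cmp C f (idn C A) = f"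
  "h \<in> ars C \<Longrightarrow> g \<in> ars C \<Longrightarrow> f \<in> ars C \<Longrightarrow> src C h = tgt C g \<Longrightarrow> src C g = tgt C f \<Longrightarrow>
    cmp C (cmp C h g) f = cmp C h (cmp C g f)"
  using idn_hom[of A] cmp_hom[of f "src C f" "tgt C f" g] idn_left[of f] idn_right[of f]
    cmp_assoc[of f "src C f" "tgt C f" g _ h]
  by (auto simp: src_ob tgt_ob)

lemma hom_refl: "f \<in> ars C \<Longrightarrow> f \<in> hom C (src C f) (tgt C f)"
  by simp

text \<open>In right-bracketed form the left side of \<open>cmp C g f = k\<close> is no longer a
  subterm once a further arrow \<open>h\<close> is composed on the right. This is the equation in
  the shape in which it can still be used for rewriting.\<close>

lemma cmp_pull:
  assumes "cmp C g f = k" "h \<in> ars C" "g \<in> ars C" "f \<in> ars C" "src C g = tgt C f" "src C f = tgt C h"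
  shows "cmp C g (cmp C f h) = cmp C k h"
  using assms by (metis ars_simps(11))

lemma inverse_unique:
  "inverse_ars C f g \<Longrightarrow> inverse_ars C f h \<Longrightarrow> g = h"
  unfolding inverse_ars_def by (simp, metis ars_simps)

lemma inv_ar_eq: "inverse_ars C f g \<Longrightarrow> inv_ar C f = g"
  unfolding inv_ar_def using inverse_unique by (intro the_equality) auto

lemma inv_ar_idn [simp]: "A \<in> obs C \<Longrightarrow> inv_ar C (idn C A) = idn C A"
  by (rule inv_ar_eq) (auto simp: inverse_ars_def)

lemma is_iso_idn [simp]: "A \<in> obs C \<Longrightarrow> is_iso C (idn C A)"
  unfolding is_iso_def by (rule exI[of _ "idn C A"]) (auto simp: inverse_ars_def)

lemma is_iso_cmp:
  assumes "is_iso C g" "is_iso C f" "src C g = tgt C f"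
  shows "is_iso C (cmp C g f)"
proof -
  from assms obtain g' f' where g': "inverse_ars C g g'" and f': "inverse_ars C f f'"
    unfolding is_iso_def by auto
  note fg = g'[unfolded inverse_ars_def, simplified] f'[unfolded inverse_ars_def, simplified]
  have "cmp C g' (cmp C g f) = f" "cmp C f (cmp C f' g') = g'"
    using fg assms(3) cmp_pull[of g' g "idn C (src C g)" f] cmp_pull[of f f' "idn C (tgt C f)" g'] by auto
  then have "inverse_ars C (cmp C g f) (cmp C f' g')"
    using fg assms(3) by (auto simp: inverse_ars_def)
  then show ?thesis unfolding is_iso_def by blast
qed

end

lemma categoryI:
  assumes "\<And>f. f \<in> ars C \<Longrightarrow> src C f \<in> obs C" "\<And>f. f \<in> ars C \<Longrightarrow> tgt C f \<in> obs C"
    "\<And>A. A \<in> obs C \<Longrightarrow> idn C A \<in> ars C \<and> src C (idn C A) = A \<and> tgt C (idn C A) = A"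
    "\<And>f g. f \<in> ars C \<Longrightarrow> g \<in> ars C \<Longrightarrow> src C g = tgt C f \<Longrightarrow>
      cmp C g f \<in> ars C \<and> src C (cmp C g f) = src C f \<and> tgt C (cmp C g f) = tgt C g"
    "\<And>f. f \<in> ars C \<Longrightarrow> cmp C (idn C (tgt C f)) f = f"
    "\<And>f. f \<in> ars C \<Longrightarrow> cmp C f (idn C (src C f)) = f"
    "\<And>f g h. f \<in> ars C \<Longrightarrow> g \<in> ars C \<Longrightarrow> h \<in> ars C \<Longrightarrow> src C g = tgt C f \<Longrightarrow> src C h = tgt C g \<Longrightarrow>
      cmp C h (cmp C g f) = cmp C (cmp C h g) f"
  shows "category C"
  using assms by unfold_locales auto

context is_functor
begin

lemma map_simps [simp]:
  "A \<in> obs C \<Longrightarrow> fo F A \<in> obs D"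
  "f \<in> ars C \<Longrightarrow> fa F f \<in> ars D"
  "f \<in> ars C \<Longrightarrow> src D (fa F f) = fo F (src C f)"
  "f \<in> ars C \<Longrightarrow> tgt D (fa F f) = fo F (tgt C f)"
  "A \<in> obs C \<Longrightarrow> fa F (idn C A) = idn D (fo F A)"
  "g \<in> ars C \<Longrightarrow> f \<in> ars C \<Longrightarrow> src C g = tgt C f \<Longrightarrow> fa F (cmp C g f) = cmp D (fa F g) (fa F f)"
  using map_ob map_hom[of f "src C f" "tgt C f"] map_idn map_cmp[of f "src C f" "tgt C f" g] by auto

lemma map_inverse: "inverse_ars C f g \<Longrightarrow> inverse_ars D (fa F f) (fa F g)"
  by (auto simp: inverse_ars_def simp flip: map_simps(5,6))

lemma map_iso: "is_iso C f \<Longrightarrow> is_iso D (fa F f)"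
  unfolding is_iso_def using map_inverse by blast

end

lemma is_functorI:
  assumes "category C" "category D" "\<And>A. A \<in> obs C \<Longrightarrow> fo F A \<in> obs D"
    "\<And>f. f \<in> ars C \<Longrightarrow> fa F f \<in> ars D \<and> src D (fa F f) = fo F (src C f) \<and> tgt D (fa F f) = fo F (tgt C f)"
    "\<And>A. A \<in> obs C \<Longrightarrow> fa F (idn C A) = idn D (fo F A)"
    "\<And>f g. g \<in> ars C \<Longrightarrow> f \<in> ars C \<Longrightarrow> src C g = tgt C f \<Longrightarrow> fa F (cmp C g f) = cmp D (fa F g) (fa F f)"
  shows "is_functor C D F"
  using assms unfolding is_functor_def is_functor_axioms_def by auto

lemma fcomp_simps [simp]: "fo (fcomp G F) A = fo G (fo F A)" "fa (fcomp G F) f = fa G (fa F f)"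
  by (auto simp: fcomp_def)

lemma fid_simps [simp]: "fo fid A = A" "fa fid f = f"
  by (auto simp: fid_def)

lemma fnc_norm_simps [simp]:
  "A \<in> obs C \<Longrightarrow> fo (fnc_norm C F) A = fo F A"
  "f \<in> ars C \<Longrightarrow> fa (fnc_norm C F) f = fa F f"
  "fnc_norm C (fnc_norm C F) = fnc_norm C F"
  by (auto simp: fnc_norm_def)

lemma is_functor_fid: "category C \<Longrightarrow> is_functor C C fid"
  by (rule is_functorI) (auto simp: category.ars_simps)

lemma is_functor_fcomp: "is_functor C D F \<Longrightarrow> is_functor D E G \<Longrightarrow> is_functor C E (fcomp G F)"
  by (intro is_functorI) (auto simp: is_functor.map_simps is_functor_def)

text \<open>The functor laws see only values on objects and arrows of the domain, so they survive
  normalisation, which changes the irrelevant values alone.\<close>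

lemma is_functor_cong:
  assumes "is_functor C D F" "\<And>A. A \<in> obs C \<Longrightarrow> fo G A = fo F A" "\<And>f. f \<in> ars C \<Longrightarrow> fa G f = fa F f"
  shows "is_functor C D G"
proof -
  interpret is_functor C D F by fact
  show ?thesis by (rule is_functorI) (auto simp: assms(2,3) Dom.category_axioms Cod.category_axioms)
qed

lemma fnc_eqI:
  assumes "fnc_norm C F = F" "fnc_norm C G = G"
    "\<And>A. A \<in> obs C \<Longrightarrow> fo F A = fo G A" "\<And>f. f \<in> ars C \<Longrightarrow> fa F f = fa G f"
  shows "F = G"
proof -
  have "fnc_norm C F = fnc_norm C G" using assms(3,4) unfolding fnc_norm_def by (auto intro: restrict_ext)
  then show ?thesis using assms(1,2) by simp
qed

context nat_trans
begin

lemma component_simps [simp]: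
  "A \<in> obs C \<Longrightarrow> \<alpha> A \<in> ars D"
  "A \<in> obs C \<Longrightarrow> src D (\<alpha> A) = fo F A"
  "A \<in> obs C \<Longrightarrow> tgt D (\<alpha> A) = fo G A"
  using component[of A] by auto

lemma natural: "f \<in> ars C \<Longrightarrow> cmp D (\<alpha> (tgt C f)) (fa F f) = cmp D (fa G f) (\<alpha> (src C f))"
  using naturality[of f "src C f" "tgt C f"] by simp

end

lemma nat_transI:
  assumes "is_functor C D F" "is_functor C D G"
    "\<And>A. A \<in> obs C \<Longrightarrow> \<alpha> A \<in> ars D \<and> src D (\<alpha> A) = fo F A \<and> tgt D (\<alpha> A) = fo G A"
    "\<And>f. f \<in> ars C \<Longrightarrow> cmp D (\<alpha> (tgt C f)) (fa F f) = cmp D (fa G f) (\<alpha> (src C f))"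
  shows "nat_trans C D F G \<alpha>"
  using assms unfolding nat_trans_def nat_trans_axioms_def by auto

lemma nat_isoI:
  assumes "nat_trans C D F G \<alpha>" "\<And>A. A \<in> obs C \<Longrightarrow> is_iso D (\<alpha> A)"
  shows "nat_iso C D F G \<alpha>"
  using assms unfolding nat_iso_def nat_iso_axioms_def by auto

section \<open>Strict indexed categories\<close>

context indexed_category
begin

lemma fib_simps [simp]:
  assumes "\<Gamma> \<in> obs C"
  shows "f \<in> ars (fib E \<Gamma>) \<Longrightarrow> src (fib E \<Gamma>) f \<in> obs (fib E \<Gamma>)"
    "f \<in> ars (fib E \<Gamma>) \<Longrightarrow> tgt (fib E \<Gamma>) f \<in> obs (fib E \<Gamma>)"
    "A \<in> obs (fib E \<Gamma>) \<Longrightarrow> idn (fib E \<Gamma>) A \<in> ars (fib E \<Gamma>)"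
    "A \<in> obs (fib E \<Gamma>) \<Longrightarrow> src (fib E \<Gamma>) (idn (fib E \<Gamma>) A) = A"
    "A \<in> obs (fib E \<Gamma>) \<Longrightarrow> tgt (fib E \<Gamma>) (idn (fib E \<Gamma>) A) = A"
    "g \<in> ars (fib E \<Gamma>) \<Longrightarrow> f \<in> ars (fib E \<Gamma>) \<Longrightarrow> src (fib E \<Gamma>) g = tgt (fib E \<Gamma>) f \<Longrightarrow>
      cmp (fib E \<Gamma>) g f \<in> ars (fib E \<Gamma>)"
    "g \<in> ars (fib E \<Gamma>) \<Longrightarrow> f \<in> ars (fib E \<Gamma>) \<Longrightarrow> src (fib E \<Gamma>) g = tgt (fib E \<Gamma>) f \<Longrightarrow>
      src (fib E \<Gamma>) (cmp (fib E \<Gamma>) g f) = src (fib E \<Gamma>) f"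
    "g \<in> ars (fib E \<Gamma>) \<Longrightarrow> f \<in> ars (fib E \<Gamma>) \<Longrightarrow> src (fib E \<Gamma>) g = tgt (fib E \<Gamma>) f \<Longrightarrow>
      tgt (fib E \<Gamma>) (cmp (fib E \<Gamma>) g f) = tgt (fib E \<Gamma>) g"
    "f \<in> ars (fib E \<Gamma>) \<Longrightarrow> tgt (fib E \<Gamma>) f = A \<Longrightarrow> cmp (fib E \<Gamma>) (idn (fib E \<Gamma>) A) f = f"
    "f \<in> ars (fib E \<Gamma>) \<Longrightarrow> src (fib E \<Gamma>) f = A \<Longrightarrow> cmp (fib E \<Gamma>) f (idn (fib E \<Gamma>) A) = f"
    "h \<in> ars (fib E \<Gamma>) \<Longrightarrow> g \<in> ars (fib E \<Gamma>) \<Longrightarrow> f \<in> ars (fib E \<Gamma>) \<Longrightarrow>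
      src (fib E \<Gamma>) h = tgt (fib E \<Gamma>) g \<Longrightarrow> src (fib E \<Gamma>) g = tgt (fib E \<Gamma>) f \<Longrightarrow>
      cmp (fib E \<Gamma>) (cmp (fib E \<Gamma>) h g) f = cmp (fib E \<Gamma>) h (cmp (fib E \<Gamma>) g f)"
    "A \<in> obs (fib E \<Gamma>) \<Longrightarrow> inv_ar (fib E \<Gamma>) (idn (fib E \<Gamma>) A) = idn (fib E \<Gamma>) A"
    "A \<in> obs (fib E \<Gamma>) \<Longrightarrow> is_iso (fib E \<Gamma>) (idn (fib E \<Gamma>) A)"
  by (simp_all add: category.ars_simps category.inv_ar_idn category.is_iso_idn fib_cat[OF assms])

lemmas fib_pull = category.cmp_pull[OF fib_cat]

lemma ri_functor': "u \<in> ars C \<Longrightarrow> src C u = \<Delta> \<Longrightarrow> tgt C u = \<Gamma> \<Longrightarrow> is_functor (fib E \<Gamma>) (fib E \<Delta>) (ri E u)"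
  using ri_functor[of u "src C u" "tgt C u"] by simp

lemma ri_simps [simp]:
  assumes "u \<in> ars C"
  shows "src C u = \<Delta> \<Longrightarrow> A \<in> obs (fib E (tgt C u)) \<Longrightarrow> fo (ri E u) A \<in> obs (fib E \<Delta>)"
    "src C u = \<Delta> \<Longrightarrow> f \<in> ars (fib E (tgt C u)) \<Longrightarrow> fa (ri E u) f \<in> ars (fib E \<Delta>)"
    "src C u = \<Delta> \<Longrightarrow> f \<in> ars (fib E (tgt C u)) \<Longrightarrow>
      src (fib E \<Delta>) (fa (ri E u) f) = fo (ri E u) (src (fib E (tgt C u)) f)"
    "src C u = \<Delta> \<Longrightarrow> f \<in> ars (fib E (tgt C u)) \<Longrightarrow>
      tgt (fib E \<Delta>) (fa (ri E u) f) = fo (ri E u) (tgt (fib E (tgt C u)) f)"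
    "tgt C u = \<Gamma> \<Longrightarrow> A \<in> obs (fib E \<Gamma>) \<Longrightarrow>
      fa (ri E u) (idn (fib E \<Gamma>) A) = idn (fib E (src C u)) (fo (ri E u) A)"
    "tgt C u = \<Gamma> \<Longrightarrow> g \<in> ars (fib E \<Gamma>) \<Longrightarrow> f \<in> ars (fib E \<Gamma>) \<Longrightarrow> src (fib E \<Gamma>) g = tgt (fib E \<Gamma>) f \<Longrightarrow>
      fa (ri E u) (cmp (fib E \<Gamma>) g f) = cmp (fib E (src C u)) (fa (ri E u) g) (fa (ri E u) f)"
  using is_functor.map_simps[OF ri_functor'[OF assms refl refl]] by (auto simp: assms)

end

context strict_indexed_category
begin

text \<open>The unitor at \<open>A\<close> is the identity of \<open>A\<close> and yet has target
  \<open>A[id]\<close>. So typing alone gives the equation on objects, and naturality of the unitor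
  gives the one on arrows.\<close>

lemma ri_idn [simp]:
  assumes "\<Gamma> \<in> obs C"
  shows "A \<in> obs (fib E \<Gamma>) \<Longrightarrow> fo (ri E (idn C \<Gamma>)) A = A"
    "f \<in> ars (fib E \<Gamma>) \<Longrightarrow> fa (ri E (idn C \<Gamma>)) f = f"
proof -
  interpret U: nat_iso "fib E \<Gamma>" "fib E \<Gamma>" fid "ri E (idn C \<Gamma>)" "un E \<Gamma>" by (rule un_iso) fact
  show *: "fo (ri E (idn C \<Gamma>)) A = A" if "A \<in> obs (fib E \<Gamma>)" for A
    using U.component_simps(3)[OF that] that assms by (simp add: un_strict)
  show "fa (ri E (idn C \<Gamma>)) f = f" if f: "f \<in> ars (fib E \<Gamma>)" for f
    using U.natural[OF f] f assms by (simp add: un_strict *)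
qed

text \<open>The compositor is the identity of \<open>A[u \<circ> v]\<close> and has source
  \<open>A[u][v]\<close>; as for the unitor, typing settles objects and naturality settles
  arrows.\<close>

lemma ri_cmp:
  assumes "u \<in> ars C" "v \<in> ars C" "src C u = tgt C v"
  shows "A \<in> obs (fib E (tgt C u)) \<Longrightarrow> fo (ri E (cmp C u v)) A = fo (ri E v) (fo (ri E u) A)"
    "f \<in> ars (fib E (tgt C u)) \<Longrightarrow> fa (ri E (cmp C u v)) f = fa (ri E v) (fa (ri E u) f)"
proof -
  interpret U: nat_iso "fib E (tgt C u)" "fib E (src C v)" "fcomp (ri E v) (ri E u)" "ri E (cmp C u v)" "cm E u v"
    using assms by (intro cm_iso) auto
  have cm: "cm E u v A = idn (fib E (src C v)) (fo (ri E (cmp C u v)) A)" if "A \<in> obs (fib E (tgt C u))" for A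
    using cm_strict that assms by auto
  show *: "fo (ri E (cmp C u v)) A = fo (ri E v) (fo (ri E u) A)" if "A \<in> obs (fib E (tgt C u))" for A
    using U.component_simps(2)[OF that] that assms by (simp add: cm)
  show "fa (ri E (cmp C u v)) f = fa (ri E v) (fa (ri E u) f)" if f: "f \<in> ars (fib E (tgt C u))" for f
    using U.natural[OF f] f assms by (simp add: cm *)
qed

lemma cm_eq:
  assumes "u \<in> ars C" "v \<in> ars C" "src C u = tgt C v" "A \<in> obs (fib E (tgt C u))" "src C v = \<Delta>"
  shows "cm E u v A = idn (fib E \<Delta>) (fo (ri E v) (fo (ri E u) A))"
  using assms cm_strict[of u "src C u" "tgt C u" v] by (auto simp: ri_cmp)

end

text \<open>Once reindexing is functorial on the nose, every coherence law is an equation between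
  identities. Base change and the terms of \<open>P_ob U X\<close> are shown to be strict through
  this rule.\<close>

lemma strict_indexed_categoryI:
  assumes C: "category C" and fib: "\<And>\<Gamma>. \<Gamma> \<in> obs C \<Longrightarrow> category (fib E \<Gamma>)"
    and ri: "\<And>u. u \<in> ars C \<Longrightarrow> is_functor (fib E (tgt C u)) (fib E (src C u)) (ri E u)"
    and idn: "\<And>\<Gamma> A. \<Gamma> \<in> obs C \<Longrightarrow> A \<in> obs (fib E \<Gamma>) \<Longrightarrow> fo (ri E (idn C \<Gamma>)) A = A"
      "\<And>\<Gamma> f. \<Gamma> \<in> obs C \<Longrightarrow> f \<in> ars (fib E \<Gamma>) \<Longrightarrow> fa (ri E (idn C \<Gamma>)) f = f"
    and cmp: "\<And>u v A. u \<in> ars C \<Longrightarrow> v \<in> ars C \<Longrightarrow> src C u = tgt C v \<Longrightarrow> A \<in> obs (fib E (tgt C u)) \<Longrightarrow>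
        fo (ri E (cmp C u v)) A = fo (ri E v) (fo (ri E u) A)"
      "\<And>u v f. u \<in> ars C \<Longrightarrow> v \<in> ars C \<Longrightarrow> src C u = tgt C v \<Longrightarrow> f \<in> ars (fib E (tgt C u)) \<Longrightarrow>
        fa (ri E (cmp C u v)) f = fa (ri E v) (fa (ri E u) f)"
    and un: "\<And>\<Gamma> A. \<Gamma> \<in> obs C \<Longrightarrow> A \<in> obs (fib E \<Gamma>) \<Longrightarrow> un E \<Gamma> A = idn (fib E \<Gamma>) A"
    and cm: "\<And>u v A. u \<in> ars C \<Longrightarrow> v \<in> ars C \<Longrightarrow> src C u = tgt C v \<Longrightarrow> A \<in> obs (fib E (tgt C u)) \<Longrightarrow>
      cm E u v A = idn (fib E (src C v)) (fo (ri E (cmp C u v)) A)"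
  shows "strict_indexed_category C E"
proof -
  interpret category C by fact
  note F = is_functor.map_simps[OF ri]
  have F': "src C u = \<Delta> \<Longrightarrow> A \<in> obs (fib E (tgt C u)) \<Longrightarrow> fo (ri E u) A \<in> obs (fib E \<Delta>)"
    if "u \<in> ars C" for u \<Delta> A using F(1)[OF that] by auto
  have F'': "tgt C u = \<Gamma> \<Longrightarrow> A \<in> obs (fib E \<Gamma>) \<Longrightarrow>
    fa (ri E u) (cat.idn (fib E \<Gamma>) A) = cat.idn (fib E (src C u)) (fo (ri E u) A)"
    if "u \<in> ars C" for u \<Gamma> A using F(5)[OF that] by auto
  note K = category.ars_simps[OF fib]
  show ?thesis
  proof (intro strict_indexed_category.intro indexed_category.intro indexed_category_axioms.intro
      strict_indexed_category_axioms.intro, goal_cases)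
    case (4 \<Gamma>)
    then have "is_functor (fib E \<Gamma>) (fib E \<Gamma>) (ri E (idn C \<Gamma>))" using ri[of "idn C \<Gamma>"] by simp
    with 4 show ?case
      by (intro nat_isoI nat_transI is_functor_fid) (auto simp: fib K idn un category.is_iso_idn)
  next
    case (5 u \<Delta> \<Gamma> v \<Theta>)
    then have "is_functor (fib E \<Gamma>) (fib E \<Theta>) (ri E (cmp C u v))" 
      "is_functor (fib E \<Gamma>) (fib E \<Theta>) (fcomp (ri E v) (ri E u))" 
      using ri[of "cmp C u v"] ri[of u] ri[of v] by (auto intro: is_functor_fcomp)
    moreover from this(2) have "fo (ri E v) (fo (ri E u) A) \<in> obs (fib E \<Theta>)" if "A \<in> obs (fib E \<Gamma>)" for A
      using is_functor.map_simps(1) that by fastforce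
    moreover from calculation(2) have "fa (ri E v) (fa (ri E u) f) \<in> ars (fib E \<Theta>)"
        "src (fib E \<Theta>) (fa (ri E v) (fa (ri E u) f)) = fo (ri E v) (fo (ri E u) (src (fib E \<Gamma>) f))"
        "tgt (fib E \<Theta>) (fa (ri E v) (fa (ri E u) f)) = fo (ri E v) (fo (ri E u) (tgt (fib E \<Gamma>) f))"
      if "f \<in> ars (fib E \<Gamma>)" for f
      using is_functor.map_simps(2-4) that by fastforce+
    ultimately show ?case using 5
      by (intro nat_isoI nat_transI) (auto simp: fib K cm cmp category.is_iso_idn)
  qed (use ri C in \<open>auto simp: fib F F' F'' K un cm idn cmp\<close>)
qed

section \<open>Strict morphisms of strict indexed categories\<close>

lemma bc_simps [simp]:
  "fib (bc F E) \<Gamma> = fib E (fo F \<Gamma>)" "ri (bc F E) u = ri E (fa F u)"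
  "un (bc F E) \<Gamma> = un E (fo F \<Gamma>)" "cm (bc F E) u v = cm E (fa F u) (fa F v)"
  by (auto simp: bc_def)

lemma bcf_simps [simp]: "cp (bcf F H) \<Gamma> = cp H (fo F \<Gamma>)" "ps (bcf F H) u = ps H (fa F u)"
  by (auto simp: bcf_def)

lemma icomp_simps [simp]:
  "cp (icomp C E K H) \<Gamma> = fcomp (cp K \<Gamma>) (cp H \<Gamma>)"
  "ps (icomp C E K H) u A = cmp (fib E (src C u)) (fa (cp K (src C u)) (ps H u A)) (ps K u (fo (cp H (tgt C u)) A))"
  by (auto simp: icomp_def)

lemma iid_simps [simp]: "cp (iid C E) \<Gamma> = fid" "ps (iid C E) u A = idn (fib E (src C u)) (fo (ri E u) A)"
  by (auto simp: iid_def)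

lemma ifun_norm_simps [simp]:
  "\<Gamma> \<in> obs C \<Longrightarrow> A \<in> obs (fib E \<Gamma>) \<Longrightarrow> fo (cp (ifun_norm C E H) \<Gamma>) A = fo (cp H \<Gamma>) A"
  "\<Gamma> \<in> obs C \<Longrightarrow> f \<in> ars (fib E \<Gamma>) \<Longrightarrow> fa (cp (ifun_norm C E H) \<Gamma>) f = fa (cp H \<Gamma>) f"
  "u \<in> ars C \<Longrightarrow> A \<in> obs (fib E (tgt C u)) \<Longrightarrow> ps (ifun_norm C E H) u A = ps H u A"
  "ifun_norm C E (ifun_norm C E H) = ifun_norm C E H"
  by (auto simp: ifun_norm_def fnc_norm_def intro!: restrict_ext)

lemma ifun_eqI:
  assumes "ifun_norm C E H = H" "ifun_norm C E K = K"
    "\<And>\<Gamma> A. \<Gamma> \<in> obs C \<Longrightarrow> A \<in> obs (fib E \<Gamma>) \<Longrightarrow> fo (cp H \<Gamma>) A = fo (cp K \<Gamma>) A"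
    "\<And>\<Gamma> f. \<Gamma> \<in> obs C \<Longrightarrow> f \<in> ars (fib E \<Gamma>) \<Longrightarrow> fa (cp H \<Gamma>) f = fa (cp K \<Gamma>) f"
    "\<And>u A. u \<in> ars C \<Longrightarrow> A \<in> obs (fib E (tgt C u)) \<Longrightarrow> ps H u A = ps K u A"
  shows "H = K"
proof -
  have "ifun_norm C E H = ifun_norm C E K"
    using assms(3-5) unfolding ifun_norm_def fnc_norm_def by (auto intro!: restrict_ext)
  then show ?thesis using assms(1,2) by simp
qed

lemma itrans_norm_simps [simp]:
  "\<Gamma> \<in> obs C \<Longrightarrow> A \<in> obs (fib E \<Gamma>) \<Longrightarrow> itrans_norm C E \<mu> \<Gamma> A = \<mu> \<Gamma> A"
  "itrans_norm C E (itrans_norm C E \<mu>) = itrans_norm C E \<mu>"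
  by (auto simp: itrans_norm_def intro!: restrict_ext)

lemma itrans_norm_cong:
  assumes "\<And>\<Gamma> A. \<Gamma> \<in> obs C \<Longrightarrow> A \<in> obs (fib E \<Gamma>) \<Longrightarrow> \<mu> \<Gamma> A = \<nu> \<Gamma> A"
  shows "itrans_norm C E \<mu> = itrans_norm C E \<nu>"
  using assms by (auto simp: itrans_norm_def intro!: restrict_ext)

lemma itrans_eqI:
  assumes "itrans_norm C E \<mu> = \<mu>" "itrans_norm C E \<nu> = \<nu>"
    "\<And>\<Gamma> A. \<Gamma> \<in> obs C \<Longrightarrow> A \<in> obs (fib E \<Gamma>) \<Longrightarrow> \<mu> \<Gamma> A = \<nu> \<Gamma> A"
  shows "\<mu> = \<nu>"
  using itrans_norm_cong[of C E \<mu> \<nu>] assms by simp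

lemma strict_indexed_category_bc:
  assumes "is_functor C D F" "strict_indexed_category D E"
  shows "strict_indexed_category C (bc F E)"
proof -
  interpret is_functor C D F by fact
  interpret E: strict_indexed_category D E by fact
  show ?thesis
    by (rule strict_indexed_categoryI)
      (auto simp: Dom.category_axioms E.fib_cat E.ri_cmp E.un_strict E.ri_functor' E.cm_eq)
qed

text \<open>The working form of a strictly natural \<open>H : E \<rightarrow> F* E'\<close>, with
  both base categories visible and pseudonaturality replaced by equations. In \<open>nat_ob\<close>
  and \<open>nat_ar\<close> the index \<open>\<Delta>\<close> stands for \<open>src C u\<close>, so
  that the rules still match after \<open>src C u\<close> has been simplified.\<close>

locale strict_mor = is_functor C D F + Dom': strict_indexed_category C E + Cod': strict_indexed_category D E'
  for C :: "('o, 'a, 'z) cat_scheme" and D :: "('p, 'b, 'y) cat_scheme" and F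
    and E :: "('o, 'a, 'fo, 'fa) icat" and E' :: "('p, 'b, 'go, 'ga) icat" +
  fixes H :: "('o, 'a, 'fo, 'fa, 'go, 'ga) ifun"
  assumes fib_functor: "\<Gamma> \<in> obs C \<Longrightarrow> is_functor (fib E \<Gamma>) (fib E' (fo F \<Gamma>)) (cp H \<Gamma>)"
    and nat_ob: "u \<in> ars C \<Longrightarrow> src C u = \<Delta> \<Longrightarrow> A \<in> obs (fib E (tgt C u)) \<Longrightarrow>
      fo (cp H \<Delta>) (fo (ri E u) A) = fo (ri E' (fa F u)) (fo (cp H (tgt C u)) A)"
    and nat_ar: "u \<in> ars C \<Longrightarrow> src C u = \<Delta> \<Longrightarrow> f \<in> ars (fib E (tgt C u)) \<Longrightarrow>
      fa (cp H \<Delta>) (fa (ri E u) f) = fa (ri E' (fa F u)) (fa (cp H (tgt C u)) f)"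
    and ps_eq: "u \<in> ars C \<Longrightarrow> A \<in> obs (fib E (tgt C u)) \<Longrightarrow>
      ps H u A = idn (fib E' (fo F (src C u))) (fo (cp H (src C u)) (fo (ri E u) A))"
begin

lemma cp_simps [simp]:
  assumes "\<Gamma> \<in> obs C"
  shows "fo F \<Gamma> = X \<Longrightarrow> A \<in> obs (fib E \<Gamma>) \<Longrightarrow> fo (cp H \<Gamma>) A \<in> obs (fib E' X)"
    "fo F \<Gamma> = X \<Longrightarrow> f \<in> ars (fib E \<Gamma>) \<Longrightarrow> fa (cp H \<Gamma>) f \<in> ars (fib E' X)"
    "fo F \<Gamma> = X \<Longrightarrow> f \<in> ars (fib E \<Gamma>) \<Longrightarrow> src (fib E' X) (fa (cp H \<Gamma>) f) = fo (cp H \<Gamma>) (src (fib E \<Gamma>) f)"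
    "fo F \<Gamma> = X \<Longrightarrow> f \<in> ars (fib E \<Gamma>) \<Longrightarrow> tgt (fib E' X) (fa (cp H \<Gamma>) f) = fo (cp H \<Gamma>) (tgt (fib E \<Gamma>) f)"
    "A \<in> obs (fib E \<Gamma>) \<Longrightarrow> fa (cp H \<Gamma>) (idn (fib E \<Gamma>) A) = idn (fib E' (fo F \<Gamma>)) (fo (cp H \<Gamma>) A)"
    "g \<in> ars (fib E \<Gamma>) \<Longrightarrow> f \<in> ars (fib E \<Gamma>) \<Longrightarrow> src (fib E \<Gamma>) g = tgt (fib E \<Gamma>) f \<Longrightarrow>
      fa (cp H \<Gamma>) (cmp (fib E \<Gamma>) g f) = cmp (fib E' (fo F \<Gamma>)) (fa (cp H \<Gamma>) g) (fa (cp H \<Gamma>) f)"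
  using is_functor.map_simps[OF fib_functor[OF assms]] by auto

end

lemmas strict_morI = strict_mor.intro[OF _ _ _ strict_mor_axioms.intro]

lemma strictly_natural_functorI:
  assumes E: "strict_indexed_category C E" and E': "strict_indexed_category C E'"
    and F: "\<And>\<Gamma>. \<Gamma> \<in> obs C \<Longrightarrow> is_functor (fib E \<Gamma>) (fib E' \<Gamma>) (cp H \<Gamma>)"
    and n: "\<And>u A. u \<in> ars C \<Longrightarrow> A \<in> obs (fib E (tgt C u)) \<Longrightarrow>
      fo (cp H (src C u)) (fo (ri E u) A) = fo (ri E' u) (fo (cp H (tgt C u)) A)"
     "\<And>u f. u \<in> ars C \<Longrightarrow> f \<in> ars (fib E (tgt C u)) \<Longrightarrow>
      fa (cp H (src C u)) (fa (ri E u) f) = fa (ri E' u) (fa (cp H (tgt C u)) f)"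
    and p: "\<And>u A. u \<in> ars C \<Longrightarrow> A \<in> obs (fib E (tgt C u)) \<Longrightarrow>
      ps H u A = idn (fib E' (src C u)) (fo (cp H (src C u)) (fo (ri E u) A))"
  shows "strictly_natural_functor C E E' H"
proof -
  interpret E: strict_indexed_category C E by fact
  interpret E': strict_indexed_category C E' by fact
  have G1: "fo (cp H \<Gamma>) A \<in> obs (fib E' \<Gamma>)" if "\<Gamma> \<in> obs C" "A \<in> obs (fib E \<Gamma>)" for \<Gamma> A
    using is_functor.map_simps(1)[OF F] that by auto
  have G2: "fa (cp H \<Gamma>) f \<in> ars (fib E' \<Gamma>)" 
    "src (fib E' \<Gamma>) (fa (cp H \<Gamma>) f) = fo (cp H \<Gamma>) (src (fib E \<Gamma>) f)"
    "tgt (fib E' \<Gamma>) (fa (cp H \<Gamma>) f) = fo (cp H \<Gamma>) (tgt (fib E \<Gamma>) f)"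
    if "\<Gamma> \<in> obs C" "f \<in> ars (fib E \<Gamma>)" for \<Gamma> f
    using is_functor.map_simps(2-4)[OF F] that by auto
  have G3: "fa (cp H \<Gamma>) (idn (fib E \<Gamma>) A) = idn (fib E' \<Gamma>) (fo (cp H \<Gamma>) A)"
    if "\<Gamma> \<in> obs C" "A \<in> obs (fib E \<Gamma>)" for \<Gamma> A
    using is_functor.map_simps(5)[OF F] that by auto
  have n': "fo (ri E' u) (fo (cp H \<Gamma>) A) = fo (cp H (src C u)) (fo (ri E u) A)" 
    if "u \<in> ars C" "tgt C u = \<Gamma>" "A \<in> obs (fib E \<Gamma>)" for u \<Gamma> A
    using n that by auto
  show ?thesis
  proof (intro strictly_natural_functor.intro indexed_functor.intro indexed_functor_axioms.intro
      strictly_natural_functor_axioms.intro, goal_cases)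
    case (4 u \<Delta> \<Gamma>)
    have "is_functor (fib E \<Gamma>) (fib E' \<Delta>) (fcomp (ri E' u) (cp H \<Gamma>))"
      "is_functor (fib E \<Gamma>) (fib E' \<Delta>) (fcomp (cp H \<Delta>) (ri E u))"
      using 4 F[of \<Gamma>] F[of \<Delta>] E.ri_functor[of u \<Delta> \<Gamma>] E'.ri_functor[of u \<Delta> \<Gamma>] by (auto intro: is_functor_fcomp)
    with 4 n show ?case by (intro nat_isoI nat_transI) (auto simp: p G1 G2 n')
  qed (insert E E' F n p, auto simp: G1 G2 G3 n' E.un_strict E'.un_strict E'.cm_eq E.cm_eq E.ri_cmp E'.ri_cmp E.indexed_category_axioms
      E'.indexed_category_axioms)
qed

text \<open>From left to right, \<open>ps H u A\<close> is an identity that is also an arrow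
  \<open>(H A)[F u] \<rightarrow> H (A[u])\<close>, so its ends coincide; naturality of
  \<open>ps H u\<close> then yields the equation on arrows.\<close>

lemma strictly_natural_iff:
  assumes "is_functor C D F" "strict_indexed_category C E" "strict_indexed_category D E'"
  shows "strictly_natural_functor C E (bc F E') H \<longleftrightarrow> strict_mor C D F E E' H"
proof
  interpret is_functor C D F by fact
  interpret E: strict_indexed_category C E by fact
  interpret E': strict_indexed_category D E' by fact
  assume "strictly_natural_functor C E (bc F E') H"
  then interpret H: strictly_natural_functor C E "bc F E'" H .
  have G: "is_functor (fib E \<Gamma>) (fib E' (fo F \<Gamma>)) (cp H \<Gamma>)" if "\<Gamma> \<in> obs C" for \<Gamma>
    using H.cp_functor that by auto
  note G' = is_functor.map_simps[OF G]
  have G1: "fo F \<Gamma> = X \<Longrightarrow> fo (cp H \<Gamma>) A \<in> obs (fib E' X)" if "\<Gamma> \<in> obs C" "A \<in> obs (fib E \<Gamma>)" for \<Gamma> A X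
    using G'(1) that by auto
  have G2: "fo F \<Gamma> = X \<Longrightarrow> fa (cp H \<Gamma>) f \<in> ars (fib E' X)" 
    "fo F \<Gamma> = X \<Longrightarrow> src (fib E' X) (fa (cp H \<Gamma>) f) = fo (cp H \<Gamma>) (src (fib E \<Gamma>) f)"
    "fo F \<Gamma> = X \<Longrightarrow> tgt (fib E' X) (fa (cp H \<Gamma>) f) = fo (cp H \<Gamma>) (tgt (fib E \<Gamma>) f)"
    if "\<Gamma> \<in> obs C" "f \<in> ars (fib E \<Gamma>)" for \<Gamma> f X
    using G'(2-4) that by auto
  have p: "ps H u A = idn (fib E' (fo F (src C u))) (fo (cp H (src C u)) (fo (ri E u) A))"
    if "u \<in> ars C" "A \<in> obs (fib E (tgt C u))" for u A
    using H.ps_strict[of u] that by auto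
  have N: "nat_iso (fib E (tgt C u)) (fib E' (fo F (src C u))) (fcomp (ri E' (fa F u)) (cp H (tgt C u)))
      (fcomp (cp H (src C u)) (ri E u)) (ps H u)" if "u \<in> ars C" for u
    using H.ps_iso[of u "src C u" "tgt C u"] that by simp
  have n1: "fo (cp H (src C u)) (fo (ri E u) A) = fo (ri E' (fa F u)) (fo (cp H (tgt C u)) A)"
    if "u \<in> ars C" "A \<in> obs (fib E (tgt C u))" for u A
  proof -
    interpret N: nat_iso "fib E (tgt C u)" "fib E' (fo F (src C u))" "fcomp (ri E' (fa F u)) (cp H (tgt C u))"
      "fcomp (cp H (src C u)) (ri E u)" "ps H u" using N that by auto
    show ?thesis using N.component_simps(2)[OF that(2)] that by (simp add: p G1)
  qed
  have n2: "fa (cp H (src C u)) (fa (ri E u) f) = fa (ri E' (fa F u)) (fa (cp H (tgt C u)) f)"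
    if "u \<in> ars C" "f \<in> ars (fib E (tgt C u))" for u f
  proof -
    interpret N: nat_iso "fib E (tgt C u)" "fib E' (fo F (src C u))" "fcomp (ri E' (fa F u)) (cp H (tgt C u))"
      "fcomp (cp H (src C u)) (ri E u)" "ps H u" using N that by auto
    show ?thesis using N.natural[OF that(2)] that by (simp add: p G1 G2 n1)
  qed
  show "strict_mor C D F E E' H"
    by (rule strict_morI[OF assms]) (auto simp: n1 n2 p G)
next
  assume "strict_mor C D F E E' H"
  then interpret H: strict_mor C D F E E' H .
  show "strictly_natural_functor C E (bc F E') H"
    by (rule strictly_natural_functorI[OF assms(2) strict_indexed_category_bc[OF assms(1,3)]])
      (auto simp: H.nat_ob H.nat_ar H.ps_eq H.fib_functor)
qed

text \<open>By \<open>ps_eq\<close> the structure maps are forced, so a normalised strict morphism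
  is determined by its functors on fibres.\<close>

lemma strict_mor_eqI:
  assumes "strict_mor C D F E E' H" "strict_mor C D F E E' K" "ifun_norm C E H = H" "ifun_norm C E K = K"
    "\<And>\<Gamma> A. \<Gamma> \<in> obs C \<Longrightarrow> A \<in> obs (fib E \<Gamma>) \<Longrightarrow> fo (cp H \<Gamma>) A = fo (cp K \<Gamma>) A"
    "\<And>\<Gamma> f. \<Gamma> \<in> obs C \<Longrightarrow> f \<in> ars (fib E \<Gamma>) \<Longrightarrow> fa (cp H \<Gamma>) f = fa (cp K \<Gamma>) f"
  shows "H = K"
proof -
  interpret H: strict_mor C D F E E' H by fact
  interpret K: strict_mor C D F E E' K by fact
  show ?thesis by (rule ifun_eqI[OF assms(3-6)]) (auto simp: H.ps_eq K.ps_eq assms(5))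
qed

lemma strict_mor_cong:
  assumes "strict_mor C D F E E' H"
    and F: "\<And>A. A \<in> obs C \<Longrightarrow> fo F' A = fo F A" "\<And>f. f \<in> ars C \<Longrightarrow> fa F' f = fa F f"
    and K: "\<And>\<Gamma> A. \<Gamma> \<in> obs C \<Longrightarrow> A \<in> obs (fib E \<Gamma>) \<Longrightarrow> fo (cp K \<Gamma>) A = fo (cp H \<Gamma>) A"
    "\<And>\<Gamma> f. \<Gamma> \<in> obs C \<Longrightarrow> f \<in> ars (fib E \<Gamma>) \<Longrightarrow> fa (cp K \<Gamma>) f = fa (cp H \<Gamma>) f"
    "\<And>u A. u \<in> ars C \<Longrightarrow> A \<in> obs (fib E (tgt C u)) \<Longrightarrow> ps K u A = ps H u A"
  shows "strict_mor C D F' E E' K"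
proof -
  interpret H: strict_mor C D F E E' H by fact
  show ?thesis
  proof (rule strict_morI, goal_cases)
    case 1 show ?case by (rule is_functor_cong) (auto simp: F H.is_functor_axioms)
  next
    case (4 \<Gamma>) then show ?case unfolding F(1)[OF 4] by (intro is_functor_cong[OF H.fib_functor]) (auto simp: K)
  qed (auto simp: F K H.nat_ob H.nat_ar H.ps_eq H.Dom'.strict_indexed_category_axioms H.Cod'.strict_indexed_category_axioms)
qed

lemma strict_mor_id:
  assumes "strict_indexed_category C E"
  shows "strict_mor C C (fnc_norm C fid) E E (ifun_norm C E (iid C E))"
proof -
  interpret strict_indexed_category C E by fact
  have "strict_mor C C fid E E (iid C E)"
    by (rule strict_morI) (auto simp: is_functor_fid category_axioms strict_indexed_category_axioms fib_cat)
  then show ?thesis by (rule strict_mor_cong) auto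
qed

lemma tp_comp_simps [simp]:
  "\<Gamma> \<in> obs C \<Longrightarrow> A \<in> obs (fib E \<Gamma>) \<Longrightarrow> fo (cp (tp_comp C E E'' G K F H) \<Gamma>) A = fo (cp K (fo F \<Gamma>)) (fo (cp H \<Gamma>) A)"
  "\<Gamma> \<in> obs C \<Longrightarrow> f \<in> ars (fib E \<Gamma>) \<Longrightarrow> fa (cp (tp_comp C E E'' G K F H) \<Gamma>) f = fa (cp K (fo F \<Gamma>)) (fa (cp H \<Gamma>) f)"
  "ifun_norm C E (tp_comp C E E'' G K F H) = tp_comp C E E'' G K F H"
  by (auto simp: tp_comp_def)

lemma strict_mor_comp:
  assumes "strict_mor C D F E E' H" "strict_mor D B G E' E'' K"
  shows "strict_mor C B (fnc_norm C (fcomp G F)) E E'' (tp_comp C E E'' G K F H)"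
proof -
  interpret H: strict_mor C D F E E' H by fact
  interpret K: strict_mor D B G E' E'' K by fact
  have "strict_mor C B (fcomp G F) E E'' (icomp C (bc F (bc G E'')) (bcf F K) H)"
  proof (rule strict_morI, goal_cases)
    case 1 show ?case using is_functor_fcomp H.is_functor_axioms K.is_functor_axioms by blast
  next
    case (4 \<Gamma>) then show ?case using H.fib_functor[of \<Gamma>] K.fib_functor[of "fo F \<Gamma>"] by (auto intro: is_functor_fcomp)
  qed (auto simp: H.nat_ob H.nat_ar H.ps_eq K.nat_ob K.nat_ar K.ps_eq
       H.Dom'.strict_indexed_category_axioms K.Cod'.strict_indexed_category_axioms)
  then show ?thesis unfolding tp_comp_def by (rule strict_mor_cong) auto
qed

section \<open>Transformations over a natural transformation\<close>

text \<open>The form of \<open>trans_over\<close> for strict data: all pseudonaturality maps are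
  identities, and the modification law shrinks to \<open>mu_mod\<close>, compatibility of \<mu> with
  reindexing.\<close>

locale strict_trans = H: strict_mor C D F E E' H + K: strict_mor C D G E E' K + nat_trans C D F G \<alpha>
  for C :: "('o, 'a, 'z) cat_scheme" and D :: "('p, 'b, 'y) cat_scheme" and F G \<alpha>
    and E :: "('o, 'a, 'fo, 'fa) icat" and E' :: "('p, 'b, 'go, 'ga) icat" and H K +
  fixes \<mu> :: "'o \<Rightarrow> 'fo \<Rightarrow> 'ga"
  assumes mu_ar: "\<Gamma> \<in> obs C \<Longrightarrow> fo F \<Gamma> = X \<Longrightarrow> A \<in> obs (fib E \<Gamma>) \<Longrightarrow> \<mu> \<Gamma> A \<in> ars (fib E' X)"
    and mu_src: "\<Gamma> \<in> obs C \<Longrightarrow> fo F \<Gamma> = X \<Longrightarrow> A \<in> obs (fib E \<Gamma>) \<Longrightarrow> src (fib E' X) (\<mu> \<Gamma> A) = fo (cp H \<Gamma>) A"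
    and mu_tgt: "\<Gamma> \<in> obs C \<Longrightarrow> fo F \<Gamma> = X \<Longrightarrow> A \<in> obs (fib E \<Gamma>) \<Longrightarrow>
      tgt (fib E' X) (\<mu> \<Gamma> A) = fo (ri E' (\<alpha> \<Gamma>)) (fo (cp K \<Gamma>) A)"
    and mu_nat: "\<Gamma> \<in> obs C \<Longrightarrow> f \<in> ars (fib E \<Gamma>) \<Longrightarrow>
      cmp (fib E' (fo F \<Gamma>)) (\<mu> \<Gamma> (tgt (fib E \<Gamma>) f)) (fa (cp H \<Gamma>) f) =
      cmp (fib E' (fo F \<Gamma>)) (fa (ri E' (\<alpha> \<Gamma>)) (fa (cp K \<Gamma>) f)) (\<mu> \<Gamma> (src (fib E \<Gamma>) f))"
    and mu_mod: "u \<in> ars C \<Longrightarrow> src C u = \<Delta> \<Longrightarrow> A \<in> obs (fib E (tgt C u)) \<Longrightarrow>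
      \<mu> \<Delta> (fo (ri E u) A) = fa (ri E' (fa F u)) (\<mu> (tgt C u) A)"
begin
lemmas mu_simps [simp] = mu_ar mu_src mu_tgt
end

lemmas strict_transI = strict_trans.intro[OF _ _ _ strict_trans_axioms.intro]

text \<open>For strict \<open>E'\<close> the canonical isomorphism in \<open>astar\<close> is an
  identity: \<open>A[\<alpha> \<Gamma>][F u]\<close> and \<open>A[G u][\<alpha> \<Delta>]\<close>
  are both the reindexing of \<open>A\<close> along the diagonal of the naturality square of
  \<alpha> at \<open>u\<close>.\<close>

lemma strict_mor_astar:
  assumes "strict_mor C D G E E' K" "nat_trans C D F G \<alpha>"
  shows "strict_mor C D F E E' (icomp C (bc F E') (astar C F G \<alpha> E') K)"
proof -
  interpret K: strict_mor C D G E E' K by fact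
  interpret A: nat_trans C D F G \<alpha> by fact
  show ?thesis
  proof (rule strict_morI, goal_cases)
    case (4 \<Gamma>)
    then show ?case using K.fib_functor[of \<Gamma>] K.Cod'.ri_functor'[of "\<alpha> \<Gamma>"]
      by (auto intro!: is_functor_fcomp simp: astar_def)
  next
    case (5 u \<Delta> A) then show ?case using A.natural[of u]
      by (auto simp: astar_def K.nat_ob simp flip: K.Cod'.ri_cmp)
  next
    case (6 u \<Delta> f) then show ?case using A.natural[of u]
      by (auto simp: astar_def K.nat_ar simp flip: K.Cod'.ri_cmp)
  next
    case (7 u A)
    have "fo (ri E' (fa F u)) (fo (ri E' (\<alpha> (tgt C u))) B) = fo (ri E' (\<alpha> (src C u))) (fo (ri E' (fa G u)) B)"
      if "B \<in> obs (fib E' (fo G (tgt C u)))" for B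
      using 7 that A.natural[of u] by (simp flip: K.Cod'.ri_cmp)
    then show ?case using 7
      by (auto simp: astar_def Let_def K.ps_eq K.nat_ob K.Cod'.cm_eq)
  qed (auto simp: A.F.is_functor_axioms K.Dom'.strict_indexed_category_axioms K.Cod'.strict_indexed_category_axioms)
qed

text \<open>The maps \<open>ps H u A\<close> and \<open>ps K u A\<close> are identities at the two
  ends of the components, so they cancel from the modification law.\<close>

lemma indexed_nat_trans_strict_iff:
  assumes "strict_mor C D F E E' H" "strict_mor C D F E E' K"
  shows "indexed_nat_trans C E (bc F E') H K \<mu> \<longleftrightarrow>
    (\<forall>\<Gamma>\<in>obs C. nat_trans (fib E \<Gamma>) (fib E' (fo F \<Gamma>)) (cp H \<Gamma>) (cp K \<Gamma>) (\<mu> \<Gamma>)) \<and>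
    (\<forall>u\<in>ars C. \<forall>A\<in>obs (fib E (tgt C u)). \<mu> (src C u) (fo (ri E u) A) = fa (ri E' (fa F u)) (\<mu> (tgt C u) A))"
    (is "?L \<longleftrightarrow> ?R")
proof -
  interpret H: strict_mor C D F E E' H by fact
  interpret K: strict_mor C D F E E' K by fact
  have HK: "indexed_functor C E (bc F E') H" "indexed_functor C E (bc F E') K"
    using assms strictly_natural_iff[of C D F E E'] H.is_functor_axioms
     H.Dom'.strict_indexed_category_axioms H.Cod'.strict_indexed_category_axioms strictly_natural_functor.axioms(1) by blast+
  have aux: "cmp (fib E' (fo F (src C u))) (\<mu> (src C u) (fo (ri E u) A)) (ps H u A) = \<mu> (src C u) (fo (ri E u) A)"
    "cmp (fib E' (fo F (src C u))) (ps K u A) (fa (ri E' (fa F u)) (\<mu> (tgt C u) A)) = fa (ri E' (fa F u)) (\<mu> (tgt C u) A)"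
    if N: "\<forall>\<Gamma>\<in>obs C. nat_trans (fib E \<Gamma>) (fib E' (fo F \<Gamma>)) (cp H \<Gamma>) (cp K \<Gamma>) (\<mu> \<Gamma>)" 
    and uA: "u \<in> ars C" "A \<in> obs (fib E (tgt C u))" for u A
  proof -
    interpret N1: nat_trans "fib E (src C u)" "fib E' (fo F (src C u))" "cp H (src C u)" "cp K (src C u)" "\<mu> (src C u)"
      using N uA by auto
    interpret N2: nat_trans "fib E (tgt C u)" "fib E' (fo F (tgt C u))" "cp H (tgt C u)" "cp K (tgt C u)" "\<mu> (tgt C u)"
      using N uA by auto
    show "cmp (fib E' (fo F (src C u))) (\<mu> (src C u) (fo (ri E u) A)) (ps H u A) = \<mu> (src C u) (fo (ri E u) A)"
    "cmp (fib E' (fo F (src C u))) (ps K u A) (fa (ri E' (fa F u)) (\<mu> (tgt C u) A)) = fa (ri E' (fa F u)) (\<mu> (tgt C u) A)"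
      using uA by (auto simp: H.ps_eq K.ps_eq K.nat_ob)
  qed
  show ?thesis
  proof
    assume ?L
    then interpret indexed_nat_trans C E "bc F E'" H K \<mu> .
    have N: "\<forall>\<Gamma>\<in>obs C. nat_trans (fib E \<Gamma>) (fib E' (fo F \<Gamma>)) (cp H \<Gamma>) (cp K \<Gamma>) (\<mu> \<Gamma>)"
      using component_nat by simp
    then show ?R using aux[OF N] modification by (metis H.Dom.hom_refl bc_simps(1,2))
  next
    assume R: ?R
    show ?L
    proof (rule indexed_nat_trans.intro[OF HK indexed_nat_trans_axioms.intro], goal_cases)
      case (2 u \<Delta> \<Gamma> A)
      with R have "u \<in> ars C" "src C u = \<Delta>" "tgt C u = \<Gamma>" by auto
      then show ?case using aux[of u A] R 2 by auto
    qed (use R in auto)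
  qed
qed

lemma trans_over_iff:
  assumes "strict_mor C D F E E' H" "strict_mor C D G E E' K" "nat_trans C D F G \<alpha>"
  shows "trans_over C E E' F G \<alpha> H K \<mu> \<longleftrightarrow> strict_trans C D F G \<alpha> E E' H K \<mu> \<and> itrans_norm C E \<mu> = \<mu>"
proof -
  interpret H: strict_mor C D F E E' H by fact
  interpret K: strict_mor C D F E E' "icomp C (bc F E') (astar C F G \<alpha> E') K" using assms by (auto intro: strict_mor_astar)
  have cp: "cp (astar C F G \<alpha> E') \<Gamma> = ri E' (\<alpha> \<Gamma>)" for \<Gamma> by (simp add: astar_def)
  show ?thesis
    unfolding trans_over_def indexed_nat_trans_strict_iff[OF assms(1) strict_mor_astar[OF assms(2,3)]]
      strict_trans_def strict_trans_axioms_def nat_trans_def nat_trans_axioms_def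
    using assms H.fib_functor K.fib_functor by (auto simp: cp nat_trans_def nat_trans_axioms_def)
qed

section \<open>Vertical and horizontal composition of the components of 2-cells\<close>

lemma base_simps [simp]:
  assumes "\<Gamma> \<in> obs C"
  shows "base_id C D F \<Gamma> = idn D (fo F \<Gamma>)"
    "base_vcmp C D \<beta> \<alpha> \<Gamma> = cmp D (\<beta> \<Gamma>) (\<alpha> \<Gamma>)"
    "base_hcmp C D F' G \<beta> \<alpha> \<Gamma> = cmp D (\<beta> (fo F' \<Gamma>)) (fa G (\<alpha> \<Gamma>))"
  using assms by (auto simp: base_id_def base_vcmp_def base_hcmp_def)

lemma base_norm [simp]:
  "restrict (base_id C D F) (obs C) = base_id C D F"
  "restrict (base_vcmp C D \<beta> \<alpha>) (obs C) = base_vcmp C D \<beta> \<alpha>"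
  "restrict (base_hcmp C D F' G \<beta> \<alpha>) (obs C) = base_hcmp C D F' G \<beta> \<alpha>"
  by (auto simp: base_id_def base_vcmp_def base_hcmp_def)

lemma restrict_eqI:
  assumes "restrict f S = f" "restrict g S = g" "\<And>x. x \<in> S \<Longrightarrow> f x = g x"
  shows "f = g"
  using assms by (metis restrict_ext)

lemma nat_trans_base_id: "is_functor C D F \<Longrightarrow> nat_trans C D F F (base_id C D F)"
  by (rule nat_transI) (auto simp: is_functor.map_simps category.ars_simps is_functor_def)

lemma nat_trans_base_vcmp:
  assumes "nat_trans C D F G \<alpha>" "nat_trans C D G L \<beta>"
  shows "nat_trans C D F L (base_vcmp C D \<beta> \<alpha>)"
proof -
  interpret a: nat_trans C D F G \<alpha> by fact
  interpret b: nat_trans C D G L \<beta> by fact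
  show ?thesis
  proof (rule nat_transI, goal_cases)
    case (4 f)
    then show ?case
      using a.F.Cod.cmp_pull[OF b.natural[OF 4], of "\<alpha> (src C f)"] by (auto simp: a.natural)
  qed (auto simp: a.F.is_functor_axioms b.G.is_functor_axioms)
qed

lemma nat_trans_base_hcmp:
  assumes "nat_trans C D F F' \<alpha>" "nat_trans D B G G' \<beta>"
  shows "nat_trans C B (fnc_norm C (fcomp G F)) (fnc_norm C (fcomp G' F')) (base_hcmp C B F' G \<beta> \<alpha>)"
proof -
  interpret a: nat_trans C D F F' \<alpha> by fact
  interpret b: nat_trans D B G G' \<beta> by fact
  show ?thesis
  proof (rule nat_transI, goal_cases)
    case 1 show ?case by (rule is_functor_cong[OF is_functor_fcomp[OF a.F.is_functor_axioms b.F.is_functor_axioms]]) auto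
  next
    case 2 show ?case by (rule is_functor_cong[OF is_functor_fcomp[OF a.G.is_functor_axioms b.G.is_functor_axioms]]) auto
  next
    case (4 f)
    have "cmp B (fa G (\<alpha> (tgt C f))) (fa G (fa F f)) = cmp B (fa G (fa F' f)) (fa G (\<alpha> (src C f)))"
      using 4 a.natural[OF 4] by (simp flip: b.F.map_simps(6))
    then show ?case
      using 4 b.F.Cod.cmp_pull[OF b.natural[of "fa F' f"], of "fa G (\<alpha> (src C f))"] by auto
  qed auto
qed

lemma trans_simps [simp]:
  assumes "\<Gamma> \<in> obs C" "A \<in> obs (fib E \<Gamma>)"
  shows "trans_id C E E' F H \<Gamma> A = idn (fib E' (fo F \<Gamma>)) (fo (cp H \<Gamma>) A)"
    "trans_vcmp C E E' F \<alpha> \<nu> \<mu> \<Gamma> A = cmp (fib E' (fo F \<Gamma>)) (fa (ri E' (\<alpha> \<Gamma>)) (\<nu> \<Gamma> A)) (\<mu> \<Gamma> A)"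
    "trans_hcmp C E E'' F F' \<alpha> H' G K \<nu> \<mu> \<Gamma> A = cmp (fib E'' (fo G (fo F \<Gamma>)))
       (fa (ri E'' (fa G (\<alpha> \<Gamma>))) (\<nu> (fo F' \<Gamma>) (fo (cp H' \<Gamma>) A)))
       (fa (cp K (fo F \<Gamma>)) (\<mu> \<Gamma> A))"
  using assms by (auto simp: trans_id_def trans_vcmp_def trans_hcmp_def)

lemma trans_norm [simp]:
  "itrans_norm C E (trans_id C E E' F H) = trans_id C E E' F H"
  "itrans_norm C E (trans_vcmp C E E' F \<alpha> \<nu> \<mu>) = trans_vcmp C E E' F \<alpha> \<nu> \<mu>"
  "itrans_norm C E (trans_hcmp C E E'' F F' \<alpha> H' G K \<nu> \<mu>) = trans_hcmp C E E'' F F' \<alpha> H' G K \<nu> \<mu>"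
  by (auto simp: trans_id_def trans_vcmp_def trans_hcmp_def)

lemma strict_trans_id:
  assumes "strict_mor C D F E E' H"
  shows "strict_trans C D F F (base_id C D F) E E' H H (trans_id C E E' F H)"
proof -
  interpret H: strict_mor C D F E E' H by fact
  show ?thesis
    by (rule strict_transI[OF assms assms nat_trans_base_id[OF H.is_functor_axioms]]) (auto simp: H.nat_ob)
qed

lemma strict_trans_vcmp:
  assumes "strict_trans C D F G \<alpha> E E' H K \<mu>" "strict_trans C D G L \<beta> E E' K M \<nu>"
  shows "strict_trans C D F L (base_vcmp C D \<beta> \<alpha>) E E' H M (trans_vcmp C E E' F \<alpha> \<nu> \<mu>)"
proof -
  interpret m: strict_trans C D F G \<alpha> E E' H K \<mu> by fact
  interpret n: strict_trans C D G L \<beta> E E' K M \<nu> by fact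
  show ?thesis
  proof (rule strict_transI[OF m.H.strict_mor_axioms n.K.strict_mor_axioms
        nat_trans_base_vcmp[OF m.nat_trans_axioms n.nat_trans_axioms]], goal_cases)
    case (4 \<Gamma> f)
    \<comment> \<open>Naturality of \<nu> lives over \<open>G \<Gamma>\<close>; reindexing along
      \<open>\<alpha> \<Gamma>\<close> carries it to the fibre over \<open>F \<Gamma>\<close>, where
      it is pasted with naturality of \<mu>.\<close>
    have "fa (ri E' (\<alpha> \<Gamma>)) (cmp (fib E' (fo G \<Gamma>)) (\<nu> \<Gamma> (tgt (fib E \<Gamma>) f)) (fa (cp K \<Gamma>) f)) =
      fa (ri E' (\<alpha> \<Gamma>)) (cmp (fib E' (fo G \<Gamma>)) (fa (ri E' (\<beta> \<Gamma>)) (fa (cp M \<Gamma>) f)) (\<nu> \<Gamma> (src (fib E \<Gamma>) f)))"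
      using n.mu_nat[OF 4] by simp
    then have eq: "cmp (fib E' (fo F \<Gamma>)) (fa (ri E' (\<alpha> \<Gamma>)) (\<nu> \<Gamma> (tgt (fib E \<Gamma>) f))) (fa (ri E' (\<alpha> \<Gamma>)) (fa (cp K \<Gamma>) f)) =
      cmp (fib E' (fo F \<Gamma>)) (fa (ri E' (\<alpha> \<Gamma>)) (fa (ri E' (\<beta> \<Gamma>)) (fa (cp M \<Gamma>) f)))
        (fa (ri E' (\<alpha> \<Gamma>)) (\<nu> \<Gamma> (src (fib E \<Gamma>) f)))"
      using 4 by simp
    show ?case
      using 4 m.H.Cod'.fib_pull[OF _ eq, of "\<mu> \<Gamma> (src (fib E \<Gamma>) f)"]
      by (auto simp: m.mu_nat m.H.Cod'.ri_cmp)
  next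
    case (5 u \<Delta> A)
    then have "fa (ri E' (\<alpha> (src C u))) (fa (ri E' (fa G u)) (\<nu> (tgt C u) A)) =
      fa (ri E' (fa F u)) (fa (ri E' (\<alpha> (tgt C u))) (\<nu> (tgt C u) A))"
      using m.natural[of u] by (auto simp flip: m.H.Cod'.ri_cmp)
    with 5 show ?case by (auto simp: m.mu_mod n.mu_mod m.H.nat_ob)
  qed (auto simp: m.H.Cod'.ri_cmp)
qed

lemma strict_trans_hcmp:
  assumes "strict_trans C D F F' \<alpha> E E' H H' \<mu>" "strict_trans D B G G' \<beta> E' E'' K K' \<nu>"
  shows "strict_trans C B (fnc_norm C (fcomp G F)) (fnc_norm C (fcomp G' F')) (base_hcmp C B F' G \<beta> \<alpha>) E E''
    (tp_comp C E E'' G K F H) (tp_comp C E E'' G' K' F' H') (trans_hcmp C E E'' F F' \<alpha> H' G K \<nu> \<mu>)"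
proof -
  interpret m: strict_trans C D F F' \<alpha> E E' H H' \<mu> by fact
  interpret n: strict_trans D B G G' \<beta> E' E'' K K' \<nu> by fact
  show ?thesis
  proof (rule strict_transI[OF strict_mor_comp[OF m.H.strict_mor_axioms n.H.strict_mor_axioms]
        strict_mor_comp[OF m.K.strict_mor_axioms n.K.strict_mor_axioms]
        nat_trans_base_hcmp[OF m.nat_trans_axioms n.nat_trans_axioms]], goal_cases)
    case (4 \<Gamma> f)
    \<comment> \<open>The naturality square of the composite is pasted from the image under
      \<open>K\<close> of naturality of \<mu> and from naturality of \<nu> at the arrow
      \<open>H' f\<close>, reindexed along \<open>G (\<alpha> \<Gamma>)\<close>.\<close>
    have 1: "fa (cp K (fo F \<Gamma>)) (cmp (fib E' (fo F \<Gamma>)) (\<mu> \<Gamma> (tgt (fib E \<Gamma>) f)) (fa (cp H \<Gamma>) f)) =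
      fa (cp K (fo F \<Gamma>)) (cmp (fib E' (fo F \<Gamma>)) (fa (ri E' (\<alpha> \<Gamma>)) (fa (cp H' \<Gamma>) f)) (\<mu> \<Gamma> (src (fib E \<Gamma>) f)))"
      using m.mu_nat[OF 4] by simp
    have 2: "fa (ri E'' (fa G (\<alpha> \<Gamma>))) (cmp (fib E'' (fo G (fo F' \<Gamma>))) (\<nu> (fo F' \<Gamma>) (fo (cp H' \<Gamma>) (tgt (fib E \<Gamma>) f)))
         (fa (cp K (fo F' \<Gamma>)) (fa (cp H' \<Gamma>) f))) =
      fa (ri E'' (fa G (\<alpha> \<Gamma>))) (cmp (fib E'' (fo G (fo F' \<Gamma>))) (fa (ri E'' (\<beta> (fo F' \<Gamma>))) (fa (cp K' (fo F' \<Gamma>)) (fa (cp H' \<Gamma>) f)))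
        (\<nu> (fo F' \<Gamma>) (fo (cp H' \<Gamma>) (src (fib E \<Gamma>) f))))"
      using n.mu_nat[of "fo F' \<Gamma>" "fa (cp H' \<Gamma>) f"] 4 by simp
    have 3: "cmp (fib E'' (fo G (fo F \<Gamma>))) (fa (ri E'' (fa G (\<alpha> \<Gamma>))) (\<nu> (fo F' \<Gamma>) (fo (cp H' \<Gamma>) (tgt (fib E \<Gamma>) f))))
         (fa (ri E'' (fa G (\<alpha> \<Gamma>))) (fa (cp K (fo F' \<Gamma>)) (fa (cp H' \<Gamma>) f))) =
      cmp (fib E'' (fo G (fo F \<Gamma>))) (fa (ri E'' (fa G (\<alpha> \<Gamma>))) (fa (ri E'' (\<beta> (fo F' \<Gamma>))) (fa (cp K' (fo F' \<Gamma>)) (fa (cp H' \<Gamma>) f))))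
        (fa (ri E'' (fa G (\<alpha> \<Gamma>))) (\<nu> (fo F' \<Gamma>) (fo (cp H' \<Gamma>) (src (fib E \<Gamma>) f))))"
      using 2 4 by simp
    show ?case
      using 4 1 n.H.Cod'.fib_pull[OF _ 3, of "fa (cp K (fo F \<Gamma>)) (\<mu> \<Gamma> (src (fib E \<Gamma>) f))"]
      by (auto simp: n.H.Cod'.ri_cmp n.H.nat_ar n.H.nat_ob)
  next
    case (5 u \<Delta> A)
    have "fa (ri E'' (fa G (\<alpha> (src C u)))) (fa (ri E'' (fa G (fa F' u))) x) =
      fa (ri E'' (fa G (fa F u))) (fa (ri E'' (fa G (\<alpha> (tgt C u)))) x)" 
      if "x \<in> ars (fib E'' (fo G (fo F' (tgt C u))))" for x
      using m.natural[of u] 5 that by (auto simp flip: n.H.Cod'.ri_cmp n.H.map_simps(6))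
    with 5 show ?case by (auto simp: m.mu_mod n.mu_mod m.K.nat_ob n.H.nat_ob n.H.nat_ar)
  qed (auto simp: n.H.Cod'.ri_cmp n.H.nat_ob)
qed

lemma trans_vcmp_id_left:
  assumes "strict_trans C D F G \<alpha> E E' H K \<mu>" "itrans_norm C E \<mu> = \<mu>"
  shows "trans_vcmp C E E' F \<alpha> (trans_id C E E' G K) \<mu> = \<mu>"
proof -
  interpret strict_trans C D F G \<alpha> E E' H K \<mu> by fact
  show ?thesis by (rule itrans_eqI[OF _ assms(2)]) auto
qed

lemma trans_vcmp_id_right:
  assumes "strict_trans C D F G \<alpha> E E' H K \<mu>" "itrans_norm C E \<mu> = \<mu>"
  shows "trans_vcmp C E E' F (base_id C D F) \<mu> (trans_id C E E' F H) = \<mu>"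
proof -
  interpret strict_trans C D F G \<alpha> E E' H K \<mu> by fact
  show ?thesis by (rule itrans_eqI[OF _ assms(2)]) auto
qed

lemma trans_vcmp_assoc:
  assumes "strict_trans C D F G \<alpha> E E' H K \<mu>" "strict_trans C D G L \<beta> E E' K M \<nu>" "strict_trans C D L Q \<gamma> E E' M R \<xi>"
  shows "trans_vcmp C E E' F (base_vcmp C D \<beta> \<alpha>) \<xi> (trans_vcmp C E E' F \<alpha> \<nu> \<mu>) =
    trans_vcmp C E E' F \<alpha> (trans_vcmp C E E' G \<beta> \<xi> \<nu>) \<mu>"
proof -
  interpret m: strict_trans C D F G \<alpha> E E' H K \<mu> by fact
  interpret n: strict_trans C D G L \<beta> E E' K M \<nu> by fact
  interpret x: strict_trans C D L Q \<gamma> E E' M R \<xi> by fact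
  show ?thesis by (rule itrans_eqI[of C E]) (auto simp: m.H.Cod'.ri_cmp)
qed

lemma trans_hcmp_id:
  assumes "strict_mor C D F E E' H" "strict_mor D B G E' E'' K"
  shows "trans_hcmp C E E'' F F (base_id C D F) H G K (trans_id D E' E'' G K) (trans_id C E E' F H) =
    trans_id C E E'' (fnc_norm C (fcomp G F)) (tp_comp C E E'' G K F H)"
proof -
  interpret H: strict_mor C D F E E' H by fact
  interpret K: strict_mor D B G E' E'' K by fact
  show ?thesis by (rule itrans_eqI[of C E]) auto
qed

lemma trans_interchange:
  assumes "strict_trans C D F F' \<alpha> E E' H H' \<mu>" "strict_trans C D F' F'' \<alpha>' E E' H' H'' \<mu>'"
    "strict_trans D B G G' \<beta> E' E'' K K' \<nu>" "strict_trans D B G' G'' \<beta>' E' E'' K' K'' \<nu>'"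
  shows "trans_hcmp C E E'' F F'' (base_vcmp C D \<alpha>' \<alpha>) H'' G K (trans_vcmp D E' E'' G \<beta> \<nu>' \<nu>) (trans_vcmp C E E' F \<alpha> \<mu>' \<mu>) =
    trans_vcmp C E E'' (fnc_norm C (fcomp G F)) (base_hcmp C B F' G \<beta> \<alpha>)
      (trans_hcmp C E E'' F' F'' \<alpha>' H'' G' K' \<nu>' \<mu>') (trans_hcmp C E E'' F F' \<alpha> H' G K \<nu> \<mu>)"
proof -
  interpret m: strict_trans C D F F' \<alpha> E E' H H' \<mu> by fact
  interpret m': strict_trans C D F' F'' \<alpha>' E E' H' H'' \<mu>' by fact
  interpret n: strict_trans D B G G' \<beta> E' E'' K K' \<nu> by fact
  interpret n': strict_trans D B G' G'' \<beta>' E' E'' K' K'' \<nu>' by fact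
  show ?thesis
  proof (rule itrans_eqI[of C E], goal_cases)
    case (3 \<Gamma> A)
    let ?X = "fib E'' (fo G (fo F \<Gamma>))" and ?r = "\<lambda>x. fa (ri E'' (fa G (\<alpha> \<Gamma>))) x"
    let ?Y = "fib E'' (fo G (fo F' \<Gamma>))"
    have 1: "fa (ri E'' (fa G (\<alpha>' \<Gamma>))) (fa (ri E'' (\<beta> (fo F'' \<Gamma>))) x) = fa (ri E'' (\<beta> (fo F' \<Gamma>))) (fa (ri E'' (fa G' (\<alpha>' \<Gamma>))) x)"
      if "x \<in> ars (fib E'' (fo G' (fo F'' \<Gamma>)))" for x
      using n.natural[of "\<alpha>' \<Gamma>"] 3 that by (simp flip: n.H.Cod'.ri_cmp)
    have r1: "fo (ri E'' (fa G (\<alpha>' \<Gamma>))) (fo (ri E'' (\<beta> (fo F'' \<Gamma>))) x) = fo (ri E'' (\<beta> (fo F' \<Gamma>))) (fo (ri E'' (fa G' (\<alpha>' \<Gamma>))) x)"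
      if "x \<in> obs (fib E'' (fo G' (fo F'' \<Gamma>)))" for x
      using n.natural[of "\<alpha>' \<Gamma>"] 3 that by (simp flip: n.H.Cod'.ri_cmp)
    \<comment> \<open>The heart of the interchange law: naturality of \<nu> at the arrow
      \<open>\<mu>' \<Gamma> A\<close>, where the component of \<nu> at its target is rewritten by
      \<open>mu_mod\<close> along \<open>\<alpha>' \<Gamma>\<close>.\<close>
    have 2: "cmp ?Y (fa (ri E'' (fa G (\<alpha>' \<Gamma>))) (\<nu> (fo F'' \<Gamma>) (fo (cp H'' \<Gamma>) A))) (fa (cp K (fo F' \<Gamma>)) (\<mu>' \<Gamma> A)) =
      cmp ?Y (fa (ri E'' (\<beta> (fo F' \<Gamma>))) (fa (cp K' (fo F' \<Gamma>)) (\<mu>' \<Gamma> A))) (\<nu> (fo F' \<Gamma>) (fo (cp H' \<Gamma>) A))"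
      using n.mu_nat[of "fo F' \<Gamma>" "\<mu>' \<Gamma> A"] n.mu_mod[of "\<alpha>' \<Gamma>" "fo F' \<Gamma>"] 3 by simp
    have 3: "cmp ?X (?r (fa (ri E'' (fa G (\<alpha>' \<Gamma>))) (\<nu> (fo F'' \<Gamma>) (fo (cp H'' \<Gamma>) A)))) (?r (fa (cp K (fo F' \<Gamma>)) (\<mu>' \<Gamma> A))) =
      cmp ?X (?r (fa (ri E'' (\<beta> (fo F' \<Gamma>))) (fa (cp K' (fo F' \<Gamma>)) (\<mu>' \<Gamma> A)))) (?r (\<nu> (fo F' \<Gamma>) (fo (cp H' \<Gamma>) A)))"
      using arg_cong[OF 2, of ?r] 3 by (simp add: n.H.nat_ob n.K.nat_ob)
    show ?case using \<open>\<Gamma> \<in> obs C\<close> \<open>A \<in> obs (fib E \<Gamma>)\<close> n.H.Cod'.fib_pull[OF _ 3, of "fa (cp K (fo F \<Gamma>)) (\<mu> \<Gamma> A)"]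
      by (simp add: n.H.Cod'.ri_cmp n.H.nat_ar n.H.nat_ob n.K.nat_ob 1 r1)
  qed auto
qed

lemma trans_hcmp_unit_left:
  assumes "strict_trans C D F G \<alpha> E E' H K \<mu>" "itrans_norm C E \<mu> = \<mu>"
  shows "trans_hcmp C E E' F G \<alpha> K (fnc_norm D fid) (ifun_norm D E' (iid D E'))
    (trans_id D E' E' (fnc_norm D fid) (ifun_norm D E' (iid D E'))) \<mu> = \<mu>"
proof -
  interpret strict_trans C D F G \<alpha> E E' H K \<mu> by fact
  show ?thesis by (rule itrans_eqI[OF _ assms(2)]) auto
qed

lemma trans_hcmp_unit_right:
  assumes "strict_trans C D F G \<alpha> E E' H K \<mu>" "itrans_norm C E \<mu> = \<mu>"
  shows "trans_hcmp C E E' (fnc_norm C fid) (fnc_norm C fid) (base_id C C (fnc_norm C fid)) (ifun_norm C E (iid C E)) F H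
    \<mu> (trans_id C E E (fnc_norm C fid) (ifun_norm C E (iid C E))) = \<mu>"
proof -
  interpret strict_trans C D F G \<alpha> E E' H K \<mu> by fact
  show ?thesis by (rule itrans_eqI[OF _ assms(2)]) auto
qed

lemma trans_hcmp_assoc:
  assumes "strict_trans C D F F' \<alpha> E E1 H H' \<mu>" "strict_trans D B G G' \<beta> E1 E2 K K' \<nu>"
    "strict_trans B A L L' \<gamma> E2 E3 M M' \<xi>"
  shows "trans_hcmp C E E3 (fnc_norm C (fcomp G F)) (fnc_norm C (fcomp G' F')) (base_hcmp C B F' G \<beta> \<alpha>)
      (tp_comp C E E2 G' K' F' H') L M \<xi> (trans_hcmp C E E2 F F' \<alpha> H' G K \<nu> \<mu>) =
    trans_hcmp C E E3 F F' \<alpha> H' (fnc_norm D (fcomp L G)) (tp_comp D E1 E3 L M G K)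
      (trans_hcmp D E1 E3 G G' \<beta> K' L M \<xi> \<nu>) \<mu>"
proof -
  interpret m: strict_trans C D F F' \<alpha> E E1 H H' \<mu> by fact
  interpret n: strict_trans D B G G' \<beta> E1 E2 K K' \<nu> by fact
  interpret x: strict_trans B A L L' \<gamma> E2 E3 M M' \<xi> by fact
  show ?thesis by (rule itrans_eqI[of C E]) (auto simp: x.H.Cod'.ri_cmp x.H.nat_ar x.H.nat_ob n.H.nat_ob)
qed

lemma base_vcmp_id:
  assumes "nat_trans C D F G \<alpha>" "restrict \<alpha> (obs C) = \<alpha>"
  shows "base_vcmp C D (base_id C D G) \<alpha> = \<alpha>" "base_vcmp C D \<alpha> (base_id C D F) = \<alpha>"
proof -
  interpret nat_trans C D F G \<alpha> by fact
  show "base_vcmp C D (base_id C D G) \<alpha> = \<alpha>" by (rule restrict_eqI[OF _ assms(2)]) auto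
  show "base_vcmp C D \<alpha> (base_id C D F) = \<alpha>" by (rule restrict_eqI[OF _ assms(2)]) auto
qed

lemma base_vcmp_assoc:
  assumes "nat_trans C D F G \<alpha>" "nat_trans C D G L \<beta>" "nat_trans C D L Q \<gamma>"
  shows "base_vcmp C D \<gamma> (base_vcmp C D \<beta> \<alpha>) = base_vcmp C D (base_vcmp C D \<gamma> \<beta>) \<alpha>"
proof -
  interpret a: nat_trans C D F G \<alpha> by fact
  interpret b: nat_trans C D G L \<beta> by fact
  interpret c: nat_trans C D L Q \<gamma> by fact
  show ?thesis by (rule restrict_eqI[of _ "obs C"]) auto
qed

lemma base_hcmp_id:
  assumes "is_functor C D F" "is_functor D B G"
  shows "base_hcmp C B F G (base_id D B G) (base_id C D F) = base_id C B (fnc_norm C (fcomp G F))"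
proof -
  interpret F: is_functor C D F by fact
  interpret G: is_functor D B G by fact
  show ?thesis by (rule restrict_eqI[of _ "obs C"]) auto
qed

lemma base_interchange:
  assumes "nat_trans C D F F' \<alpha>" "nat_trans C D F' F'' \<alpha>'" "nat_trans D B G G' \<beta>" "nat_trans D B G' G'' \<beta>'"
  shows "base_hcmp C B F'' G (base_vcmp D B \<beta>' \<beta>) (base_vcmp C D \<alpha>' \<alpha>) =
    base_vcmp C B (base_hcmp C B F'' G' \<beta>' \<alpha>') (base_hcmp C B F' G \<beta> \<alpha>)"
proof -
  interpret a: nat_trans C D F F' \<alpha> by fact
  interpret a': nat_trans C D F' F'' \<alpha>' by fact
  interpret b: nat_trans D B G G' \<beta> by fact
  interpret b': nat_trans D B G' G'' \<beta>' by fact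
  show ?thesis
  proof (rule restrict_eqI[of _ "obs C"], goal_cases)
    case (3 \<Gamma>)
    then show ?case using b.F.Cod.cmp_pull[OF b.natural[of "\<alpha>' \<Gamma>"], of "fa G (\<alpha> \<Gamma>)"] by simp
  qed auto
qed

lemma base_hcmp_unit:
  assumes "nat_trans C D F G \<alpha>" "restrict \<alpha> (obs C) = \<alpha>"
  shows "base_hcmp C D G (fnc_norm D fid) (base_id D D (fnc_norm D fid)) \<alpha> = \<alpha>"
    "base_hcmp C D (fnc_norm C fid) F \<alpha> (base_id C C (fnc_norm C fid)) = \<alpha>"
proof -
  interpret nat_trans C D F G \<alpha> by fact
  show "base_hcmp C D G (fnc_norm D fid) (base_id D D (fnc_norm D fid)) \<alpha> = \<alpha>"
    by (rule restrict_eqI[OF _ assms(2)]) auto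
  show "base_hcmp C D (fnc_norm C fid) F \<alpha> (base_id C C (fnc_norm C fid)) = \<alpha>"
    by (rule restrict_eqI[OF _ assms(2)]) auto
qed

lemma base_hcmp_assoc:
  assumes "nat_trans C D F F' \<alpha>" "nat_trans D B G G' \<beta>" "nat_trans B A L L' \<gamma>"
  shows "base_hcmp C A (fnc_norm C (fcomp G' F')) L \<gamma> (base_hcmp C B F' G \<beta> \<alpha>) =
    base_hcmp C A F' (fnc_norm D (fcomp L G)) (base_hcmp D A G' L \<gamma> \<beta>) \<alpha>"
proof -
  interpret a: nat_trans C D F F' \<alpha> by fact
  interpret b: nat_trans D B G G' \<beta> by fact
  interpret c: nat_trans B A L L' \<gamma> by fact
  show ?thesis by (rule restrict_eqI[of _ "obs C"]) auto
qed

section \<open>The 2-category of pre-natural models\<close>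

lemma is_pullback_ars:
  "is_pullback C p f p' f' \<Longrightarrow> p \<in> ars C \<and> f \<in> ars C \<and> p' \<in> ars C \<and> f' \<in> ars C"
  by (auto simp: is_pullback_def)

lemma display_functor_cong:
  assumes "display_functor C D F" "\<And>A. A \<in> obs C \<Longrightarrow> fo G A = fo F A" "\<And>f. f \<in> ars C \<Longrightarrow> fa G f = fa F f"
  shows "display_functor C D G"
proof -
  interpret display_functor C D F by fact
  have "is_functor C D G" by (rule is_functor_cong[OF is_functor_axioms assms(2,3)])
  then show ?thesis
    unfolding display_functor_def display_functor_axioms_def
    using map_dsp map_pullback is_pullback_ars[where C = C] Dom.dsp_ars
    by (auto simp: Dom.display_category_axioms Cod.display_category_axioms assms(3) subset_iff)
qed

lemma display_functor_id: "display_category C \<Longrightarrow> display_functor C C (fnc_norm C fid)"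
proof -
  assume "display_category C"
  then interpret display_category C .
  have "display_functor C C fid"
    using is_functor_fid[OF category_axioms] display_category_axioms
    unfolding display_functor_def display_functor_axioms_def by auto
  then show ?thesis by (rule display_functor_cong) auto
qed

lemma display_functor_comp:
  assumes "display_functor C D F" "display_functor D B G"
  shows "display_functor C B (fnc_norm C (fcomp G F))"
proof -
  interpret F: display_functor C D F by fact
  interpret G: display_functor D B G by fact
  have "display_functor C B (fcomp G F)"
    using is_functor_fcomp[OF F.is_functor_axioms G.is_functor_axioms] F.Dom.display_category_axioms G.Cod.display_category_axioms
    unfolding display_functor_def display_functor_axioms_def by (auto simp: F.map_dsp G.map_dsp F.map_pullback G.map_pullback)
  then show ?thesis by (rule display_functor_cong) auto
qed

section \<open>Pre-natural models, their morphisms and their 2-cells\<close>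

locale prenm =
  fixes U :: "'u universe" and N :: "'u prenm"
  assumes prenm: "is_prenm U N"

sublocale prenm \<subseteq> B: display_category "n_base N"
  using prenm by (simp add: is_prenm_def Let_def)

sublocale prenm \<subseteq> Tp: strict_indexed_category "n_base N" "n_tp N"
  using prenm by (simp add: is_prenm_def Let_def)

sublocale prenm \<subseteq> Tm: strict_indexed_category "n_base N" "n_tm N"
  using prenm by (simp add: is_prenm_def Let_def)

text \<open>Lets the projection from terms to types count as a strict morphism over the identity
  functor, so that it obeys the same rules as the actions of morphisms.\<close>

lemma bc_fid: "bc fid E = E"
  by (cases E) (simp add: bc_def)

sublocale prenm \<subseteq> pr: strict_mor "n_base N" "n_base N" fid "n_tm N" "n_tp N" "n_proj N"
  using strictly_natural_iff[OF is_functor_fid Tm.strict_indexed_category_axioms Tp.strict_indexed_category_axioms, of "n_proj N"]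
    B.category_axioms prenm by (simp add: is_prenm_def Let_def bc_fid)

locale nm_mor = N: prenm U N + M: prenm U M for U :: "'u universe" and N M +
  fixes F :: "'u nm_mor"
  assumes nm_mor: "is_nm_mor N M F"

sublocale nm_mor \<subseteq> base: display_functor "n_base N" "n_base M" "nm_base F"
  using nm_mor by (simp add: is_nm_mor_def)

sublocale nm_mor \<subseteq> Tp: strict_mor "n_base N" "n_base M" "nm_base F" "n_tp N" "n_tp M" "nm_tp F"
  using nm_mor strictly_natural_iff[OF base.is_functor_axioms N.Tp.strict_indexed_category_axioms M.Tp.strict_indexed_category_axioms]
  by (simp add: is_nm_mor_def)

sublocale nm_mor \<subseteq> Tm: strict_mor "n_base N" "n_base M" "nm_base F" "n_tm N" "n_tm M" "nm_tm F"
  using nm_mor strictly_natural_iff[OF base.is_functor_axioms N.Tm.strict_indexed_category_axioms M.Tm.strict_indexed_category_axioms]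
  by (simp add: is_nm_mor_def)

context nm_mor
begin

lemma norms [simp]:
  "fnc_norm (n_base N) (nm_base F) = nm_base F"
  "ifun_norm (n_base N) (n_tp N) (nm_tp F) = nm_tp F"
  "ifun_norm (n_base N) (n_tm N) (nm_tm F) = nm_tm F"
  using nm_mor by (auto simp: is_nm_mor_def)

lemma proj_simps [simp]:
  "\<Gamma> \<in> obs (n_base N) \<Longrightarrow> X = fo (nm_base F) \<Gamma> \<Longrightarrow> t \<in> obs (fib (n_tm N) \<Gamma>) \<Longrightarrow>
    fo (cp (n_proj M) X) (fo (cp (nm_tm F) \<Gamma>) t) = fo (cp (nm_tp F) \<Gamma>) (fo (cp (n_proj N) \<Gamma>) t)"
  "\<Gamma> \<in> obs (n_base N) \<Longrightarrow> X = fo (nm_base F) \<Gamma> \<Longrightarrow> k \<in> ars (fib (n_tm N) \<Gamma>) \<Longrightarrow>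
    fa (cp (n_proj M) X) (fa (cp (nm_tm F) \<Gamma>) k) = fa (cp (nm_tp F) \<Gamma>) (fa (cp (n_proj N) \<Gamma>) k)"
  using nm_mor by (auto simp: is_nm_mor_def)

end

lemma nm_morI:
  assumes "is_prenm U N" "is_prenm U M" "display_functor (n_base N) (n_base M) (nm_base F)"
    "strict_mor (n_base N) (n_base M) (nm_base F) (n_tp N) (n_tp M) (nm_tp F)"
    "strict_mor (n_base N) (n_base M) (nm_base F) (n_tm N) (n_tm M) (nm_tm F)"
    "\<And>\<Gamma> t. \<Gamma> \<in> obs (n_base N) \<Longrightarrow> t \<in> obs (fib (n_tm N) \<Gamma>) \<Longrightarrow>
      fo (cp (n_proj M) (fo (nm_base F) \<Gamma>)) (fo (cp (nm_tm F) \<Gamma>) t) = fo (cp (nm_tp F) \<Gamma>) (fo (cp (n_proj N) \<Gamma>) t)"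
    "\<And>\<Gamma> k. \<Gamma> \<in> obs (n_base N) \<Longrightarrow> k \<in> ars (fib (n_tm N) \<Gamma>) \<Longrightarrow>
      fa (cp (n_proj M) (fo (nm_base F) \<Gamma>)) (fa (cp (nm_tm F) \<Gamma>) k) = fa (cp (nm_tp F) \<Gamma>) (fa (cp (n_proj N) \<Gamma>) k)"
    "fnc_norm (n_base N) (nm_base F) = nm_base F"
    "ifun_norm (n_base N) (n_tp N) (nm_tp F) = nm_tp F"
    "ifun_norm (n_base N) (n_tm N) (nm_tm F) = nm_tm F"
  shows "nm_mor U N M F"
proof -
  interpret N: prenm U N by unfold_locales fact
  interpret M: prenm U M by unfold_locales fact
  have F: "is_functor (n_base N) (n_base M) (nm_base F)" using assms(3) display_functor.axioms(1) by blast
  show ?thesis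
    by unfold_locales (use assms in \<open>simp add: is_nm_mor_def strictly_natural_iff[OF F]
      N.Tm.strict_indexed_category_axioms M.Tm.strict_indexed_category_axioms
      N.Tp.strict_indexed_category_axioms M.Tp.strict_indexed_category_axioms\<close>)
qed

lemma nm_mor_eqI:
  assumes "nm_mor U N M F" "nm_mor U N M G"
    and b: "nm_base F = nm_base G" and t: "nm_tp F = nm_tp G"
    and m: "\<And>\<Gamma> t. \<Gamma> \<in> obs (n_base N) \<Longrightarrow> t \<in> obs (fib (n_tm N) \<Gamma>) \<Longrightarrow> fo (cp (nm_tm F) \<Gamma>) t = fo (cp (nm_tm G) \<Gamma>) t"
    "\<And>\<Gamma> k. \<Gamma> \<in> obs (n_base N) \<Longrightarrow> k \<in> ars (fib (n_tm N) \<Gamma>) \<Longrightarrow> fa (cp (nm_tm F) \<Gamma>) k = fa (cp (nm_tm G) \<Gamma>) k"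
  shows "F = G"
proof -
  interpret F: nm_mor U N M F by fact
  interpret G: nm_mor U N M G by fact
  have "nm_tm F = nm_tm G"
    by (rule strict_mor_eqI[OF F.Tm.strict_mor_axioms _ F.norms(3) G.norms(3)])
      (simp_all add: b m G.Tm.strict_mor_axioms)
  with b t show ?thesis by simp
qed

locale nm_cell = F: nm_mor U N M "nc_src a" + G: nm_mor U N M "nc_tgt a" for U :: "'u universe" and N M and a :: "'u nm_cell" +
  assumes nm_cell: "is_nm_cell N M a"

sublocale nm_cell \<subseteq> base: nat_trans "n_base N" "n_base M" "nm_base (nc_src a)" "nm_base (nc_tgt a)" "nc_base a"
  using nm_cell by (simp add: is_nm_cell_def Let_def)

sublocale nm_cell \<subseteq> Tp: strict_trans "n_base N" "n_base M" "nm_base (nc_src a)" "nm_base (nc_tgt a)" "nc_base a"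
    "n_tp N" "n_tp M" "nm_tp (nc_src a)" "nm_tp (nc_tgt a)" "nc_tp a"
  using nm_cell trans_over_iff[OF F.Tp.strict_mor_axioms G.Tp.strict_mor_axioms base.nat_trans_axioms]
  by (simp add: is_nm_cell_def Let_def)

sublocale nm_cell \<subseteq> Tm: strict_trans "n_base N" "n_base M" "nm_base (nc_src a)" "nm_base (nc_tgt a)" "nc_base a"
    "n_tm N" "n_tm M" "nm_tm (nc_src a)" "nm_tm (nc_tgt a)" "nc_tm a"
  using nm_cell trans_over_iff[OF F.Tm.strict_mor_axioms G.Tm.strict_mor_axioms base.nat_trans_axioms]
  by (simp add: is_nm_cell_def Let_def)

context nm_cell
begin

lemma norms [simp]:
  "restrict (nc_base a) (obs (n_base N)) = nc_base a"
  "itrans_norm (n_base N) (n_tp N) (nc_tp a) = nc_tp a"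
  "itrans_norm (n_base N) (n_tm N) (nc_tm a) = nc_tm a"
  using nm_cell by (auto simp: is_nm_cell_def Let_def trans_over_def)

lemma proj_simps [simp]:
  "\<Gamma> \<in> obs (n_base N) \<Longrightarrow> X = fo (nm_base (nc_src a)) \<Gamma> \<Longrightarrow> t \<in> obs (fib (n_tm N) \<Gamma>) \<Longrightarrow>
    fa (cp (n_proj M) X) (nc_tm a \<Gamma> t) = nc_tp a \<Gamma> (fo (cp (n_proj N) \<Gamma>) t)"
  using nm_cell by (auto simp: is_nm_cell_def Let_def)

end

lemma nm_cellI:
  assumes "nm_mor U N M (nc_src a)" "nm_mor U N M (nc_tgt a)"
    "nat_trans (n_base N) (n_base M) (nm_base (nc_src a)) (nm_base (nc_tgt a)) (nc_base a)"
    "strict_trans (n_base N) (n_base M) (nm_base (nc_src a)) (nm_base (nc_tgt a)) (nc_base a)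
      (n_tp N) (n_tp M) (nm_tp (nc_src a)) (nm_tp (nc_tgt a)) (nc_tp a)"
    "strict_trans (n_base N) (n_base M) (nm_base (nc_src a)) (nm_base (nc_tgt a)) (nc_base a)
      (n_tm N) (n_tm M) (nm_tm (nc_src a)) (nm_tm (nc_tgt a)) (nc_tm a)"
    "restrict (nc_base a) (obs (n_base N)) = nc_base a"
    "itrans_norm (n_base N) (n_tp N) (nc_tp a) = nc_tp a"
    "itrans_norm (n_base N) (n_tm N) (nc_tm a) = nc_tm a"
    "\<And>\<Gamma> t. \<Gamma> \<in> obs (n_base N) \<Longrightarrow> t \<in> obs (fib (n_tm N) \<Gamma>) \<Longrightarrow>
      fa (cp (n_proj M) (fo (nm_base (nc_src a)) \<Gamma>)) (nc_tm a \<Gamma> t) = nc_tp a \<Gamma> (fo (cp (n_proj N) \<Gamma>) t)"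
  shows "nm_cell U N M a"
proof -
  interpret F: nm_mor U N M "nc_src a" by fact
  interpret G: nm_mor U N M "nc_tgt a" by fact
  show ?thesis
    by unfold_locales (use assms F.nm_mor G.nm_mor in \<open>simp add: is_nm_cell_def Let_def
      trans_over_iff[OF F.Tp.strict_mor_axioms G.Tp.strict_mor_axioms]
      trans_over_iff[OF F.Tm.strict_mor_axioms G.Tm.strict_mor_axioms]\<close>)
qed

lemma nm_mor_iff: "is_prenm U N \<Longrightarrow> is_prenm U M \<Longrightarrow> nm_mor U N M F \<longleftrightarrow> is_nm_mor N M F"
  by (auto simp: nm_mor_def prenm_def nm_mor_axioms_def)

lemma nm_cell_iff: "is_prenm U N \<Longrightarrow> is_prenm U M \<Longrightarrow> nm_cell U N M a \<longleftrightarrow> is_nm_cell N M a"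
  by (auto simp: nm_cell_def nm_cell_axioms_def nm_mor_iff is_nm_cell_def Let_def)

lemma nm_id_simps [simp]:
  "nm_base (nm_id N) = fnc_norm (n_base N) fid"
  "nm_tp (nm_id N) = ifun_norm (n_base N) (n_tp N) (iid (n_base N) (n_tp N))"
  "nm_tm (nm_id N) = ifun_norm (n_base N) (n_tm N) (iid (n_base N) (n_tm N))"
  by (auto simp: nm_id_def)

lemma nm_cmp_simps [simp]:
  "nm_base (nm_cmp N M L G F) = fnc_norm (n_base N) (fcomp (nm_base G) (nm_base F))"
  "nm_tp (nm_cmp N M L G F) = tp_comp (n_base N) (n_tp N) (n_tp L) (nm_base G) (nm_tp G) (nm_base F) (nm_tp F)"
  "nm_tm (nm_cmp N M L G F) = tp_comp (n_base N) (n_tm N) (n_tm L) (nm_base G) (nm_tm G) (nm_base F) (nm_tm F)"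
  by (auto simp: nm_cmp_def)

lemma nm_mor_id: "is_prenm U N \<Longrightarrow> nm_mor U N N (nm_id N)"
proof -
  assume "is_prenm U N"
  then interpret prenm U N by unfold_locales
  show ?thesis
    by (rule nm_morI[OF prenm prenm]) (auto simp: B.display_category_axioms Tp.strict_indexed_category_axioms
      Tm.strict_indexed_category_axioms intro!: display_functor_id strict_mor_id)
qed

lemma nm_mor_comp:
  assumes "nm_mor U N M F" "nm_mor U M L G"
  shows "nm_mor U N L (nm_cmp N M L G F)"
proof -
  interpret F: nm_mor U N M F by fact
  interpret G: nm_mor U M L G by fact
  show ?thesis
  proof (rule nm_morI[OF F.N.prenm G.M.prenm], goal_cases)
    case 1 show ?case using display_functor_comp[OF F.base.display_functor_axioms G.base.display_functor_axioms] by (simp add: nm_cmp_def)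
  next
    case 2 show ?case using strict_mor_comp[OF F.Tp.strict_mor_axioms G.Tp.strict_mor_axioms] by (simp add: nm_cmp_def)
  next
    case 3 show ?case using strict_mor_comp[OF F.Tm.strict_mor_axioms G.Tm.strict_mor_axioms] by (simp add: nm_cmp_def)
  qed (auto simp: nm_cmp_def)
qed

lemma nm_hom_simps [simp]:
  "obs (nm_hom N M) = {F. is_nm_mor N M F}" "ars (nm_hom N M) = {a. is_nm_cell N M a}"
  "src (nm_hom N M) = nc_src" "tgt (nm_hom N M) = nc_tgt"
  by (auto simp: nm_hom_def)

lemma nm_cell_id:
  assumes "nm_mor U N M F"
  shows "nm_cell U N M (idn (nm_hom N M) F)"
proof -
  interpret F: nm_mor U N M F by fact
  show ?thesis
    by (rule nm_cellI) (auto simp: nm_hom_def assms intro!: nat_trans_base_id strict_trans_id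
      F.base.is_functor_axioms F.Tp.strict_mor_axioms F.Tm.strict_mor_axioms)
qed

lemma nm_cell_vcmp:
  assumes "nm_cell U N M a" "nm_cell U N M b" "nc_src b = nc_tgt a"
  shows "nm_cell U N M (cmp (nm_hom N M) b a)"
proof -
  interpret a: nm_cell U N M a by fact
  interpret b: nm_cell U N M b by fact
  \<comment> \<open>The facts about \<open>b\<close> speak of \<open>nc_src b\<close>; they are
    restated for \<open>nc_tgt a\<close> so that the composition lemmas match.\<close>
  note b = b.base.nat_trans_axioms[unfolded assms(3)] b.Tp.strict_trans_axioms[unfolded assms(3)] b.Tm.strict_trans_axioms[unfolded assms(3)]
  note eq = arg_cong[OF assms(3), of nm_base] arg_cong[OF assms(3), of nm_tp] arg_cong[OF assms(3), of nm_tm]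
  show ?thesis
    by (rule nm_cellI) (auto simp: nm_hom_def a.F.nm_mor_axioms b.G.nm_mor_axioms eq a.F.M.pr.nat_ar
     intro!: nat_trans_base_vcmp[OF _ b(1)] strict_trans_vcmp[OF _ b(2)] strict_trans_vcmp[OF _ b(3)]
      a.base.nat_trans_axioms a.Tp.strict_trans_axioms a.Tm.strict_trans_axioms)
qed

lemma nm_cell_hcmp:
  assumes "nm_cell U N M a" "nm_cell U M L b"
  shows "nm_cell U N L (nm_cmp2 N M L b a)"
proof -
  interpret a: nm_cell U N M a by fact
  interpret b: nm_cell U M L b by fact
  have src: "nm_mor U N L (nc_src (nm_cmp2 N M L b a))" and tgt: "nm_mor U N L (nc_tgt (nm_cmp2 N M L b a))"
    by (auto simp: nm_cmp2_def intro!: nm_mor_comp a.F.nm_mor_axioms a.G.nm_mor_axioms b.F.nm_mor_axioms b.G.nm_mor_axioms)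
  show ?thesis
  proof (rule nm_cellI[OF src tgt], goal_cases)
    case 1 show ?case using nat_trans_base_hcmp[OF a.base.nat_trans_axioms b.base.nat_trans_axioms]
      by (simp add: nm_cmp2_def)
  next
    case 2 show ?case using strict_trans_hcmp[OF a.Tp.strict_trans_axioms b.Tp.strict_trans_axioms]
      by (simp add: nm_cmp2_def)
  next
    case 3 show ?case using strict_trans_hcmp[OF a.Tm.strict_trans_axioms b.Tm.strict_trans_axioms]
      by (simp add: nm_cmp2_def)
  qed (auto simp: nm_cmp2_def b.F.M.pr.nat_ar b.F.Tm.nat_ob)
qed

lemma nm_cell_eqI:
  "nc_src a = nc_src b \<Longrightarrow> nc_tgt a = nc_tgt b \<Longrightarrow> nc_base a = nc_base b \<Longrightarrow> nc_tp a = nc_tp b \<Longrightarrow>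
    nc_tm a = nc_tm b \<Longrightarrow> a = (b :: 'u nm_cell)"
  by (cases a; cases b) simp

lemma nm_hom_category:
  assumes "is_prenm U N" "is_prenm U M"
  shows "category (nm_hom N M)"
proof (rule categoryI, goal_cases)
  case (3 F)
  then show ?case using nm_cell_id[of U N M F] assms
    by (simp add: nm_mor_iff nm_cell_iff) (simp add: nm_hom_def)
next
  case (4 a b)
  then show ?case using nm_cell_vcmp[of U N M a b] assms
    by (simp add: nm_cell_iff) (simp add: nm_hom_def)
next
  case (5 a)
  then interpret nm_cell U N M a by (simp add: nm_cell_iff assms)
  show ?case
    by (rule nm_cell_eqI) (auto simp: nm_hom_def base_vcmp_id[OF base.nat_trans_axioms]
      trans_vcmp_id_left[OF Tp.strict_trans_axioms] trans_vcmp_id_left[OF Tm.strict_trans_axioms])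
next
  case (6 a)
  then interpret nm_cell U N M a by (simp add: nm_cell_iff assms)
  show ?case
    by (rule nm_cell_eqI) (auto simp: nm_hom_def base_vcmp_id[OF base.nat_trans_axioms]
      trans_vcmp_id_right[OF Tp.strict_trans_axioms] trans_vcmp_id_right[OF Tm.strict_trans_axioms])
next
  case (7 a b c)
  then interpret a: nm_cell U N M a by (simp add: nm_cell_iff assms)
  from 7 interpret b: nm_cell U N M b by (simp add: nm_cell_iff assms)
  from 7 interpret c: nm_cell U N M c by (simp add: nm_cell_iff assms)
  from 7 have eq: "nc_src b = nc_tgt a" "nc_src c = nc_tgt b" by auto
  note b' = b.base.nat_trans_axioms[unfolded eq] b.Tp.strict_trans_axioms[unfolded eq] b.Tm.strict_trans_axioms[unfolded eq]
  note c' = c.base.nat_trans_axioms[unfolded eq] c.Tp.strict_trans_axioms[unfolded eq] c.Tm.strict_trans_axioms[unfolded eq]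
  show ?case
    by (rule nm_cell_eqI) (auto simp: nm_hom_def eq arg_cong[OF eq(1), of nm_base] arg_cong[OF eq(2), of nm_base]
      base_vcmp_assoc[OF a.base.nat_trans_axioms b'(1) c'(1)]
      trans_vcmp_assoc[OF a.Tp.strict_trans_axioms b'(2) c'(2)] trans_vcmp_assoc[OF a.Tm.strict_trans_axioms b'(3) c'(3)])
qed (auto simp: is_nm_cell_def Let_def)

section \<open>Horizontal composition and the 2-category axioms\<close>

lemma PreNM_simps [simp]:
  "t_ob (PreNM U) = {N. is_prenm U N}" "t_hom (PreNM U) = nm_hom" "t_id (PreNM U) = nm_id"
  "t_cmp (PreNM U) = nm_cmp" "t_cmp2 (PreNM U) = nm_cmp2"
  by (auto simp: PreNM_def)

lemma prod_cat_simps [simp]: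
  "obs (prod_cat C D) = obs C \<times> obs D" "ars (prod_cat C D) = ars C \<times> ars D"
  "src (prod_cat C D) (f, g) = (src C f, src D g)" "tgt (prod_cat C D) (f, g) = (tgt C f, tgt D g)"
  "idn (prod_cat C D) (A, B) = (idn C A, idn D B)"
  "cmp (prod_cat C D) (f', g') (f, g) = (cmp C f' f, cmp D g' g)"
  by (auto simp: prod_cat_def)

lemma category_prod: "category C \<Longrightarrow> category D \<Longrightarrow> category (prod_cat C D)"
  by (rule categoryI) (auto simp: category.ars_simps)

lemma nm_cmp_functor:
  assumes "is_prenm U N" "is_prenm U M" "is_prenm U L"
  shows "is_functor (prod_cat (nm_hom M L) (nm_hom N M)) (nm_hom N L)
    \<lparr>fo = (\<lambda>(G, F). nm_cmp N M L G F), fa = (\<lambda>(b, a). nm_cmp2 N M L b a)\<rparr>"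
proof (rule is_functorI, goal_cases)
  case (3 GF)
  then show ?case using nm_mor_comp[of U N M "snd GF" L "fst GF"] by (auto simp: nm_mor_iff assms)
next
  case (4 ba)
  then show ?case using nm_cell_hcmp[of U N M "snd ba" L "fst ba"] by (auto simp: nm_cell_iff assms) (auto simp: nm_cmp2_def)
next
  case (5 GF)
  obtain G F where GF: "GF = (G, F)" by (cases GF)
  from 5 interpret F: nm_mor U N M F by (simp add: nm_mor_iff assms GF)
  from 5 interpret G: nm_mor U M L G by (simp add: nm_mor_iff assms GF)
  show ?case unfolding GF
    by (simp, rule nm_cell_eqI) (auto simp: nm_hom_def nm_cmp2_def base_hcmp_id[OF F.base.is_functor_axioms G.base.is_functor_axioms]
      trans_hcmp_id[OF F.Tp.strict_mor_axioms G.Tp.strict_mor_axioms] trans_hcmp_id[OF F.Tm.strict_mor_axioms G.Tm.strict_mor_axioms])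
next
  case (6 ba ba')
  obtain b a b' a' where ba: "ba' = (b, a)" "ba = (b', a')" by (cases ba; cases ba')
  from 6 interpret a: nm_cell U N M a by (simp add: nm_cell_iff assms ba)
  from 6 interpret b: nm_cell U M L b by (simp add: nm_cell_iff assms ba)
  from 6 interpret a': nm_cell U N M a' by (simp add: nm_cell_iff assms ba)
  from 6 interpret b': nm_cell U M L b' by (simp add: nm_cell_iff assms ba)
  from 6 ba have eq: "nc_tgt a' = nc_src a" "nc_tgt b' = nc_src b" by auto
  note n = a'.base.nat_trans_axioms[unfolded eq] b'.base.nat_trans_axioms[unfolded eq]
  note t = a'.Tp.strict_trans_axioms[unfolded eq] a'.Tm.strict_trans_axioms[unfolded eq]
    b'.Tp.strict_trans_axioms[unfolded eq] b'.Tm.strict_trans_axioms[unfolded eq]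
  show ?case unfolding ba
    by (simp, rule nm_cell_eqI) (auto simp: nm_hom_def nm_cmp2_def eq base_interchange[OF n(1) a.base.nat_trans_axioms n(2) b.base.nat_trans_axioms]
      trans_interchange[OF t(1) a.Tp.strict_trans_axioms t(3) b.Tp.strict_trans_axioms]
      trans_interchange[OF t(2) a.Tm.strict_trans_axioms t(4) b.Tm.strict_trans_axioms])
qed (auto intro: category_prod nm_hom_category assms)

lemma base_eqs:
  "fnc_norm C F = F \<Longrightarrow> is_functor C D F \<Longrightarrow> fnc_norm C (fcomp (fnc_norm D fid) F) = F"
  "fnc_norm C F = F \<Longrightarrow> is_functor C D F \<Longrightarrow> fnc_norm C (fcomp F (fnc_norm C fid)) = F"
  "is_functor C D F \<Longrightarrow> is_functor D B G \<Longrightarrow>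
    fnc_norm C (fcomp L (fnc_norm C (fcomp G F))) = fnc_norm C (fcomp (fnc_norm D (fcomp L G)) F)"
  by (rule fnc_eqI[of C]; simp add: is_functor.map_simps)+

lemma tp_eqs:
  assumes "strict_mor C D F E E' H" "ifun_norm C E H = H"
  shows "tp_comp C E E' (fnc_norm D fid) (ifun_norm D E' (iid D E')) F H = H"
    "tp_comp C E E' F H (fnc_norm C fid) (ifun_norm C E (iid C E)) = H"
proof -
  interpret strict_mor C D F E E' H by fact
  show "tp_comp C E E' (fnc_norm D fid) (ifun_norm D E' (iid D E')) F H = H"
    unfolding tp_comp_def by (rule ifun_eqI[OF _ assms(2)]) (auto simp: ps_eq nat_ob)
  show "tp_comp C E E' F H (fnc_norm C fid) (ifun_norm C E (iid C E)) = H"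
    unfolding tp_comp_def by (rule ifun_eqI[OF _ assms(2)]) (auto simp: ps_eq nat_ob)
qed

lemma tp_assoc:
  assumes "strict_mor C D F E E1 H" "strict_mor D B G E1 E2 K" "strict_mor B A L E2 E3 M"
  shows "tp_comp C E E3 L M (fnc_norm C (fcomp G F)) (tp_comp C E E2 G K F H) =
    tp_comp C E E3 (fnc_norm D (fcomp L G)) (tp_comp D E1 E3 L M G K) F H"
proof -
  interpret F: strict_mor C D F E E1 H by fact
  interpret G: strict_mor D B G E1 E2 K by fact
  interpret L: strict_mor B A L E2 E3 M by fact
  \<comment> \<open>The two bracketings lie over base functors that are equal but differently
    written; identifying them makes both composites strict morphisms over one functor, as
    \<open>strict_mor_eqI\<close> requires.\<close>
  have *: "fnc_norm C (fcomp L (fnc_norm C (fcomp G F))) = fnc_norm C (fcomp (fnc_norm D (fcomp L G)) F)"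
    using F.is_functor_axioms G.is_functor_axioms by (rule base_eqs)
  show ?thesis
    by (rule strict_mor_eqI[OF
      strict_mor_comp[OF strict_mor_comp[OF assms(1,2)] assms(3), unfolded *]
      strict_mor_comp[OF assms(1) strict_mor_comp[OF assms(2,3)]]]) auto
qed

lemma nm_mor_record_eqI: "nm_base F = nm_base G \<Longrightarrow> nm_tp F = nm_tp G \<Longrightarrow> nm_tm F = nm_tm G \<Longrightarrow> F = (G :: 'u nm_mor)"
  by (cases F; cases G) simp

lemma nm_cmp_id_left: "nm_mor U N M F \<Longrightarrow> nm_cmp N M M (nm_id M) F = F"
proof -
  assume "nm_mor U N M F"
  then interpret nm_mor U N M F .
  show ?thesis
    by (rule nm_mor_record_eqI) (simp_all add: base_eqs[OF _ base.is_functor_axioms]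
      tp_eqs[OF Tp.strict_mor_axioms] tp_eqs[OF Tm.strict_mor_axioms])
qed

lemma nm_cmp_id_right: "nm_mor U N M F \<Longrightarrow> nm_cmp N N M F (nm_id N) = F"
proof -
  assume "nm_mor U N M F"
  then interpret nm_mor U N M F .
  show ?thesis
    by (rule nm_mor_record_eqI) (simp_all add: base_eqs[OF _ base.is_functor_axioms]
      tp_eqs[OF Tp.strict_mor_axioms] tp_eqs[OF Tm.strict_mor_axioms])
qed

lemma nm_cmp_assoc:
  assumes "nm_mor U N M F" "nm_mor U M L G" "nm_mor U L K H"
  shows "nm_cmp N L K H (nm_cmp N M L G F) = nm_cmp N M K (nm_cmp M L K H G) F"
proof -
  interpret F: nm_mor U N M F by fact
  interpret G: nm_mor U M L G by fact
  interpret H: nm_mor U L K H by fact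
  show ?thesis
    by (rule nm_mor_record_eqI) (simp_all add: base_eqs(3)[OF F.base.is_functor_axioms G.base.is_functor_axioms]
      tp_assoc[OF F.Tp.strict_mor_axioms G.Tp.strict_mor_axioms H.Tp.strict_mor_axioms]
      tp_assoc[OF F.Tm.strict_mor_axioms G.Tm.strict_mor_axioms H.Tm.strict_mor_axioms])
qed

text \<open>The only 2-category whose axioms are verified directly. Natural models inherit them by
  restriction, pre-CwAs and CwAs by transport.\<close>

theorem strict_2category_PreNM: "strict_2category (PreNM U)"
proof (rule strict_2category.intro, goal_cases)
  case 1 then show ?case by (auto intro: nm_hom_category)
next
  case (2 N) then show ?case using nm_mor_id[of U N] by (simp add: nm_mor_iff)
next
  case 3 then show ?case using nm_cmp_functor[of U] by simp
next
  case (4 N M F) then show ?case using nm_cmp_id_left[of U N M F] by (simp add: nm_mor_iff)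
next
  case (5 N M F) then show ?case using nm_cmp_id_right[of U N M F] by (simp add: nm_mor_iff)
next
  case (6 W X Y Z F G H) then show ?case using nm_cmp_assoc[of U W X F Y G Z H] by (simp add: nm_mor_iff)
next
  case (7 N M a)
  then interpret nm_cell U N M a by (simp add: nm_cell_iff)
  show ?case
    by (simp, rule nm_cell_eqI) (auto simp: nm_hom_def nm_cmp2_def nm_cmp_id_left[OF F.nm_mor_axioms] nm_cmp_id_left[OF G.nm_mor_axioms]
      base_hcmp_unit[OF base.nat_trans_axioms]
      trans_hcmp_unit_left[OF Tp.strict_trans_axioms] trans_hcmp_unit_left[OF Tm.strict_trans_axioms])
next
  case (8 N M a)
  then interpret nm_cell U N M a by (simp add: nm_cell_iff)
  show ?case
    by (simp, rule nm_cell_eqI) (auto simp: nm_hom_def nm_cmp2_def nm_cmp_id_right[OF F.nm_mor_axioms] nm_cmp_id_right[OF G.nm_mor_axioms]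
      base_hcmp_unit[OF base.nat_trans_axioms]
      trans_hcmp_unit_right[OF Tp.strict_trans_axioms] trans_hcmp_unit_right[OF Tm.strict_trans_axioms])
next
  case (9 W X Y Z a b c)
  then interpret a: nm_cell U W X a by (simp add: nm_cell_iff)
  from 9 interpret b: nm_cell U X Y b by (simp add: nm_cell_iff)
  from 9 interpret c: nm_cell U Y Z c by (simp add: nm_cell_iff)
  show ?case
    by (simp, rule nm_cell_eqI) (auto simp: nm_cmp2_def nm_cmp_assoc[OF a.F.nm_mor_axioms b.F.nm_mor_axioms c.F.nm_mor_axioms]
      nm_cmp_assoc[OF a.G.nm_mor_axioms b.G.nm_mor_axioms c.G.nm_mor_axioms]
      base_hcmp_assoc[OF a.base.nat_trans_axioms b.base.nat_trans_axioms c.base.nat_trans_axioms]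
      trans_hcmp_assoc[OF a.Tp.strict_trans_axioms b.Tp.strict_trans_axioms c.Tp.strict_trans_axioms]
      trans_hcmp_assoc[OF a.Tm.strict_trans_axioms b.Tm.strict_trans_axioms c.Tm.strict_trans_axioms])
qed

section \<open>Indexed functors\<close>

context indexed_category
begin

lemma un_cm_simps [simp]:
  "\<Gamma> \<in> obs C \<Longrightarrow> A \<in> obs (fib E \<Gamma>) \<Longrightarrow> un E \<Gamma> A \<in> ars (fib E \<Gamma>)"
  "\<Gamma> \<in> obs C \<Longrightarrow> A \<in> obs (fib E \<Gamma>) \<Longrightarrow> src (fib E \<Gamma>) (un E \<Gamma> A) = A"
  "\<Gamma> \<in> obs C \<Longrightarrow> A \<in> obs (fib E \<Gamma>) \<Longrightarrow> tgt (fib E \<Gamma>) (un E \<Gamma> A) = fo (ri E (idn C \<Gamma>)) A"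
  "u \<in> ars C \<Longrightarrow> v \<in> ars C \<Longrightarrow> src C u = tgt C v \<Longrightarrow> A \<in> obs (fib E (tgt C u)) \<Longrightarrow> src C v = \<Delta> \<Longrightarrow>
    cm E u v A \<in> ars (fib E \<Delta>)"
  "u \<in> ars C \<Longrightarrow> v \<in> ars C \<Longrightarrow> src C u = tgt C v \<Longrightarrow> A \<in> obs (fib E (tgt C u)) \<Longrightarrow> src C v = \<Delta> \<Longrightarrow>
    src (fib E \<Delta>) (cm E u v A) = fo (ri E v) (fo (ri E u) A)"
  "u \<in> ars C \<Longrightarrow> v \<in> ars C \<Longrightarrow> src C u = tgt C v \<Longrightarrow> A \<in> obs (fib E (tgt C u)) \<Longrightarrow> src C v = \<Delta> \<Longrightarrow>
    tgt (fib E \<Delta>) (cm E u v A) = fo (ri E (cmp C u v)) A"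
  using nat_trans.component_simps[OF nat_iso.axioms(1)[OF un_iso], of \<Gamma> A]
    nat_trans.component_simps[OF nat_iso.axioms(1)[OF cm_iso[of u "src C u" "tgt C u" v "src C v"]], of A]
  by auto

end

context indexed_functor
begin

lemma cp_simps [simp]:
  assumes "\<Gamma> \<in> obs C"
  shows "A \<in> obs (fib E \<Gamma>) \<Longrightarrow> fo (cp H \<Gamma>) A \<in> obs (fib E' \<Gamma>)"
    "f \<in> ars (fib E \<Gamma>) \<Longrightarrow> fa (cp H \<Gamma>) f \<in> ars (fib E' \<Gamma>)"
    "f \<in> ars (fib E \<Gamma>) \<Longrightarrow> src (fib E' \<Gamma>) (fa (cp H \<Gamma>) f) = fo (cp H \<Gamma>) (src (fib E \<Gamma>) f)"
    "f \<in> ars (fib E \<Gamma>) \<Longrightarrow> tgt (fib E' \<Gamma>) (fa (cp H \<Gamma>) f) = fo (cp H \<Gamma>) (tgt (fib E \<Gamma>) f)"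
    "A \<in> obs (fib E \<Gamma>) \<Longrightarrow> fa (cp H \<Gamma>) (idn (fib E \<Gamma>) A) = idn (fib E' \<Gamma>) (fo (cp H \<Gamma>) A)"
    "g \<in> ars (fib E \<Gamma>) \<Longrightarrow> f \<in> ars (fib E \<Gamma>) \<Longrightarrow> src (fib E \<Gamma>) g = tgt (fib E \<Gamma>) f \<Longrightarrow>
      fa (cp H \<Gamma>) (cmp (fib E \<Gamma>) g f) = cmp (fib E' \<Gamma>) (fa (cp H \<Gamma>) g) (fa (cp H \<Gamma>) f)"
  using is_functor.map_simps[OF cp_functor[OF assms]] by auto

lemma ps_nat_iso: "u \<in> ars C \<Longrightarrow> nat_iso (fib E (tgt C u)) (fib E' (src C u))
    (fcomp (ri E' u) (cp H (tgt C u))) (fcomp (cp H (src C u)) (ri E u)) (ps H u)"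
  using ps_iso[of u "src C u" "tgt C u"] by simp

lemma ps_simps [simp]:
  assumes "u \<in> ars C" "src C u = \<Delta>" "A \<in> obs (fib E (tgt C u))"
  shows "ps H u A \<in> ars (fib E' \<Delta>)"
    "src (fib E' \<Delta>) (ps H u A) = fo (ri E' u) (fo (cp H (tgt C u)) A)"
    "tgt (fib E' \<Delta>) (ps H u A) = fo (cp H \<Delta>) (fo (ri E u) A)"
    "is_iso (fib E' \<Delta>) (ps H u A)"
  using nat_trans.component_simps[OF nat_iso.axioms(1)[OF ps_nat_iso[OF assms(1)]] assms(3)]
    nat_iso.component_iso[OF ps_nat_iso[OF assms(1)] assms(3)] assms by auto

lemma ps_nat:
  "u \<in> ars C \<Longrightarrow> f \<in> ars (fib E (tgt C u)) \<Longrightarrow>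
    cmp (fib E' (src C u)) (ps H u (tgt (fib E (tgt C u)) f)) (fa (ri E' u) (fa (cp H (tgt C u)) f)) =
    cmp (fib E' (src C u)) (fa (cp H (src C u)) (fa (ri E u) f)) (ps H u (src (fib E (tgt C u)) f))"
  using nat_trans.natural[OF nat_iso.axioms(1)[OF ps_nat_iso]] by simp

lemma ps_cm':
  "u \<in> ars C \<Longrightarrow> v \<in> ars C \<Longrightarrow> src C u = tgt C v \<Longrightarrow> A \<in> obs (fib E (tgt C u)) \<Longrightarrow>
      cmp (fib E' (src C v)) (ps H (cmp C u v) A) (cm E' u v (fo (cp H (tgt C u)) A))
        = cmp (fib E' (src C v)) (fa (cp H (src C v)) (cm E u v A))
            (cmp (fib E' (src C v)) (ps H v (fo (ri E u) A)) (fa (ri E' v) (ps H u A)))"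
  using ps_cm[of u "src C u" "tgt C u" v "src C v" A] by auto

end

lemma indexed_functorI:
  assumes E: "indexed_category C E" and E': "indexed_category C E'"
    and F: "\<And>\<Gamma>. \<Gamma> \<in> obs C \<Longrightarrow> is_functor (fib E \<Gamma>) (fib E' \<Gamma>) (cp H \<Gamma>)"
    and ps: "\<And>u A. u \<in> ars C \<Longrightarrow> A \<in> obs (fib E (tgt C u)) \<Longrightarrow> ps H u A \<in> ars (fib E' (src C u)) \<and>
      src (fib E' (src C u)) (ps H u A) = fo (ri E' u) (fo (cp H (tgt C u)) A) \<and>
      tgt (fib E' (src C u)) (ps H u A) = fo (cp H (src C u)) (fo (ri E u) A) \<and> is_iso (fib E' (src C u)) (ps H u A)"
    and nat: "\<And>u f. u \<in> ars C \<Longrightarrow> f \<in> ars (fib E (tgt C u)) \<Longrightarrow>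
      cmp (fib E' (src C u)) (ps H u (tgt (fib E (tgt C u)) f)) (fa (ri E' u) (fa (cp H (tgt C u)) f)) =
      cmp (fib E' (src C u)) (fa (cp H (src C u)) (fa (ri E u) f)) (ps H u (src (fib E (tgt C u)) f))"
    and un: "\<And>\<Gamma> A. \<Gamma> \<in> obs C \<Longrightarrow> A \<in> obs (fib E \<Gamma>) \<Longrightarrow>
      cmp (fib E' \<Gamma>) (ps H (idn C \<Gamma>) A) (un E' \<Gamma> (fo (cp H \<Gamma>) A)) = fa (cp H \<Gamma>) (un E \<Gamma> A)"
    and cm: "\<And>u v A. u \<in> ars C \<Longrightarrow> v \<in> ars C \<Longrightarrow> src C u = tgt C v \<Longrightarrow> A \<in> obs (fib E (tgt C u)) \<Longrightarrow>
      cmp (fib E' (src C v)) (ps H (cmp C u v) A) (cm E' u v (fo (cp H (tgt C u)) A))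
        = cmp (fib E' (src C v)) (fa (cp H (src C v)) (cm E u v A))
            (cmp (fib E' (src C v)) (ps H v (fo (ri E u) A)) (fa (ri E' v) (ps H u A)))"
  shows "indexed_functor C E E' H"
proof -
  interpret E: indexed_category C E by fact
  interpret E': indexed_category C E' by fact
  show ?thesis
  proof (rule indexed_functor.intro[OF E E' indexed_functor_axioms.intro], goal_cases)
    case (2 u \<Delta> \<Gamma>)
    then have u: "u \<in> ars C" "src C u = \<Delta>" "tgt C u = \<Gamma>" by auto
    show ?case unfolding u(2,3)[symmetric]
      using u F[of \<Gamma>] F[of \<Delta>] E.ri_functor[OF 2] E'.ri_functor[OF 2] ps[OF u(1)] nat[OF u(1)]
      by (intro nat_isoI nat_transI is_functor_fcomp) auto
  qed (use F un cm in auto)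
qed

text \<open>The source and target of \<tau> are composites of this kind, and comprehension makes
  them genuinely pseudonatural. Each law pastes the image under \<open>K\<close> of the law for
  \<open>H\<close> with the law for \<open>K\<close>.\<close>

lemma indexed_functor_icomp:
  assumes "indexed_functor C E E' H" "indexed_functor C E' E'' K"
  shows "indexed_functor C E E'' (icomp C E'' K H)"
proof -
  interpret H: indexed_functor C E E' H by fact
  interpret K: indexed_functor C E' E'' K by fact
  show ?thesis
  proof (rule indexed_functorI, goal_cases)
    case 1 show ?case by (rule H.Dom.indexed_category_axioms)
  next
    case 2 show ?case by (rule K.Cod.indexed_category_axioms)
  next
    case (3 \<Gamma>) then show ?case by (auto intro: is_functor_fcomp H.cp_functor K.cp_functor)
  next
    case (4 u A)
    then have "is_iso (fib E'' (src C u)) (fa (cp K (src C u)) (ps H u A))"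
      by (intro is_functor.map_iso[OF K.cp_functor]) auto
    with 4 show ?case by (auto intro!: category.is_iso_cmp[OF K.Cod.fib_cat])
  next
    case (5 u f)
    let ?K = "fa (cp K (src C u))"
    have 1: "?K (cmp (fib E' (src C u)) (ps H u (tgt (fib E (tgt C u)) f)) (fa (ri E' u) (fa (cp H (tgt C u)) f))) =
      ?K (cmp (fib E' (src C u)) (fa (cp H (src C u)) (fa (ri E u) f)) (ps H u (src (fib E (tgt C u)) f)))"
      using 5 by (simp add: H.ps_nat)
    then have 1: "cmp (fib E'' (src C u)) (?K (ps H u (tgt (fib E (tgt C u)) f))) (?K (fa (ri E' u) (fa (cp H (tgt C u)) f))) =
      cmp (fib E'' (src C u)) (?K (fa (cp H (src C u)) (fa (ri E u) f))) (?K (ps H u (src (fib E (tgt C u)) f)))"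
      using 5 by simp
    show ?case
      using 5 K.ps_nat[of u "fa (cp H (tgt C u)) f"] K.Cod.fib_pull[OF _ 1, of "ps K u (fo (cp H (tgt C u)) (src (fib E (tgt C u)) f))"]
      by simp
  next
    case (6 \<Gamma> A)
    have "fa (cp K \<Gamma>) (cmp (fib E' \<Gamma>) (ps H (idn C \<Gamma>) A) (un E' \<Gamma> (fo (cp H \<Gamma>) A))) = fa (cp K \<Gamma>) (fa (cp H \<Gamma>) (un E \<Gamma> A))"
      using 6 by (simp add: H.ps_un)
    then show ?case using 6 by (simp add: K.ps_un)
  next
    case (7 u v A)
    let ?K = "fa (cp K (src C v))" and ?X = "fib E'' (src C v)"
    have "?K (cmp (fib E' (src C v)) (ps H (cmp C u v) A) (cm E' u v (fo (cp H (tgt C u)) A)))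
        = ?K (cmp (fib E' (src C v)) (fa (cp H (src C v)) (cm E u v A))
            (cmp (fib E' (src C v)) (ps H v (fo (ri E u) A)) (fa (ri E' v) (ps H u A))))"
      using 7 by (simp add: H.ps_cm')
    then have 1: "cmp ?X (?K (ps H (cmp C u v) A)) (?K (cm E' u v (fo (cp H (tgt C u)) A)))
        = cmp ?X (?K (fa (cp H (src C v)) (cm E u v A))) (cmp ?X (?K (ps H v (fo (ri E u) A))) (?K (fa (ri E' v) (ps H u A))))"
      using 7 by simp
    \<comment> \<open>Naturality of \<open>ps K v\<close> at the arrow \<open>ps H u A\<close>,
      which exchanges the two middle factors.\<close>
    have 2: "cmp ?X (ps K v (fo (cp H (tgt C v)) (fo (ri E u) A))) (fa (ri E'' v) (fa (cp K (tgt C v)) (ps H u A))) =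
      cmp ?X (?K (fa (ri E' v) (ps H u A))) (ps K v (fo (ri E' u) (fo (cp H (tgt C u)) A)))"
      using K.ps_nat[of v "ps H u A"] 7 by simp
    show ?case
      using 7 K.ps_cm'[of u v "fo (cp H (tgt C u)) A"]
       K.Cod.fib_pull[OF _ 1, of "cmp ?X (ps K v (fo (ri E' u) (fo (cp H (tgt C u)) A))) (fa (ri E'' v) (ps K u (fo (cp H (tgt C u)) A)))"]
       K.Cod.fib_pull[OF _ 2, of "fa (ri E'' v) (ps K u (fo (cp H (tgt C u)) A))"]
      by simp
  qed
qed

lemma indexed_category_bc:
  assumes "is_functor C D F" "indexed_category D E"
  shows "indexed_category C (bc F E)"
proof -
  interpret is_functor C D F by fact
  interpret E: indexed_category D E by fact
  have *: "f \<in> hom C A B \<Longrightarrow> fa F f \<in> hom D (fo F A) (fo F B)" for f A B by (rule map_hom)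
  show ?thesis
  proof (rule indexed_category.intro[OF Dom.category_axioms indexed_category_axioms.intro], goal_cases)
    case (3 \<Gamma>) then show ?case using E.un_iso[of "fo F \<Gamma>"] by simp
  next
    case (4 u \<Delta> \<Gamma> v \<Theta>) then show ?case using E.cm_iso[OF * *, of u \<Delta> \<Gamma> v \<Theta>] by auto
  next
    case (5 u \<Delta> \<Gamma> A) then show ?case using E.cm_un_left[OF *, of u \<Delta> \<Gamma> A] by auto
  next
    case (6 u \<Delta> \<Gamma> A) then show ?case using E.cm_un_right[OF *, of u \<Delta> \<Gamma> A] by auto
  next
    case (7 u \<Delta> \<Gamma> v \<Theta> w \<Xi> A) then show ?case using E.cm_assoc[OF * * *, of u \<Delta> \<Gamma> v \<Theta> w \<Xi> A] by auto
  qed (auto simp: E.fib_cat E.ri_functor')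
qed

lemma indexed_functor_bcf:
  assumes "is_functor C D F" "indexed_functor D E E' H"
  shows "indexed_functor C (bc F E) (bc F E') (bcf F H)"
proof -
  interpret is_functor C D F by fact
  interpret H: indexed_functor D E E' H by fact
  show ?thesis
  proof (rule indexed_functorI, goal_cases)
    case (5 u f) then show ?case using H.ps_nat[of "fa F u" f] by simp
  next
    case (6 \<Gamma> A) then show ?case using H.ps_un[of "fo F \<Gamma>" A] by simp
  next
    case (7 u v A) then show ?case using H.ps_cm'[of "fa F u" "fa F v" A] by simp
  qed (use H.cp_functor in \<open>auto intro!: indexed_category_bc[OF assms(1)] H.Dom.indexed_category_axioms H.Cod.indexed_category_axioms\<close>)
qed

lemma indexed_functor_of_strict_mor:
  assumes "strict_mor C D F E E' H" shows "indexed_functor C E (bc F E') H"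
proof -
  interpret strict_mor C D F E E' H by fact
  show ?thesis
    using strictly_natural_iff[OF is_functor_axioms Dom'.strict_indexed_category_axioms Cod'.strict_indexed_category_axioms]
      assms strictly_natural_functor.axioms(1) by blast
qed

section \<open>Modifications and their inverses\<close>

context indexed_nat_trans
begin

lemma mu_simps [simp]:
  assumes "\<Gamma> \<in> obs C" "A \<in> obs (fib E \<Gamma>)"
  shows "\<mu> \<Gamma> A \<in> ars (fib E' \<Gamma>)" "src (fib E' \<Gamma>) (\<mu> \<Gamma> A) = fo (cp H \<Gamma>) A" "tgt (fib E' \<Gamma>) (\<mu> \<Gamma> A) = fo (cp K \<Gamma>) A"
  using nat_trans.component_simps[OF component_nat[OF assms(1)] assms(2)] by auto

lemma mu_nat:
  "\<Gamma> \<in> obs C \<Longrightarrow> f \<in> ars (fib E \<Gamma>) \<Longrightarrow>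
    cmp (fib E' \<Gamma>) (\<mu> \<Gamma> (tgt (fib E \<Gamma>) f)) (fa (cp H \<Gamma>) f) = cmp (fib E' \<Gamma>) (fa (cp K \<Gamma>) f) (\<mu> \<Gamma> (src (fib E \<Gamma>) f))"
  using nat_trans.natural[OF component_nat] by auto

lemma mu_mod:
  "u \<in> ars C \<Longrightarrow> A \<in> obs (fib E (tgt C u)) \<Longrightarrow>
      cmp (fib E' (src C u)) (\<mu> (src C u) (fo (ri E u) A)) (ps H u A)
        = cmp (fib E' (src C u)) (ps K u A) (fa (ri E' u) (\<mu> (tgt C u) A))"
  using modification[of u "src C u" "tgt C u"] by auto

end

lemma indexed_nat_transI:
  assumes "indexed_functor C E E' H" "indexed_functor C E E' K"
    "\<And>\<Gamma> A. \<Gamma> \<in> obs C \<Longrightarrow> A \<in> obs (fib E \<Gamma>) \<Longrightarrow>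
      \<mu> \<Gamma> A \<in> ars (fib E' \<Gamma>) \<and> src (fib E' \<Gamma>) (\<mu> \<Gamma> A) = fo (cp H \<Gamma>) A \<and> tgt (fib E' \<Gamma>) (\<mu> \<Gamma> A) = fo (cp K \<Gamma>) A"
    "\<And>\<Gamma> f. \<Gamma> \<in> obs C \<Longrightarrow> f \<in> ars (fib E \<Gamma>) \<Longrightarrow>
      cmp (fib E' \<Gamma>) (\<mu> \<Gamma> (tgt (fib E \<Gamma>) f)) (fa (cp H \<Gamma>) f) = cmp (fib E' \<Gamma>) (fa (cp K \<Gamma>) f) (\<mu> \<Gamma> (src (fib E \<Gamma>) f))"
    "\<And>u A. u \<in> ars C \<Longrightarrow> A \<in> obs (fib E (tgt C u)) \<Longrightarrow>
      cmp (fib E' (src C u)) (\<mu> (src C u) (fo (ri E u) A)) (ps H u A)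
        = cmp (fib E' (src C u)) (ps K u A) (fa (ri E' u) (\<mu> (tgt C u) A))"
  shows "indexed_nat_trans C E E' H K \<mu>"
proof -
  interpret H: indexed_functor C E E' H by fact
  interpret K: indexed_functor C E E' K by fact
  show ?thesis
    by (rule indexed_nat_trans.intro[OF assms(1,2) indexed_nat_trans_axioms.intro])
      (use assms(3-5) in \<open>auto intro!: nat_transI H.cp_functor K.cp_functor\<close>)
qed

text \<open>Pointwise inverses automatically form a modification: each law for \<nu> results from
  the one for \<mu> by inserting \<nu> after \<mu> and cancelling. Invertibility of \<tau> thereby
  becomes a condition in single fibres.\<close>

lemma invertible_itransI:
  assumes "indexed_nat_trans C E E' H K \<mu>"
    "\<And>\<Gamma> A. \<Gamma> \<in> obs C \<Longrightarrow> A \<in> obs (fib E \<Gamma>) \<Longrightarrow> is_iso (fib E' \<Gamma>) (\<mu> \<Gamma> A)"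
  shows "invertible_itrans C E E' H K \<mu>"
proof -
  interpret indexed_nat_trans C E E' H K \<mu> by fact
  define \<nu> where "\<nu> \<Gamma> A = (SOME g. inverse_ars (fib E' \<Gamma>) (\<mu> \<Gamma> A) g)" for \<Gamma> A
  have inv: "inverse_ars (fib E' \<Gamma>) (\<mu> \<Gamma> A) (\<nu> \<Gamma> A)" if "\<Gamma> \<in> obs C" "A \<in> obs (fib E \<Gamma>)" for \<Gamma> A
    using assms(2)[OF that] unfolding is_iso_def \<nu>_def by (rule someI_ex)
  have nu [simp]: "\<nu> \<Gamma> A \<in> ars (fib E' \<Gamma>)" "src (fib E' \<Gamma>) (\<nu> \<Gamma> A) = fo (cp K \<Gamma>) A" "tgt (fib E' \<Gamma>) (\<nu> \<Gamma> A) = fo (cp H \<Gamma>) A"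
    "cmp (fib E' \<Gamma>) (\<nu> \<Gamma> A) (\<mu> \<Gamma> A) = idn (fib E' \<Gamma>) (fo (cp H \<Gamma>) A)"
    "cmp (fib E' \<Gamma>) (\<mu> \<Gamma> A) (\<nu> \<Gamma> A) = idn (fib E' \<Gamma>) (fo (cp K \<Gamma>) A)"
    if "\<Gamma> \<in> obs C" "A \<in> obs (fib E \<Gamma>)" for \<Gamma> A
    using inv[OF that] that by (auto simp: inverse_ars_def)
  have nat: "cmp (fib E' \<Gamma>) (\<nu> \<Gamma> (tgt (fib E \<Gamma>) f)) (fa (cp K \<Gamma>) f) = cmp (fib E' \<Gamma>) (fa (cp H \<Gamma>) f) (\<nu> \<Gamma> (src (fib E \<Gamma>) f))"
    (is "?L = ?R") if "\<Gamma> \<in> obs C" "f \<in> ars (fib E \<Gamma>)" for \<Gamma> f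
  proof -
    let ?b = "tgt (fib E \<Gamma>) f" and ?a = "src (fib E \<Gamma>) f"
    have "?R = cmp (fib E' \<Gamma>) (\<nu> \<Gamma> ?b) (cmp (fib E' \<Gamma>) (\<mu> \<Gamma> ?b) ?R)"
      using that Dom.Cod.fib_pull[OF _ nu(4), of \<Gamma> ?b ?R] by simp
    also have "cmp (fib E' \<Gamma>) (\<mu> \<Gamma> ?b) ?R = fa (cp K \<Gamma>) f"
      using that Dom.Cod.fib_pull[OF _ mu_nat, of \<Gamma> f "\<nu> \<Gamma> ?a"] by simp
    finally show ?thesis ..
  qed
  have mod: "cmp (fib E' (src C u)) (\<nu> (src C u) (fo (ri E u) A)) (ps K u A)
        = cmp (fib E' (src C u)) (ps H u A) (fa (ri E' u) (\<nu> (tgt C u) A))" (is "?L = ?R")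
    if uA: "u \<in> ars C" "A \<in> obs (fib E (tgt C u))" for u A
  proof -
    let ?X = "fib E' (src C u)"
    have 1: "cmp ?X (fa (ri E' u) (\<mu> (tgt C u) A)) (fa (ri E' u) (\<nu> (tgt C u) A)) = idn ?X (fo (ri E' u) (fo (cp K (tgt C u)) A))"
      using uA by (simp flip: Dom.Cod.ri_simps(6))
    have "?R = cmp ?X (\<nu> (src C u) (fo (ri E u) A)) (cmp ?X (\<mu> (src C u) (fo (ri E u) A)) ?R)"
      using uA Dom.Cod.fib_pull[OF _ nu(4), of "src C u" "fo (ri E u) A" ?R] by simp
    also have "cmp ?X (\<mu> (src C u) (fo (ri E u) A)) ?R = cmp ?X (ps K u A) (cmp ?X (fa (ri E' u) (\<mu> (tgt C u) A)) (fa (ri E' u) (\<nu> (tgt C u) A)))"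
      using uA Dom.Cod.fib_pull[OF _ mu_mod, of u A "fa (ri E' u) (\<nu> (tgt C u) A)"] by simp
    finally show ?thesis using uA 1 by simp
  qed
  have "indexed_nat_trans C E E' K H \<nu>"
    by (rule indexed_nat_transI) (auto simp: nat mod Dom.indexed_functor_axioms Cod.indexed_functor_axioms)
  then show ?thesis unfolding invertible_itrans_def using assms(1) by (auto intro!: exI[of _ \<nu>])
qed

lemma invertible_itrans_iso:
  assumes "invertible_itrans C E E' H K \<mu>" "\<Gamma> \<in> obs C" "A \<in> obs (fib E \<Gamma>)"
  shows "is_iso (fib E' \<Gamma>) (\<mu> \<Gamma> A)"
proof -
  obtain \<nu> where n: "indexed_nat_trans C E E' K H \<nu>" and m: "indexed_nat_trans C E E' H K \<mu>"
    and inv: "cmp (fib E' \<Gamma>) (\<nu> \<Gamma> A) (\<mu> \<Gamma> A) = idn (fib E' \<Gamma>) (fo (cp H \<Gamma>) A) \<and>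
          cmp (fib E' \<Gamma>) (\<mu> \<Gamma> A) (\<nu> \<Gamma> A) = idn (fib E' \<Gamma>) (fo (cp K \<Gamma>) A)"
    using assms unfolding invertible_itrans_def by blast
  interpret n: indexed_nat_trans C E E' K H \<nu> by fact
  interpret m: indexed_nat_trans C E E' H K \<mu> by fact
  show ?thesis unfolding is_iso_def using inv assms(2,3)
    by (intro exI[of _ "\<nu> \<Gamma> A"]) (auto simp: inverse_ars_def)
qed

section \<open>The indexed category of displays\<close>

lemma is_pullback_square:
  assumes "is_pullback C p f p' f'"
  shows "p \<in> ars C" "f \<in> ars C" "p' \<in> ars C" "f' \<in> ars C" "tgt C p = tgt C f" "tgt C p' = src C f"
    "src C f' = src C p'" "tgt C f' = src C p" "cmp C p f' = cmp C f p'"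
  using assms by (auto simp: is_pullback_def)

lemma pb_pair_simps:
  assumes P: "is_pullback C p f p' f'" and "x \<in> ars C" "y \<in> ars C" "src C y = src C x" "tgt C x = src C f" "tgt C y = src C p"
    "cmp C f x = cmp C p y"
  shows "pb_pair C p' f' x y \<in> ars C" "src C (pb_pair C p' f' x y) = src C x" "tgt C (pb_pair C p' f' x y) = src C p'"
    "cmp C p' (pb_pair C p' f' x y) = x" "cmp C f' (pb_pair C p' f' x y) = y"
proof -
  have "\<exists>!k. k \<in> hom C (src C x) (src C p') \<and> cmp C p' k = x \<and> cmp C f' k = y"
    using assms unfolding is_pullback_def by auto
  from theI'[OF this] show "pb_pair C p' f' x y \<in> ars C" "src C (pb_pair C p' f' x y) = src C x" "tgt C (pb_pair C p' f' x y) = src C p'"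
    "cmp C p' (pb_pair C p' f' x y) = x" "cmp C f' (pb_pair C p' f' x y) = y"
    unfolding pb_pair_def by auto
qed

lemma (in category) pullback_eqI:
  assumes P: "is_pullback C p f p' f'" and "k \<in> ars C" "k' \<in> ars C" "src C k = src C k'" "tgt C k = src C p'" "tgt C k' = src C p'"
    "cmp C p' k = cmp C p' k'" "cmp C f' k = cmp C f' k'"
  shows "k = k'"
proof -
  note sq = is_pullback_square[OF P]
  have "cmp C f (cmp C p' k) = cmp C p (cmp C f' k)" using assms sq cmp_pull[OF sq(9), of k] by simp
  then have x: "cmp C p' k \<in> hom C (src C k) (src C f) \<and> cmp C f' k \<in> hom C (src C k) (src C p) \<and>
      cmp C f (cmp C p' k) = cmp C p (cmp C f' k)"
    using assms sq by simp
  have "\<forall>X x y. x \<in> hom C X (src C f) \<and> y \<in> hom C X (src C p) \<and> cmp C f x = cmp C p y \<longrightarrow>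
        (\<exists>!k. k \<in> hom C X (src C p') \<and> cmp C p' k = x \<and> cmp C f' k = y)"
    using P unfolding is_pullback_def by blast
  from this[rule_format, OF x] have "\<exists>!l. l \<in> hom C (src C k) (src C p') \<and> cmp C p' l = cmp C p' k \<and> cmp C f' l = cmp C f' k" .
  then show ?thesis using assms by auto
qed

text \<open>The source of every structural isomorphism of \<open>dic\<close> and
  \<open>dfun\<close>: chosen pullbacks are compared with trivial squares, with pasted squares and
  with images under a display functor.\<close>

lemma (in category) pullback_comparison:
  assumes P: "is_pullback C p f p' f'" and Q: "is_pullback C p f q' g'"
  shows "inverse_ars C (pb_pair C p' f' q' g') (pb_pair C q' g' p' f')"
proof -
  note sq = is_pullback_square[OF P] is_pullback_square[OF Q]
  let ?k = "pb_pair C p' f' q' g'" and ?l = "pb_pair C q' g' p' f'"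
  have K: "?k \<in> ars C" "src C ?k = src C q'" "tgt C ?k = src C p'" "cmp C p' ?k = q'" "cmp C f' ?k = g'"
    by (rule pb_pair_simps[OF P]; simp add: sq)+
  have L: "?l \<in> ars C" "src C ?l = src C p'" "tgt C ?l = src C q'" "cmp C q' ?l = p'" "cmp C g' ?l = f'"
    by (rule pb_pair_simps[OF Q]; simp add: sq)+
  note pull = cmp_pull[OF K(4), of ?l] cmp_pull[OF K(5), of ?l] cmp_pull[OF L(4), of ?k] cmp_pull[OF L(5), of ?k]
  have "cmp C ?k ?l = idn C (src C p')" by (rule pullback_eqI[OF P]) (simp_all add: K L sq pull)
  moreover have "cmp C ?l ?k = idn C (src C q')" by (rule pullback_eqI[OF Q]) (simp_all add: K L sq pull)
  ultimately show ?thesis unfolding inverse_ars_def by (simp add: K L)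
qed

text \<open>Supplies the second pullback of \<open>p\<close> along \<open>cmp C u v\<close>, with
  which the compositor of the displays compares the chosen one.\<close>

lemma (in category) pullback_paste:
  assumes P: "is_pullback C p u q f" and Q: "is_pullback C q v r g"
  shows "is_pullback C p (cmp C u v) r (cmp C f g)"
proof -
  note sqP = is_pullback_square[OF P] and sqQ = is_pullback_square[OF Q]
  have uv: "src C u = tgt C v" using sqP(6) sqQ(5) by simp
  note sq [simp] = sqP(1-5,7-9) uv sqQ(2-4,6-9)
  have [simp]: "q \<in> ars C" "tgt C q = tgt C v" using sqQ by auto
  have ex: "\<exists>!k. k \<in> hom C X (src C r) \<and> cmp C r k = x \<and> cmp C (cmp C f g) k = y"
    if x: "x \<in> hom C X (src C (cmp C u v))" and y: "y \<in> hom C X (src C p)" and eq: "cmp C (cmp C u v) x = cmp C p y" for X x y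
  proof -
    have xs: "x \<in> ars C" "src C x = X" "tgt C x = src C v" using x by auto
    have ys: "y \<in> ars C" "src C y = X" "tgt C y = src C p" using y by auto
    \<comment> \<open>A cone over the outer square is factored in two stages, \<open>?l\<close>
      through the square \<open>P\<close> and then \<open>?k\<close> through the square
      \<open>Q\<close>.\<close>
    let ?l = "pb_pair C q f (cmp C v x) y"
    note L = pb_pair_simps[OF P, of "cmp C v x" y]
    let ?k = "pb_pair C r g x ?l"
    note K = pb_pair_simps[OF Q, of x ?l]
    have eq': "cmp C u (cmp C v x) = cmp C p y" using xs eq by simp
    show ?thesis
    proof (rule ex1I[of _ ?k])
      show "?k \<in> hom C X (src C r) \<and> cmp C r ?k = x \<and> cmp C (cmp C f g) ?k = y"
        using xs ys eq' by (simp add: L K)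
    next
      fix k assume k: "k \<in> hom C X (src C r) \<and> cmp C r k = x \<and> cmp C (cmp C f g) k = y"
      then have k': "k \<in> ars C" "src C k = X" "tgt C k = src C r" by auto
      have "cmp C q (cmp C g k) = cmp C v x" using cmp_pull[OF sqQ(9), of k] k k' by auto
      then have "cmp C g k = ?l"
        using k k' xs ys eq' by - (rule pullback_eqI[OF P]; simp add: L)
      then show "k = ?k"
        using k k' xs ys eq' by - (rule pullback_eqI[OF Q]; simp add: L K)
    qed
  qed
  have "cmp C p (cmp C f g) = cmp C (cmp C u v) r" using cmp_pull[OF sqP(9), of g] by simp
  then show ?thesis unfolding is_pullback_def
    by (intro conjI allI impI) ((elim conjE, rule ex; assumption) | simp)+
qed

text \<open>The trivial square that the unitor of the displays compares with the chosen pullback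
  along an identity.\<close>

lemma (in category) pullback_idn: "p \<in> ars C \<Longrightarrow> tgt C p = \<Gamma> \<Longrightarrow> is_pullback C p (idn C \<Gamma>) p (idn C (src C p))"
  unfolding is_pullback_def
proof (intro conjI allI impI, goal_cases)
  case (8 X x y)
  note h = 8(3)[THEN conjunct1] 8(3)[THEN conjunct2, THEN conjunct1] 8(3)[THEN conjunct2, THEN conjunct2]
  have y: "y \<in> ars C" "src C y = X" "tgt C y = src C p" and x: "x \<in> ars C" "tgt C x = \<Gamma>"
    using h(1,2) 8(1,2) ars_simps(2)[of p] by simp_all
  have "cmp C p y = x" using h(3) x by simp
  with y 8(1) show ?case by (intro ex1I[of _ y]; (elim conjE)?; simp)
qed (use ars_simps(2)[of p] in simp_all)

context display_category
begin

lemma dsp_ar [simp]: "p \<in> dsp C \<Longrightarrow> p \<in> ars C"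
  using dsp_ars by auto

lemma pb_simps [simp]:
  assumes "p \<in> dsp C" "u \<in> ars C" "tgt C u = tgt C p"
  shows "pb C u p \<in> dsp C" "tgt C (pb C u p) = src C u" "pt C u p \<in> ars C"
    "src C (pt C u p) = src C (pb C u p)" "tgt C (pt C u p) = src C p" "cmp C p (pt C u p) = cmp C u (pb C u p)"
  using pb_dsp[OF assms] is_pullback_square[OF pb_pullback[OF assms]] by auto

lemma pt_pull [simp]:
  assumes "p \<in> dsp C" "u \<in> ars C" "tgt C u = tgt C p" "h \<in> ars C" "tgt C h = src C (pb C u p)"
  shows "cmp C p (cmp C (pt C u p) h) = cmp C u (cmp C (pb C u p) h)"
  using assms cmp_pull[OF pb_simps(6), of p u h] by simp

lemma pair_simps [simp]:
  assumes "p \<in> dsp C" "u \<in> ars C" "tgt C u = tgt C p"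
    and "x \<in> ars C" "y \<in> ars C" "src C y = src C x" "tgt C x = src C u" "tgt C y = src C p" "cmp C u x = cmp C p y"
  shows "pb_pair C (pb C u p) (pt C u p) x y \<in> ars C" "src C (pb_pair C (pb C u p) (pt C u p) x y) = src C x"
    "tgt C (pb_pair C (pb C u p) (pt C u p) x y) = src C (pb C u p)"
    "cmp C (pb C u p) (pb_pair C (pb C u p) (pt C u p) x y) = x" "cmp C (pt C u p) (pb_pair C (pb C u p) (pt C u p) x y) = y"
  using pb_pair_simps[OF pb_pullback[OF assms(1-3)] assms(4-9)] by auto

lemma pair_pull [simp]:
  assumes "p \<in> dsp C" "u \<in> ars C" "tgt C u = tgt C p"
    and "x \<in> ars C" "y \<in> ars C" "src C y = src C x" "tgt C x = src C u" "tgt C y = src C p" "cmp C u x = cmp C p y"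
    and "h \<in> ars C" "tgt C h = src C x"
  shows "cmp C (pb C u p) (cmp C (pb_pair C (pb C u p) (pt C u p) x y) h) = cmp C x h"
    "cmp C (pt C u p) (cmp C (pb_pair C (pb C u p) (pt C u p) x y) h) = cmp C y h"
  using assms cmp_pull[OF pair_simps(4)[OF assms(1-9)], of h] cmp_pull[OF pair_simps(5)[OF assms(1-9)], of h] by auto

lemma pb_eqI:
  assumes "p \<in> dsp C" "u \<in> ars C" "tgt C u = tgt C p"
    "k \<in> ars C" "k' \<in> ars C" "src C k = src C k'" "tgt C k = src C (pb C u p)" "tgt C k' = src C (pb C u p)"
    "cmp C (pb C u p) k = cmp C (pb C u p) k'" "cmp C (pt C u p) k = cmp C (pt C u p) k'"
  shows "k = k'"
  by (rule pullback_eqI[OF pb_pullback[OF assms(1-3)] assms(4-)])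

end

section \<open>Fibres and reindexing of displays\<close>

lemma dfib_simps [simp]:
  "p \<in> obs (dfib C \<Gamma>) \<longleftrightarrow> p \<in> ars C \<and> p \<in> dsp C \<and> tgt C p = \<Gamma>"
  "(p, q, h) \<in> ars (dfib C \<Gamma>) \<longleftrightarrow> p \<in> dsp C \<and> q \<in> dsp C \<and> p \<in> ars C \<and> q \<in> ars C \<and> tgt C p = \<Gamma> \<and> tgt C q = \<Gamma> \<and> h \<in> ars C \<and>
    src C h = src C p \<and> tgt C h = src C q \<and> cmp C q h = p"
  "src (dfib C \<Gamma>) (p, q, h) = p" "tgt (dfib C \<Gamma>) (p, q, h) = q"
  "idn (dfib C \<Gamma>) p = (p, p, idn C (src C p))"
  "cmp (dfib C \<Gamma>) (q', r, k) (p, q, h) = (p, r, cmp C k h)"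
  by (auto simp: dfib_def full_sub_def slice_def)

lemma dfib_composable:
  assumes "src (dfib C \<Gamma>) g = tgt (dfib C \<Gamma>) f"
  obtains p q h r k where "f = (p, q, h)" "g = (q, r, k)"
  using assms by (cases f, cases g) simp

lemma und_simp [simp]: "und (p, q, h) = h"
  by (simp add: und_def)

lemma dic_simps [simp]:
  "fib (dic C) = dfib C"
  "fo (ri (dic C) u) p = pb C u p"
  "fa (ri (dic C) u) (p, q, h) = (pb C u p, pb C u q,
              pb_pair C (pb C u q) (pt C u q) (pb C u p) (cmp C h (pt C u p)))"
  "un (dic C) \<Gamma> p = (p, pb C (idn C \<Gamma>) p, pb_pair C (pb C (idn C \<Gamma>) p) (pt C (idn C \<Gamma>) p) p (idn C (src C p)))"
  "cm (dic C) u v p = (pb C v (pb C u p), pb C (cmp C u v) p,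
     pb_pair C (pb C (cmp C u v) p) (pt C (cmp C u v) p) (pb C v (pb C u p)) (cmp C (pt C u p) (pt C v (pb C u p))))"
  by (auto simp: dic_def Let_def)

context display_category
begin

lemma category_dfib: "category (dfib C \<Gamma>)"
proof (rule categoryI, goal_cases)
  case (4 f g)
  then obtain p q h r k where fg: "f = (p, q, h)" "g = (q, r, k)" by (elim dfib_composable)
  from 4 show ?case unfolding fg by (simp add: cmp_pull[of r k q h])
next
  case (7 f g h)
  then show ?case by (cases f; cases g; cases h) simp
qed (simp_all add: split_paired_all)

text \<open>The inverse of a map over the base lies over the base as well. Together with
  \<open>dfib_isoD\<close> this tests isomorphisms of displays on underlying maps.\<close>

lemma dfib_iso:
  assumes "(p, q, h) \<in> ars (dfib C \<Gamma>)" "is_iso C h"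
  shows "is_iso (dfib C \<Gamma>) (p, q, h)"
proof -
  from assms obtain k where k: "inverse_ars C h k" by (auto simp: is_iso_def)
  have "cmp C p k = q" using cmp_pull[of q h p k] assms(1) k by (simp add: inverse_ars_def)
  then have "inverse_ars (dfib C \<Gamma>) (p, q, h) (q, p, k)"
    using assms(1) k by (simp add: inverse_ars_def)
  then show ?thesis unfolding is_iso_def by blast
qed

lemma dfib_isoD: "is_iso (dfib C \<Gamma>) (p, q, h) \<Longrightarrow> is_iso C h"
proof -
  assume "is_iso (dfib C \<Gamma>) (p, q, h)"
  then obtain q' p' k where "inverse_ars (dfib C \<Gamma>) (p, q, h) (q', p', k)"
    unfolding is_iso_def by (metis prod_cases3)
  then have "inverse_ars C h k" by (simp add: inverse_ars_def)
  then show ?thesis unfolding is_iso_def by blast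
qed

lemma dic_ri_functor:
  assumes "u \<in> ars C"
  shows "is_functor (dfib C (tgt C u)) (dfib C (src C u)) (ri (dic C) u)"
proof (rule is_functorI[OF category_dfib category_dfib], goal_cases)
  case (2 f) then show ?case using assms by (cases f) (simp add: cmp_pull)
next
  case (3 A) then show ?case using assms by simp (rule pb_eqI[of A u]; simp)
next
  case (4 f g)
  from 4 obtain p q h r k where fg: "f = (p, q, h)" "g = (q, r, k)" by (elim dfib_composable)
  note pull = cmp_pull[of r k q] cmp_pull[of q h p]
  show ?case using 4 assms unfolding fg
    by (simp add: pull) (rule pb_eqI[of r u]; simp add: pull)
qed (use assms in auto)

lemma un_iso_aux:
  assumes "p \<in> dsp C" "tgt C p = \<Gamma>"
  shows "is_iso C (pb_pair C (pb C (idn C \<Gamma>) p) (pt C (idn C \<Gamma>) p) p (idn C (src C p)))"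
  unfolding is_iso_def
  by (rule exI, rule pullback_comparison[OF pb_pullback pullback_idn]) (use assms ars_simps(2)[of p] in simp_all)

lemma cm_iso_aux:
  assumes "p \<in> dsp C" "tgt C p = tgt C u" "u \<in> ars C" "v \<in> ars C" "src C u = tgt C v"
  shows "is_iso C (pb_pair C (pb C (cmp C u v) p) (pt C (cmp C u v) p) (pb C v (pb C u p)) (cmp C (pt C u p) (pt C v (pb C u p))))"
  unfolding is_iso_def
  by (rule exI, rule pullback_comparison[OF pb_pullback pullback_paste[OF pb_pullback pb_pullback]]) (use assms in simp_all)

text \<open>Every law equates maps into a chosen pullback. The structure maps are pairings, so their
  two legs are known, and \<open>pb_eqI\<close> reduces each law to these legs.\<close>

lemma indexed_category_dic: "indexed_category C (dic C)"
proof (rule indexed_category.intro[OF category_axioms indexed_category_axioms.intro], goal_cases)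
  case (1 \<Gamma>) show ?case by (simp add: category_dfib)
next
  case (2 u \<Delta> \<Gamma>) then show ?case using dic_ri_functor[of u] by auto
next
  case (3 \<Gamma>)
  have n: "nat_trans (fib (dic C) \<Gamma>) (fib (dic C) \<Gamma>) fid (ri (dic C) (idn C \<Gamma>)) (un (dic C) \<Gamma>)"
  proof (rule nat_transI, goal_cases)
    case 1 show ?case by (simp add: is_functor_fid category_dfib)
  next
    case 2 show ?case using dic_ri_functor[of "idn C \<Gamma>"] 3 by simp
  next
    case (3 p) then show ?case using \<open>\<Gamma> \<in> obs C\<close> by simp
  next
    case (4 f) then obtain p q h where f: "f = (p, q, h)" by (cases f)
    with 4 3 show ?case
      by (simp add: cmp_pull[of q h p]) (rule pb_eqI[of q "idn C \<Gamma>"]; simp add: cmp_pull[of q h p])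
  qed
  show ?case
    by (rule nat_isoI[OF n]) (use 3 in \<open>simp add: dfib_iso un_iso_aux\<close>)
next
  case (4 u \<Delta> \<Gamma> v \<Theta>)
  then have uv: "u \<in> ars C" "v \<in> ars C" "src C u = tgt C v" "\<Delta> = tgt C v" "\<Theta> = src C v" "\<Gamma> = tgt C u" by auto
  have n: "nat_trans (fib (dic C) \<Gamma>) (fib (dic C) \<Theta>) (fcomp (ri (dic C) v) (ri (dic C) u)) (ri (dic C) (cmp C u v)) (cm (dic C) u v)"
  proof (rule nat_transI, goal_cases)
    case 1 show ?case using dic_ri_functor[of u] dic_ri_functor[of v] uv by (auto intro: is_functor_fcomp)
  next
    case 2 show ?case using dic_ri_functor[of "cmp C u v"] uv by simp
  next
    case (3 p) then show ?case using uv by simp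
  next
    case (4 f)
    then obtain p q h where f: "f = (p, q, h)" by (cases f)
    with 4 have a: "p \<in> dsp C" "q \<in> dsp C" "h \<in> ars C" "tgt C p = tgt C u" "tgt C q = tgt C u" "src C h = src C p" "tgt C h = src C q" "cmp C q h = p"
      using uv by simp_all
    note pull = cmp_pull[OF a(8)]
    show ?case using a uv unfolding f
      by (simp add: pull) (rule pb_eqI[of q "cmp C u v"]; simp add: pull)
  qed
  show ?case
    by (rule nat_isoI[OF n]) (use uv in \<open>simp add: dfib_iso cm_iso_aux\<close>)
next
  case (5 u \<Delta> \<Gamma> p)
  then show ?case using ars_simps(1,2)[of u] by (simp, elim conjE) (rule pb_eqI[of p u]; simp)
next
  case (6 u \<Delta> \<Gamma> p)
  then show ?case using ars_simps(1,2)[of u] by (simp, elim conjE) (rule pb_eqI[of p u]; simp)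
next
  case (7 u \<Delta> \<Gamma> v \<Theta> w \<Xi> p)
  then show ?case using ars_simps(1,2)[of u] by (simp, elim conjE) (rule pb_eqI[of p "cmp C u (cmp C v w)"]; simp)
qed

end

section \<open>The indexed functor induced by a display functor\<close>

lemma dfun_simps [simp]:
  "fo (cp (dfun C D F) \<Gamma>) p = fa F p"
  "fa (cp (dfun C D F) \<Gamma>) (p, q, h) = (fa F p, fa F q, fa F h)"
  "ps (dfun C D F) u p = (pb D (fa F u) (fa F p), fa F (pb C u p),
     pb_pair D (fa F (pb C u p)) (fa F (pt C u p)) (pb D (fa F u) (fa F p)) (pt D (fa F u) (fa F p)))"
  by (auto simp: dfun_def Let_def)

context display_functor
begin

lemma dsp_simp [simp]: "p \<in> dsp C \<Longrightarrow> fa F p \<in> dsp D"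
  by (rule map_dsp)

text \<open>The image of a chosen pullback is a pullback but in general not the chosen one. The
  lemmas after it therefore repeat pairing and joint monicity for the image square.\<close>

lemma image_pullback:
  assumes "p \<in> dsp C" "u \<in> ars C" "tgt C u = tgt C p"
  shows "is_pullback D (fa F p) (fa F u) (fa F (pb C u p)) (fa F (pt C u p))"
  using map_pullback Dom.pb_pullback assms by blast

lemma image_square [simp]:
  assumes "p \<in> dsp C" "u \<in> ars C" "tgt C u = tgt C p"
  shows "cmp D (fa F p) (fa F (pt C u p)) = cmp D (fa F u) (fa F (pb C u p))"
  using is_pullback_square[OF image_pullback[OF assms]] by simp

lemma image_pull [simp]:
  assumes "p \<in> dsp C" "u \<in> ars C" "tgt C u = tgt C p" "h \<in> ars D" "tgt D h = fo F (src C (pb C u p))"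
  shows "cmp D (fa F p) (cmp D (fa F (pt C u p)) h) = cmp D (fa F u) (cmp D (fa F (pb C u p)) h)"
  using assms Cod.cmp_pull[OF image_square[OF assms(1-3)], of h] by simp

lemma image_pair [simp]:
  assumes p: "p \<in> dsp C" "u \<in> ars C" "tgt C u = tgt C p"
    and "x \<in> ars D" "y \<in> ars D" "src D y = src D x" "tgt D x = fo F (src C u)" "tgt D y = fo F (src C p)" "cmp D (fa F u) x = cmp D (fa F p) y"
  shows "pb_pair D (fa F (pb C u p)) (fa F (pt C u p)) x y \<in> ars D" "src D (pb_pair D (fa F (pb C u p)) (fa F (pt C u p)) x y) = src D x"
    "tgt D (pb_pair D (fa F (pb C u p)) (fa F (pt C u p)) x y) = fo F (src C (pb C u p))"
    "cmp D (fa F (pb C u p)) (pb_pair D (fa F (pb C u p)) (fa F (pt C u p)) x y) = x" "cmp D (fa F (pt C u p)) (pb_pair D (fa F (pb C u p)) (fa F (pt C u p)) x y) = y"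
    "h \<in> ars D \<Longrightarrow> tgt D h = src D x \<Longrightarrow> cmp D (fa F (pb C u p)) (cmp D (pb_pair D (fa F (pb C u p)) (fa F (pt C u p)) x y) h) = cmp D x h"
    "h \<in> ars D \<Longrightarrow> tgt D h = src D x \<Longrightarrow> cmp D (fa F (pt C u p)) (cmp D (pb_pair D (fa F (pb C u p)) (fa F (pt C u p)) x y) h) = cmp D y h"
proof -
  let ?k = "pb_pair D (fa F (pb C u p)) (fa F (pt C u p)) x y"
  note K = pb_pair_simps[OF image_pullback[OF p], of x y]
  show 1: "?k \<in> ars D" "src D ?k = src D x"
    "tgt D ?k = fo F (src C (pb C u p))" "cmp D (fa F (pb C u p)) ?k = x" "cmp D (fa F (pt C u p)) ?k = y"
    using K assms by auto
  show "h \<in> ars D \<Longrightarrow> tgt D h = src D x \<Longrightarrow> cmp D (fa F (pb C u p)) (cmp D ?k h) = cmp D x h"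
    "h \<in> ars D \<Longrightarrow> tgt D h = src D x \<Longrightarrow> cmp D (fa F (pt C u p)) (cmp D ?k h) = cmp D y h"
    using Cod.cmp_pull[OF 1(4), of h] Cod.cmp_pull[OF 1(5), of h] p 1 by auto
qed

lemma image_eqI:
  assumes "p \<in> dsp C" "u \<in> ars C" "tgt C u = tgt C p"
    "k \<in> ars D" "k' \<in> ars D" "src D k = src D k'" "tgt D k = fo F (src C (pb C u p))" "tgt D k' = fo F (src C (pb C u p))"
    "cmp D (fa F (pb C u p)) k = cmp D (fa F (pb C u p)) k'" "cmp D (fa F (pt C u p)) k = cmp D (fa F (pt C u p)) k'"
  shows "k = k'"
  by (rule Cod.pullback_eqI[OF image_pullback[OF assms(1-3)]]) (use assms in auto)

lemma indexed_category_bc_dic: "indexed_category C (bc F (dic D))"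
  by (rule indexed_category_bc[OF is_functor_axioms Cod.indexed_category_dic])

lemma indexed_functor_dfun: "indexed_functor C (dic C) (bc F (dic D)) (dfun C D F)"
proof (rule indexed_functorI[OF Dom.indexed_category_dic indexed_category_bc_dic], goal_cases)
  case (1 \<Gamma>)
  show ?case
  proof (rule is_functorI, goal_cases)
    case (4 f) then show ?case by (cases f) (simp flip: map_simps(6))
  next
    case (6 f g) then show ?case by (cases f; cases g) simp
  qed (auto simp: Dom.category_dfib Cod.category_dfib)
next
  case (2 u p)
  then have "is_iso D (pb_pair D (fa F (pb C u p)) (fa F (pt C u p)) (pb D (fa F u) (fa F p)) (pt D (fa F u) (fa F p)))"
    unfolding is_iso_def
    by - (rule exI, rule Cod.pullback_comparison[OF image_pullback Cod.pb_pullback]; simp)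
  with 2 show ?case by (simp add: Cod.dfib_iso)
next
  case (3 u f)
  then obtain p q h where f: "f = (p, q, h)" by (cases f)
  with 3 have a: "p \<in> dsp C" "q \<in> dsp C" "h \<in> ars C" "tgt C p = tgt C u" "tgt C q = tgt C u" "src C h = src C p" "tgt C h = src C q" "cmp C q h = p"
    by simp_all
  have 1: "cmp D (fa F q) (fa F h) = fa F p" using a by (simp flip: map_simps(6))
  note pull = Dom.cmp_pull[OF a(8)] Cod.cmp_pull[OF 1]
  \<comment> \<open>The legs of the image of a reindexed map are obtained by computing its legs in
    \<open>C\<close> and applying \<open>F\<close>.\<close>
  have 2: "cmp D (fa F (pt C u q)) (fa F (pb_pair C (pb C u q) (pt C u q) (pb C u p) (cmp C h (pt C u p)))) =
    cmp D (fa F h) (fa F (pt C u p))" 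
    "cmp D (fa F (pb C u q)) (fa F (pb_pair C (pb C u q) (pt C u q) (pb C u p) (cmp C h (pt C u p)))) = fa F (pb C u p)"
    using a 3 by (auto simp: pull simp flip: map_simps(6))
  note pull2 = Cod.cmp_pull[OF 2(1)] Cod.cmp_pull[OF 2(2)]
  show ?case using 3 a unfolding f
    by (simp add: pull pull2) (rule image_eqI[of q u]; simp add: pull pull2)
next
  case (4 \<Gamma> p)
  have a: "cmp D (fa F (pt C (idn C \<Gamma>) p)) (fa F (pb_pair C (pb C (idn C \<Gamma>) p) (pt C (idn C \<Gamma>) p) p (idn C (src C p)))) = idn D (fo F (src C p))" 
    "cmp D (fa F (pb C (idn C \<Gamma>) p)) (fa F (pb_pair C (pb C (idn C \<Gamma>) p) (pt C (idn C \<Gamma>) p) p (idn C (src C p)))) = fa F p"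
    using 4 by (auto simp flip: map_simps(6))
  note pull = a[THEN Cod.cmp_pull]
  show ?case using 4 by simp (rule image_eqI[of p "idn C \<Gamma>"]; simp add: a)
next
  case (5 u v p)
  let ?c = "pb_pair C (pb C (cmp C u v) p) (pt C (cmp C u v) p) (pb C v (pb C u p)) (cmp C (pt C u p) (pt C v (pb C u p)))"
  have a: "cmp D (fa F (pt C (cmp C u v) p)) (fa F ?c) = cmp D (fa F (pt C u p)) (fa F (pt C v (pb C u p)))"
    "cmp D (fa F (pb C (cmp C u v) p)) (fa F ?c) = fa F (pb C v (pb C u p))"
    using 5 by (auto simp flip: map_simps(6))
  note pull = a[THEN Cod.cmp_pull]
  have tv: "tgt C v = src C u" using 5 by simp
  show ?case using 5
    by (simp add: pull tv) (rule image_eqI[of p "cmp C u v"]; simp add: pull tv)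
qed

end

section \<open>Comprehension in a pre-natural model\<close>

context strict_indexed_category
begin

text \<open>A commuting triangle of the base read on types and terms; it does for strict reindexing
  what \<open>cmp_pull\<close> does for composition.\<close>

lemma ri_pull:
  assumes "cmp C u v = w" "u \<in> ars C" "v \<in> ars C" "src C u = tgt C v"
  shows "A \<in> obs (fib E (tgt C u)) \<Longrightarrow> fo (ri E v) (fo (ri E u) A) = fo (ri E w) A"
    "f \<in> ars (fib E (tgt C u)) \<Longrightarrow> fa (ri E v) (fa (ri E u) f) = fa (ri E w) f"
  using assms ri_cmp by metis+

end

context discrete_opfibration
begin

lemma dlift_simps:
  assumes "x \<in> obs C" "f \<in> ars D" "src D f = fo F x"
  shows "dlift C F f x \<in> ars C" "src C (dlift C F f x) = x" "fa F (dlift C F f x) = f"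
  using theI'[OF unique_lift[OF assms]] unfolding dlift_def by auto

lemma dlift_eqI:
  assumes "k \<in> ars C" "src C k = x" "fa F k = f"
  shows "dlift C F f x = k"
proof -
  have "\<exists>!k. k \<in> ars C \<and> src C k = x \<and> fa F k = f"
    using assms by (intro unique_lift) auto
  then show ?thesis unfolding dlift_def using assms by (intro the1_equality) auto
qed

lemma lift_unique:
  "k \<in> ars C \<Longrightarrow> l \<in> ars C \<Longrightarrow> src C k = src C l \<Longrightarrow> fa F k = fa F l \<Longrightarrow> k = l"
  using dlift_eqI[of k "src C k" "fa F k"] dlift_eqI[of l "src C k" "fa F k"] by simp

end

text \<open>The covariant action of arrows of types on terms that is equivalent to the discrete
  opfibration of terms over types.\<close>

definition push :: "'u prenm \<Rightarrow> 'u \<Rightarrow> 'u \<Rightarrow> 'u \<Rightarrow> 'u" where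
  "push N \<Gamma> f t = tgt (fib (n_tm N) \<Gamma>) (dlift (fib (n_tm N) \<Gamma>) (cp (n_proj N) \<Gamma>) f t)"

text \<open>The map \<open>\<Gamma>.f\<close> of the induced comprehension. Like
  \<open>ext_ps\<close>, its pseudonaturality map, it is detached from the triples and from the
  normalisation inside \<open>nm_comp\<close>.\<close>

definition ext_map :: "'u prenm \<Rightarrow> 'u \<Rightarrow> 'u \<Rightarrow> 'u" where
  "ext_map N \<Gamma> f = (let A = src (fib (n_tp N) \<Gamma>) f; p = n_ext N \<Gamma> A in
    ext_pair N \<Gamma> (tgt (fib (n_tp N) \<Gamma>) f) p (push N (src (n_base N) p) (fa (ri (n_tp N) p) f) (n_var N \<Gamma> A)))"

definition ext_ps :: "'u prenm \<Rightarrow> 'u \<Rightarrow> 'u \<Rightarrow> 'u" where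
  "ext_ps N u A = (let C = n_base N; p = n_ext N (tgt C u) A in
    ext_pair N (src C u) (fo (ri (n_tp N) u) A) (pb C u p) (fo (ri (n_tm N) (pt C u p)) (n_var N (tgt C u) A)))"

section \<open>Transport of terms and the universal property of extensions\<close>

context prenm
begin

abbreviation "C \<equiv> n_base N"
abbreviation "TY \<equiv> fib (n_tp N)"
abbreviation "TM \<equiv> fib (n_tm N)"
abbreviation "typ \<Gamma> t \<equiv> fo (cp (n_proj N) \<Gamma>) t"
abbreviation "ext \<Gamma> A \<equiv> n_ext N \<Gamma> A"
abbreviation "var \<Gamma> A \<equiv> n_var N \<Gamma> A"

lemma dof: "\<Gamma> \<in> obs C \<Longrightarrow> discrete_opfibration (TM \<Gamma>) (TY \<Gamma>) (cp (n_proj N) \<Gamma>)"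
  using prenm by (simp add: is_prenm_def Let_def)

lemmas dlift_simps [simp] = discrete_opfibration.dlift_simps[OF dof]
lemmas dlift_eqI = discrete_opfibration.dlift_eqI[OF dof]
lemmas lift_unique = discrete_opfibration.lift_unique[OF dof]

lemma tm_nat [simp]:
  "u \<in> ars C \<Longrightarrow> src C u = \<Delta> \<Longrightarrow> t \<in> obs (TM (tgt C u)) \<Longrightarrow> typ \<Delta> (fo (ri (n_tm N) u) t) = fo (ri (n_tp N) u) (typ (tgt C u) t)"
  "u \<in> ars C \<Longrightarrow> src C u = \<Delta> \<Longrightarrow> k \<in> ars (TM (tgt C u)) \<Longrightarrow>
    fa (cp (n_proj N) \<Delta>) (fa (ri (n_tm N) u) k) = fa (ri (n_tp N) u) (fa (cp (n_proj N) (tgt C u)) k)"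
  using pr.nat_ob[of u \<Delta> t] pr.nat_ar[of u \<Delta> k] by simp_all

lemma push_simps [simp]:
  assumes "\<Gamma> \<in> obs C" "t \<in> obs (TM \<Gamma>)" "f \<in> ars (TY \<Gamma>)" "src (TY \<Gamma>) f = typ \<Gamma> t"
  shows "push N \<Gamma> f t \<in> obs (TM \<Gamma>)" "typ \<Gamma> (push N \<Gamma> f t) = tgt (TY \<Gamma>) f"
proof -
  show "push N \<Gamma> f t \<in> obs (TM \<Gamma>)" using assms by (simp add: push_def)
  have "tgt (TY \<Gamma>) (fa (cp (n_proj N) \<Gamma>) (dlift (TM \<Gamma>) (cp (n_proj N) \<Gamma>) f t)) = typ \<Gamma> (push N \<Gamma> f t)"
    unfolding push_def using assms by (subst pr.cp_simps(4)) simp_all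
  then show "typ \<Gamma> (push N \<Gamma> f t) = tgt (TY \<Gamma>) f" using assms by simp
qed

text \<open>An arrow of terms is the unique lift of its own projection. So a law of
  \<open>push\<close> is proved by exhibiting one arrow with the right projection: an identity, a
  composite of lifts or a reindexed lift.\<close>

lemma push_ar:
  "\<Gamma> \<in> obs C \<Longrightarrow> k \<in> ars (TM \<Gamma>) \<Longrightarrow> push N \<Gamma> (fa (cp (n_proj N) \<Gamma>) k) (src (TM \<Gamma>) k) = tgt (TM \<Gamma>) k"
  unfolding push_def by (simp add: dlift_eqI[of \<Gamma> k])

lemma push_idn [simp]: "\<Gamma> \<in> obs C \<Longrightarrow> t \<in> obs (TM \<Gamma>) \<Longrightarrow> typ \<Gamma> t = A \<Longrightarrow> push N \<Gamma> (idn (TY \<Gamma>) A) t = t"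
  using push_ar[of \<Gamma> "idn (TM \<Gamma>) t"] by auto

lemma push_cmp [simp]:
  assumes "\<Gamma> \<in> obs C" "t \<in> obs (TM \<Gamma>)" "f \<in> ars (TY \<Gamma>)" "src (TY \<Gamma>) f = typ \<Gamma> t" "g \<in> ars (TY \<Gamma>)" "src (TY \<Gamma>) g = tgt (TY \<Gamma>) f"
  shows "push N \<Gamma> (cmp (TY \<Gamma>) g f) t = push N \<Gamma> g (push N \<Gamma> f t)"
proof -
  let ?k = "dlift (TM \<Gamma>) (cp (n_proj N) \<Gamma>) f t" and ?l = "dlift (TM \<Gamma>) (cp (n_proj N) \<Gamma>) g (push N \<Gamma> f t)"
  have k: "?k \<in> ars (TM \<Gamma>)" "src (TM \<Gamma>) ?k = t" "fa (cp (n_proj N) \<Gamma>) ?k = f" "tgt (TM \<Gamma>) ?k = push N \<Gamma> f t"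
    using assms by (auto simp: push_def)
  have l: "?l \<in> ars (TM \<Gamma>)" "src (TM \<Gamma>) ?l = push N \<Gamma> f t" "fa (cp (n_proj N) \<Gamma>) ?l = g" "tgt (TM \<Gamma>) ?l = push N \<Gamma> g (push N \<Gamma> f t)"
    using assms by (auto simp: push_def[of N \<Gamma> g])
  show ?thesis using push_ar[of \<Gamma> "cmp (TM \<Gamma>) ?l ?k"] k l assms by simp
qed

lemma push_ri [simp]:
  assumes "u \<in> ars C" "tgt C u = \<Gamma>" "t \<in> obs (TM \<Gamma>)" "f \<in> ars (TY \<Gamma>)" "src (TY \<Gamma>) f = typ \<Gamma> t"
  shows "fo (ri (n_tm N) u) (push N \<Gamma> f t) = push N (src C u) (fa (ri (n_tp N) u) f) (fo (ri (n_tm N) u) t)"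
proof -
  let ?k = "dlift (TM \<Gamma>) (cp (n_proj N) \<Gamma>) f t"
  have \<Gamma>: "\<Gamma> \<in> obs C" using assms by auto
  have k: "?k \<in> ars (TM \<Gamma>)" "src (TM \<Gamma>) ?k = t" "fa (cp (n_proj N) \<Gamma>) ?k = f" "tgt (TM \<Gamma>) ?k = push N \<Gamma> f t"
    using assms \<Gamma> by (auto simp: push_def)
  show ?thesis using push_ar[of "src C u" "fa (ri (n_tm N) u) ?k"] k assms by simp
qed

lemma ext_simps [simp]:
  assumes "\<Gamma> \<in> obs C" "A \<in> obs (TY \<Gamma>)"
  shows "ext \<Gamma> A \<in> dsp C" "tgt C (ext \<Gamma> A) = \<Gamma>" 
    "src C (ext \<Gamma> A) = X \<Longrightarrow> var \<Gamma> A \<in> obs (TM X)"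
    "src C (ext \<Gamma> A) = X \<Longrightarrow> typ X (var \<Gamma> A) = fo (ri (n_tp N) (ext \<Gamma> A)) A"
  using prenm assms by (auto simp: is_prenm_def Let_def represents_def)

lemma ext_universal:
  assumes "\<Gamma> \<in> obs C" "A \<in> obs (TY \<Gamma>)" "u \<in> ars C" "tgt C u = \<Gamma>" "t \<in> obs (TM (src C u))" "typ (src C u) t = fo (ri (n_tp N) u) A"
  shows "\<exists>!k. k \<in> hom C (src C u) (src C (ext \<Gamma> A)) \<and> cmp C (ext \<Gamma> A) k = u \<and> fo (ri (n_tm N) k) (var \<Gamma> A) = t"
proof -
  have "represents N \<Gamma> A (ext \<Gamma> A) (var \<Gamma> A)"
    using prenm assms unfolding is_prenm_def Let_def by blast
  then have "\<forall>\<Delta> u t. u \<in> hom C \<Delta> \<Gamma> \<and> t \<in> obs (TM \<Delta>) \<and> typ \<Delta> t = fo (ri (n_tp N) u) A \<longrightarrow>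
        (\<exists>!k. k \<in> hom C \<Delta> (src C (ext \<Gamma> A)) \<and> cmp C (ext \<Gamma> A) k = u \<and> fo (ri (n_tm N) k) (var \<Gamma> A) = t)"
    unfolding represents_def Let_def by blast
  then show ?thesis using assms(3-6) by simp
qed

lemma ext_pair_simps [simp]:
  assumes "\<Gamma> \<in> obs C" "A \<in> obs (TY \<Gamma>)" "u \<in> ars C" "tgt C u = \<Gamma>" "t \<in> obs (TM (src C u))" "typ (src C u) t = fo (ri (n_tp N) u) A"
  shows "ext_pair N \<Gamma> A u t \<in> ars C" "src C (ext_pair N \<Gamma> A u t) = src C u" "tgt C (ext_pair N \<Gamma> A u t) = src C (ext \<Gamma> A)"
    "cmp C (ext \<Gamma> A) (ext_pair N \<Gamma> A u t) = u" "fo (ri (n_tm N) (ext_pair N \<Gamma> A u t)) (var \<Gamma> A) = t"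
  using theI'[OF ext_universal[OF assms]] unfolding ext_pair_def Let_def by simp_all

text \<open>Uniqueness in the universal property. It reduces equations between maps into an
  extension to equations between terms, where reindexing is strict.\<close>

lemma ext_eqI:
  assumes "\<Gamma> \<in> obs C" "A \<in> obs (TY \<Gamma>)" "k \<in> ars C" "k' \<in> ars C" "src C k = src C k'"
    "tgt C k = src C (ext \<Gamma> A)" "tgt C k' = src C (ext \<Gamma> A)" "cmp C (ext \<Gamma> A) k = cmp C (ext \<Gamma> A) k'"
    "fo (ri (n_tm N) k) (var \<Gamma> A) = fo (ri (n_tm N) k') (var \<Gamma> A)"
  shows "k = k'"
proof -
  have "\<exists>!l. l \<in> hom C (src C (cmp C (ext \<Gamma> A) k)) (src C (ext \<Gamma> A)) \<and> cmp C (ext \<Gamma> A) l = cmp C (ext \<Gamma> A) k \<and>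
      fo (ri (n_tm N) l) (var \<Gamma> A) = fo (ri (n_tm N) k) (var \<Gamma> A)"
    using assms(1-7) by (intro ext_universal) (simp_all add: Tp.ri_cmp)
  then show ?thesis using assms by auto
qed

lemma ext_pair_pull [simp]:
  assumes "\<Gamma> \<in> obs C" "A \<in> obs (TY \<Gamma>)" "u \<in> ars C" "tgt C u = \<Gamma>" "t \<in> obs (TM (src C u))" "typ (src C u) t = fo (ri (n_tp N) u) A"
    "h \<in> ars C" "tgt C h = src C u"
  shows "cmp C (ext \<Gamma> A) (cmp C (ext_pair N \<Gamma> A u t) h) = cmp C u h"
  using B.cmp_pull[OF ext_pair_simps(4)[OF assms(1-6)], of h] assms by simp

lemma ext_map_simps [simp]:
  assumes "\<Gamma> \<in> obs C" "f \<in> ars (TY \<Gamma>)" "src (TY \<Gamma>) f = A" "tgt (TY \<Gamma>) f = B"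
  shows "ext_map N \<Gamma> f \<in> ars C" "src C (ext_map N \<Gamma> f) = src C (ext \<Gamma> A)" "tgt C (ext_map N \<Gamma> f) = src C (ext \<Gamma> B)"
    "cmp C (ext \<Gamma> B) (ext_map N \<Gamma> f) = ext \<Gamma> A"
    "fo (ri (n_tm N) (ext_map N \<Gamma> f)) (var \<Gamma> B) = push N (src C (ext \<Gamma> A)) (fa (ri (n_tp N) (ext \<Gamma> A)) f) (var \<Gamma> A)"
    "h \<in> ars C \<Longrightarrow> tgt C h = src C (ext \<Gamma> A) \<Longrightarrow> cmp C (ext \<Gamma> B) (cmp C (ext_map N \<Gamma> f) h) = cmp C (ext \<Gamma> A) h"
  using assms unfolding ext_map_def Let_def by auto

lemma ext_ps_simps [simp]:
  assumes "u \<in> ars C" "A \<in> obs (TY (tgt C u))"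
  shows "ext_ps N u A \<in> ars C" "src C (ext_ps N u A) = src C (pb C u (ext (tgt C u) A))"
    "tgt C (ext_ps N u A) = src C (ext (src C u) (fo (ri (n_tp N) u) A))"
    "cmp C (ext (src C u) (fo (ri (n_tp N) u) A)) (ext_ps N u A) = pb C u (ext (tgt C u) A)"
    "fo (ri (n_tm N) (ext_ps N u A)) (var (src C u) (fo (ri (n_tp N) u) A)) =
      fo (ri (n_tm N) (pt C u (ext (tgt C u) A))) (var (tgt C u) A)"
    "h \<in> ars C \<Longrightarrow> tgt C h = src C (pb C u (ext (tgt C u) A)) \<Longrightarrow>
      cmp C (ext (src C u) (fo (ri (n_tp N) u) A)) (cmp C (ext_ps N u A) h) = cmp C (pb C u (ext (tgt C u) A)) h"
proof -
  let ?p = "ext (tgt C u) A"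
  have "typ (src C (pb C u ?p)) (fo (ri (n_tm N) (pt C u ?p)) (var (tgt C u) A)) = fo (ri (n_tp N) (pb C u ?p)) (fo (ri (n_tp N) u) A)"
    using assms Tp.ri_pull(1)[OF B.pb_simps(6)[of ?p u], of A] by (simp add: Tp.ri_cmp)
  then show "ext_ps N u A \<in> ars C" "src C (ext_ps N u A) = src C (pb C u (ext (tgt C u) A))"
    "tgt C (ext_ps N u A) = src C (ext (src C u) (fo (ri (n_tp N) u) A))"
    "cmp C (ext (src C u) (fo (ri (n_tp N) u) A)) (ext_ps N u A) = pb C u (ext (tgt C u) A)"
    "fo (ri (n_tm N) (ext_ps N u A)) (var (src C u) (fo (ri (n_tp N) u) A)) =
      fo (ri (n_tm N) (pt C u (ext (tgt C u) A))) (var (tgt C u) A)"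
    "h \<in> ars C \<Longrightarrow> tgt C h = src C (pb C u (ext (tgt C u) A)) \<Longrightarrow>
      cmp C (ext (src C u) (fo (ri (n_tp N) u) A)) (cmp C (ext_ps N u A) h) = cmp C (pb C u (ext (tgt C u) A)) h"
    using assms unfolding ext_ps_def Let_def by simp_all
qed

text \<open>The extension by \<open>A[u]\<close> is another pullback along \<open>u\<close> of the
  extension by \<open>A\<close>. The inverse pairs its display with the canonical map
  \<open>e\<close> between the two extensions.\<close>

lemma ext_ps_iso:
  assumes "u \<in> ars C" "A \<in> obs (TY (tgt C u))"
  shows "is_iso C (ext_ps N u A)"
proof -
  let ?A = "fo (ri (n_tp N) u) A" and ?p = "ext (tgt C u) A"
  let ?q = "ext (src C u) ?A"
  \<comment> \<open>The map over \<open>u\<close> from the extension by \<open>A[u]\<close> to the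
    extension by \<open>A\<close> that pulls the universal element of \<open>A\<close> back to that
    of \<open>A[u]\<close>.\<close>
  define e where "e = ext_pair N (tgt C u) A (cmp C u ?q) (var (src C u) ?A)"
  have e: "e \<in> ars C" "src C e = src C ?q" "tgt C e = src C ?p" "cmp C ?p e = cmp C u ?q"
    "fo (ri (n_tm N) e) (var (tgt C u) A) = var (src C u) ?A"
    unfolding e_def using assms by (simp_all add: Tp.ri_cmp)
  define k where "k = pb_pair C (pb C u ?p) (pt C u ?p) ?q e"
  have k: "k \<in> ars C" "src C k = src C ?q" "tgt C k = src C (pb C u ?p)" "cmp C (pb C u ?p) k = ?q" "cmp C (pt C u ?p) k = e"
    "cmp C (pb C u ?p) (cmp C k (ext_ps N u A)) = cmp C ?q (ext_ps N u A)"
    "cmp C (pt C u ?p) (cmp C k (ext_ps N u A)) = cmp C e (ext_ps N u A)"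
    unfolding k_def using assms e by simp_all
  have "cmp C (ext_ps N u A) k = idn C (src C ?q)"
    by (rule ext_eqI[of "src C u" ?A])
      (use assms e k Tm.ri_pull(1)[OF k(5), of "var (tgt C u) A"] in \<open>simp_all add: Tm.ri_cmp\<close>)
  moreover have "cmp C e (ext_ps N u A) = pt C u ?p"
    by (rule ext_eqI[of "tgt C u" A]) (use assms e B.cmp_pull[OF e(4), of "ext_ps N u A"] in \<open>simp_all add: Tm.ri_cmp\<close>)
  then have "cmp C k (ext_ps N u A) = idn C (src C (pb C u ?p))"
    using assms k by - (rule B.pb_eqI[of ?p u]; simp)
  ultimately have "inverse_ars C (ext_ps N u A) k" unfolding inverse_ars_def using assms k by simp
  then show ?thesis unfolding is_iso_def by blast
qed

lemma nm_comp_simps [simp]: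
  "\<Gamma> \<in> obs C \<Longrightarrow> A \<in> obs (TY \<Gamma>) \<Longrightarrow> fo (cp (nm_comp N) \<Gamma>) A = ext \<Gamma> A"
  "\<Gamma> \<in> obs C \<Longrightarrow> f \<in> ars (TY \<Gamma>) \<Longrightarrow> fa (cp (nm_comp N) \<Gamma>) f = (ext \<Gamma> (src (TY \<Gamma>) f), ext \<Gamma> (tgt (TY \<Gamma>) f), ext_map N \<Gamma> f)"
  "u \<in> ars C \<Longrightarrow> A \<in> obs (TY (tgt C u)) \<Longrightarrow> ps (nm_comp N) u A =
    (pb C u (ext (tgt C u) A), ext (src C u) (fo (ri (n_tp N) u) A), ext_ps N u A)"
  by (simp_all add: nm_comp_def Let_def ext_map_def ext_ps_def push_def)

lemma nm_comp_norm [simp]: "ifun_norm C (n_tp N) (nm_comp N) = nm_comp N"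
  by (simp add: nm_comp_def Let_def)

lemma ext_map_idn [simp]: "\<Gamma> \<in> obs C \<Longrightarrow> A \<in> obs (TY \<Gamma>) \<Longrightarrow> ext_map N \<Gamma> (idn (TY \<Gamma>) A) = idn C (src C (ext \<Gamma> A))"
  by (rule ext_eqI[of \<Gamma> A]) simp_all

lemma ext_map_cmp:
  assumes "\<Gamma> \<in> obs C" "g \<in> ars (TY \<Gamma>)" "f \<in> ars (TY \<Gamma>)" "src (TY \<Gamma>) g = tgt (TY \<Gamma>) f"
  shows "ext_map N \<Gamma> (cmp (TY \<Gamma>) g f) = cmp C (ext_map N \<Gamma> g) (ext_map N \<Gamma> f)"
proof -
  have "fa (ri (n_tp N) (ext_map N \<Gamma> f)) (fa (ri (n_tp N) (ext \<Gamma> (tgt (TY \<Gamma>) f))) g) = fa (ri (n_tp N) (ext \<Gamma> (src (TY \<Gamma>) f))) g"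
    using assms by (intro Tp.ri_pull) simp_all
  then show ?thesis
    using assms by - (rule ext_eqI[of \<Gamma> "tgt (TY \<Gamma>) g"]; simp add: Tm.ri_cmp)
qed

text \<open>The coherence laws compare maps into extensions. After \<open>ext_eqI\<close> they
  concern terms, which are evaluated along the legs of the pairings by
  \<open>Tm.ri_pull\<close>.\<close>

lemma indexed_functor_nm_comp: "indexed_functor C (n_tp N) (dic C) (nm_comp N)"
proof (rule indexed_functorI[OF Tp.indexed_category_axioms B.indexed_category_dic], goal_cases)
  case (1 \<Gamma>)
  then show ?case
  proof (intro is_functorI, goal_cases)
    case 1 then show ?case by (rule Tp.fib_cat)
  next
    case 2 then show ?case by (simp add: B.category_dfib)
  next
    case (3 A) then show ?case by simp
  next
    case (4 f) then show ?case by simp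
  next
    case (5 A) then show ?case by simp
  next
    case (6 f g) then show ?case by (simp add: ext_map_cmp)
  qed
next
  case (2 u A)
  then show ?case by (simp add: B.dfib_iso ext_ps_iso)
next
  case (3 u f)
  let ?A = "src (TY (tgt C u)) f" and ?B = "tgt (TY (tgt C u)) f"
  let ?p = "ext (tgt C u) ?A" and ?q = "ext (tgt C u) ?B"
  \<comment> \<open>The reindexing of \<open>ext_map N (tgt C u) f\<close> along \<open>u\<close> in
    the displays.\<close>
  define k where "k = pb_pair C (pb C u ?q) (pt C u ?q) (pb C u ?p) (cmp C (ext_map N (tgt C u) f) (pt C u ?p))"
  have k: "k \<in> ars C" "src C k = src C (pb C u ?p)" "tgt C k = src C (pb C u ?q)" "cmp C (pb C u ?q) k = pb C u ?p"
    "cmp C (pt C u ?q) k = cmp C (ext_map N (tgt C u) f) (pt C u ?p)"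
    unfolding k_def using 3 by simp_all
  have 1: "fo (ri (n_tm N) k) (fo (ri (n_tm N) (pt C u ?q)) (var (tgt C u) ?B)) =
    push N (src C (pb C u ?p)) (fa (ri (n_tp N) (pb C u ?p)) (fa (ri (n_tp N) u) f)) (fo (ri (n_tm N) (pt C u ?p)) (var (tgt C u) ?A))"
    using 3 k Tm.ri_pull(1)[OF k(5), of "var (tgt C u) ?B"] Tp.ri_pull(2)[OF B.pb_simps(6)[of ?p u], of f]
    by (simp add: Tm.ri_cmp Tp.ri_cmp)
  have 2: "fa (ri (n_tp N) (ext_ps N u ?A)) (fa (ri (n_tp N) (ext (src C u) (fo (ri (n_tp N) u) ?A))) (fa (ri (n_tp N) u) f)) =
      fa (ri (n_tp N) (pb C u ?p)) (fa (ri (n_tp N) u) f)"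
    using 3 by (intro Tp.ri_pull) simp_all
  have "cmp C (ext_ps N u ?B) k = cmp C (ext_map N (src C u) (fa (ri (n_tp N) u) f)) (ext_ps N u ?A)"
    by (rule ext_eqI[of "src C u" "fo (ri (n_tp N) u) ?B"]) (use 3 k 1 2 in \<open>simp_all add: Tm.ri_cmp\<close>)
  then show ?case using 3 by (simp add: k_def)
next
  case (4 \<Gamma> A)
  \<comment> \<open>The rules for \<open>ext_ps\<close> at an identity, with
    \<open>tgt C (idn C \<Gamma>)\<close> and \<open>A[id]\<close> already simplified; in their
    general form they no longer match.\<close>
  have ps: "ext_ps N (idn C \<Gamma>) A \<in> ars C" "src C (ext_ps N (idn C \<Gamma>) A) = src C (pb C (idn C \<Gamma>) (ext \<Gamma> A))" 
    "tgt C (ext_ps N (idn C \<Gamma>) A) = src C (ext \<Gamma> A)"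
    "cmp C (ext \<Gamma> A) (ext_ps N (idn C \<Gamma>) A) = pb C (idn C \<Gamma>) (ext \<Gamma> A)"
    "fo (ri (n_tm N) (ext_ps N (idn C \<Gamma>) A)) (var \<Gamma> A) = fo (ri (n_tm N) (pt C (idn C \<Gamma>) (ext \<Gamma> A))) (var \<Gamma> A)"
    "h \<in> ars C \<Longrightarrow> tgt C h = src C (pb C (idn C \<Gamma>) (ext \<Gamma> A)) \<Longrightarrow>
      cmp C (ext \<Gamma> A) (cmp C (ext_ps N (idn C \<Gamma>) A) h) = cmp C (pb C (idn C \<Gamma>) (ext \<Gamma> A)) h" for h
    using ext_ps_simps[of "idn C \<Gamma>" A] 4 by simp_all
  \<comment> \<open>The underlying map of the unitor of the displays.\<close>
  define c where "c = pb_pair C (pb C (idn C \<Gamma>) (ext \<Gamma> A)) (pt C (idn C \<Gamma>) (ext \<Gamma> A)) (ext \<Gamma> A) (idn C (src C (ext \<Gamma> A)))"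
  have c: "c \<in> ars C" "src C c = src C (ext \<Gamma> A)" "tgt C c = src C (pb C (idn C \<Gamma>) (ext \<Gamma> A))" 
    "cmp C (pb C (idn C \<Gamma>) (ext \<Gamma> A)) c = ext \<Gamma> A"
    "cmp C (pt C (idn C \<Gamma>) (ext \<Gamma> A)) c = idn C (src C (ext \<Gamma> A))"
    unfolding c_def using 4 by simp_all
  have "cmp C (ext_ps N (idn C \<Gamma>) A) c = idn C (src C (ext \<Gamma> A))"
    by (rule ext_eqI[of \<Gamma> A]) (use 4 ps c Tm.ri_pull(1)[OF c(5), of "var \<Gamma> A"] in \<open>simp_all add: Tm.ri_cmp\<close>)
  then show ?case using 4 by (simp add: Tp.un_strict c_def)
next
  case (5 u v A)
  let ?p = "ext (tgt C u) A" and ?w = "cmp C u v" and ?A = "fo (ri (n_tp N) u) A"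
  let ?B = "fo (ri (n_tp N) v) ?A" and ?q = "ext (tgt C v) (fo (ri (n_tp N) u) A)"
  have w: "ext_ps N ?w A \<in> ars C" "src C (ext_ps N ?w A) = src C (pb C ?w ?p)" 
    "tgt C (ext_ps N ?w A) = src C (ext (src C v) ?B)"
    "cmp C (ext (src C v) ?B) (ext_ps N ?w A) = pb C ?w ?p"
    "fo (ri (n_tm N) (ext_ps N ?w A)) (var (src C v) ?B) = fo (ri (n_tm N) (pt C ?w ?p)) (var (tgt C u) A)"
    "h \<in> ars C \<Longrightarrow> tgt C h = src C (pb C ?w ?p) \<Longrightarrow>
      cmp C (ext (src C v) ?B) (cmp C (ext_ps N ?w A) h) = cmp C (pb C ?w ?p) h" for h
    using ext_ps_simps[of ?w A] 5 by (simp_all add: Tp.ri_cmp)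
  have u: "ext_ps N u A \<in> ars C" "src C (ext_ps N u A) = src C (pb C u ?p)" 
    "tgt C (ext_ps N u A) = src C ?q"
    "cmp C ?q (ext_ps N u A) = pb C u ?p"
    "fo (ri (n_tm N) (ext_ps N u A)) (var (tgt C v) ?A) = fo (ri (n_tm N) (pt C u ?p)) (var (tgt C u) A)"
    "h \<in> ars C \<Longrightarrow> tgt C h = src C (pb C u ?p) \<Longrightarrow> cmp C ?q (cmp C (ext_ps N u A) h) = cmp C (pb C u ?p) h" for h
    using ext_ps_simps[of u A] 5 by simp_all
  \<comment> \<open>\<open>c\<close> is the compositor of the displays and \<open>d\<close> the
    reindexing of \<open>ext_ps N u A\<close> along \<open>v\<close>; they enter the two sides of
    the coherence law.\<close>
  define c where "c = pb_pair C (pb C ?w ?p) (pt C ?w ?p) (pb C v (pb C u ?p)) (cmp C (pt C u ?p) (pt C v (pb C u ?p)))"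
  have c: "c \<in> ars C" "src C c = src C (pb C v (pb C u ?p))" "tgt C c = src C (pb C ?w ?p)" 
    "cmp C (pb C ?w ?p) c = pb C v (pb C u ?p)"
    "cmp C (pt C ?w ?p) c = cmp C (pt C u ?p) (pt C v (pb C u ?p))"
    unfolding c_def using 5 by simp_all
  define d where "d = pb_pair C (pb C v ?q) (pt C v ?q) (pb C v (pb C u ?p)) (cmp C (ext_ps N u A) (pt C v (pb C u ?p)))"
  have d: "d \<in> ars C" "src C d = src C (pb C v (pb C u ?p))" "tgt C d = src C (pb C v ?q)" 
    "cmp C (pb C v ?q) d = pb C v (pb C u ?p)"
    "cmp C (pt C v ?q) d = cmp C (ext_ps N u A) (pt C v (pb C u ?p))"
    unfolding d_def using 5 u by simp_all
  have "cmp C (ext_ps N ?w A) c = cmp C (ext_ps N v ?A) d"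
    by (rule ext_eqI[of "src C v" ?B])
      (use 5 w u c d Tm.ri_pull(1)[OF c(5), of "var (tgt C u) A"] Tm.ri_pull(1)[OF d(5), of "var (tgt C v) ?A"]
       in \<open>simp_all add: Tm.ri_cmp\<close>)
  then show ?case using 5 by (simp add: Tp.cm_eq Tp.ri_cmp d c flip: c_def d_def)
qed

end

section \<open>Morphisms of pre-natural models and comprehension\<close>

lemma C_ob_simps [simp]: "c_base (C_ob N) = n_base N" "c_tp (C_ob N) = n_tp N" "c_comp (C_ob N) = nm_comp N"
  by (simp_all add: C_ob_def)

text \<open>The data common to morphisms of both kinds: the base functor and the action on types.
  From a term of type \<open>(K A)[F p]\<close> over the image of each extension,
  \<open>w_tau\<close> makes a candidate for \<tau>.\<close>

locale tp_mor = N: prenm U N + M: prenm U M +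
  D: display_functor "n_base N" "n_base M" F + K: strict_mor "n_base N" "n_base M" F "n_tp N" "n_tp M" K
  for U :: "'u universe" and N M F K
begin

abbreviation "w_tau w \<Gamma> A \<equiv> (fa F (N.ext \<Gamma> A), M.ext (fo F \<Gamma>) (fo (cp K \<Gamma>) A),
  ext_pair M (fo F \<Gamma>) (fo (cp K \<Gamma>) A) (fa F (N.ext \<Gamma> A)) (w \<Gamma> A))"

lemma indexed_functor_tau_src: "indexed_functor N.C (n_tp N) (bc F (dic M.C)) (tau_src (C_ob N) (C_ob M) F)"
  unfolding tau_src_def C_ob_simps by (rule indexed_functor_icomp[OF N.indexed_functor_nm_comp D.indexed_functor_dfun])

lemma indexed_functor_tau_tgt: "indexed_functor N.C (n_tp N) (bc F (dic M.C)) (tau_tgt (C_ob N) (C_ob M) F K)"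
  unfolding tau_tgt_def C_ob_simps
  by (rule indexed_functor_icomp[OF indexed_functor_of_strict_mor[OF K.strict_mor_axioms]
        indexed_functor_bcf[OF D.is_functor_axioms M.indexed_functor_nm_comp]])

text \<open>Both axioms of \<tau> equate maps into extensions of \<open>M\<close>, so each is
  equivalent to its value at the universal element. Naturality in \<open>f\<close> becomes
  compatibility of \<open>w\<close> with \<open>push\<close>, and the modification law becomes
  compatibility with \<open>ext_ps\<close>.\<close>

lemma tau_iff:
  assumes w [simp]: "\<And>\<Gamma> A X. \<Gamma> \<in> obs N.C \<Longrightarrow> A \<in> obs (N.TY \<Gamma>) \<Longrightarrow> fo F (src N.C (N.ext \<Gamma> A)) = X \<Longrightarrow>
      w \<Gamma> A \<in> obs (M.TM X) \<and> M.typ X (w \<Gamma> A) = fo (ri (n_tp M) (fa F (N.ext \<Gamma> A))) (fo (cp K \<Gamma>) A)"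
    and \<tau> [simp]: "\<And>\<Gamma> A. \<Gamma> \<in> obs N.C \<Longrightarrow> A \<in> obs (N.TY \<Gamma>) \<Longrightarrow> \<tau> \<Gamma> A = w_tau w \<Gamma> A"
  shows "indexed_nat_trans N.C (n_tp N) (bc F (dic M.C)) (tau_src (C_ob N) (C_ob M) F) (tau_tgt (C_ob N) (C_ob M) F K) \<tau> \<longleftrightarrow>
    (\<forall>\<Gamma>\<in>obs N.C. \<forall>f\<in>ars (N.TY \<Gamma>).
      push M (fo F (src N.C (N.ext \<Gamma> (src (N.TY \<Gamma>) f)))) (fa (ri (n_tp M) (fa F (N.ext \<Gamma> (src (N.TY \<Gamma>) f)))) (fa (cp K \<Gamma>) f))
        (w \<Gamma> (src (N.TY \<Gamma>) f)) = fo (ri (n_tm M) (fa F (ext_map N \<Gamma> f))) (w \<Gamma> (tgt (N.TY \<Gamma>) f))) \<and>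
    (\<forall>u\<in>ars N.C. \<forall>A\<in>obs (N.TY (tgt N.C u)).
      fo (ri (n_tm M) (fa F (ext_ps N u A))) (w (src N.C u) (fo (ri (n_tp N) u) A)) =
      fo (ri (n_tm M) (fa F (pt N.C u (N.ext (tgt N.C u) A)))) (w (tgt N.C u) A))" (is "?L \<longleftrightarrow> ?R1 \<and> ?R2")
proof -
  let ?h = "\<lambda>\<Gamma> A. ext_pair M (fo F \<Gamma>) (fo (cp K \<Gamma>) A) (fa F (N.ext \<Gamma> A)) (w \<Gamma> A)"
  \<comment> \<open>The underlying map of \<tau> is hidden behind \<open>h\<close>, so that
    rewriting uses only its universal property.\<close>
  define h where "h \<Gamma> A = ?h \<Gamma> A" for \<Gamma> A
  have h [simp]: "h \<Gamma> A \<in> ars M.C" "src M.C (h \<Gamma> A) = fo F (src N.C (N.ext \<Gamma> A))"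
    "tgt M.C (h \<Gamma> A) = src M.C (M.ext (fo F \<Gamma>) (fo (cp K \<Gamma>) A))"
    "cmp M.C (M.ext (fo F \<Gamma>) (fo (cp K \<Gamma>) A)) (h \<Gamma> A) = fa F (N.ext \<Gamma> A)"
    "fo (ri (n_tm M) (h \<Gamma> A)) (M.var (fo F \<Gamma>) (fo (cp K \<Gamma>) A)) = w \<Gamma> A"
    "x \<in> ars M.C \<Longrightarrow> tgt M.C x = fo F (src N.C (N.ext \<Gamma> A)) \<Longrightarrow>
      cmp M.C (M.ext (fo F \<Gamma>) (fo (cp K \<Gamma>) A)) (cmp M.C (h \<Gamma> A) x) = cmp M.C (fa F (N.ext \<Gamma> A)) x"
    if "\<Gamma> \<in> obs N.C" "A \<in> obs (N.TY \<Gamma>)" for \<Gamma> A x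
    unfolding h_def using that by simp_all
  have \<tau>h: "\<tau> \<Gamma> A = (fa F (N.ext \<Gamma> A), M.ext (fo F \<Gamma>) (fo (cp K \<Gamma>) A), h \<Gamma> A)"
    if "\<Gamma> \<in> obs N.C" "A \<in> obs (N.TY \<Gamma>)" for \<Gamma> A
    using \<tau> that by (simp add: h_def)
  note \<tau> [simp del]
  note \<tau>h [simp]
  have Fext: "cmp M.C (fa F (N.ext \<Gamma> B)) (fa F (ext_map N \<Gamma> f)) = fa F (N.ext \<Gamma> A)"
    if "\<Gamma> \<in> obs N.C" "f \<in> ars (N.TY \<Gamma>)" "src (N.TY \<Gamma>) f = A" "tgt (N.TY \<Gamma>) f = B" for \<Gamma> f A B
    using that by (auto simp flip: D.map_simps(6))
  have ty: "\<tau> \<Gamma> A \<in> ars (dfib M.C (fo F \<Gamma>)) \<and> src (dfib M.C (fo F \<Gamma>)) (\<tau> \<Gamma> A) = fo (cp (tau_src (C_ob N) (C_ob M) F) \<Gamma>) A \<and>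
      tgt (dfib M.C (fo F \<Gamma>)) (\<tau> \<Gamma> A) = fo (cp (tau_tgt (C_ob N) (C_ob M) F K) \<Gamma>) A"
    if "\<Gamma> \<in> obs N.C" "A \<in> obs (N.TY \<Gamma>)" for \<Gamma> A
    using that by (simp add: tau_src_def tau_tgt_def)
  have nat: "cmp (dfib M.C (fo F \<Gamma>)) (\<tau> \<Gamma> (tgt (N.TY \<Gamma>) f)) (fa (cp (tau_src (C_ob N) (C_ob M) F) \<Gamma>) f) =
      cmp (dfib M.C (fo F \<Gamma>)) (fa (cp (tau_tgt (C_ob N) (C_ob M) F K) \<Gamma>) f) (\<tau> \<Gamma> (src (N.TY \<Gamma>) f)) \<longleftrightarrow>
    push M (fo F (src N.C (N.ext \<Gamma> (src (N.TY \<Gamma>) f)))) (fa (ri (n_tp M) (fa F (N.ext \<Gamma> (src (N.TY \<Gamma>) f)))) (fa (cp K \<Gamma>) f))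
        (w \<Gamma> (src (N.TY \<Gamma>) f)) = fo (ri (n_tm M) (fa F (ext_map N \<Gamma> f))) (w \<Gamma> (tgt (N.TY \<Gamma>) f))"
    (is "?l = ?r \<longleftrightarrow> ?x = ?y")
    if "\<Gamma> \<in> obs N.C" "f \<in> ars (N.TY \<Gamma>)" for \<Gamma> f
  proof -
    let ?A = "src (N.TY \<Gamma>) f" and ?B = "tgt (N.TY \<Gamma>) f"
    let ?KB = "fo (cp K \<Gamma>) ?B"
    let ?l' = "cmp M.C (h \<Gamma> ?B) (fa F (ext_map N \<Gamma> f))" and ?r' = "cmp M.C (ext_map M (fo F \<Gamma>) (fa (cp K \<Gamma>) f)) (h \<Gamma> ?A)"
    have "?l = ?r \<longleftrightarrow> ?l' = ?r'"
      using that by (simp add: tau_src_def tau_tgt_def)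
    moreover have y: "fo (ri (n_tm M) ?l') (M.var (fo F \<Gamma>) ?KB) = ?y"
      using that by (simp add: M.Tm.ri_cmp)
    have "fa (ri (n_tp M) (h \<Gamma> ?A)) (fa (ri (n_tp M) (M.ext (fo F \<Gamma>) (fo (cp K \<Gamma>) ?A))) (fa (cp K \<Gamma>) f)) =
      fa (ri (n_tp M) (fa F (N.ext \<Gamma> ?A))) (fa (cp K \<Gamma>) f)"
      using that by (intro M.Tp.ri_pull) simp_all
    then have x: "fo (ri (n_tm M) ?r') (M.var (fo F \<Gamma>) ?KB) = ?x"
      using that by (simp add: M.Tm.ri_cmp)
    have "?l' = ?r'" if "?x = ?y"
      by (rule M.ext_eqI[of "fo F \<Gamma>" ?KB]) (use that \<open>\<Gamma> \<in> obs N.C\<close> \<open>f \<in> ars (N.TY \<Gamma>)\<close> x y in \<open>simp_all add: Fext\<close>)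
    ultimately show ?thesis using x y by metis
  qed
  have mod: "cmp (dfib M.C (fo F (src N.C u))) (\<tau> (src N.C u) (fo (ri (n_tp N) u) A)) (ps (tau_src (C_ob N) (C_ob M) F) u A)
        = cmp (dfib M.C (fo F (src N.C u))) (ps (tau_tgt (C_ob N) (C_ob M) F K) u A) (fa (ri (bc F (dic M.C)) u) (\<tau> (tgt N.C u) A)) \<longleftrightarrow>
      fo (ri (n_tm M) (fa F (ext_ps N u A))) (w (src N.C u) (fo (ri (n_tp N) u) A)) =
      fo (ri (n_tm M) (fa F (pt N.C u (N.ext (tgt N.C u) A)))) (w (tgt N.C u) A)" (is "?l = ?r \<longleftrightarrow> ?x = ?y")
    if "u \<in> ars N.C" "A \<in> obs (N.TY (tgt N.C u))" for u A
  proof -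
    let ?\<Delta> = "src N.C u" and ?\<Gamma> = "tgt N.C u" and ?B = "fo (ri (n_tp N) u) A"
    let ?p = "N.ext ?\<Gamma> A" and ?q = "M.ext (fo F ?\<Gamma>) (fo (cp K ?\<Gamma>) A)"
    let ?KB = "fo (ri (n_tp M) (fa F u)) (fo (cp K ?\<Gamma>) A)"
    \<comment> \<open>\<open>j\<close> is the structure map of \<open>dfun\<close>, from the chosen
      pullback of the image display to the image of the chosen pullback; \<open>j'\<close> is its
      inverse.\<close>
    define j where "j = pb_pair M.C (fa F (pb N.C u ?p)) (fa F (pt N.C u ?p)) (pb M.C (fa F u) (fa F ?p)) (pt M.C (fa F u) (fa F ?p))"
    define j' where "j' = pb_pair M.C (pb M.C (fa F u) (fa F ?p)) (pt M.C (fa F u) (fa F ?p)) (fa F (pb N.C u ?p)) (fa F (pt N.C u ?p))"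
    have j: "j \<in> ars M.C" "src M.C j = src M.C (pb M.C (fa F u) (fa F ?p))" "tgt M.C j = fo F (src N.C (pb N.C u ?p))"
      "cmp M.C (fa F (pb N.C u ?p)) j = pb M.C (fa F u) (fa F ?p)" "cmp M.C (fa F (pt N.C u ?p)) j = pt M.C (fa F u) (fa F ?p)"
      unfolding j_def using that by simp_all
    have "inverse_ars M.C j j'"
      unfolding j_def j'_def using that by (intro M.B.pullback_comparison[OF D.image_pullback M.B.pb_pullback]) simp_all
    then have j': "j' \<in> ars M.C" "src M.C j' = fo F (src N.C (pb N.C u ?p))" "tgt M.C j' = src M.C (pb M.C (fa F u) (fa F ?p))"
      "cmp M.C j j' = idn M.C (fo F (src N.C (pb N.C u ?p)))"
      using j by (simp_all add: inverse_ars_def)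
    \<comment> \<open>The underlying map of \<open>\<tau> A\<close> reindexed along
      \<open>F u\<close>.\<close>
    define k where "k = pb_pair M.C (pb M.C (fa F u) ?q) (pt M.C (fa F u) ?q) (pb M.C (fa F u) (fa F ?p)) (cmp M.C (h ?\<Gamma> A) (pt M.C (fa F u) (fa F ?p)))"
    have k: "k \<in> ars M.C" "src M.C k = src M.C (pb M.C (fa F u) (fa F ?p))" "tgt M.C k = src M.C (pb M.C (fa F u) ?q)"
       "cmp M.C (pb M.C (fa F u) ?q) k = pb M.C (fa F u) (fa F ?p)"
       "cmp M.C (pt M.C (fa F u) ?q) k = cmp M.C (h ?\<Gamma> A) (pt M.C (fa F u) (fa F ?p))"
      unfolding k_def using that by simp_all
    have Fps: "cmp M.C (fa F (N.ext ?\<Delta> ?B)) (fa F (ext_ps N u A)) = fa F (pb N.C u ?p)"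
      using that by (simp flip: D.map_simps(6))
    have Fps': "cmp M.C (fa F (N.ext ?\<Delta> ?B)) (cmp M.C (fa F (ext_ps N u A)) j) = pb M.C (fa F u) (fa F ?p)"
      using M.B.cmp_pull[OF Fps, of j] that j by simp
    have ps: "ext_ps M (fa F u) (fo (cp K ?\<Gamma>) A) \<in> ars M.C"
       "src M.C (ext_ps M (fa F u) (fo (cp K ?\<Gamma>) A)) = src M.C (pb M.C (fa F u) ?q)"
       "tgt M.C (ext_ps M (fa F u) (fo (cp K ?\<Gamma>) A)) = src M.C (M.ext (fo F ?\<Delta>) ?KB)"
      "cmp M.C (M.ext (fo F ?\<Delta>) ?KB) (ext_ps M (fa F u) (fo (cp K ?\<Gamma>) A)) = pb M.C (fa F u) ?q"
      "fo (ri (n_tm M) (ext_ps M (fa F u) (fo (cp K ?\<Gamma>) A))) (M.var (fo F ?\<Delta>) ?KB) = fo (ri (n_tm M) (pt M.C (fa F u) ?q)) (M.var (fo F ?\<Gamma>) (fo (cp K ?\<Gamma>) A))"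
      "x \<in> ars M.C \<Longrightarrow> tgt M.C x = src M.C (pb M.C (fa F u) ?q) \<Longrightarrow>
       cmp M.C (M.ext (fo F ?\<Delta>) ?KB) (cmp M.C (ext_ps M (fa F u) (fo (cp K ?\<Gamma>) A)) x) = cmp M.C (pb M.C (fa F u) ?q) x" for x
      using M.ext_ps_simps[of "fa F u" "fo (cp K ?\<Gamma>) A"] that by simp_all
    have h': "tgt M.C (h ?\<Delta> ?B) = src M.C (M.ext (fo F ?\<Delta>) ?KB)" "cmp M.C (M.ext (fo F ?\<Delta>) ?KB) (h ?\<Delta> ?B) = fa F (N.ext ?\<Delta> ?B)"
      "fo (ri (n_tm M) (h ?\<Delta> ?B)) (M.var (fo F ?\<Delta>) ?KB) = w ?\<Delta> ?B"
      "x \<in> ars M.C \<Longrightarrow> tgt M.C x = fo F (src N.C (N.ext ?\<Delta> ?B)) \<Longrightarrow>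
      cmp M.C (M.ext (fo F ?\<Delta>) ?KB) (cmp M.C (h ?\<Delta> ?B) x) = cmp M.C (fa F (N.ext ?\<Delta> ?B)) x" for x
      using h(3-6)[of ?\<Delta> ?B] that by (simp_all add: K.nat_ob)
    let ?l' = "cmp M.C (h ?\<Delta> ?B) (cmp M.C (fa F (ext_ps N u A)) j)" and ?r' = "cmp M.C (ext_ps M (fa F u) (fo (cp K ?\<Gamma>) A)) k"
    have lr: "?l = ?r \<longleftrightarrow> ?l' = ?r'"
      using that ps k j by (simp add: tau_src_def tau_tgt_def K.ps_eq K.nat_ob flip: j_def k_def)
    have l: "fo (ri (n_tm M) ?l') (M.var (fo F ?\<Delta>) ?KB) = fo (ri (n_tm M) j) ?x"
      using that j h' by (simp add: M.Tm.ri_cmp)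
    have r: "fo (ri (n_tm M) ?r') (M.var (fo F ?\<Delta>) ?KB) = fo (ri (n_tm M) j) ?y"
    proof -
      have "fo (ri (n_tm M) ?r') (M.var (fo F ?\<Delta>) ?KB) = fo (ri (n_tm M) k) (fo (ri (n_tm M) (pt M.C (fa F u) ?q)) (M.var (fo F ?\<Gamma>) (fo (cp K ?\<Gamma>) A)))"
        using that ps k by (simp add: M.Tm.ri_cmp)
      also have "\<dots> = fo (ri (n_tm M) (cmp M.C (h ?\<Gamma> A) (pt M.C (fa F u) (fa F ?p)))) (M.var (fo F ?\<Gamma>) (fo (cp K ?\<Gamma>) A))"
        by (rule M.Tm.ri_pull[OF k(5)]) (use that k in simp_all)
      also have "\<dots> = fo (ri (n_tm M) (pt M.C (fa F u) (fa F ?p))) (w ?\<Gamma> A)"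
        using that by (simp add: M.Tm.ri_cmp)
      also have "\<dots> = fo (ri (n_tm M) j) ?y"
        by (rule M.Tm.ri_pull[OF j(5), symmetric]) (use that j in simp_all)
      finally show ?thesis .
    qed
    \<comment> \<open>Both sides were evaluated after reindexing along \<open>j\<close>. Since
      \<open>j\<close> is invertible and reindexing is strict, this reindexing is injective.\<close>
    have xy: "?x = ?y" if "fo (ri (n_tm M) j) ?x = fo (ri (n_tm M) j) ?y"
    proof -
      have "fo (ri (n_tm M) j') (fo (ri (n_tm M) j) z) = z" if "z \<in> obs (M.TM (fo F (src N.C (pb N.C u ?p))))" for z
        using M.Tm.ri_pull(1)[OF j'(4), of z] j j' that \<open>u \<in> ars N.C\<close> \<open>A \<in> obs (N.TY (tgt N.C u))\<close> by simp
      then show ?thesis using arg_cong[OF that, of "fo (ri (n_tm M) j')"] \<open>u \<in> ars N.C\<close> \<open>A \<in> obs (N.TY (tgt N.C u))\<close> by simp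
    qed
    have "?l' = ?r'" if "?x = ?y"
      by (rule M.ext_eqI[of "fo F ?\<Delta>" ?KB])
        (use l r that \<open>u \<in> ars N.C\<close> \<open>A \<in> obs (N.TY (tgt N.C u))\<close> j k ps h' Fps' in simp_all)
    with lr l r xy show ?thesis by metis
  qed
  show ?thesis
  proof
    assume ?L
    then interpret indexed_nat_trans N.C "n_tp N" "bc F (dic M.C)" "tau_src (C_ob N) (C_ob M) F" "tau_tgt (C_ob N) (C_ob M) F K" \<tau> .
    show "?R1 \<and> ?R2"
      using nat mod mu_nat mu_mod by (simp add: \<tau>h[simp del])
  next
    assume "?R1 \<and> ?R2"
    then show ?L
      using nat mod by (intro indexed_nat_transI[OF indexed_functor_tau_src indexed_functor_tau_tgt]) (simp_all add: ty del: \<tau>h)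
  qed
qed

end

text \<open>\<open>w_nat\<close> and \<open>w_mod\<close> are the right-hand side of
  \<open>tau_iff\<close>. They make the action on terms generated by \<open>w\<close> compatible
  with \<open>push\<close> and with reindexing, respectively.\<close>

locale comp_data = tp_mor U N M F K for U :: "'u universe" and N M F K +
  fixes w :: "'u \<Rightarrow> 'u \<Rightarrow> 'u"
  assumes w_ob [simp]: "\<Gamma> \<in> obs N.C \<Longrightarrow> A \<in> obs (N.TY \<Gamma>) \<Longrightarrow> fo F (src N.C (N.ext \<Gamma> A)) = X \<Longrightarrow> w \<Gamma> A \<in> obs (M.TM X)"
    and w_typ [simp]: "\<Gamma> \<in> obs N.C \<Longrightarrow> A \<in> obs (N.TY \<Gamma>) \<Longrightarrow> fo F (src N.C (N.ext \<Gamma> A)) = X \<Longrightarrow>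
      M.typ X (w \<Gamma> A) = fo (ri (n_tp M) (fa F (N.ext \<Gamma> A))) (fo (cp K \<Gamma>) A)"
    and w_nat: "\<Gamma> \<in> obs N.C \<Longrightarrow> f \<in> ars (N.TY \<Gamma>) \<Longrightarrow> src (N.TY \<Gamma>) f = A \<Longrightarrow> 
      push M (fo F (src N.C (N.ext \<Gamma> A))) (fa (ri (n_tp M) (fa F (N.ext \<Gamma> A))) (fa (cp K \<Gamma>) f)) (w \<Gamma> A) =
      fo (ri (n_tm M) (fa F (ext_map N \<Gamma> f))) (w \<Gamma> (tgt (N.TY \<Gamma>) f))"
    and w_mod: "u \<in> ars N.C \<Longrightarrow> A \<in> obs (N.TY (tgt N.C u)) \<Longrightarrow>
      fo (ri (n_tm M) (fa F (ext_ps N u A))) (w (src N.C u) (fo (ri (n_tp N) u) A)) =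
      fo (ri (n_tm M) (fa F (pt N.C u (N.ext (tgt N.C u) A)))) (w (tgt N.C u) A)"
begin

definition T_ob :: "'u \<Rightarrow> 'u \<Rightarrow> 'u" where
  "T_ob \<Gamma> t = fo (ri (n_tm M) (fa F (ext_pair N \<Gamma> (N.typ \<Gamma> t) (idn N.C \<Gamma>) t))) (w \<Gamma> (N.typ \<Gamma> t))"

text \<open>On arrows the action is forced: its values must be lifts of the image of the
  projection.\<close>

definition T_mor :: "'u nm_mor" where
  "T_mor = \<lparr>nm_base = F, nm_tp = K, nm_tm = ifun_norm N.C (n_tm N) \<lparr>
     cp = (\<lambda>\<Gamma>. \<lparr>fo = T_ob \<Gamma>, fa = (\<lambda>k. dlift (M.TM (fo F \<Gamma>)) (cp (n_proj M) (fo F \<Gamma>))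
       (fa (cp K \<Gamma>) (fa (cp (n_proj N) \<Gamma>) k)) (T_ob \<Gamma> (src (N.TM \<Gamma>) k)))\<rparr>),
     ps = (\<lambda>u t. idn (M.TM (fo F (src N.C u))) (T_ob (src N.C u) (fo (ri (n_tm N) u) t)))\<rparr>\<rparr>"

lemma section_simps:
  assumes "\<Gamma> \<in> obs N.C" "t \<in> obs (N.TM \<Gamma>)" "N.typ \<Gamma> t = A"
  shows "ext_pair N \<Gamma> A (idn N.C \<Gamma>) t \<in> ars N.C" "src N.C (ext_pair N \<Gamma> A (idn N.C \<Gamma>) t) = \<Gamma>"
    "tgt N.C (ext_pair N \<Gamma> A (idn N.C \<Gamma>) t) = src N.C (N.ext \<Gamma> A)"
    "cmp N.C (N.ext \<Gamma> A) (ext_pair N \<Gamma> A (idn N.C \<Gamma>) t) = idn N.C \<Gamma>"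
    "fo (ri (n_tm N) (ext_pair N \<Gamma> A (idn N.C \<Gamma>) t)) (N.var \<Gamma> A) = t"
    "B \<in> obs (M.TY (fo F \<Gamma>)) \<Longrightarrow>
      fo (ri (n_tp M) (fa F (ext_pair N \<Gamma> A (idn N.C \<Gamma>) t))) (fo (ri (n_tp M) (fa F (N.ext \<Gamma> A))) B) = B"
proof -
  have A: "A \<in> obs (N.TY \<Gamma>)" using assms by auto
  define s where "s = ext_pair N \<Gamma> A (idn N.C \<Gamma>) t"
  have s: "s \<in> ars N.C" "src N.C s = \<Gamma>" "tgt N.C s = src N.C (N.ext \<Gamma> A)" "cmp N.C (N.ext \<Gamma> A) s = idn N.C \<Gamma>"
    "fo (ri (n_tm N) s) (N.var \<Gamma> A) = t"
    unfolding s_def using assms A by simp_all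
  then show "ext_pair N \<Gamma> A (idn N.C \<Gamma>) t \<in> ars N.C" "src N.C (ext_pair N \<Gamma> A (idn N.C \<Gamma>) t) = \<Gamma>"
    "tgt N.C (ext_pair N \<Gamma> A (idn N.C \<Gamma>) t) = src N.C (N.ext \<Gamma> A)"
    "cmp N.C (N.ext \<Gamma> A) (ext_pair N \<Gamma> A (idn N.C \<Gamma>) t) = idn N.C \<Gamma>"
    "fo (ri (n_tm N) (ext_pair N \<Gamma> A (idn N.C \<Gamma>) t)) (N.var \<Gamma> A) = t" by (simp_all add: s_def)
  have "cmp M.C (fa F (N.ext \<Gamma> A)) (fa F s) = idn M.C (fo F \<Gamma>)"
    using assms A s by (simp flip: D.map_simps(5,6))
  from M.Tp.ri_pull(1)[OF this, of B]
  show "B \<in> obs (M.TY (fo F \<Gamma>)) \<Longrightarrow>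
      fo (ri (n_tp M) (fa F (ext_pair N \<Gamma> A (idn N.C \<Gamma>) t))) (fo (ri (n_tp M) (fa F (N.ext \<Gamma> A))) B) = B"
    using assms A s by (simp flip: s_def)
qed

text \<open>\<open>T_ob\<close> is defined through sections; here an arbitrary map over
  \<open>u\<close> classifying \<open>t\<close> is allowed. This map and the section both factor
  through the pullback of the display of \<open>A\<close> along \<open>u\<close>, where
  \<open>w_mod\<close> equates the two values.\<close>

lemma T_ob_eq:
  assumes "u \<in> ars N.C" "A \<in> obs (N.TY (tgt N.C u))" "t \<in> obs (N.TM (src N.C u))" "N.typ (src N.C u) t = fo (ri (n_tp N) u) A"
  shows "T_ob (src N.C u) t = fo (ri (n_tm M) (fa F (ext_pair N (tgt N.C u) A u t))) (w (tgt N.C u) A)"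
proof -
  let ?\<Delta> = "src N.C u" and ?\<Gamma> = "tgt N.C u" and ?B = "fo (ri (n_tp N) u) A"
  let ?p = "N.ext ?\<Gamma> A"
  define e where "e = ext_pair N ?\<Gamma> A u t"
  have e: "e \<in> ars N.C" "src N.C e = ?\<Delta>" "tgt N.C e = src N.C ?p" "cmp N.C ?p e = u" "fo (ri (n_tm N) e) (N.var ?\<Gamma> A) = t"
    unfolding e_def using assms by simp_all
  define s where "s = ext_pair N ?\<Delta> ?B (idn N.C ?\<Delta>) t"
  have s: "s \<in> ars N.C" "src N.C s = ?\<Delta>" "tgt N.C s = src N.C (N.ext ?\<Delta> ?B)" "cmp N.C (N.ext ?\<Delta> ?B) s = idn N.C ?\<Delta>"
    "fo (ri (n_tm N) s) (N.var ?\<Delta> ?B) = t"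
    unfolding s_def using section_simps[of ?\<Delta> t] assms by simp_all
  \<comment> \<open>The section of the chosen pullback whose second leg is \<open>e\<close>;
    followed by \<open>ext_ps N u A\<close> it becomes the section \<open>s\<close>.\<close>
  define k where "k = pb_pair N.C (pb N.C u ?p) (pt N.C u ?p) (idn N.C ?\<Delta>) e"
  have k: "k \<in> ars N.C" "src N.C k = ?\<Delta>" "tgt N.C k = src N.C (pb N.C u ?p)" "cmp N.C (pb N.C u ?p) k = idn N.C ?\<Delta>" "cmp N.C (pt N.C u ?p) k = e"
    unfolding k_def using assms e by simp_all
  have se: "s = cmp N.C (ext_ps N u A) k"
    by (rule N.ext_eqI[of ?\<Delta> ?B]) (use assms e s k N.Tm.ri_pull(1)[OF k(5), of "N.var ?\<Gamma> A"] in \<open>simp_all add: N.Tm.ri_cmp\<close>)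
  have pk: "cmp M.C (fa F (pt N.C u ?p)) (fa F k) = fa F e"
    using assms k by (simp flip: D.map_simps(6))
  have "T_ob ?\<Delta> t = fo (ri (n_tm M) (fa F s)) (w ?\<Delta> ?B)"
    using assms by (simp add: T_ob_def s_def)
  also have "\<dots> = fo (ri (n_tm M) (fa F k)) (fo (ri (n_tm M) (fa F (ext_ps N u A))) (w ?\<Delta> ?B))"
    unfolding se using assms k by (simp add: M.Tm.ri_cmp)
  also have "\<dots> = fo (ri (n_tm M) (fa F e)) (w ?\<Gamma> A)"
    using assms k e M.Tm.ri_pull(1)[OF pk, of "w ?\<Gamma> A"] by (simp add: w_mod)
  finally show ?thesis by (simp add: e_def)
qed

lemma T_ob_simps [simp]:
  assumes "\<Gamma> \<in> obs N.C" "t \<in> obs (N.TM \<Gamma>)" "fo F \<Gamma> = X"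
  shows "T_ob \<Gamma> t \<in> obs (M.TM X)" "M.typ X (T_ob \<Gamma> t) = fo (cp K \<Gamma>) (N.typ \<Gamma> t)"
  unfolding T_ob_def using assms section_simps[OF assms(1,2) refl] by auto

text \<open>The term \<open>t[u]\<close> is classified over \<open>u\<close> by the section of
  \<open>t\<close> precomposed with \<open>u\<close>, so \<open>T_ob_eq\<close> applies.\<close>

lemma T_ob_ri:
  assumes "u \<in> ars N.C" "t \<in> obs (N.TM (tgt N.C u))"
  shows "T_ob (src N.C u) (fo (ri (n_tm N) u) t) = fo (ri (n_tm M) (fa F u)) (T_ob (tgt N.C u) t)"
proof -
  let ?A = "N.typ (tgt N.C u) t"
  define s where "s = ext_pair N (tgt N.C u) ?A (idn N.C (tgt N.C u)) t"
  have s: "s \<in> ars N.C" "src N.C s = tgt N.C u" "tgt N.C s = src N.C (N.ext (tgt N.C u) ?A)" "cmp N.C (N.ext (tgt N.C u) ?A) s = idn N.C (tgt N.C u)"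
    "fo (ri (n_tm N) s) (N.var (tgt N.C u) ?A) = t"
    unfolding s_def using section_simps[of "tgt N.C u" t] assms by simp_all
  have "ext_pair N (tgt N.C u) ?A u (fo (ri (n_tm N) u) t) = cmp N.C s u"
    by (rule N.ext_eqI[of "tgt N.C u" ?A]) (use assms s N.B.cmp_pull[OF s(4), of u] in \<open>simp_all add: N.Tm.ri_cmp\<close>)
  then show ?thesis
    using assms s T_ob_eq[of u ?A "fo (ri (n_tm N) u) t"] by (simp add: M.Tm.ri_cmp T_ob_def flip: s_def)
qed

text \<open>The pushed term is classified by the section of \<open>t\<close> followed by
  \<open>ext_map N \<Gamma> f\<close>. The claim is then \<open>w_nat\<close>, reindexed along the
  image of the section.\<close>

lemma T_ob_push:
  assumes "\<Gamma> \<in> obs N.C" "t \<in> obs (N.TM \<Gamma>)" "f \<in> ars (N.TY \<Gamma>)" "src (N.TY \<Gamma>) f = N.typ \<Gamma> t"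
  shows "T_ob \<Gamma> (push N \<Gamma> f t) = push M (fo F \<Gamma>) (fa (cp K \<Gamma>) f) (T_ob \<Gamma> t)"
proof -
  let ?A = "N.typ \<Gamma> t" and ?B = "tgt (N.TY \<Gamma>) f"
  define s where "s = ext_pair N \<Gamma> ?A (idn N.C \<Gamma>) t"
  have s: "s \<in> ars N.C" "src N.C s = \<Gamma>" "tgt N.C s = src N.C (N.ext \<Gamma> ?A)" "cmp N.C (N.ext \<Gamma> ?A) s = idn N.C \<Gamma>"
    "fo (ri (n_tm N) s) (N.var \<Gamma> ?A) = t"
    unfolding s_def using section_simps[of \<Gamma> t] assms by simp_all
  have f: "fa (ri (n_tp N) s) (fa (ri (n_tp N) (N.ext \<Gamma> ?A)) f) = f"
    using assms s N.Tp.ri_pull(2)[OF s(4), of f] by simp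
  have Fs: "cmp M.C (fa F (N.ext \<Gamma> ?A)) (fa F s) = idn M.C (fo F \<Gamma>)"
    using assms s by (simp flip: D.map_simps(5,6))
  have Ff: "fa (ri (n_tp M) (fa F s)) (fa (ri (n_tp M) (fa F (N.ext \<Gamma> ?A))) (fa (cp K \<Gamma>) f)) = fa (cp K \<Gamma>) f"
    using assms s M.Tp.ri_pull(2)[OF Fs, of "fa (cp K \<Gamma>) f"] by simp
  have "ext_pair N \<Gamma> ?B (idn N.C \<Gamma>) (push N \<Gamma> f t) = cmp N.C (ext_map N \<Gamma> f) s"
    by (rule N.ext_eqI[of \<Gamma> ?B]) (use assms s f in \<open>simp_all add: N.Tm.ri_cmp\<close>)
  then have "T_ob \<Gamma> (push N \<Gamma> f t) = fo (ri (n_tm M) (fa F s)) (fo (ri (n_tm M) (fa F (ext_map N \<Gamma> f))) (w \<Gamma> ?B))"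
    using assms s by (simp add: T_ob_def M.Tm.ri_cmp)
  also have "\<dots> = push M (fo F \<Gamma>) (fa (cp K \<Gamma>) f) (fo (ri (n_tm M) (fa F s)) (w \<Gamma> ?A))"
    using assms s Ff by (simp flip: w_nat[of \<Gamma> f ?A])
  finally show ?thesis by (simp add: T_ob_def s_def)
qed

lemma T_tm_simps:
  shows "nm_base T_mor = F" "nm_tp T_mor = K"
    "\<Gamma> \<in> obs N.C \<Longrightarrow> t \<in> obs (N.TM \<Gamma>) \<Longrightarrow> fo (cp (nm_tm T_mor) \<Gamma>) t = T_ob \<Gamma> t"
    "\<Gamma> \<in> obs N.C \<Longrightarrow> k \<in> ars (N.TM \<Gamma>) \<Longrightarrow> fa (cp (nm_tm T_mor) \<Gamma>) k =
      dlift (M.TM (fo F \<Gamma>)) (cp (n_proj M) (fo F \<Gamma>)) (fa (cp K \<Gamma>) (fa (cp (n_proj N) \<Gamma>) k)) (T_ob \<Gamma> (src (N.TM \<Gamma>) k))"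
    "u \<in> ars N.C \<Longrightarrow> t \<in> obs (N.TM (tgt N.C u)) \<Longrightarrow> ps (nm_tm T_mor) u t = idn (M.TM (fo F (src N.C u))) (T_ob (src N.C u) (fo (ri (n_tm N) u) t))"
    "ifun_norm N.C (n_tm N) (nm_tm T_mor) = nm_tm T_mor"
  by (simp_all add: T_mor_def)

lemma T_lift:
  assumes "\<Gamma> \<in> obs N.C" "k \<in> ars (N.TM \<Gamma>)"
  defines "l \<equiv> dlift (M.TM (fo F \<Gamma>)) (cp (n_proj M) (fo F \<Gamma>)) (fa (cp K \<Gamma>) (fa (cp (n_proj N) \<Gamma>) k)) (T_ob \<Gamma> (src (N.TM \<Gamma>) k))"
  shows "l \<in> ars (M.TM (fo F \<Gamma>))" "src (M.TM (fo F \<Gamma>)) l = T_ob \<Gamma> (src (N.TM \<Gamma>) k)"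
    "fa (cp (n_proj M) (fo F \<Gamma>)) l = fa (cp K \<Gamma>) (fa (cp (n_proj N) \<Gamma>) k)"
    "tgt (M.TM (fo F \<Gamma>)) l = T_ob \<Gamma> (tgt (N.TM \<Gamma>) k)"
proof -
  show "l \<in> ars (M.TM (fo F \<Gamma>))" "src (M.TM (fo F \<Gamma>)) l = T_ob \<Gamma> (src (N.TM \<Gamma>) k)"
    "fa (cp (n_proj M) (fo F \<Gamma>)) l = fa (cp K \<Gamma>) (fa (cp (n_proj N) \<Gamma>) k)"
    unfolding l_def using assms by simp_all
  show "tgt (M.TM (fo F \<Gamma>)) l = T_ob \<Gamma> (tgt (N.TM \<Gamma>) k)"
    unfolding l_def push_def[symmetric] using assms T_ob_push[of \<Gamma> "src (N.TM \<Gamma>) k" "fa (cp (n_proj N) \<Gamma>) k"] N.push_ar[of \<Gamma> k]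
    by simp
qed

text \<open>On objects this is \<open>T_ob_ri\<close>. On arrows both sides of each law are lifts of
  the same arrow at the same term.\<close>

lemma strict_mor_T: "strict_mor N.C M.C F (n_tm N) (n_tm M) (nm_tm T_mor)"
proof (rule strict_morI[OF D.is_functor_axioms N.Tm.strict_indexed_category_axioms M.Tm.strict_indexed_category_axioms], goal_cases)
  case (1 \<Gamma>)
  show ?case
  proof (rule is_functorI, goal_cases)
    case (4 k) then show ?case using T_lift[of \<Gamma> k] 1 by (simp add: T_tm_simps)
  next
    case (5 t) then show ?case using 1 by (simp add: T_tm_simps M.dlift_eqI)
  next
    case (6 k l)
    note T = T_lift[OF 1 6(1)] T_lift[OF 1 6(2)]
    show ?case using 6 1 T by (simp add: T_tm_simps) (rule M.dlift_eqI; simp)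
  qed (use 1 in \<open>simp_all add: N.Tm.fib_cat M.Tm.fib_cat T_tm_simps\<close>)
next
  case (2 u \<Delta> t) then show ?case using T_ob_ri[of u t] N.B.ars_simps(1)[of u] by (auto simp: T_tm_simps)
next
  case (3 u \<Delta> k)
  note T = T_lift[of "tgt N.C u" k]
  from 3 have D: "\<Delta> = src N.C u" by simp
  show ?case using 3(1,3) T unfolding D
    by (simp add: T_tm_simps T_ob_ri) (rule M.dlift_eqI; simp add: K.nat_ar)
qed (simp add: T_tm_simps)

end

section \<open>The action of \<open>C_functor\<close> on morphisms and its inverse\<close>

lemma is_precwa_C_ob: "is_prenm U N \<Longrightarrow> is_precwa U (C_ob N)"
proof -
  assume "is_prenm U N"
  then interpret prenm U N by unfold_locales
  show ?thesis
    using prenm indexed_functor_nm_comp by (simp add: is_precwa_def is_prenm_def Let_def)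
qed

context nm_mor
begin

text \<open>A morphism commutes with the projections, so it sends lifts to lifts.\<close>

lemma tm_push [simp]:
  assumes "\<Gamma> \<in> obs N.C" "t \<in> obs (N.TM \<Gamma>)" "f \<in> ars (N.TY \<Gamma>)" "src (N.TY \<Gamma>) f = N.typ \<Gamma> t"
  shows "fo (cp (nm_tm F) \<Gamma>) (push N \<Gamma> f t) = push M (fo (nm_base F) \<Gamma>) (fa (cp (nm_tp F) \<Gamma>) f) (fo (cp (nm_tm F) \<Gamma>) t)"
proof -
  let ?k = "dlift (N.TM \<Gamma>) (cp (n_proj N) \<Gamma>) f t"
  have k: "?k \<in> ars (N.TM \<Gamma>)" "src (N.TM \<Gamma>) ?k = t" "fa (cp (n_proj N) \<Gamma>) ?k = f" "tgt (N.TM \<Gamma>) ?k = push N \<Gamma> f t"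
    using assms by (auto simp: push_def)
  show ?thesis using M.push_ar[of "fo (nm_base F) \<Gamma>" "fa (cp (nm_tm F) \<Gamma>) ?k"] k assms by simp
qed

declare Tp.nat_ob [simp]

abbreviation "w \<equiv> \<lambda>\<Gamma> A. fo (cp (nm_tm F) (src N.C (N.ext \<Gamma> A))) (N.var \<Gamma> A)"

text \<open>The images of the universal elements satisfy the axioms of \<open>comp_data\<close>: the
  action on terms is applied to the equations that characterise \<open>ext_map\<close> and
  \<open>ext_ps\<close> by their effect on universal elements.\<close>

sublocale W: comp_data U N M "nm_base F" "nm_tp F" w
proof (unfold_locales, goal_cases)
  case (3 \<Gamma> f A)
  then have A: "A \<in> obs (N.TY \<Gamma>)" by auto
  have "fo (cp (nm_tm F) (src N.C (N.ext \<Gamma> A))) (push N (src N.C (N.ext \<Gamma> A)) (fa (ri (n_tp N) (N.ext \<Gamma> A)) f) (N.var \<Gamma> A)) =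
    fo (cp (nm_tm F) (src N.C (N.ext \<Gamma> A))) (fo (ri (n_tm N) (ext_map N \<Gamma> f)) (N.var \<Gamma> (tgt (N.TY \<Gamma>) f)))"
    using 3 A by simp
  then show ?case using 3 A by (subst (asm) tm_push) (simp_all add: Tp.nat_ar Tm.nat_ob del: N.ext_map_simps(5))
next
  case (4 u A)
  let ?\<Delta> = "src N.C (pb N.C u (N.ext (tgt N.C u) A))"
  have "fo (cp (nm_tm F) ?\<Delta>) (fo (ri (n_tm N) (ext_ps N u A)) (N.var (src N.C u) (fo (ri (n_tp N) u) A))) =
    fo (cp (nm_tm F) ?\<Delta>) (fo (ri (n_tm N) (pt N.C u (N.ext (tgt N.C u) A))) (N.var (tgt N.C u) A))"
    using 4 by simp
  then show ?case using 4 by (simp add: Tm.nat_ob del: N.ext_ps_simps(5))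
qed (auto simp: Tp.nat_ob)

lemma nm_tau_simp: "\<Gamma> \<in> obs N.C \<Longrightarrow> A \<in> obs (N.TY \<Gamma>) \<Longrightarrow> nm_tau N M F \<Gamma> A = W.w_tau w \<Gamma> A"
  by (simp add: nm_tau_def Let_def)

lemma nm_tau_norm [simp]: "itrans_norm N.C (n_tp N) (nm_tau N M F) = nm_tau N M F"
  by (simp add: nm_tau_def)

lemma is_cwa_mor_C_mor: "is_cwa_mor (C_ob N) (C_ob M) (C_mor N M F)"
proof -
  have "indexed_nat_trans N.C (n_tp N) (bc (nm_base F) (dic M.C)) (tau_src (C_ob N) (C_ob M) (nm_base F))
      (tau_tgt (C_ob N) (C_ob M) (nm_base F) (nm_tp F)) (nm_tau N M F)"
  proof (subst W.tau_iff[of w], goal_cases)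
    case 3 show ?case using W.w_nat W.w_mod by simp
  qed (simp_all add: nm_tau_simp Tp.nat_ob)
  then show ?thesis
    using nm_mor by (simp add: is_cwa_mor_def C_mor_def is_nm_mor_def)
qed

text \<open>\<open>t\<close> is the universal element reindexed along the section of
  \<open>t\<close>, and the action on terms commutes with reindexing; hence this action is
  determined by \<open>w\<close>.\<close>

lemma tm_section:
  assumes "\<Gamma> \<in> obs N.C" "t \<in> obs (N.TM \<Gamma>)"
  shows "fo (cp (nm_tm F) \<Gamma>) t = W.T_ob \<Gamma> t"
proof -
  define s where "s = ext_pair N \<Gamma> (N.typ \<Gamma> t) (idn N.C \<Gamma>) t"
  have s: "s \<in> ars N.C" "src N.C s = \<Gamma>" "tgt N.C s = src N.C (N.ext \<Gamma> (N.typ \<Gamma> t))"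
    "fo (ri (n_tm N) s) (N.var \<Gamma> (N.typ \<Gamma> t)) = t"
    unfolding s_def using W.section_simps[of \<Gamma> t] assms by simp_all
  have "fo (cp (nm_tm F) \<Gamma>) t = fo (cp (nm_tm F) \<Gamma>) (fo (ri (n_tm N) s) (N.var \<Gamma> (N.typ \<Gamma> t)))" by (simp add: s)
  also have "\<dots> = W.T_ob \<Gamma> t"
    using assms s(1-3) by (simp add: Tm.nat_ob W.T_ob_def flip: s_def)
  finally show ?thesis .
qed

end

text \<open>Inverse to \<open>w_tau\<close>: reads off the family of terms from \<tau>.\<close>

definition tau_term :: "'u prenm \<Rightarrow> 'u cwa_mor \<Rightarrow> 'u \<Rightarrow> 'u \<Rightarrow> 'u" where
  "tau_term M G \<Gamma> A = fo (ri (n_tm M) (und (cm_tau G \<Gamma> A))) (n_var M (fo (cm_base G) \<Gamma>) (fo (cp (cm_tp G) \<Gamma>) A))"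

lemma (in nm_mor) tau_term_C_mor:
  assumes "\<Gamma> \<in> obs N.C" "A \<in> obs (N.TY \<Gamma>)"
  shows "tau_term M (C_mor N M F) \<Gamma> A = w \<Gamma> A"
  using assms by (simp add: tau_term_def C_mor_def nm_tau_simp)

lemma C_mor_inj:
  assumes "nm_mor U N M F" "nm_mor U N M G" "C_mor N M F = C_mor N M G"
  shows "F = G"
proof -
  interpret F: nm_mor U N M F by fact
  interpret G: nm_mor U N M G by fact
  from assms(3) have eq: "nm_base F = nm_base G" "nm_tp F = nm_tp G" by (simp_all add: C_mor_def)
  \<comment> \<open>By \<open>tau_term_C_mor\<close> the family \<open>w\<close> depends only on the
    image under \<open>C_mor\<close>.\<close>
  have w: "F.w \<Gamma> A = G.w \<Gamma> A" if "\<Gamma> \<in> obs F.N.C" "A \<in> obs (F.N.TY \<Gamma>)" for \<Gamma> A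
    by (rule trans[OF F.tau_term_C_mor[OF that, symmetric, unfolded assms(3)] G.tau_term_C_mor[OF that]])
  have t: "fo (cp (nm_tm F) \<Gamma>) t = fo (cp (nm_tm G) \<Gamma>) t" if "\<Gamma> \<in> obs F.N.C" "t \<in> obs (F.N.TM \<Gamma>)" for \<Gamma> t
    unfolding F.tm_section[OF that] G.tm_section[OF that] F.W.T_ob_def G.W.T_ob_def
    using w[of \<Gamma> "F.N.typ \<Gamma> t"] that eq by simp
  show ?thesis
  proof (rule nm_mor_eqI[OF assms(1,2) eq t])
    fix \<Gamma> k assume k: "\<Gamma> \<in> obs F.N.C" "k \<in> ars (F.N.TM \<Gamma>)"
    have X: "fo (nm_base F) \<Gamma> = fo (nm_base G) \<Gamma>" using eq by simp
    note f = F.Tm.cp_simps(2,3)[OF k(1) X k(2)] F.proj_simps(2)[OF k(1) X[symmetric] k(2)]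
    show "fa (cp (nm_tm F) \<Gamma>) k = fa (cp (nm_tm G) \<Gamma>) k"
      using k f by - (rule F.M.lift_unique[of "fo (nm_base G) \<Gamma>"]; simp add: t eq)
  qed
qed

text \<open>A component of \<tau> is a map into an extension with prescribed composite to the base,
  so it is given by a term. Hence every \<tau> has the form \<open>w_tau w\<close>, and
  \<open>tau_iff\<close> can be read from left to right.\<close>

lemma cwa_mor_comp_data:
  assumes "is_prenm U N" "is_prenm U M" "is_cwa_mor (C_ob N) (C_ob M) G"
  shows "comp_data U N M (cm_base G) (cm_tp G) (tau_term M G)" (is ?th1)
    "\<And>\<Gamma> A. \<Gamma> \<in> obs (n_base N) \<Longrightarrow> A \<in> obs (fib (n_tp N) \<Gamma>) \<Longrightarrow>
      cm_tau G \<Gamma> A = (fa (cm_base G) (n_ext N \<Gamma> A), n_ext M (fo (cm_base G) \<Gamma>) (fo (cp (cm_tp G) \<Gamma>) A),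
        ext_pair M (fo (cm_base G) \<Gamma>) (fo (cp (cm_tp G) \<Gamma>) A) (fa (cm_base G) (n_ext N \<Gamma> A)) (tau_term M G \<Gamma> A))"
proof -
  interpret N: prenm U N by unfold_locales fact
  interpret M: prenm U M by unfold_locales fact
  interpret D: display_functor "n_base N" "n_base M" "cm_base G" using assms(3) by (simp add: is_cwa_mor_def)
  interpret K: strict_mor "n_base N" "n_base M" "cm_base G" "n_tp N" "n_tp M" "cm_tp G"
    using assms(3) strictly_natural_iff[OF D.is_functor_axioms N.Tp.strict_indexed_category_axioms M.Tp.strict_indexed_category_axioms]
    by (simp add: is_cwa_mor_def)
  interpret tp_mor U N M "cm_base G" "cm_tp G" by unfold_locales
  have nt: "indexed_nat_trans N.C (n_tp N) (bc (cm_base G) (dic M.C)) (tau_src (C_ob N) (C_ob M) (cm_base G))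
      (tau_tgt (C_ob N) (C_ob M) (cm_base G) (cm_tp G)) (cm_tau G)"
    using assms(3) by (simp add: is_cwa_mor_def)
  have \<tau>: "cm_tau G \<Gamma> A = w_tau (tau_term M G) \<Gamma> A \<and> tau_term M G \<Gamma> A \<in> obs (M.TM (fo (cm_base G) (src N.C (N.ext \<Gamma> A)))) \<and>
      M.typ (fo (cm_base G) (src N.C (N.ext \<Gamma> A))) (tau_term M G \<Gamma> A) = fo (ri (n_tp M) (fa (cm_base G) (N.ext \<Gamma> A))) (fo (cp (cm_tp G) \<Gamma>) A)"
    if "\<Gamma> \<in> obs N.C" "A \<in> obs (N.TY \<Gamma>)" for \<Gamma> A
  proof -
    obtain p q h where t: "cm_tau G \<Gamma> A = (p, q, h)" by (cases "cm_tau G \<Gamma> A")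
    let ?q = "M.ext (fo (cm_base G) \<Gamma>) (fo (cp (cm_tp G) \<Gamma>) A)" and ?p = "fa (cm_base G) (N.ext \<Gamma> A)"
    have "(p, q, h) \<in> ars (dfib M.C (fo (cm_base G) \<Gamma>))" "p = ?p" "q = ?q"
      using indexed_nat_trans.mu_simps[OF nt that] that by (simp_all add: t tau_src_def tau_tgt_def)
    then have h: "h \<in> ars M.C" "src M.C h = fo (cm_base G) (src N.C (N.ext \<Gamma> A))" "tgt M.C h = src M.C ?q" "cmp M.C ?q h = ?p" "p = ?p" "q = ?q"
      using that by simp_all
    have tt: "tau_term M G \<Gamma> A = fo (ri (n_tm M) h) (M.var (fo (cm_base G) \<Gamma>) (fo (cp (cm_tp G) \<Gamma>) A))"
      by (simp add: tau_term_def t)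
    have 1: "tau_term M G \<Gamma> A \<in> obs (M.TM (fo (cm_base G) (src N.C (N.ext \<Gamma> A))))"
      "M.typ (fo (cm_base G) (src N.C (N.ext \<Gamma> A))) (tau_term M G \<Gamma> A) = fo (ri (n_tp M) ?p) (fo (cp (cm_tp G) \<Gamma>) A)"
      using that h M.Tp.ri_pull(1)[OF h(4), of "fo (cp (cm_tp G) \<Gamma>) A"] by (simp_all add: tt)
    have "h = ext_pair M (fo (cm_base G) \<Gamma>) (fo (cp (cm_tp G) \<Gamma>) A) ?p (tau_term M G \<Gamma> A)"
      by (rule M.ext_eqI[of "fo (cm_base G) \<Gamma>" "fo (cp (cm_tp G) \<Gamma>) A"]) (use that h(1-4) 1 tt in simp_all)
    then show ?thesis using 1 h(5,6) t by simp
  qed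
  then show "\<And>\<Gamma> A. \<Gamma> \<in> obs N.C \<Longrightarrow> A \<in> obs (N.TY \<Gamma>) \<Longrightarrow> cm_tau G \<Gamma> A = w_tau (tau_term M G) \<Gamma> A" by blast
  have w: "fo (cm_base G) (src N.C (N.ext \<Gamma> A)) = X \<Longrightarrow> tau_term M G \<Gamma> A \<in> obs (M.TM X) \<and>
      M.typ X (tau_term M G \<Gamma> A) = fo (ri (n_tp M) (fa (cm_base G) (N.ext \<Gamma> A))) (fo (cp (cm_tp G) \<Gamma>) A)"
    if "\<Gamma> \<in> obs N.C" "A \<in> obs (N.TY \<Gamma>)" for \<Gamma> A X
    using \<tau>[OF that] by blast
  note w' = iffD1[OF tau_iff[OF w \<tau>[THEN conjunct1]] nt]
  show ?th1
  proof (rule comp_data.intro[OF tp_mor_axioms comp_data_axioms.intro], goal_cases)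
    case (3 \<Gamma> f A)
    show ?case unfolding 3(3)[symmetric] using w'[THEN conjunct1] 3(1,2) by blast
  next
    case (4 u A) then show ?case using w'[THEN conjunct2] by blast
  qed (use w in blast)+
qed

lemma (in comp_data) nm_mor_T:
  assumes "fnc_norm N.C F = F" "ifun_norm N.C (n_tp N) K = K"
  shows "nm_mor U N M T_mor"
  by (rule nm_morI[OF N.prenm M.prenm]) (use strict_mor_T assms in \<open>simp_all add: T_tm_simps D.display_functor_axioms K.strict_mor_axioms\<close>)

text \<open>The identity of an extension classifies the universal element over the display, so the
  generated action returns \<open>w\<close> there. This is why the generated morphism induces the
  given \<tau>.\<close>

lemma (in comp_data) T_ob_var:
  assumes "\<Gamma> \<in> obs N.C" "A \<in> obs (N.TY \<Gamma>)"
  shows "T_ob (src N.C (N.ext \<Gamma> A)) (N.var \<Gamma> A) = w \<Gamma> A"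
proof -
  have "ext_pair N \<Gamma> A (N.ext \<Gamma> A) (N.var \<Gamma> A) = idn N.C (src N.C (N.ext \<Gamma> A))"
    by (rule N.ext_eqI[of \<Gamma> A]) (use assms in simp_all)
  then show ?thesis
    using assms T_ob_eq[of "N.ext \<Gamma> A" A "N.var \<Gamma> A"] by (simp add: T_tm_simps)
qed

definition C_inv :: "'u prenm \<Rightarrow> 'u prenm \<Rightarrow> 'u cwa_mor \<Rightarrow> 'u nm_mor" where
  "C_inv N M G = comp_data.T_mor N M (cm_base G) (cm_tp G) (tau_term M G)"

lemma C_inv:
  assumes "is_prenm U N" "is_prenm U M" "is_cwa_mor (C_ob N) (C_ob M) G"
  shows "nm_mor U N M (C_inv N M G)" "C_mor N M (C_inv N M G) = G"
proof -
  interpret comp_data U N M "cm_base G" "cm_tp G" "tau_term M G" by (rule cwa_mor_comp_data[OF assms])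
  show m: "nm_mor U N M (C_inv N M G)"
    unfolding C_inv_def by (rule nm_mor_T) (use assms(3) in \<open>simp_all add: is_cwa_mor_def\<close>)
  interpret T: nm_mor U N M "C_inv N M G" by (rule m)
  have "nm_tau N M (C_inv N M G) = cm_tau G"
    by (rule itrans_eqI[of "n_base N" "n_tp N"])
      (use assms(3) in \<open>simp_all add: T.nm_tau_simp[unfolded C_inv_def] T.nm_tau_norm[unfolded C_inv_def] cwa_mor_comp_data(2)[OF assms] T_ob_var C_inv_def T_tm_simps is_cwa_mor_def\<close>)
  then show "C_mor N M (C_inv N M G) = G"
    by - (rule cwa_mor.equality; simp add: C_mor_def C_inv_def T_tm_simps)
qed

section \<open>2-cells and comprehension\<close>

text \<open>A 2-cell without its part on terms: what a 2-cell of pre-CwAs provides before its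
  coherence condition is imposed.\<close>

locale nm_par = F: nm_mor U N M F + G: nm_mor U N M G +
  tp: strict_trans "n_base N" "n_base M" "nm_base F" "nm_base G" \<alpha> "n_tp N" "n_tp M" "nm_tp F" "nm_tp G" \<mu>
  for U :: "'u universe" and N M F G \<alpha> \<mu>
begin

text \<open>The coherence condition equates maps into the extension by
  \<open>(G A)[\<alpha> \<Gamma>]\<close>. At the universal element it says where the lift of the
  reindexed \<open>\<mu> \<Gamma> A\<close> starting at \<open>F.w \<Gamma> A\<close> ends: at
  \<open>G.w \<Gamma> A\<close> reindexed along \<alpha>.\<close>

lemma cell_iff:
  assumes A: "\<Gamma> \<in> obs F.N.C" "A \<in> obs (F.N.TY \<Gamma>)"
  shows "cmp (dfib F.M.C (fo (nm_base F) \<Gamma>)) (fa (cp (nm_comp M) (fo (nm_base F) \<Gamma>)) (\<mu> \<Gamma> A)) (nm_tau N M F \<Gamma> A) =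
        cmp (dfib F.M.C (fo (nm_base F) \<Gamma>)) (ps (nm_comp M) (\<alpha> \<Gamma>) (fo (cp (nm_tp G) \<Gamma>) A))
          (cmp (dfib F.M.C (fo (nm_base F) \<Gamma>)) (fa (ri (dic F.M.C) (\<alpha> \<Gamma>)) (nm_tau N M G \<Gamma> A))
            (dalpha F.N.C F.M.C (nm_base F) (nm_base G) \<alpha> (F.N.ext \<Gamma> A))) \<longleftrightarrow>
    push M (fo (nm_base F) (src F.N.C (F.N.ext \<Gamma> A))) (fa (ri (n_tp M) (fa (nm_base F) (F.N.ext \<Gamma> A))) (\<mu> \<Gamma> A)) (F.w \<Gamma> A) =
      fo (ri (n_tm M) (\<alpha> (src F.N.C (F.N.ext \<Gamma> A)))) (G.w \<Gamma> A)" (is "?l = ?r \<longleftrightarrow> ?x = ?y")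
proof -
  let ?p = "F.N.ext \<Gamma> A" and ?FA = "fo (cp (nm_tp F) \<Gamma>) A" and ?GA = "fo (cp (nm_tp G) \<Gamma>) A"
  let ?X = "fo (nm_base F) \<Gamma>"
  let ?B = "fo (ri (n_tp M) (\<alpha> \<Gamma>)) ?GA" and ?C = "F.M.C"
  let ?a = "\<alpha> (src F.N.C ?p)"
  define h where "h = ext_pair M ?X ?FA (fa (nm_base F) ?p) (F.w \<Gamma> A)"
  have h: "h \<in> ars ?C" "src ?C h = fo (nm_base F) (src F.N.C ?p)" "tgt ?C h = src ?C (F.M.ext ?X ?FA)" 
    "cmp ?C (F.M.ext ?X ?FA) h = fa (nm_base F) ?p" "fo (ri (n_tm M) h) (F.M.var ?X ?FA) = F.w \<Gamma> A"
    unfolding h_def using A by simp_all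
  define g where "g = ext_pair M (fo (nm_base G) \<Gamma>) ?GA (fa (nm_base G) ?p) (G.w \<Gamma> A)"
  have g: "g \<in> ars ?C" "src ?C g = fo (nm_base G) (src F.N.C ?p)" "tgt ?C g = src ?C (F.M.ext (fo (nm_base G) \<Gamma>) ?GA)" 
    "cmp ?C (F.M.ext (fo (nm_base G) \<Gamma>) ?GA) g = fa (nm_base G) ?p" "fo (ri (n_tm M) g) (F.M.var (fo (nm_base G) \<Gamma>) ?GA) = G.w \<Gamma> A"
    unfolding g_def using A by simp_all
  note gp = F.M.B.cmp_pull[OF g(4)]
  have nat: "cmp ?C (\<alpha> \<Gamma>) (fa (nm_base F) ?p) = cmp ?C (fa (nm_base G) ?p) ?a"
    using tp.natural[of ?p] A by simp
  \<comment> \<open>The underlying map of \<open>dalpha\<close> at the display of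
    \<open>A\<close>.\<close>
  define d where "d = pb_pair ?C (pb ?C (\<alpha> \<Gamma>) (fa (nm_base G) ?p)) (pt ?C (\<alpha> \<Gamma>) (fa (nm_base G) ?p)) (fa (nm_base F) ?p) ?a"
  have d: "d \<in> ars ?C" "src ?C d = fo (nm_base F) (src F.N.C ?p)" "tgt ?C d = src ?C (pb ?C (\<alpha> \<Gamma>) (fa (nm_base G) ?p))"
    "cmp ?C (pb ?C (\<alpha> \<Gamma>) (fa (nm_base G) ?p)) d = fa (nm_base F) ?p" "cmp ?C (pt ?C (\<alpha> \<Gamma>) (fa (nm_base G) ?p)) d = ?a"
    unfolding d_def using A nat by simp_all
  let ?q = "F.M.ext (fo (nm_base G) \<Gamma>) ?GA"
  \<comment> \<open>The underlying map of \<open>nm_tau N M G \<Gamma> A\<close> reindexed along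
    \<open>\<alpha> \<Gamma>\<close>.\<close>
  define k where "k = pb_pair ?C (pb ?C (\<alpha> \<Gamma>) ?q) (pt ?C (\<alpha> \<Gamma>) ?q) (pb ?C (\<alpha> \<Gamma>) (fa (nm_base G) ?p)) (cmp ?C g (pt ?C (\<alpha> \<Gamma>) (fa (nm_base G) ?p)))"
  have k: "k \<in> ars ?C" "src ?C k = src ?C (pb ?C (\<alpha> \<Gamma>) (fa (nm_base G) ?p))" "tgt ?C k = src ?C (pb ?C (\<alpha> \<Gamma>) ?q)"
    "cmp ?C (pb ?C (\<alpha> \<Gamma>) ?q) k = pb ?C (\<alpha> \<Gamma>) (fa (nm_base G) ?p)"
    "cmp ?C (pt ?C (\<alpha> \<Gamma>) ?q) k = cmp ?C g (pt ?C (\<alpha> \<Gamma>) (fa (nm_base G) ?p))"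
    unfolding k_def using A g by (simp_all add: gp)
  have ps: "ext_ps M (\<alpha> \<Gamma>) ?GA \<in> ars ?C" "src ?C (ext_ps M (\<alpha> \<Gamma>) ?GA) = src ?C (pb ?C (\<alpha> \<Gamma>) ?q)"
     "tgt ?C (ext_ps M (\<alpha> \<Gamma>) ?GA) = src ?C (F.M.ext ?X ?B)"
     "cmp ?C (F.M.ext ?X ?B) (ext_ps M (\<alpha> \<Gamma>) ?GA) = pb ?C (\<alpha> \<Gamma>) ?q"
     "fo (ri (n_tm M) (ext_ps M (\<alpha> \<Gamma>) ?GA)) (F.M.var ?X ?B) = fo (ri (n_tm M) (pt ?C (\<alpha> \<Gamma>) ?q)) (F.M.var (fo (nm_base G) \<Gamma>) ?GA)"
     "x \<in> ars ?C \<Longrightarrow> tgt ?C x = src ?C (pb ?C (\<alpha> \<Gamma>) ?q) \<Longrightarrow>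
       cmp ?C (F.M.ext ?X ?B) (cmp ?C (ext_ps M (\<alpha> \<Gamma>) ?GA) x) = cmp ?C (pb ?C (\<alpha> \<Gamma>) ?q) x" for x
    using F.M.ext_ps_simps[of "\<alpha> \<Gamma>" ?GA] A by simp_all
  let ?l' = "cmp ?C (ext_map M ?X (\<mu> \<Gamma> A)) h" and ?r' = "cmp ?C (ext_ps M (\<alpha> \<Gamma>) ?GA) (cmp ?C k d)"
  have lr: "?l = ?r \<longleftrightarrow> ?l' = ?r'"
    using A by (simp add: F.nm_tau_simp G.nm_tau_simp dalpha_def Let_def flip: h_def g_def) (simp flip: k_def d_def)
  have "fa (ri (n_tp M) h) (fa (ri (n_tp M) (F.M.ext ?X ?FA)) (\<mu> \<Gamma> A)) = fa (ri (n_tp M) (fa (nm_base F) ?p)) (\<mu> \<Gamma> A)"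
    using A h by (intro F.M.Tp.ri_pull) simp_all
  then have x: "fo (ri (n_tm M) ?l') (F.M.var ?X ?B) = ?x"
    using A h by (simp add: F.M.Tm.ri_cmp)
  have "fo (ri (n_tm M) ?r') (F.M.var ?X ?B) = fo (ri (n_tm M) d) (fo (ri (n_tm M) k) (fo (ri (n_tm M) (pt ?C (\<alpha> \<Gamma>) ?q)) (F.M.var (fo (nm_base G) \<Gamma>) ?GA)))"
    using A ps k d by (simp add: F.M.Tm.ri_cmp)
  also have "\<dots> = fo (ri (n_tm M) d) (fo (ri (n_tm M) (cmp ?C g (pt ?C (\<alpha> \<Gamma>) (fa (nm_base G) ?p)))) (F.M.var (fo (nm_base G) \<Gamma>) ?GA))"
    using A ps k by (subst F.M.Tm.ri_pull(1)[OF k(5)]) simp_all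
  also have "\<dots> = fo (ri (n_tm M) d) (fo (ri (n_tm M) (pt ?C (\<alpha> \<Gamma>) (fa (nm_base G) ?p))) (G.w \<Gamma> A))"
    using A g by (simp add: F.M.Tm.ri_cmp)
  also have "\<dots> = ?y"
    using A d by (intro F.M.Tm.ri_pull(1)[OF d(5)]) simp_all
  finally have y: "fo (ri (n_tm M) ?r') (F.M.var ?X ?B) = ?y" .
  have "?l' = ?r'" if "?x = ?y"
    by (rule F.M.ext_eqI[of ?X ?B]) (use x y that A h k d ps F.M.B.cmp_pull[OF k(4), of d] in simp_all)
  then show ?thesis using lr x y by metis
qed

text \<open>From universal elements to all terms: the hypothesis is reindexed along the image under
  \<open>F\<close> of the section classifying \<open>t\<close>, and naturality of \<alpha> at this
  section moves the right side.\<close>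

lemma cell_lift:
  assumes x: "\<And>\<Gamma> A. \<Gamma> \<in> obs F.N.C \<Longrightarrow> A \<in> obs (F.N.TY \<Gamma>) \<Longrightarrow>
      push M (fo (nm_base F) (src F.N.C (F.N.ext \<Gamma> A))) (fa (ri (n_tp M) (fa (nm_base F) (F.N.ext \<Gamma> A))) (\<mu> \<Gamma> A)) (F.w \<Gamma> A) =
      fo (ri (n_tm M) (\<alpha> (src F.N.C (F.N.ext \<Gamma> A)))) (G.w \<Gamma> A)"
    and t: "\<Gamma> \<in> obs F.N.C" "t \<in> obs (F.N.TM \<Gamma>)"
  shows "push M (fo (nm_base F) \<Gamma>) (\<mu> \<Gamma> (F.N.typ \<Gamma> t)) (fo (cp (nm_tm F) \<Gamma>) t) = fo (ri (n_tm M) (\<alpha> \<Gamma>)) (fo (cp (nm_tm G) \<Gamma>) t)"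
proof -
  let ?A = "F.N.typ \<Gamma> t"
  let ?p = "F.N.ext \<Gamma> ?A"
  define s where "s = ext_pair N \<Gamma> ?A (idn F.N.C \<Gamma>) t"
  have s: "s \<in> ars F.N.C" "src F.N.C s = \<Gamma>" "tgt F.N.C s = src F.N.C ?p" "cmp F.N.C ?p s = idn F.N.C \<Gamma>"
    unfolding s_def using F.W.section_simps[of \<Gamma> t] t by simp_all
  have Fs: "cmp F.M.C (fa (nm_base F) ?p) (fa (nm_base F) s) = idn F.M.C (fo (nm_base F) \<Gamma>)"
    using t s by (simp flip: F.base.map_simps(5,6))
  have \<mu>: "fa (ri (n_tp M) (fa (nm_base F) s)) (fa (ri (n_tp M) (fa (nm_base F) ?p)) (\<mu> \<Gamma> ?A)) = \<mu> \<Gamma> ?A"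
    using t s F.M.Tp.ri_pull(2)[OF Fs, of "\<mu> \<Gamma> ?A"] by simp
  have tF: "fo (cp (nm_tm F) \<Gamma>) t = fo (ri (n_tm M) (fa (nm_base F) s)) (F.w \<Gamma> ?A)"
    unfolding s_def by (rule F.tm_section[OF t, unfolded F.W.T_ob_def])
  have tG: "fo (cp (nm_tm G) \<Gamma>) t = fo (ri (n_tm M) (fa (nm_base G) s)) (G.w \<Gamma> ?A)"
    unfolding s_def by (rule G.tm_section[OF t, unfolded G.W.T_ob_def])
  have "push M (fo (nm_base F) \<Gamma>) (\<mu> \<Gamma> ?A) (fo (cp (nm_tm F) \<Gamma>) t) =
    fo (ri (n_tm M) (fa (nm_base F) s)) (push M (fo (nm_base F) (src F.N.C ?p)) (fa (ri (n_tp M) (fa (nm_base F) ?p)) (\<mu> \<Gamma> ?A)) (F.w \<Gamma> ?A))"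
    unfolding tF using t s \<mu> by simp
  also have "\<dots> = fo (ri (n_tm M) (fa (nm_base F) s)) (fo (ri (n_tm M) (\<alpha> (src F.N.C ?p))) (G.w \<Gamma> ?A))"
    using x[of \<Gamma> ?A] t by simp
  also have "\<dots> = fo (ri (n_tm M) (cmp F.M.C (fa (nm_base G) s) (\<alpha> \<Gamma>))) (G.w \<Gamma> ?A)"
    using t s tp.natural[of s] by (intro F.M.Tm.ri_pull) simp_all
  also have "\<dots> = fo (ri (n_tm M) (\<alpha> \<Gamma>)) (fo (cp (nm_tm G) \<Gamma>) t)"
    unfolding tG using t s by (simp add: F.M.Tm.ri_cmp)
  finally show ?thesis .
qed

end

lemma (in nm_cell) is_cwa_cell_C_cell: "is_cwa_cell (C_ob N) (C_ob M) (C_cell N M a)"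
proof -
  interpret nm_par U N M "nc_src a" "nc_tgt a" "nc_base a" "nc_tp a" by unfold_locales
  have "push M (fo (nm_base (nc_src a)) (src F.N.C (F.N.ext \<Gamma> A)))
        (fa (ri (n_tp M) (fa (nm_base (nc_src a)) (F.N.ext \<Gamma> A))) (nc_tp a \<Gamma> A)) (F.w \<Gamma> A) =
      fo (ri (n_tm M) (nc_base a (src F.N.C (F.N.ext \<Gamma> A)))) (G.w \<Gamma> A)"
    if A: "\<Gamma> \<in> obs F.N.C" "A \<in> obs (F.N.TY \<Gamma>)" for \<Gamma> A
    \<comment> \<open>The component of \<open>nc_tm a\<close> at the universal element projects to
      \<open>nc_tp a\<close> at \<open>A[p]\<close>, which by \<open>mu_mod\<close> is the reindexed
      \<open>nc_tp a \<Gamma> A\<close>. Hence \<open>push_ar\<close> computes the target of the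
      lift.\<close>
    using A F.M.push_ar[of "fo (nm_base (nc_src a)) (src F.N.C (F.N.ext \<Gamma> A))" "nc_tm a (src F.N.C (F.N.ext \<Gamma> A)) (F.N.var \<Gamma> A)"]
    by (simp add: Tp.mu_mod)
  then show ?thesis
    using cell_iff F.is_cwa_mor_C_mor G.is_cwa_mor_C_mor nm_cell
    by (simp add: is_cwa_cell_def Let_def C_cell_def is_nm_cell_def C_mor_def)
qed

lemma C_cell_inj:
  assumes "nm_cell U N M a" "nm_cell U N M b" "C_cell N M a = C_cell N M b"
  shows "a = b"
proof -
  interpret a: nm_cell U N M a by fact
  interpret b: nm_cell U N M b by fact
  from assms(3) have eq: "nc_base a = nc_base b" "nc_tp a = nc_tp b" "C_mor N M (nc_src a) = C_mor N M (nc_src b)"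
    "C_mor N M (nc_tgt a) = C_mor N M (nc_tgt b)" by (simp_all add: C_cell_def)
  have eq': "nc_src a = nc_src b" "nc_tgt a = nc_tgt b"
    using eq(3,4) C_mor_inj[OF a.F.nm_mor_axioms b.F.nm_mor_axioms] C_mor_inj[OF a.G.nm_mor_axioms b.G.nm_mor_axioms] by simp_all
  have "nc_tm a = nc_tm b"
  proof (rule itrans_eqI[OF a.norms(3) b.norms(3)])
    fix \<Gamma> t assume t: "\<Gamma> \<in> obs a.F.N.C" "t \<in> obs (a.F.N.TM \<Gamma>)"
    have X: "fo (nm_base (nc_src a)) \<Gamma> = fo (nm_base (nc_src b)) \<Gamma>" using eq' by simp
    note A = a.Tm.mu_simps(1,2)[OF t(1) X t(2)] a.proj_simps[OF t(1) X[symmetric] t(2)]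
    show "nc_tm a \<Gamma> t = nc_tm b \<Gamma> t"
      using t A by - (rule a.F.M.lift_unique[of "fo (nm_base (nc_src b)) \<Gamma>"]; simp add: eq eq')
  qed
  then show ?thesis using eq eq' by (intro nm_cell_eqI) simp_all
qed

definition cell_tm :: "'u prenm \<Rightarrow> 'u prenm \<Rightarrow> 'u nm_mor \<Rightarrow> ('u \<Rightarrow> 'u \<Rightarrow> 'u) \<Rightarrow> 'u \<Rightarrow> 'u \<Rightarrow> 'u" where
  "cell_tm N M F \<mu> = itrans_norm (n_base N) (n_tm N) (\<lambda>\<Gamma> t. dlift (fib (n_tm M) (fo (nm_base F) \<Gamma>)) (cp (n_proj M) (fo (nm_base F) \<Gamma>))
     (\<mu> \<Gamma> (fo (cp (n_proj N) \<Gamma>) t)) (fo (cp (nm_tm F) \<Gamma>) t))"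

definition C_inv_cell :: "'u prenm \<Rightarrow> 'u prenm \<Rightarrow> 'u cwa_cell \<Rightarrow> 'u nm_cell" where
  "C_inv_cell N M b = \<lparr>nc_src = C_inv N M (cc_src b), nc_tgt = C_inv N M (cc_tgt b), nc_base = cc_base b,
    nc_tp = cc_tp b, nc_tm = cell_tm N M (C_inv N M (cc_src b)) (cc_tp b)\<rparr>"

lemma C_inv_cell:
  assumes "is_prenm U N" "is_prenm U M" "is_cwa_cell (C_ob N) (C_ob M) b"
  shows "nm_cell U N M (C_inv_cell N M b)" "C_cell N M (C_inv_cell N M b) = b"
proof -
  let ?F = "C_inv N M (cc_src b)" and ?G = "C_inv N M (cc_tgt b)"
  have FG: "is_cwa_mor (C_ob N) (C_ob M) (cc_src b)" "is_cwa_mor (C_ob N) (C_ob M) (cc_tgt b)"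
    using assms(3) by (simp_all add: is_cwa_cell_def Let_def)
  note F = C_inv[OF assms(1,2) FG(1)] and G = C_inv[OF assms(1,2) FG(2)]
  show eq: "C_cell N M (C_inv_cell N M b) = b" by (cases b) (use F G in \<open>simp add: C_cell_def C_inv_cell_def\<close>)
  have src: "cc_src b = C_mor N M ?F" and tgt: "cc_tgt b = C_mor N M ?G" using F G by simp_all
  interpret F: nm_mor U N M ?F by (rule F)
  interpret G: nm_mor U N M ?G by (rule G)
  have bs: "cm_base (cc_src b) = nm_base ?F" "cm_tp (cc_src b) = nm_tp ?F" "cm_tau (cc_src b) = nm_tau N M ?F"
    "cm_base (cc_tgt b) = nm_base ?G" "cm_tp (cc_tgt b) = nm_tp ?G" "cm_tau (cc_tgt b) = nm_tau N M ?G"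
    using arg_cong[OF src, of cm_base] arg_cong[OF src, of cm_tp] arg_cong[OF src, of cm_tau]
     arg_cong[OF tgt, of cm_base] arg_cong[OF tgt, of cm_tp] arg_cong[OF tgt, of cm_tau] by (simp_all add: C_mor_def)
  note b = assms(3)[unfolded is_cwa_cell_def Let_def bs C_ob_simps]
  interpret base: nat_trans "n_base N" "n_base M" "nm_base ?F" "nm_base ?G" "cc_base b" using b by blast
  interpret tp: strict_trans "n_base N" "n_base M" "nm_base ?F" "nm_base ?G" "cc_base b" "n_tp N" "n_tp M" "nm_tp ?F" "nm_tp ?G" "cc_tp b"
    using b trans_over_iff[OF F.Tp.strict_mor_axioms G.Tp.strict_mor_axioms base.nat_trans_axioms] by blast
  interpret nm_par U N M ?F ?G "cc_base b" "cc_tp b" by unfold_locales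
  have "push M (fo (nm_base ?F) (src F.N.C (F.N.ext \<Gamma> A))) (fa (ri (n_tp M) (fa (nm_base ?F) (F.N.ext \<Gamma> A))) (cc_tp b \<Gamma> A)) (F.w \<Gamma> A) =
      fo (ri (n_tm M) (cc_base b (src F.N.C (F.N.ext \<Gamma> A)))) (G.w \<Gamma> A)" if "\<Gamma> \<in> obs F.N.C" "A \<in> obs (F.N.TY \<Gamma>)" for \<Gamma> A
    using b that by (subst cell_iff[symmetric]) simp_all
  \<comment> \<open>This gives the lifts in \<open>cell_tm\<close> their required targets;
    naturality and compatibility with reindexing then follow from uniqueness of lifts.\<close>
  note lift = cell_lift[OF this]
  let ?\<mu> = "cell_tm N M ?F (cc_tp b)"
  have \<mu>: "?\<mu> \<Gamma> t \<in> ars (F.M.TM X)" "src (F.M.TM X) (?\<mu> \<Gamma> t) = fo (cp (nm_tm ?F) \<Gamma>) t"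
    "tgt (F.M.TM X) (?\<mu> \<Gamma> t) = fo (ri (n_tm M) (cc_base b \<Gamma>)) (fo (cp (nm_tm ?G) \<Gamma>) t)"
    "fa (cp (n_proj M) X) (?\<mu> \<Gamma> t) = cc_tp b \<Gamma> (F.N.typ \<Gamma> t)"
    if "\<Gamma> \<in> obs F.N.C" "fo (nm_base ?F) \<Gamma> = X" "t \<in> obs (F.N.TM \<Gamma>)" for \<Gamma> t X
    using that lift[of \<Gamma> t] by (auto simp: cell_tm_def push_def)
  have tm: "strict_trans F.N.C F.M.C (nm_base ?F) (nm_base ?G) (cc_base b) (n_tm N) (n_tm M) (nm_tm ?F) (nm_tm ?G) ?\<mu>"
  proof (rule strict_transI[OF F.Tm.strict_mor_axioms G.Tm.strict_mor_axioms base.nat_trans_axioms \<mu>(1-3)], assumption+, goal_cases)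
    case (1 \<Gamma> k)
    then show ?case
      using tp.mu_nat[of \<Gamma> "fa (cp (n_proj N) \<Gamma>) k"]
      by - (rule F.M.lift_unique[of "fo (nm_base ?F) \<Gamma>"]; simp add: \<mu>)
  next
    case (2 u \<Delta> t)
    then have D: "\<Delta> = src F.N.C u" by simp
    show ?case using 2(1,3) unfolding D
      using base.natural[of u] F.M.Tm.ri_cmp[of "cc_base b (tgt F.N.C u)" "fa (nm_base ?F) u"]
      by - (rule F.M.lift_unique[of "fo (nm_base ?F) (src F.N.C u)"]; simp add: \<mu> tp.mu_mod F.Tm.nat_ob)
  qed
  show "nm_cell U N M (C_inv_cell N M b)"
    by (rule nm_cellI) (use b tm in \<open>simp_all add: C_inv_cell_def F.nm_mor_axioms G.nm_mor_axioms base.nat_trans_axioms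
      tp.strict_trans_axioms trans_over_def \<mu>\<close>, simp_all add: cell_tm_def)
qed

section \<open>Preservation of the operations\<close>

lemma (in prenm) C_mor_id: "C_mor N N (nm_id N) = cwa_id (C_ob N)"
proof -
  interpret I: nm_mor U N N "nm_id N" by (rule nm_mor_id[OF prenm])
  have "nm_tau N N (nm_id N) = cm_tau (cwa_id (C_ob N))"
  proof (rule itrans_eqI[of C "n_tp N"])
    fix \<Gamma> A assume A: "\<Gamma> \<in> obs C" "A \<in> obs (TY \<Gamma>)"
    have "ext_pair N \<Gamma> A (ext \<Gamma> A) (var \<Gamma> A) = idn C (src C (ext \<Gamma> A))"
      by (rule ext_eqI[of \<Gamma> A]) (use A in simp_all)
    then show "nm_tau N N (nm_id N) \<Gamma> A = cm_tau (cwa_id (C_ob N)) \<Gamma> A"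
      using A by (simp add: cwa_id_def nm_tau_def Let_def)
  qed (simp_all add: cwa_id_def)
  then show ?thesis by (simp add: C_mor_def cwa_id_def)
qed

lemma C_mor_cmp:
  assumes "nm_mor U N M F" "nm_mor U M L G"
  shows "C_mor N L (nm_cmp N M L G F) = cwa_cmp (C_ob N) (C_ob M) (C_ob L) (C_mor M L G) (C_mor N M F)"
proof -
  interpret F: nm_mor U N M F by fact
  interpret G: nm_mor U M L G by fact
  interpret GF: nm_mor U N L "nm_cmp N M L G F" by (rule nm_mor_comp[OF assms])
  have "nm_tau N L (nm_cmp N M L G F) = cm_tau (cwa_cmp (C_ob N) (C_ob M) (C_ob L) (C_mor M L G) (C_mor N M F))"
  proof (rule itrans_eqI[of F.N.C "n_tp N"])
    fix \<Gamma> A assume A: "\<Gamma> \<in> obs F.N.C" "A \<in> obs (F.N.TY \<Gamma>)"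
    let ?X = "fo (nm_base F) \<Gamma>" and ?FA = "fo (cp (nm_tp F) \<Gamma>) A" and ?p = "F.N.ext \<Gamma> A"
    let ?Y = "fo (nm_base G) ?X" and ?GA = "fo (cp (nm_tp G) ?X) ?FA"
    define h where "h = ext_pair M ?X ?FA (fa (nm_base F) ?p) (F.w \<Gamma> A)"
    have h: "h \<in> ars F.M.C" "src F.M.C h = fo (nm_base F) (src F.N.C ?p)" "tgt F.M.C h = src F.M.C (F.M.ext ?X ?FA)" 
      "cmp F.M.C (F.M.ext ?X ?FA) h = fa (nm_base F) ?p" "fo (ri (n_tm M) h) (F.M.var ?X ?FA) = F.w \<Gamma> A"
      unfolding h_def using A by simp_all
    have Gh: "cmp G.M.C (fa (nm_base G) (F.M.ext ?X ?FA)) (fa (nm_base G) h) = fa (nm_base G) (fa (nm_base F) ?p)"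
      using A h by (simp flip: G.base.map_simps(6))
    \<comment> \<open>\<open>F.w \<Gamma> A\<close> is the universal element of \<open>M\<close> at
      \<open>F A\<close> reindexed along \<open>h\<close>, and the action of \<open>G\<close> on
      terms commutes with this reindexing.\<close>
    have Gw: "fo (ri (n_tm L) (fa (nm_base G) h)) (G.w ?X ?FA) = fo (cp (nm_tm G) (fo (nm_base F) (src F.N.C ?p))) (F.w \<Gamma> A)"
      using A h(1-3) by (simp flip: h(5) add: G.Tm.nat_ob)
    have "ext_pair L ?Y ?GA (fa (nm_base G) (fa (nm_base F) ?p)) (fo (cp (nm_tm G) (fo (nm_base F) (src F.N.C ?p))) (F.w \<Gamma> A)) =
      cmp G.M.C (ext_pair L ?Y ?GA (fa (nm_base G) (F.M.ext ?X ?FA)) (G.w ?X ?FA)) (fa (nm_base G) h)"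
      by (rule G.M.ext_eqI[of ?Y ?GA]) (use A h Gh Gw in \<open>simp_all add: G.M.Tm.ri_cmp\<close>)
    then show "nm_tau N L (nm_cmp N M L G F) \<Gamma> A = cm_tau (cwa_cmp (C_ob N) (C_ob M) (C_ob L) (C_mor M L G) (C_mor N M F)) \<Gamma> A"
      using A by (simp add: cwa_cmp_def C_mor_def Let_def F.nm_tau_simp G.nm_tau_simp GF.nm_tau_simp flip: h_def)
  qed (simp_all add: cwa_cmp_def)
  then show ?thesis by (simp add: C_mor_def cwa_cmp_def)
qed

lemma C_cell_ops:
  "C_cell N M (idn (nm_hom N M) F) = idn (cwa_hom (C_ob N) (C_ob M)) (C_mor N M F)"
  "C_cell N M (cmp (nm_hom N M) b a) = cmp (cwa_hom (C_ob N) (C_ob M)) (C_cell N M b) (C_cell N M a)"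
  by (simp_all add: C_cell_def nm_hom_def cwa_hom_def C_mor_def)

lemma C_cell_hcmp:
  assumes "nm_cell U N M a" "nm_cell U M L b"
  shows "C_cell N L (nm_cmp2 N M L b a) = cwa_cmp2 (C_ob N) (C_ob M) (C_ob L) (C_cell M L b) (C_cell N M a)"
proof -
  interpret a: nm_cell U N M a by fact
  interpret b: nm_cell U M L b by fact
  show ?thesis
    by (simp add: C_cell_def nm_cmp2_def cwa_cmp2_def C_mor_cmp[OF a.F.nm_mor_axioms b.F.nm_mor_axioms]
      C_mor_cmp[OF a.G.nm_mor_axioms b.G.nm_mor_axioms]) (simp add: C_mor_def)
qed

section \<open>The pre-natural model of a pre-CwA\<close>

lemma cat_norm_idem [simp]: "cat_norm (cat_norm C) = cat_norm C"
  by (cases C) (auto simp: cat_norm_def fun_eq_iff)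

lemma cat_norm_sets [simp]: "obs (cat_norm C) = obs C" "ars (cat_norm C) = ars C"
  by (simp_all add: cat_norm_def)

lemma icat_norm_idem: 
  assumes "\<And>u. u \<in> ars C \<Longrightarrow> src C u \<in> obs C \<and> tgt C u \<in> obs C"
  shows "icat_norm C (icat_norm C E) = icat_norm C E"
  using assms by (auto simp: icat_norm_def fnc_norm_def fun_eq_iff)

lemma sfib_simps [simp]:
  "(p, s) \<in> obs (sfib C \<Gamma>) \<longleftrightarrow> (p \<in> ars C \<and> p \<in> dsp C \<and> tgt C p = \<Gamma>) \<and> s \<in> ars C \<and> src C s = \<Gamma> \<and> tgt C s = src C p \<and> cmp C p s = idn C \<Gamma>"
  "(x, y, h) \<in> ars (sfib C \<Gamma>) \<longleftrightarrow> x \<in> obs (sfib C \<Gamma>) \<and> y \<in> obs (sfib C \<Gamma>) \<and> (fst x, fst y, h) \<in> ars (dfib C \<Gamma>) \<and> cmp C h (snd x) = snd y"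
  "src (sfib C \<Gamma>) (x, y, h) = x" "tgt (sfib C \<Gamma>) (x, y, h) = y"
  "idn (sfib C \<Gamma>) (p, s) = ((p, s), (p, s), idn C (src C p))"
  "cmp (sfib C \<Gamma>) (y', z, k) (x, y, h) = (x, z, cmp C k h)"
  by (auto simp: sfib_def Let_def split: prod.splits)

lemma varpi_simps [simp]:
  "fo (cp (varpi C) \<Gamma>) x = fst x" "fa (cp (varpi C) \<Gamma>) (x, y, h) = (fst x, fst y, h)"
  by (simp_all add: varpi_def)

lemma sic_simps [simp]: "fib (sic C) = sfib C" "fo (ri (sic C) u) x = section_pb C u x"
  by (simp_all add: sic_def)

text \<open>A map of displays acts on sections by composition, so the lift and its endpoint are
  forced.\<close>

lemma (in display_category) dlift_varpi:
  assumes "(p, q, h) \<in> ars (dfib C \<Gamma>)" "(p, s) \<in> obs (sfib C \<Gamma>)"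
  shows "dlift (sfib C \<Gamma>) (cp (varpi C) \<Gamma>) (p, q, h) (p, s) = ((p, s), (q, cmp C h s), h)"
  unfolding dlift_def
proof (rule the_equality, goal_cases)
  case 1 show ?case using assms by (simp add: cmp_pull[of q h p s])
next
  case (2 k)
  obtain x y l where "k = (x, y, l)" by (cases k)
  with 2 show ?case by (cases x; cases y) simp
qed

section \<open>Lifts of a map through a display, and sections of the reindexed type\<close>

definition cmar :: "'u precwa \<Rightarrow> 'u \<Rightarrow> 'u \<Rightarrow> 'u" where
  "cmar X \<Gamma> f = und (fa (cp (c_comp X) \<Gamma>) f)"

definition rho :: "'u precwa \<Rightarrow> 'u \<Rightarrow> 'u \<Rightarrow> 'u" where
  "rho X u A = und (ps (c_comp X) u A)"

text \<open>The correspondence behind representability: a lift \<open>k\<close> of \<open>u\<close>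
  through \<open>comp A\<close> amounts to a section of the pullback along \<open>u\<close>, and
  \<open>rho\<close> carries that to a section of \<open>comp (A[u])\<close>.\<close>

definition sh :: "'u precwa \<Rightarrow> 'u \<Rightarrow> 'u \<Rightarrow> 'u \<Rightarrow> 'u" where
  "sh X u A k = (let C = c_base X; p = fo (cp (c_comp X) (tgt C u)) A in
     cmp C (rho X u A) (pb_pair C (pb C u p) (pt C u p) (idn C (src C u)) k))"

locale precwa = is_universe U for U :: "'u universe" + fixes X :: "'u precwa"
  assumes precwa: "is_precwa U X"
begin

abbreviation "C \<equiv> c_base X"
abbreviation "TY \<equiv> fib (c_tp X)"
abbreviation "TM \<equiv> fib (P_tm U X)"
abbreviation "p \<Gamma> A \<equiv> fo (cp (c_comp X) \<Gamma>) A"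

end

sublocale precwa \<subseteq> B: display_category "c_base X"
  using precwa by (simp add: is_precwa_def)

sublocale precwa \<subseteq> T: strict_indexed_category "c_base X" "c_tp X"
  using precwa by (simp add: is_precwa_def)

sublocale precwa \<subseteq> comp: indexed_functor "c_base X" "c_tp X" "dic (c_base X)" "c_comp X"
  using precwa by (simp add: is_precwa_def)

context precwa
begin

lemma comp_simps [simp]:
  assumes "\<Gamma> \<in> obs C" "A \<in> obs (TY \<Gamma>)"
  shows "p \<Gamma> A \<in> dsp C" "tgt C (p \<Gamma> A) = \<Gamma>"
  using comp.cp_simps(1)[OF assms] by simp_all

lemma fa_comp [simp]:
  assumes "\<Gamma> \<in> obs C" "f \<in> ars (TY \<Gamma>)"
  shows "fa (cp (c_comp X) \<Gamma>) f = (p \<Gamma> (src (TY \<Gamma>) f), p \<Gamma> (tgt (TY \<Gamma>) f), cmar X \<Gamma> f)"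
  using comp.cp_simps(3,4)[OF assms] by (cases "fa (cp (c_comp X) \<Gamma>) f") (simp add: cmar_def)

lemma cmar_simps [simp]:
  assumes "\<Gamma> \<in> obs C" "f \<in> ars (TY \<Gamma>)" "src (TY \<Gamma>) f = A" "tgt (TY \<Gamma>) f = B"
  shows "cmar X \<Gamma> f \<in> ars C" "src C (cmar X \<Gamma> f) = src C (p \<Gamma> A)" "tgt C (cmar X \<Gamma> f) = src C (p \<Gamma> B)"
    "cmp C (p \<Gamma> B) (cmar X \<Gamma> f) = p \<Gamma> A"
    "h \<in> ars C \<Longrightarrow> tgt C h = src C (p \<Gamma> A) \<Longrightarrow> cmp C (p \<Gamma> B) (cmp C (cmar X \<Gamma> f) h) = cmp C (p \<Gamma> A) h"
proof -
  show *: "cmar X \<Gamma> f \<in> ars C" "src C (cmar X \<Gamma> f) = src C (p \<Gamma> A)" "tgt C (cmar X \<Gamma> f) = src C (p \<Gamma> B)"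
    "cmp C (p \<Gamma> B) (cmar X \<Gamma> f) = p \<Gamma> A"
    using comp.cp_simps(2)[OF assms(1,2)] assms by simp_all
  have "B \<in> obs (TY \<Gamma>)" using assms by auto
  then show "h \<in> ars C \<Longrightarrow> tgt C h = src C (p \<Gamma> A) \<Longrightarrow> cmp C (p \<Gamma> B) (cmp C (cmar X \<Gamma> f) h) = cmp C (p \<Gamma> A) h"
    using B.cmp_pull[OF *(4), of h] * assms by simp
qed

lemma cmar_idn [simp]: "\<Gamma> \<in> obs C \<Longrightarrow> A \<in> obs (TY \<Gamma>) \<Longrightarrow> cmar X \<Gamma> (idn (TY \<Gamma>) A) = idn C (src C (p \<Gamma> A))"
  using comp.cp_simps(5)[of \<Gamma> A] by simp

lemma cmar_cmp:
  assumes "\<Gamma> \<in> obs C" "g \<in> ars (TY \<Gamma>)" "f \<in> ars (TY \<Gamma>)" "src (TY \<Gamma>) g = tgt (TY \<Gamma>) f"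
  shows "cmar X \<Gamma> (cmp (TY \<Gamma>) g f) = cmp C (cmar X \<Gamma> g) (cmar X \<Gamma> f)"
  using comp.cp_simps(6)[OF assms] assms by simp

lemma ps_comp [simp]:
  assumes "u \<in> ars C" "A \<in> obs (TY (tgt C u))"
  shows "ps (c_comp X) u A = (pb C u (p (tgt C u) A), p (src C u) (fo (ri (c_tp X) u) A), rho X u A)"
  using comp.ps_simps(2,3)[OF assms(1) refl assms(2)] by (cases "ps (c_comp X) u A") (simp add: rho_def)

lemma rho_simps [simp]:
  assumes "u \<in> ars C" "A \<in> obs (TY (tgt C u))" "src C u = \<Delta>"
  shows "rho X u A \<in> ars C" "src C (rho X u A) = src C (pb C u (p (tgt C u) A))"
    "tgt C (rho X u A) = src C (p \<Delta> (fo (ri (c_tp X) u) A))"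
    "cmp C (p \<Delta> (fo (ri (c_tp X) u) A)) (rho X u A) = pb C u (p (tgt C u) A)"
    "h \<in> ars C \<Longrightarrow> tgt C h = src C (pb C u (p (tgt C u) A)) \<Longrightarrow>
      cmp C (p \<Delta> (fo (ri (c_tp X) u) A)) (cmp C (rho X u A) h) = cmp C (pb C u (p (tgt C u) A)) h"
    "is_iso C (rho X u A)"
proof -
  show *: "rho X u A \<in> ars C" "src C (rho X u A) = src C (pb C u (p (tgt C u) A))"
    "tgt C (rho X u A) = src C (p \<Delta> (fo (ri (c_tp X) u) A))"
    "cmp C (p \<Delta> (fo (ri (c_tp X) u) A)) (rho X u A) = pb C u (p (tgt C u) A)"
    using comp.ps_simps(1)[OF assms(1) refl assms(2)] assms by simp_all
  have "\<Delta> \<in> obs C" using assms by auto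
  then show "h \<in> ars C \<Longrightarrow> tgt C h = src C (pb C u (p (tgt C u) A)) \<Longrightarrow>
      cmp C (p \<Delta> (fo (ri (c_tp X) u) A)) (cmp C (rho X u A) h) = cmp C (pb C u (p (tgt C u) A)) h"
    using B.cmp_pull[OF *(4), of h] * assms by simp
  show "is_iso C (rho X u A)" using comp.ps_simps(4)[OF assms(1) refl assms(2)] assms by (simp add: B.dfib_isoD)
qed

definition sec :: "'u \<Rightarrow> 'u \<Rightarrow> 'u set" where
  "sec \<Gamma> A = {s. s \<in> ars C \<and> src C s = \<Gamma> \<and> tgt C s = src C (p \<Gamma> A) \<and> cmp C (p \<Gamma> A) s = idn C \<Gamma>}"

lemma sec_simps:
  "s \<in> sec \<Gamma> A \<Longrightarrow> s \<in> ars C" "s \<in> sec \<Gamma> A \<Longrightarrow> src C s = \<Gamma>"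
  "s \<in> sec \<Gamma> A \<Longrightarrow> tgt C s = src C (p \<Gamma> A)" "s \<in> sec \<Gamma> A \<Longrightarrow> cmp C (p \<Gamma> A) s = idn C \<Gamma>"
  by (auto simp: sec_def)

lemma sec_pull:
  assumes "s \<in> sec \<Gamma> A" "\<Gamma> \<in> obs C" "A \<in> obs (TY \<Gamma>)" "u \<in> ars C" "tgt C u = \<Gamma>"
  shows "cmp C (p \<Gamma> A) (cmp C s u) = u"
  using B.cmp_pull[OF sec_simps(4)[OF assms(1)], of u] assms by (simp add: sec_simps)

text \<open>The domain of the correspondence \<open>sh X u A\<close>; its values lie in
  \<open>sec\<close>.\<close>

definition over :: "'u \<Rightarrow> 'u \<Rightarrow> 'u \<Rightarrow> bool" where
  "over u A k \<longleftrightarrow> u \<in> ars C \<and> A \<in> obs (TY (tgt C u)) \<and> k \<in> ars C \<and> src C k = src C u \<and> tgt C k = src C (p (tgt C u) A) \<and>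
     cmp C (p (tgt C u) A) k = u"

lemma overD:
  assumes "over u A k"
  shows "u \<in> ars C" "A \<in> obs (TY (tgt C u))" "k \<in> ars C" "src C k = src C u" "tgt C k = src C (p (tgt C u) A)"
    "cmp C (p (tgt C u) A) k = u"
  using assms by (simp_all add: over_def)

lemma sh_pair:
  assumes "over u A k"
  defines "l \<equiv> pb_pair C (pb C u (p (tgt C u) A)) (pt C u (p (tgt C u) A)) (idn C (src C u)) k"
  shows "l \<in> ars C" "src C l = src C u" "tgt C l = src C (pb C u (p (tgt C u) A))" "cmp C (pb C u (p (tgt C u) A)) l = idn C (src C u)"
    "cmp C (pt C u (p (tgt C u) A)) l = k" "sh X u A k = cmp C (rho X u A) l"
  unfolding l_def sh_def Let_def using overD[OF assms(1)] by simp_all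

lemma sh_sec:
  assumes "over u A k" shows "sh X u A k \<in> sec (src C u) (fo (ri (c_tp X) u) A)"
  using sh_pair[OF assms] overD[OF assms] by (simp add: sec_def)

text \<open>\<open>rho\<close> is invertible and \<open>k\<close> is a leg of the pairing, so
  \<open>k\<close> can be recovered from \<open>sh X u A k\<close>.\<close>

lemma sh_eq_iff:
  assumes "over u A k" "over u A k'" shows "sh X u A k = sh X u A k' \<longleftrightarrow> k = k'"
proof
  assume eq: "sh X u A k = sh X u A k'"
  note k = sh_pair[OF assms(1)] and k' = sh_pair[OF assms(2)] and u = overD[OF assms(1)]
  from u obtain r where r: "inverse_ars C (rho X u A) r" using rho_simps(6)[of u A] by (auto simp: is_iso_def)
  then have r': "r \<in> ars C" "src C r = src C (p (src C u) (fo (ri (c_tp X) u) A))" "cmp C r (rho X u A) = idn C (src C (rho X u A))"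
    using u by (simp_all add: inverse_ars_def)
  have "cmp C r (sh X u A k) = cmp C r (sh X u A k')" by (simp add: eq)
  then have "pb_pair C (pb C u (p (tgt C u) A)) (pt C u (p (tgt C u) A)) (idn C (src C u)) k =
    pb_pair C (pb C u (p (tgt C u) A)) (pt C u (p (tgt C u) A)) (idn C (src C u)) k'"
    unfolding k(6) k'(6) using k(1-3) k'(1-3) u r' B.cmp_pull[OF r'(3)] by simp
  then show "k = k'" using k(5) k'(5) by metis
qed simp

text \<open>The preimage of \<open>s\<close> is found by undoing \<open>rho\<close> and taking the
  leg that lies above \<open>u\<close>.\<close>

lemma sh_surj:
  assumes "u \<in> ars C" "A \<in> obs (TY (tgt C u))" "s \<in> sec (src C u) (fo (ri (c_tp X) u) A)"
  obtains k where "over u A k" "sh X u A k = s"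
proof -
  from assms obtain r where r: "inverse_ars C (rho X u A) r" using rho_simps(6)[of u A] by (auto simp: is_iso_def)
  let ?p = "p (tgt C u) A" and ?q = "p (src C u) (fo (ri (c_tp X) u) A)"
  have r': "r \<in> ars C" "src C r = src C ?q" "tgt C r = src C (pb C u ?p)" "cmp C (rho X u A) r = idn C (src C ?q)"
    using r assms by (simp_all add: inverse_ars_def)
  note s = sec_simps[OF assms(3)]
  have "cmp C ?q (cmp C (rho X u A) r) = cmp C (pb C u ?p) r" using assms r'(1-3) by simp
  then have 1: "cmp C (pb C u ?p) r = ?q" using assms r' by simp
  have rs: "cmp C (pb C u ?p) (cmp C r s) = idn C (src C u)" using B.cmp_pull[OF 1, of s] assms r' s by simp
  have ov: "over u A (cmp C (pt C u ?p) (cmp C r s))"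
    using assms r' s rs by (simp add: over_def)
  have "pb_pair C (pb C u ?p) (pt C u ?p) (idn C (src C u)) (cmp C (pt C u ?p) (cmp C r s)) = cmp C r s"
    by (rule B.pb_eqI[of ?p u]) (use assms r' s rs sh_pair[OF ov] in simp_all)
  then have "sh X u A (cmp C (pt C u ?p) (cmp C r s)) = s"
    using sh_pair(6)[OF ov] B.cmp_pull[OF r'(4), of s] assms r' s by simp
  with ov show thesis by (rule that)
qed

text \<open>The unit law \<open>ps_un\<close>: as types are strict, it says that \<open>rho\<close>
  at an identity cancels the unitor \<open>c\<close> of the displays.\<close>

lemma sh_idn:
  assumes "\<Gamma> \<in> obs C" "A \<in> obs (TY \<Gamma>)" "s \<in> sec \<Gamma> A"
  shows "sh X (idn C \<Gamma>) A s = s"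
proof -
  let ?c = "pb_pair C (pb C (idn C \<Gamma>) (p \<Gamma> A)) (pt C (idn C \<Gamma>) (p \<Gamma> A)) (p \<Gamma> A) (idn C (src C (p \<Gamma> A)))"
  have c: "cmp C (rho X (idn C \<Gamma>) A) ?c = idn C (src C (p \<Gamma> A))"
    using comp.ps_un[of \<Gamma> A] assms by (simp add: T.un_strict)
  define c where "c = ?c"
  have c': "c \<in> ars C" "src C c = src C (p \<Gamma> A)" "tgt C c = src C (pb C (idn C \<Gamma>) (p \<Gamma> A))"
    "cmp C (pb C (idn C \<Gamma>) (p \<Gamma> A)) c = p \<Gamma> A" "cmp C (pt C (idn C \<Gamma>) (p \<Gamma> A)) c = idn C (src C (p \<Gamma> A))"
    unfolding c_def using assms by simp_all
  note s = sec_simps[OF assms(3)]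
  have "over (idn C \<Gamma>) A s" using assms s by (simp add: over_def)
  note l = sh_pair[OF this]
  have "pb_pair C (pb C (idn C \<Gamma>) (p \<Gamma> A)) (pt C (idn C \<Gamma>) (p \<Gamma> A)) (idn C \<Gamma>) s = cmp C c s"
    by (rule B.pb_eqI[of "p \<Gamma> A" "idn C \<Gamma>"]) (use assms s c' l(1-5) B.cmp_pull[OF c'(4), of s] B.cmp_pull[OF c'(5), of s] in simp_all)
  then show ?thesis using l(6) B.cmp_pull[OF c[folded c_def], of s] assms s c' by simp
qed

text \<open>The composition law \<open>ps_cm\<close> read on sections. Shifting along
  \<open>cmp C u v\<close> is done in two stages, where the intermediate lift of \<open>v\<close> is
  the pairing of \<open>v\<close> and \<open>l\<close> followed by \<open>rho\<close>.\<close>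

lemma sh_cmp:
  assumes "u \<in> ars C" "v \<in> ars C" "src C u = tgt C v" "A \<in> obs (TY (tgt C u))" "over (cmp C u v) A l"
  shows "sh X (cmp C u v) A l = sh X v (fo (ri (c_tp X) u) A)
    (cmp C (rho X u A) (pb_pair C (pb C u (p (tgt C u) A)) (pt C u (p (tgt C u) A)) v l))"
proof -
  let ?p = "p (tgt C u) A" and ?A = "fo (ri (c_tp X) u) A" and ?w = "cmp C u v"
  let ?q = "p (tgt C v) ?A"
  have l: "l \<in> ars C" "src C l = src C v" "tgt C l = src C ?p" "cmp C ?p l = cmp C u v"
    using overD[OF assms(5)] assms(1-4) by simp_all
  define m where "m = pb_pair C (pb C u ?p) (pt C u ?p) v l"
  have m: "m \<in> ars C" "src C m = src C v" "tgt C m = src C (pb C u ?p)" "cmp C (pb C u ?p) m = v" "cmp C (pt C u ?p) m = l"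
    unfolding m_def using assms l by simp_all
  \<comment> \<open>\<open>c\<close> is the compositor of the displays, \<open>d\<close> is
    \<open>rho X u A\<close> reindexed along \<open>v\<close>, and \<open>e\<close> is the section
    of the iterated pullback with second leg \<open>m\<close>. Both sides of the claim factor
    through \<open>e\<close>.\<close>
  define c where "c = pb_pair C (pb C ?w ?p) (pt C ?w ?p) (pb C v (pb C u ?p)) (cmp C (pt C u ?p) (pt C v (pb C u ?p)))"
  have c: "c \<in> ars C" "src C c = src C (pb C v (pb C u ?p))" "tgt C c = src C (pb C ?w ?p)"
    "cmp C (pb C ?w ?p) c = pb C v (pb C u ?p)" "cmp C (pt C ?w ?p) c = cmp C (pt C u ?p) (pt C v (pb C u ?p))"
    unfolding c_def using assms by simp_all
  define d where "d = pb_pair C (pb C v ?q) (pt C v ?q) (pb C v (pb C u ?p)) (cmp C (rho X u A) (pt C v (pb C u ?p)))"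
  have d: "d \<in> ars C" "src C d = src C (pb C v (pb C u ?p))" "tgt C d = src C (pb C v ?q)"
    "cmp C (pb C v ?q) d = pb C v (pb C u ?p)" "cmp C (pt C v ?q) d = cmp C (rho X u A) (pt C v (pb C u ?p))"
    unfolding d_def using assms by simp_all
  have cd: "cmp C (rho X ?w A) c = cmp C (rho X v ?A) d"
    using comp.ps_cm'[of u v A] assms(1-4) by (simp add: T.cm_eq T.ri_cmp d flip: c_def d_def)
  define e where "e = pb_pair C (pb C v (pb C u ?p)) (pt C v (pb C u ?p)) (idn C (src C v)) m"
  have e: "e \<in> ars C" "src C e = src C v" "tgt C e = src C (pb C v (pb C u ?p))"
    "cmp C (pb C v (pb C u ?p)) e = idn C (src C v)" "cmp C (pt C v (pb C u ?p)) e = m"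
    unfolding e_def using assms m by simp_all
  note L = sh_pair[OF assms(5)]
  have 1: "pb_pair C (pb C ?w (p (tgt C ?w) A)) (pt C ?w (p (tgt C ?w) A)) (idn C (src C ?w)) l = cmp C c e"
    by (rule B.pb_eqI[of ?p ?w])
      (use assms(1-4) c e L(1-5) l m B.cmp_pull[OF c(4), of e] B.cmp_pull[OF c(5), of e] in simp_all)
  have ov: "over v ?A (cmp C (rho X u A) m)"
    using assms(1-4) m by (simp add: over_def)
  note M = sh_pair[OF ov]
  have 2: "pb_pair C (pb C v (p (tgt C v) ?A)) (pt C v (p (tgt C v) ?A)) (idn C (src C v)) (cmp C (rho X u A) m) = cmp C d e"
    by (rule B.pb_eqI[of ?q v])
      (use assms(1-4) d e M(1-5) l m B.cmp_pull[OF d(4), of e] B.cmp_pull[OF d(5), of e] in simp_all)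
  have "sh X ?w A l = cmp C (cmp C (rho X ?w A) c) e" using L(6) 1 assms(1-4) c e by simp
  also have "\<dots> = cmp C (cmp C (rho X v ?A) d) e" by (simp add: cd)
  also have "\<dots> = sh X v ?A (cmp C (rho X u A) m)" using M(6) 2 assms(1-4) d e by simp
  finally show ?thesis by (simp add: m_def)
qed

text \<open>Under \<open>sh\<close>, reindexing a section along \<open>v\<close> is precomposition
  of its lift with \<open>v\<close>. This turns pseudonatural comprehension into strictly functorial
  reindexing of terms.\<close>

lemma sh_precomp:
  assumes "over u A k" "v \<in> ars C" "src C u = tgt C v"
  shows "sh X v (fo (ri (c_tp X) u) A) (cmp C (sh X u A k) v) = sh X (cmp C u v) A (cmp C k v)"
proof -
  note k = overD[OF assms(1)] and l = sh_pair[OF assms(1)]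
  let ?p = "p (tgt C u) A"
  have ov: "over (cmp C u v) A (cmp C k v)"
    using k assms B.cmp_pull[OF k(6), of v] by (simp add: over_def)
  have "pb_pair C (pb C u ?p) (pt C u ?p) v (cmp C k v) = cmp C (pb_pair C (pb C u ?p) (pt C u ?p) (idn C (src C u)) k) v"
    by (rule B.pb_eqI[of ?p u])
      (use k assms(2,3) l(1-5) B.cmp_pull[OF l(4), of v] B.cmp_pull[OF l(5), of v] B.cmp_pull[OF k(6), of v] in simp_all)
  then show ?thesis
    using sh_cmp[OF k(1) assms(2,3) k(2) ov] l(1-3,6) k assms(2,3) by simp
qed

text \<open>Naturality of \<open>rho\<close> in the type, transferred to sections.\<close>

lemma sh_nat:
  assumes "u \<in> ars C" "f \<in> ars (TY (tgt C u))" "over u (src (TY (tgt C u)) f) k"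
  shows "sh X u (tgt (TY (tgt C u)) f) (cmp C (cmar X (tgt C u) f) k) = cmp C (cmar X (src C u) (fa (ri (c_tp X) u) f)) (sh X u (src (TY (tgt C u)) f) k)"
    "over u (tgt (TY (tgt C u)) f) (cmp C (cmar X (tgt C u) f) k)"
proof -
  let ?A = "src (TY (tgt C u)) f" and ?B = "tgt (TY (tgt C u)) f"
  let ?p = "p (tgt C u) ?A" and ?q = "p (tgt C u) ?B"
  note k = overD[OF assms(3)] and l = sh_pair[OF assms(3)]
  show ov: "over u ?B (cmp C (cmar X (tgt C u) f) k)" using assms(1,2) k by (simp add: over_def)
  note m = sh_pair[OF ov]
  define d where "d = pb_pair C (pb C u ?q) (pt C u ?q) (pb C u ?p) (cmp C (cmar X (tgt C u) f) (pt C u ?p))"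
  have d: "d \<in> ars C" "src C d = src C (pb C u ?p)" "tgt C d = src C (pb C u ?q)"
    "cmp C (pb C u ?q) d = pb C u ?p" "cmp C (pt C u ?q) d = cmp C (cmar X (tgt C u) f) (pt C u ?p)"
    unfolding d_def using assms(1,2) by simp_all
  have rd: "cmp C (rho X u ?B) d = cmp C (cmar X (src C u) (fa (ri (c_tp X) u) f)) (rho X u ?A)"
    using comp.ps_nat[of u f] assms(1,2) by (simp flip: d_def)
  define x where "x = pb_pair C (pb C u ?p) (pt C u ?p) (idn C (src C u)) k"
  note l = l[folded x_def]
  have 1: "pb_pair C (pb C u ?q) (pt C u ?q) (idn C (src C u)) (cmp C (cmar X (tgt C u) f) k) = cmp C d x"
    by (rule B.pb_eqI[of ?q u])
      (use assms(1,2) k d l(1-5) m(1-5) B.cmp_pull[OF d(4), of x] B.cmp_pull[OF d(5), of x] in simp_all)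
  show "sh X u ?B (cmp C (cmar X (tgt C u) f) k) = cmp C (cmar X (src C u) (fa (ri (c_tp X) u) f)) (sh X u ?A k)"
    using m(6) l(6) 1 assms(1,2) d l(1-3) B.cmp_pull[OF rd, of x] by simp
qed

end

lemma enc_simps: "enc_ob U (A, p, s) = enc U A s" "enc_ar U (f, (p, s), (q, t), h) = enc U f (enc U s t)"
  by (simp_all add: enc_ob_def enc_ar_def)

section \<open>The coded pullback: its fibres and its reindexing\<close>

context precwa
begin

text \<open>The lift of \<open>f\<close> at the section \<open>s\<close>, coded here and uncoded in
  \<open>par\<close>. Comprehension forces the remaining components, so these normal forms exhaust
  the arrows of the fibres.\<close>

abbreviation "arr \<Gamma> f s \<equiv> enc U f (enc U s (cmp C (cmar X \<Gamma> f) s))"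
abbreviation "pob \<Gamma> A s \<equiv> (A, p \<Gamma> A, s)"
abbreviation "par \<Gamma> f s \<equiv> (f, (p \<Gamma> (src (TY \<Gamma>) f), s), (p \<Gamma> (tgt (TY \<Gamma>) f), cmp C (cmar X \<Gamma> f) s), cmar X \<Gamma> f)"

lemma cmar_sec:
  assumes "\<Gamma> \<in> obs C" "f \<in> ars (TY \<Gamma>)" "s \<in> sec \<Gamma> (src (TY \<Gamma>) f)"
  shows "cmp C (cmar X \<Gamma> f) s \<in> sec \<Gamma> (tgt (TY \<Gamma>) f)"
  using assms sec_simps[OF assms(3)] by (simp add: sec_def)

lemma sec_obs: "\<Gamma> \<in> obs C \<Longrightarrow> A \<in> obs (TY \<Gamma>) \<Longrightarrow> (p \<Gamma> A, s) \<in> obs (sfib C \<Gamma>) \<longleftrightarrow> s \<in> sec \<Gamma> A"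
  by (simp add: sec_def)

lemma pull_obs:
  assumes "\<Gamma> \<in> obs C"
  shows "obs (fib (P_pull X) \<Gamma>) = {pob \<Gamma> A s |A s. A \<in> obs (TY \<Gamma>) \<and> s \<in> sec \<Gamma> A}"
  using sec_obs[OF assms] by (auto simp: P_pull_def ipull_def ipull_fib_def simp del: sfib_simps(1))

lemma pull_ars:
  assumes "\<Gamma> \<in> obs C"
  shows "ars (fib (P_pull X) \<Gamma>) = {par \<Gamma> f s |f s. f \<in> ars (TY \<Gamma>) \<and> s \<in> sec \<Gamma> (src (TY \<Gamma>) f)}" (is "?L = ?R")
proof (intro set_eqI iffI)
  fix k assume k: "k \<in> ?L"
  obtain f q s r t h where k_eq: "k = (f, (q, s), (r, t), h)" by (metis prod.exhaust)
  have "f \<in> ars (TY \<Gamma>)" "((q, s), (r, t), h) \<in> ars (sfib C \<Gamma>)" "fa (cp (c_comp X) \<Gamma>) f = (q, r, h)"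
    using k by (simp_all add: k_eq P_pull_def ipull_def ipull_fib_def del: sfib_simps fa_comp)
  then have f: "f \<in> ars (TY \<Gamma>)" and s: "s \<in> sec \<Gamma> (src (TY \<Gamma>) f)"
    and eq: "q = p \<Gamma> (src (TY \<Gamma>) f)" "r = p \<Gamma> (tgt (TY \<Gamma>) f)" "h = cmar X \<Gamma> f" "t = cmp C (cmar X \<Gamma> f) s"
    using assms by (simp_all add: sec_def)
  show "k \<in> ?R" unfolding k_eq eq using f s by blast
next
  fix k assume "k \<in> ?R"
  then obtain f s where k: "k = par \<Gamma> f s" "f \<in> ars (TY \<Gamma>)" "s \<in> sec \<Gamma> (src (TY \<Gamma>) f)" by blast
  show "k \<in> ?L" unfolding k(1) using k(2,3) assms cmar_sec[OF assms k(2,3)] sec_simps[OF k(3)]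
    by (simp add: P_pull_def ipull_def ipull_fib_def sec_def)
qed

text \<open>The strict pullback reindexes a section by pulling it back and transporting it along
  \<open>ps\<close>; these two operations together are \<open>sh\<close> applied to the lift
  \<open>cmp C s u\<close>.\<close>

lemma push_eq:
  assumes "u \<in> ars C" "A \<in> obs (TY (tgt C u))" "s \<in> sec (tgt C u) A"
  shows "ipull_push C (c_tp X) (sic C) (c_comp X) (varpi C) u (pob (tgt C u) A s) =
      pob (src C u) (fo (ri (c_tp X) u) A) (sh X u A (cmp C s u))"
    "over u A (cmp C s u)"
proof -
  note s = sec_simps[OF assms(3)]
  show ov: "over u A (cmp C s u)" using assms(1,2) s sec_pull[OF assms(3) _ assms(2,1)] by (simp add: over_def)
  note l = sh_pair[OF ov]
  have "dlift (sfib C (src C u)) (cp (varpi C) (src C u)) (ps (c_comp X) u A)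
      (section_pb C u (p (tgt C u) A, s)) =
    ((pb C u (p (tgt C u) A), pb_pair C (pb C u (p (tgt C u) A)) (pt C u (p (tgt C u) A)) (idn C (src C u)) (cmp C s u)),
     (p (src C u) (fo (ri (c_tp X) u) A), sh X u A (cmp C s u)), rho X u A)"
    unfolding section_pb_def ps_comp[OF assms(1,2)] split l(6)
    using assms(1,2) l(1-4) s by (intro B.dlift_varpi) simp_all
  then show "ipull_push C (c_tp X) (sic C) (c_comp X) (varpi C) u (pob (tgt C u) A s) =
      pob (src C u) (fo (ri (c_tp X) u) A) (sh X u A (cmp C s u))"
    by (simp add: ipull_push_def)
qed

lemma sh_sec': 
  assumes "u \<in> ars C" "A \<in> obs (TY (tgt C u))" "s \<in> sec (tgt C u) A"
  shows "sh X u A (cmp C s u) \<in> sec (src C u) (fo (ri (c_tp X) u) A)"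
  using sh_sec[OF push_eq(2)[OF assms]] .

lemma pull_ri:
  assumes "u \<in> ars C"
  shows "A \<in> obs (TY (tgt C u)) \<Longrightarrow> s \<in> sec (tgt C u) A \<Longrightarrow>
      fo (ri (P_pull X) u) (pob (tgt C u) A s) = pob (src C u) (fo (ri (c_tp X) u) A) (sh X u A (cmp C s u))"
    "f \<in> ars (TY (tgt C u)) \<Longrightarrow> s \<in> sec (tgt C u) (src (TY (tgt C u)) f) \<Longrightarrow>
      fa (ri (P_pull X) u) (par (tgt C u) f s) =
      par (src C u) (fa (ri (c_tp X) u) f) (sh X u (src (TY (tgt C u)) f) (cmp C s u))"
proof -
  show "A \<in> obs (TY (tgt C u)) \<Longrightarrow> s \<in> sec (tgt C u) A \<Longrightarrow>
      fo (ri (P_pull X) u) (pob (tgt C u) A s) = pob (src C u) (fo (ri (c_tp X) u) A) (sh X u A (cmp C s u))"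
    using push_eq(1)[OF assms] by (simp add: P_pull_def ipull_def)
  assume f: "f \<in> ars (TY (tgt C u))" and s: "s \<in> sec (tgt C u) (src (TY (tgt C u)) f)"
  let ?A = "src (TY (tgt C u)) f"
  let ?f = "fa (ri (c_tp X) u) f" and ?s = "sh X u ?A (cmp C s u)"
  have A: "?A \<in> obs (TY (tgt C u))" using assms f by simp
  have "dlift (sfib C (src C u)) (cp (varpi C) (src C u)) (fa (cp (c_comp X) (src C u)) ?f) (p (src C u) (fo (ri (c_tp X) u) ?A), ?s) =
    snd (par (src C u) ?f ?s)"
    using assms f A sec_simps[OF sh_sec'[OF assms A s]] by (simp add: B.dlift_varpi)
  then show "fa (ri (P_pull X) u) (par (tgt C u) f s) = par (src C u) ?f ?s"
    using push_eq(1)[OF assms A s] by (simp add: P_pull_def ipull_def ipull_fib_def prod_cat_def Let_def)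
qed

text \<open>Omitting the display from the code loses nothing, since the display is the comprehension
  of the coded type; this is the injectivity behind \<open>inv_into\<close>.\<close>

lemma dec_ob [simp]:
  assumes "\<Gamma> \<in> obs C" "A \<in> obs (TY \<Gamma>)" "s \<in> sec \<Gamma> A"
  shows "dec_ob U X \<Gamma> (enc U A s) = pob \<Gamma> A s"
proof -
  have "inj_on (enc_ob U) (obs (fib (P_pull X) \<Gamma>))"
    unfolding pull_obs[OF assms(1)] by (auto simp: inj_on_def enc_simps enc_inject)
  from inv_into_f_f[OF this, of "pob \<Gamma> A s"] show ?thesis
    using assms by (auto simp: dec_ob_def pull_obs enc_simps)
qed

lemma dec_ar [simp]:
  assumes "\<Gamma> \<in> obs C" "f \<in> ars (TY \<Gamma>)" "s \<in> sec \<Gamma> (src (TY \<Gamma>) f)"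
  shows "dec_ar U X \<Gamma> (arr \<Gamma> f s) = par \<Gamma> f s"
proof -
  have "inj_on (enc_ar U) (ars (fib (P_pull X) \<Gamma>))"
    unfolding pull_ars[OF assms(1)] by (auto simp: inj_on_def enc_simps enc_inject)
  from inv_into_f_f[OF this, of "par \<Gamma> f s"] show ?thesis
    using assms by (auto simp: dec_ar_def pull_ars enc_simps)
qed

lemma P_fib:
  assumes "\<Gamma> \<in> obs C"
  shows "TM \<Gamma> = cat_norm \<lparr>
       obs = {enc U A s |A s. A \<in> obs (TY \<Gamma>) \<and> s \<in> sec \<Gamma> A},
       ars = {arr \<Gamma> f s |f s. f \<in> ars (TY \<Gamma>) \<and> s \<in> sec \<Gamma> (src (TY \<Gamma>) f)},
       src = (\<lambda>k. enc_ob U (src (fib (P_pull X) \<Gamma>) (dec_ar U X \<Gamma> k))),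
       tgt = (\<lambda>k. enc_ob U (tgt (fib (P_pull X) \<Gamma>) (dec_ar U X \<Gamma> k))),
       idn = (\<lambda>x. enc_ar U (idn (fib (P_pull X) \<Gamma>) (dec_ob U X \<Gamma> x))),
       cmp = (\<lambda>l k. enc_ar U (cmp (fib (P_pull X) \<Gamma>) (dec_ar U X \<Gamma> l) (dec_ar U X \<Gamma> k)))\<rparr>"
proof -
  have "enc_ob U ` obs (fib (P_pull X) \<Gamma>) = {enc U A s |A s. A \<in> obs (TY \<Gamma>) \<and> s \<in> sec \<Gamma> A}"
    unfolding pull_obs[OF assms] by (force simp: enc_simps)
  moreover have "enc_ar U ` ars (fib (P_pull X) \<Gamma>) = {arr \<Gamma> f s |f s. f \<in> ars (TY \<Gamma>) \<and> s \<in> sec \<Gamma> (src (TY \<Gamma>) f)}"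
    unfolding pull_ars[OF assms] by (force simp: enc_simps)
  ultimately show ?thesis
    using assms by (simp add: P_tm_def icat_norm_def icat_code_def Let_def dec_ob_def dec_ar_def)
qed

lemma P_obs_iff [simp]: "\<Gamma> \<in> obs C \<Longrightarrow> enc U A s \<in> obs (TM \<Gamma>) \<longleftrightarrow> A \<in> obs (TY \<Gamma>) \<and> s \<in> sec \<Gamma> A"
  by (auto simp: P_fib enc_inject)

lemma P_obsE:
  assumes "x \<in> obs (TM \<Gamma>)" "\<Gamma> \<in> obs C"
  obtains A s where "x = enc U A s" "A \<in> obs (TY \<Gamma>)" "s \<in> sec \<Gamma> A"
  using assms by (auto simp: P_fib)

lemma P_arsI [simp]: "\<Gamma> \<in> obs C \<Longrightarrow> f \<in> ars (TY \<Gamma>) \<Longrightarrow> s \<in> sec \<Gamma> (src (TY \<Gamma>) f) \<Longrightarrow> arr \<Gamma> f s \<in> ars (TM \<Gamma>)"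
  by (auto simp: P_fib)

lemma P_arsE:
  assumes "k \<in> ars (TM \<Gamma>)" "\<Gamma> \<in> obs C"
  obtains f s where "k = arr \<Gamma> f s" "f \<in> ars (TY \<Gamma>)" "s \<in> sec \<Gamma> (src (TY \<Gamma>) f)"
  using assms by (auto simp: P_fib)

lemma P_src_tgt [simp]:
  assumes "\<Gamma> \<in> obs C" "f \<in> ars (TY \<Gamma>)" "s \<in> sec \<Gamma> (src (TY \<Gamma>) f)"
  shows "src (TM \<Gamma>) (arr \<Gamma> f s) = enc U (src (TY \<Gamma>) f) s"
    "tgt (TM \<Gamma>) (arr \<Gamma> f s) = enc U (tgt (TY \<Gamma>) f) (cmp C (cmar X \<Gamma> f) s)"
proof -
  have "arr \<Gamma> f s \<in> ars (TM \<Gamma>)" using assms by simp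
  then have "src (TM \<Gamma>) (arr \<Gamma> f s) = enc_ob U (src (fib (P_pull X) \<Gamma>) (dec_ar U X \<Gamma> (arr \<Gamma> f s)))"
    "tgt (TM \<Gamma>) (arr \<Gamma> f s) = enc_ob U (tgt (fib (P_pull X) \<Gamma>) (dec_ar U X \<Gamma> (arr \<Gamma> f s)))"
    unfolding P_fib[OF assms(1)] by (simp_all add: cat_norm_def)
  then show "src (TM \<Gamma>) (arr \<Gamma> f s) = enc U (src (TY \<Gamma>) f) s"
    "tgt (TM \<Gamma>) (arr \<Gamma> f s) = enc U (tgt (TY \<Gamma>) f) (cmp C (cmar X \<Gamma> f) s)"
    using assms by (simp_all add: enc_simps P_pull_def ipull_def ipull_fib_def prod_cat_def)
qed

lemma P_idn [simp]:
  assumes "\<Gamma> \<in> obs C" "A \<in> obs (TY \<Gamma>)" "s \<in> sec \<Gamma> A"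
  shows "idn (TM \<Gamma>) (enc U A s) = arr \<Gamma> (idn (TY \<Gamma>) A) s"
proof -
  have "enc U A s \<in> obs (TM \<Gamma>)" using assms by simp
  then have "idn (TM \<Gamma>) (enc U A s) = enc_ar U (idn (fib (P_pull X) \<Gamma>) (dec_ob U X \<Gamma> (enc U A s)))"
    unfolding P_fib[OF assms(1)] by (simp add: cat_norm_def)
  then show ?thesis
    using assms sec_simps[OF assms(3)] by (simp add: enc_simps P_pull_def ipull_def ipull_fib_def prod_cat_def)
qed

lemma P_cmp [simp]:
  assumes "\<Gamma> \<in> obs C" "f \<in> ars (TY \<Gamma>)" "s \<in> sec \<Gamma> (src (TY \<Gamma>) f)" "g \<in> ars (TY \<Gamma>)" "src (TY \<Gamma>) g = tgt (TY \<Gamma>) f"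
  shows "cmp (TM \<Gamma>) (arr \<Gamma> g (cmp C (cmar X \<Gamma> f) s)) (arr \<Gamma> f s) = arr \<Gamma> (cmp (TY \<Gamma>) g f) s"
proof -
  have t: "cmp C (cmar X \<Gamma> f) s \<in> sec \<Gamma> (src (TY \<Gamma>) g)" using cmar_sec[OF assms(1-3)] assms by simp
  have m: "arr \<Gamma> g (cmp C (cmar X \<Gamma> f) s) \<in> ars (TM \<Gamma>)" "arr \<Gamma> f s \<in> ars (TM \<Gamma>)"
    "src (TM \<Gamma>) (arr \<Gamma> g (cmp C (cmar X \<Gamma> f) s)) = tgt (TM \<Gamma>) (arr \<Gamma> f s)" using assms t by simp_all
  then have "cmp (TM \<Gamma>) (arr \<Gamma> g (cmp C (cmar X \<Gamma> f) s)) (arr \<Gamma> f s) =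
      enc_ar U (cmp (fib (P_pull X) \<Gamma>) (dec_ar U X \<Gamma> (arr \<Gamma> g (cmp C (cmar X \<Gamma> f) s))) (dec_ar U X \<Gamma> (arr \<Gamma> f s)))"
    unfolding P_fib[OF assms(1)] by (simp add: cat_norm_def)
  then show ?thesis
    using assms t sec_simps[OF assms(3)] by (simp add: enc_simps P_pull_def ipull_def ipull_fib_def prod_cat_def cmar_cmp)
qed

lemma P_ri [simp]:
  assumes "u \<in> ars C"
  shows "A \<in> obs (TY (tgt C u)) \<Longrightarrow> s \<in> sec (tgt C u) A \<Longrightarrow>
      fo (ri (P_tm U X) u) (enc U A s) = enc U (fo (ri (c_tp X) u) A) (sh X u A (cmp C s u))"
    "tgt C u = \<Gamma> \<Longrightarrow> f \<in> ars (TY \<Gamma>) \<Longrightarrow> s \<in> sec \<Gamma> (src (TY \<Gamma>) f) \<Longrightarrow>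
      fa (ri (P_tm U X) u) (arr \<Gamma> f s) =
      arr (src C u) (fa (ri (c_tp X) u) f) (sh X u (src (TY \<Gamma>) f) (cmp C s u))"
proof -
  have T: "tgt C u \<in> obs C" using assms by simp
  have R: "ri (P_tm U X) u = fnc_norm (fib (icat_code C (enc_ob U) (enc_ar U) (P_pull X)) (tgt C u)) \<lparr>
       fo = (\<lambda>x. enc_ob U (fo (ri (P_pull X) u) (dec_ob U X (tgt C u) x))),
       fa = (\<lambda>k. enc_ar U (fa (ri (P_pull X) u) (dec_ar U X (tgt C u) k)))\<rparr>"
    using assms by (simp add: P_tm_def icat_norm_def icat_code_def Let_def dec_ob_def dec_ar_def)
  have O: "obs (fib (icat_code C (enc_ob U) (enc_ar U) (P_pull X)) \<Gamma>) = obs (TM \<Gamma>)"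
    "ars (fib (icat_code C (enc_ob U) (enc_ar U) (P_pull X)) \<Gamma>) = ars (TM \<Gamma>)" if "\<Gamma> \<in> obs C" for \<Gamma>
    using that by (simp_all add: P_tm_def icat_norm_def)
  show "A \<in> obs (TY (tgt C u)) \<Longrightarrow> s \<in> sec (tgt C u) A \<Longrightarrow>
      fo (ri (P_tm U X) u) (enc U A s) = enc U (fo (ri (c_tp X) u) A) (sh X u A (cmp C s u))"
    using T assms by (simp add: R fnc_norm_def O pull_ri enc_simps)
  assume "tgt C u = \<Gamma>" "f \<in> ars (TY \<Gamma>)" "s \<in> sec \<Gamma> (src (TY \<Gamma>) f)"
  then show "fa (ri (P_tm U X) u) (arr \<Gamma> f s) = arr (src C u) (fa (ri (c_tp X) u) f) (sh X u (src (TY \<Gamma>) f) (cmp C s u))"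
    using T assms pull_ri(2)[OF assms, of f s] by (auto simp add: R fnc_norm_def O enc_simps)
qed

lemma P_un_cm:
  shows "\<Gamma> \<in> obs C \<Longrightarrow> x \<in> obs (TM \<Gamma>) \<Longrightarrow> un (P_tm U X) \<Gamma> x = idn (TM \<Gamma>) x"
    "u \<in> ars C \<Longrightarrow> v \<in> ars C \<Longrightarrow> src C u = tgt C v \<Longrightarrow> x \<in> obs (TM (tgt C u)) \<Longrightarrow>
      cm (P_tm U X) u v x = idn (TM (src C v)) (fo (ri (P_tm U X) (cmp C u v)) x)"
proof -
  have O: "obs (fib (icat_code C (enc_ob U) (enc_ar U) (P_pull X)) \<Gamma>) = obs (TM \<Gamma>)" if "\<Gamma> \<in> obs C" for \<Gamma>
    using that by (simp add: P_tm_def icat_norm_def)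
  have I: "idn (TM \<Gamma>) (enc U A s) = enc_ar U (idn (ipull_fib (c_tp X) (sic C) (c_comp X) (varpi C) \<Gamma>) (pob \<Gamma> A s))"
    if "\<Gamma> \<in> obs C" "A \<in> obs (TY \<Gamma>)" "s \<in> sec \<Gamma> A" for \<Gamma> A s
    using that sec_simps[OF that(3)] by (simp add: enc_simps ipull_fib_def prod_cat_def)
  show "un (P_tm U X) \<Gamma> x = idn (TM \<Gamma>) x" if "\<Gamma> \<in> obs C" "x \<in> obs (TM \<Gamma>)"
  proof -
    from that obtain A s where x: "x = enc U A s" "A \<in> obs (TY \<Gamma>)" "s \<in> sec \<Gamma> A" by (elim P_obsE)
    have "un (P_tm U X) \<Gamma> x = enc_ar U (un (P_pull X) \<Gamma> (dec_ob U X \<Gamma> x))"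
      using that by (simp add: P_tm_def icat_norm_def icat_code_def Let_def dec_ob_def)
    then show ?thesis using that x I[OF that(1) x(2,3)] by (simp add: P_pull_def ipull_def del: P_idn)
  qed
  show "cm (P_tm U X) u v x = idn (TM (src C v)) (fo (ri (P_tm U X) (cmp C u v)) x)"
    if uv: "u \<in> ars C" "v \<in> ars C" "src C u = tgt C v" and x: "x \<in> obs (TM (tgt C u))"
  proof -
    have T: "tgt C u \<in> obs C" using uv by simp
    from x T obtain A s where x': "x = enc U A s" "A \<in> obs (TY (tgt C u))" "s \<in> sec (tgt C u) A" by (elim P_obsE)
    have 1: "cm (P_tm U X) u v x = enc_ar U (cm (P_pull X) u v (dec_ob U X (tgt C u) x))"
      using uv x T O[OF T] by (simp add: P_tm_def icat_norm_def icat_code_def Let_def dec_ob_def)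
    have w: "cmp C u v \<in> ars C" "A \<in> obs (TY (tgt C (cmp C u v)))" "s \<in> sec (tgt C (cmp C u v)) A" using uv x' by simp_all
    have wA: "fo (ri (c_tp X) (cmp C u v)) A \<in> obs (TY (src C v))" "src C (cmp C u v) = src C v" "tgt C (cmp C u v) = tgt C u"
      using uv x' by simp_all
    show ?thesis
      unfolding 1 using uv T x' push_eq(1)[OF w] P_ri(1)[OF w] I[OF _ wA(1) sh_sec'[OF w, unfolded wA(2)]]
      by (simp add: P_pull_def ipull_def wA(2,3) del: P_idn P_ri)
  qed
qed

lemma category_TM:
  assumes "\<Gamma> \<in> obs C" shows "category (TM \<Gamma>)"
proof (rule categoryI, goal_cases)
  case (1 k) with assms show ?case by (elim P_arsE) simp_all
next
  case (2 k) with assms show ?case by (elim P_arsE) (simp_all add: cmar_sec)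
next
  case (3 x)
  with assms obtain A s where x: "x = enc U A s" "A \<in> obs (TY \<Gamma>)" "s \<in> sec \<Gamma> A" by (elim P_obsE)
  show ?case unfolding x(1) using x(2,3) assms sec_simps[OF x(3)]
    P_arsI[of \<Gamma> "idn (TY \<Gamma>) A" s] P_src_tgt[of \<Gamma> "idn (TY \<Gamma>) A" s] by simp
next
  case (4 k l)
  then obtain f s g t where kl: "k = arr \<Gamma> f s" "f \<in> ars (TY \<Gamma>)" "s \<in> sec \<Gamma> (src (TY \<Gamma>) f)"
    "l = arr \<Gamma> g t" "g \<in> ars (TY \<Gamma>)" "t \<in> sec \<Gamma> (src (TY \<Gamma>) g)" using assms by (elim P_arsE)
  \<comment> \<open>Codes are injective, so composability forces the second arrow to start at the
    very section where the first one ends.\<close>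
  have g: "src (TY \<Gamma>) g = tgt (TY \<Gamma>) f" "t = cmp C (cmar X \<Gamma> f) s"
    using 4(3) kl assms by (simp_all add: enc_inject)
  show ?case unfolding kl(1,4) g(2)
    using kl(2,3,5) g(1) assms cmar_sec[of \<Gamma> f s] sec_simps[OF kl(3)]
      P_arsI[of \<Gamma> "cmp (TY \<Gamma>) g f" s] P_src_tgt[of \<Gamma> "cmp (TY \<Gamma>) g f" s] by (simp add: cmar_cmp)
next
  case (5 k)
  then obtain f s where k: "k = arr \<Gamma> f s" "f \<in> ars (TY \<Gamma>)" "s \<in> sec \<Gamma> (src (TY \<Gamma>) f)" using assms by (elim P_arsE)
  then show ?case unfolding k(1) using assms cmar_sec[of \<Gamma> f s] P_cmp[of \<Gamma> f s "idn (TY \<Gamma>) (tgt (TY \<Gamma>) f)"] by simp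
next
  case (6 k)
  then obtain f s where k: "k = arr \<Gamma> f s" "f \<in> ars (TY \<Gamma>)" "s \<in> sec \<Gamma> (src (TY \<Gamma>) f)" using assms by (elim P_arsE)
  then show ?case unfolding k(1) using assms sec_simps[OF k(3)] P_cmp[of \<Gamma> "idn (TY \<Gamma>) (src (TY \<Gamma>) f)" s f] by simp
next
  case (7 k l m)
  then obtain f s g t h r where kl: "k = arr \<Gamma> f s" "f \<in> ars (TY \<Gamma>)" "s \<in> sec \<Gamma> (src (TY \<Gamma>) f)"
    "l = arr \<Gamma> g t" "g \<in> ars (TY \<Gamma>)" "t \<in> sec \<Gamma> (src (TY \<Gamma>) g)" 
    "m = arr \<Gamma> h r" "h \<in> ars (TY \<Gamma>)" "r \<in> sec \<Gamma> (src (TY \<Gamma>) h)" using assms by (elim P_arsE)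
  have g: "src (TY \<Gamma>) g = tgt (TY \<Gamma>) f" "t = cmp C (cmar X \<Gamma> f) s" "src (TY \<Gamma>) h = tgt (TY \<Gamma>) g" "r = cmp C (cmar X \<Gamma> g) t"
    using 7(4,5) kl assms by (simp_all add: enc_inject)
  have 1: "cmp (TM \<Gamma>) l k = arr \<Gamma> (cmp (TY \<Gamma>) g f) s" "cmp (TM \<Gamma>) m l = arr \<Gamma> (cmp (TY \<Gamma>) h g) t"
    unfolding kl(1,4,7) g(4) using kl g(1,3) assms by (simp_all add: g(2))
  have r: "r = cmp C (cmar X \<Gamma> (cmp (TY \<Gamma>) g f)) s"
    unfolding g(4) g(2) using kl(2,3,5) g(1) sec_simps[OF kl(3)] assms by (simp add: cmar_cmp)
  have "cmp (TM \<Gamma>) m (cmp (TM \<Gamma>) l k) = arr \<Gamma> (cmp (TY \<Gamma>) h (cmp (TY \<Gamma>) g f)) s"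
    unfolding 1 kl(7) r using kl(2,3,5,8) g(1,3) assms by (intro P_cmp) simp_all
  also have "\<dots> = cmp (TM \<Gamma>) (cmp (TM \<Gamma>) m l) k"
    unfolding 1 kl(1) g(2) using kl(2,3,5,8) g(1,3) assms by (subst P_cmp) simp_all
  finally show ?case .
qed

lemma sh_nat':
  assumes "u \<in> ars C" "f \<in> ars (TY (tgt C u))" "s \<in> sec (tgt C u) (src (TY (tgt C u)) f)"
  shows "sh X u (tgt (TY (tgt C u)) f) (cmp C (cmp C (cmar X (tgt C u) f) s) u) =
    cmp C (cmar X (src C u) (fa (ri (c_tp X) u) f)) (sh X u (src (TY (tgt C u)) f) (cmp C s u))"
  using sh_nat(1)[OF assms(1,2) push_eq(2)[OF assms(1) _ assms(3)]] assms sec_simps[OF assms(3)] by simp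

text \<open>Strictness although comprehension is only pseudonatural: \<open>sh_idn\<close> and
  \<open>sh_precomp\<close> are the functor laws of reindexing, and \<open>sh_nat'\<close> makes
  each reindexing a functor between fibres.\<close>

lemma strict_indexed_category_P_tm: "strict_indexed_category C (P_tm U X)"
proof (rule strict_indexed_categoryI[OF B.category_axioms], goal_cases)
  case (1 \<Gamma>) then show ?case by (rule category_TM)
next
  case (2 u)
  have T: "tgt C u \<in> obs C" "src C u \<in> obs C" using 2 by simp_all
  show ?case
  proof (rule is_functorI[OF category_TM[OF T(1)] category_TM[OF T(2)]], goal_cases)
    case (1 x)
    from 1 T obtain A s where x: "x = enc U A s" "A \<in> obs (TY (tgt C u))" "s \<in> sec (tgt C u) A" by (elim P_obsE)
    then show ?case using 2 T sh_sec'[OF 2 x(2,3)] by simp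
  next
    case (2 k)
    from 2 T obtain f s where k: "k = arr (tgt C u) f s" "f \<in> ars (TY (tgt C u))" "s \<in> sec (tgt C u) (src (TY (tgt C u)) f)" by (elim P_arsE)
    then show ?case unfolding k(1) using \<open>u \<in> ars C\<close> T cmar_sec[OF T(1) k(2,3)] sh_nat'[of u f s] sh_sec'[of u _ s] by simp
  next
    case (3 x)
    from 3 T obtain A s where x: "x = enc U A s" "A \<in> obs (TY (tgt C u))" "s \<in> sec (tgt C u) A" by (elim P_obsE)
    note f = P_ri(2)[OF 2 refl, of "idn (TY (tgt C u)) A" s]
    show ?case unfolding x(1) using x(2,3) 2 T sh_sec'[OF 2 x(2,3)] f by simp
  next
    case (4 k l)
    then obtain f s g t where kl: "k = arr (tgt C u) f s" "f \<in> ars (TY (tgt C u))" "s \<in> sec (tgt C u) (src (TY (tgt C u)) f)"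
      "l = arr (tgt C u) g t" "g \<in> ars (TY (tgt C u))" "t \<in> sec (tgt C u) (src (TY (tgt C u)) g)" using T by (elim P_arsE)
    have g: "src (TY (tgt C u)) g = tgt (TY (tgt C u)) f" "t = cmp C (cmar X (tgt C u) f) s"
      using 4(3) kl T by (simp_all add: enc_inject)
    have A: "src (TY (tgt C u)) f \<in> obs (TY (tgt C u))" using kl T by simp
    have "fa (ri (P_tm U X) u) (cmp (TM (tgt C u)) l k) =
      arr (src C u) (cmp (TY (src C u)) (fa (ri (c_tp X) u) g) (fa (ri (c_tp X) u) f)) (sh X u (src (TY (tgt C u)) f) (cmp C s u))"
      unfolding kl(1,4) g(2) using kl(2,3,5) g(1) T \<open>u \<in> ars C\<close> P_ri(2)[OF \<open>u \<in> ars C\<close> refl, of "cmp (TY (tgt C u)) g f" s] by simp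
    also have "\<dots> = cmp (TM (src C u)) (fa (ri (P_tm U X) u) l) (fa (ri (P_tm U X) u) k)"
      unfolding kl(1,4) using kl(2,3,5,6) g T \<open>u \<in> ars C\<close> sh_nat'[OF \<open>u \<in> ars C\<close> kl(2,3)] sh_sec'[OF \<open>u \<in> ars C\<close> A kl(3)] by simp
    finally show ?case .
  qed
next
  case (3 \<Gamma> x)
  then obtain A s where x: "x = enc U A s" "A \<in> obs (TY \<Gamma>)" "s \<in> sec \<Gamma> A" by (elim P_obsE)
  then show ?case using 3(1) P_ri(1)[of "idn C \<Gamma>" A s] sh_idn[OF 3(1) x(2,3)] sec_simps[OF x(3)] by simp
next
  case (4 \<Gamma> k)
  then obtain f s where k: "k = arr \<Gamma> f s" "f \<in> ars (TY \<Gamma>)" "s \<in> sec \<Gamma> (src (TY \<Gamma>) f)" by (elim P_arsE)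
  then show ?case using 4(1) P_ri(2)[of "idn C \<Gamma>" \<Gamma> f s] sh_idn[OF 4(1) _ k(3)] sec_simps[OF k(3)] by simp
next
  case (5 u v x)
  have T: "tgt C u \<in> obs C" using 5 by simp
  from 5 T obtain A s where x: "x = enc U A s" "A \<in> obs (TY (tgt C u))" "s \<in> sec (tgt C u) A" by (elim P_obsE)
  then show ?case using 5(1-3) T P_ri(1)[of "cmp C u v" A s] P_ri(1)[of v "fo (ri (c_tp X) u) A" "sh X u A (cmp C s u)"]
    sh_sec'[OF 5(1) x(2,3)] sh_precomp[OF push_eq(2)[OF 5(1) x(2,3)] 5(2,3)] sec_simps[OF x(3)] by (simp add: T.ri_cmp)
next
  case (6 u v k)
  have T: "tgt C u \<in> obs C" "tgt C v \<in> obs C" using 6 by simp_all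
  from 6 T obtain f s where k: "k = arr (tgt C u) f s" "f \<in> ars (TY (tgt C u))" "s \<in> sec (tgt C u) (src (TY (tgt C u)) f)" by (elim P_arsE)
  have A: "src (TY (tgt C u)) f \<in> obs (TY (tgt C u))" using k T by simp
  show ?case unfolding k(1) using k(2,3) 6(1-3) T A P_ri(2)[of "cmp C u v" "tgt C u" f s]
      P_ri(2)[of v "tgt C v" "fa (ri (c_tp X) u) f" "sh X u (src (TY (tgt C u)) f) (cmp C s u)"]
    sh_sec'[OF 6(1) A k(3)] sh_precomp[OF push_eq(2)[OF 6(1) A k(3)] 6(2,3)] sec_simps[OF k(3)] by (simp add: T.ri_cmp)
qed (rule P_un_cm; assumption)+

section \<open>The axioms of a pre-natural model for \<open>P_ob U X\<close>\<close>

lemma P_proj_simps [simp]: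
  assumes "\<Gamma> \<in> obs C"
  shows "A \<in> obs (TY \<Gamma>) \<Longrightarrow> s \<in> sec \<Gamma> A \<Longrightarrow> fo (cp (P_proj U X) \<Gamma>) (enc U A s) = A"
    "f \<in> ars (TY \<Gamma>) \<Longrightarrow> s \<in> sec \<Gamma> (src (TY \<Gamma>) f) \<Longrightarrow> fa (cp (P_proj U X) \<Gamma>) (arr \<Gamma> f s) = f"
  using assms by (simp_all add: P_proj_def)

text \<open>An arrow is determined by its type part and its source section, so
  \<open>arr \<Gamma> f s\<close> is the unique lift of \<open>f\<close> at
  \<open>enc U A s\<close>.\<close>

lemma discrete_opfibration_P:
  assumes "\<Gamma> \<in> obs C"
  shows "discrete_opfibration (TM \<Gamma>) (TY \<Gamma>) (cp (P_proj U X) \<Gamma>)"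
proof (intro discrete_opfibration.intro discrete_opfibration_axioms.intro, goal_cases)
  case 1
  show ?case
  proof (rule is_functorI[OF category_TM[OF assms] T.fib_cat[OF assms]], goal_cases)
    case (1 x) with assms show ?case by (elim P_obsE) simp_all
  next
    case (2 k) with assms show ?case by (elim P_arsE) (simp_all add: cmar_sec)
  next
    case (3 x)
    with assms obtain A s where x: "x = enc U A s" "A \<in> obs (TY \<Gamma>)" "s \<in> sec \<Gamma> A" by (elim P_obsE)
    then show ?case using assms P_proj_simps(2)[OF assms, of "idn (TY \<Gamma>) A" s] by simp
  next
    case (4 k l)
    then obtain f s g t where kl: "k = arr \<Gamma> f s" "f \<in> ars (TY \<Gamma>)" "s \<in> sec \<Gamma> (src (TY \<Gamma>) f)"
      "l = arr \<Gamma> g t" "g \<in> ars (TY \<Gamma>)" "t \<in> sec \<Gamma> (src (TY \<Gamma>) g)" using assms by (elim P_arsE)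
    have g: "src (TY \<Gamma>) g = tgt (TY \<Gamma>) f" "t = cmp C (cmar X \<Gamma> f) s"
      using 4(3) kl assms by (simp_all add: enc_inject)
    show ?case unfolding kl(1,4) using kl(2,3,5,6) g(1) assms P_proj_simps(2)[OF assms, of "cmp (TY \<Gamma>) g f" s] by (simp add: g(2))
  qed
next
  case (2 x f)
  with assms obtain A s where x: "x = enc U A s" "A \<in> obs (TY \<Gamma>)" "s \<in> sec \<Gamma> A" by (elim P_obsE)
  with 2 assms have f: "f \<in> ars (TY \<Gamma>)" "src (TY \<Gamma>) f = A" by simp_all
  show ?case
  proof (rule ex1I[of _ "arr \<Gamma> f s"])
    show "arr \<Gamma> f s \<in> ars (TM \<Gamma>) \<and> src (TM \<Gamma>) (arr \<Gamma> f s) = x \<and> fa (cp (P_proj U X) \<Gamma>) (arr \<Gamma> f s) = f"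
      using assms f x by simp
    fix k assume k: "k \<in> ars (TM \<Gamma>) \<and> src (TM \<Gamma>) k = x \<and> fa (cp (P_proj U X) \<Gamma>) k = f"
    then obtain g t where g: "k = arr \<Gamma> g t" "g \<in> ars (TY \<Gamma>)" "t \<in> sec \<Gamma> (src (TY \<Gamma>) g)" using assms by (elim conjE P_arsE)
    with k x assms show "k = arr \<Gamma> f s" by (simp add: enc_inject)
  qed
qed

lemma strictly_natural_P: "strictly_natural_functor C (P_tm U X) (c_tp X) (P_proj U X)"
proof (rule strictly_natural_functorI[OF strict_indexed_category_P_tm T.strict_indexed_category_axioms], goal_cases)
  case (1 \<Gamma>) then show ?case using discrete_opfibration.axioms(1)[OF discrete_opfibration_P] by blast
next
  case (2 u x)
  have T: "tgt C u \<in> obs C" "src C u \<in> obs C" using 2 by simp_all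
  from 2 T obtain A s where x: "x = enc U A s" "A \<in> obs (TY (tgt C u))" "s \<in> sec (tgt C u) A" by (elim P_obsE)
  then show ?case using 2(1) T sh_sec'[OF 2(1) x(2,3)] by simp
next
  case (3 u k)
  have T: "tgt C u \<in> obs C" "src C u \<in> obs C" using 3 by simp_all
  from 3 T obtain f s where k: "k = arr (tgt C u) f s" "f \<in> ars (TY (tgt C u))" "s \<in> sec (tgt C u) (src (TY (tgt C u)) f)" by (elim P_arsE)
  have A: "src (TY (tgt C u)) f \<in> obs (TY (tgt C u))" using k T by simp
  show ?case unfolding k(1) using k(2,3) 3(1) T sh_sec'[OF 3(1) A k(3)] by simp
next
  case (4 u x)
  have T: "tgt C u \<in> obs C" "src C u \<in> obs C" using 4 by simp_all
  from 4 T obtain A s where x: "x = enc U A s" "A \<in> obs (TY (tgt C u))" "s \<in> sec (tgt C u) A" by (elim P_obsE)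
  then show ?case using 4 T sh_sec'[OF 4(1) x(2,3)] by (simp add: P_proj_def)
qed

lemma P_ob_simps [simp]:
  "n_base (P_ob U X) = C" "n_tp (P_ob U X) = c_tp X" "n_tm (P_ob U X) = P_tm U X" "n_proj (P_ob U X) = P_proj U X"
  "\<Gamma> \<in> obs C \<Longrightarrow> A \<in> obs (TY \<Gamma>) \<Longrightarrow> n_ext (P_ob U X) \<Gamma> A = p \<Gamma> A"
  "\<Gamma> \<in> obs C \<Longrightarrow> A \<in> obs (TY \<Gamma>) \<Longrightarrow>
    n_var (P_ob U X) \<Gamma> A = enc U (fo (ri (c_tp X) (p \<Gamma> A)) A) (sh X (p \<Gamma> A) A (idn C (src C (p \<Gamma> A))))"
  by (simp_all add: P_ob_def P_var_def Let_def enc_simps sh_def)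

lemma over_idn: "\<Gamma> \<in> obs C \<Longrightarrow> A \<in> obs (TY \<Gamma>) \<Longrightarrow> over (p \<Gamma> A) A (idn C (src C (p \<Gamma> A)))"
  by (simp add: over_def)

text \<open>The universal element is \<open>sh\<close> of an identity, so by
  \<open>sh_precomp\<close> reindexing it along \<open>k\<close> gives \<open>sh\<close> of
  \<open>k\<close>. Lifts and the terms they classify thus correspond through
  \<open>sh\<close>.\<close>

lemma var_ri:
  assumes "over u A k"
  shows "fo (ri (P_tm U X) k) (n_var (P_ob U X) (tgt C u) A) = enc U (fo (ri (c_tp X) u) A) (sh X u A k)"
proof -
  let ?p = "p (tgt C u) A"
  note k = overD[OF assms]
  have T: "tgt C u \<in> obs C" using k by simp
  note i = over_idn[OF T k(2)]
  have s: "sh X ?p A (idn C (src C ?p)) \<in> sec (tgt C k) (fo (ri (c_tp X) ?p) A)" using sh_sec[OF i] k by simp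
  have 1: "fo (ri (c_tp X) k) (fo (ri (c_tp X) ?p) A) = fo (ri (c_tp X) u) A"
    using k by (intro T.ri_pull) simp_all
  show ?thesis using T k s 1 sh_precomp[OF i k(3)] by simp
qed

text \<open>By \<open>var_ri\<close> representability is bijectivity of \<open>sh X u A\<close>:
  \<open>sh_surj\<close> gives existence and \<open>sh_eq_iff\<close> uniqueness.\<close>

lemma represents_P:
  assumes "\<Gamma> \<in> obs C" "A \<in> obs (TY \<Gamma>)"
  shows "represents (P_ob U X) \<Gamma> A (n_ext (P_ob U X) \<Gamma> A) (n_var (P_ob U X) \<Gamma> A)"
proof -
  have v: "n_var (P_ob U X) \<Gamma> A \<in> obs (TM (src C (p \<Gamma> A)))" "fo (cp (P_proj U X) (src C (p \<Gamma> A))) (n_var (P_ob U X) \<Gamma> A) = fo (ri (c_tp X) (p \<Gamma> A)) A"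
    using assms sh_sec[OF over_idn[OF assms]] by simp_all
  have "\<exists>!k. k \<in> hom C \<Delta> (src C (p \<Gamma> A)) \<and> cmp C (p \<Gamma> A) k = u \<and> fo (ri (P_tm U X) k) (n_var (P_ob U X) \<Gamma> A) = t"
    if ut: "u \<in> hom C \<Delta> \<Gamma>" "t \<in> obs (TM \<Delta>)" "fo (cp (P_proj U X) \<Delta>) t = fo (ri (c_tp X) u) A" for \<Delta> u t
  proof -
    have u: "u \<in> ars C" "src C u = \<Delta>" "tgt C u = \<Gamma>" "\<Delta> \<in> obs C" using ut by auto
    from ut u obtain B s where t: "t = enc U B s" "B \<in> obs (TY \<Delta>)" "s \<in> sec \<Delta> B" by (elim P_obsE)
    with ut u have B: "B = fo (ri (c_tp X) u) A" by simp
    obtain k where k: "over u A k" "sh X u A k = s" using sh_surj[of u A s] u assms t B by auto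
    note k' = overD[OF k(1)]
    show ?thesis
    proof (rule ex1I[of _ k], goal_cases)
      case 1 show ?case using k' k(2) var_ri[OF k(1)] u t B by simp
    next
      case (2 l)
      then have l: "l \<in> ars C" "src C l = \<Delta>" "tgt C l = src C (p \<Gamma> A)" "cmp C (p \<Gamma> A) l = u"
        and e: "fo (ri (P_tm U X) l) (n_var (P_ob U X) \<Gamma> A) = t" by (simp_all del: P_ob_simps)
      have ov: "over u A l" using l u assms by (simp add: over_def)
      have "t = enc U (fo (ri (c_tp X) u) A) (sh X u A l)" using e var_ri[OF ov] unfolding u(3) by simp
      then have "sh X u A l = sh X u A k" using t(1) k(2) by (simp add: enc_inject)
      then show ?case using sh_eq_iff[OF ov k(1)] by simp
    qed
  qed
  then show ?thesis using assms v unfolding represents_def Let_def by simp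
qed

lemma is_prenm_P_ob: "is_prenm U (P_ob U X)"
proof -
  have s: "small_cat U C" "small_icat U C (c_tp X)" using precwa by (simp_all add: is_precwa_def)
  have sm: "small U (obs (TM \<Gamma>))" "small U (ars (TM \<Gamma>))" if G: "\<Gamma> \<in> obs C" for \<Gamma>
  proof -
    have *: "small U (obs (TY \<Gamma>))" "small U (ars (TY \<Gamma>))" "small U (ars C)"
      using s G by (auto simp: small_cat_def small_icat_def)
    have "obs (TM \<Gamma>) \<subseteq> {enc U x y |x y. x \<in> obs (TY \<Gamma>) \<and> y \<in> ars C}"
      using G sec_simps(1) by (blast elim: P_obsE)
    then show "small U (obs (TM \<Gamma>))" by (rule small_subset[OF small_prod[OF *(1,3)]])
    \<comment> \<open>The code of an arrow is a pair whose second entry is again a pair, so closure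
      of smallness under products is used twice.\<close>
    have "ars (TM \<Gamma>) \<subseteq> {enc U x y |x y. x \<in> ars (TY \<Gamma>) \<and> y \<in> {enc U x y |x y. x \<in> ars C \<and> y \<in> ars C}}"
    proof
      fix k assume "k \<in> ars (TM \<Gamma>)"
      then obtain f t where k: "k = arr \<Gamma> f t" "f \<in> ars (TY \<Gamma>)" "t \<in> sec \<Gamma> (src (TY \<Gamma>) f)" using G by (elim P_arsE)
      have "enc U t (cmp C (cmar X \<Gamma> f) t) \<in> {enc U x y |x y. x \<in> ars C \<and> y \<in> ars C}"
        using sec_simps(1)[OF k(3)] sec_simps(1)[OF cmar_sec[OF G k(2,3)]] by blast
      with k show "k \<in> {enc U x y |x y. x \<in> ars (TY \<Gamma>) \<and> y \<in> {enc U x y |x y. x \<in> ars C \<and> y \<in> ars C}}" by blast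
    qed
    then show "small U (ars (TM \<Gamma>))" by (rule small_subset[OF small_prod[OF *(2) small_prod[OF *(3,3)]]])
  qed
  have n: "dcat_norm C = C" "icat_norm C (c_tp X) = c_tp X" using precwa by (simp_all add: is_precwa_def)
  have "icat_norm C (P_tm U X) = P_tm U X" unfolding P_tm_def by (rule icat_norm_idem) simp
  moreover have "ifun_norm C (P_tm U X) (P_proj U X) = P_proj U X" by (simp add: P_proj_def)
  moreover have "itrans_norm C (c_tp X) (n_ext (P_ob U X)) = n_ext (P_ob U X)" "itrans_norm C (c_tp X) (n_var (P_ob U X)) = n_var (P_ob U X)"
    by (simp_all add: P_ob_def)
  ultimately show ?thesis
    using s n sm represents_P discrete_opfibration_P strictly_natural_P strict_indexed_category_P_tm B.display_category_axioms T.strict_indexed_category_axioms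
    unfolding is_prenm_def Let_def by (simp add: small_icat_def small_cat_def del: P_ob_simps(5,6))
qed

lemma P_push:
  assumes "\<Gamma> \<in> obs C" "f \<in> ars (TY \<Gamma>)" "s \<in> sec \<Gamma> (src (TY \<Gamma>) f)"
  shows "push (P_ob U X) \<Gamma> f (enc U (src (TY \<Gamma>) f) s) = enc U (tgt (TY \<Gamma>) f) (cmp C (cmar X \<Gamma> f) s)"
proof -
  have "dlift (TM \<Gamma>) (cp (P_proj U X) \<Gamma>) f (enc U (src (TY \<Gamma>) f) s) = arr \<Gamma> f s"
    by (rule discrete_opfibration.dlift_eqI[OF discrete_opfibration_P[OF assms(1)]]) (use assms in simp_all)
  then show ?thesis using assms by (simp add: push_def)
qed

text \<open>The rebuilt comprehension is the original one on the nose, because \<open>cmar\<close>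
  and \<open>rho\<close> have the universal properties that characterise \<open>ext_map\<close> and
  \<open>ext_ps\<close>; this is \<open>sh_nat\<close> and \<open>sh_cmp\<close>
  respectively.\<close>

lemma nm_comp_P_ob: "nm_comp (P_ob U X) = c_comp X"
proof -
  interpret N: prenm U "P_ob U X" by unfold_locales (rule is_prenm_P_ob)
  note P = P_ob_simps(1-5)
  show ?thesis
  proof (rule ifun_eqI[of C "c_tp X"], goal_cases)
    case 1 show ?case using N.nm_comp_norm by simp
  next
    case 2 show ?case using precwa by (simp add: is_precwa_def)
  next
    case (3 \<Gamma> A) then show ?case using N.nm_comp_simps(1)[of \<Gamma> A] by simp
  next
    case (4 \<Gamma> f)
    let ?A = "src (TY \<Gamma>) f" and ?B = "tgt (TY \<Gamma>) f"
    have AB: "?A \<in> obs (TY \<Gamma>)" "?B \<in> obs (TY \<Gamma>)" using 4 by simp_all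
    note e = N.ext_map_simps(1-5)[of \<Gamma> f ?A ?B, unfolded P, OF 4 refl refl]
    have ov: "over (p \<Gamma> ?A) ?B (cmar X \<Gamma> f)" using 4 AB by (simp add: over_def)
    note i = over_idn[OF 4(1) AB(1)]
    have s: "sh X (p \<Gamma> ?A) ?A (idn C (src C (p \<Gamma> ?A))) \<in> sec (src C (p \<Gamma> ?A)) (fo (ri (c_tp X) (p \<Gamma> ?A)) ?A)"
      using sh_sec[OF i] .
    have n: "sh X (p \<Gamma> ?A) ?B (cmar X \<Gamma> f) = cmp C (cmar X (src C (p \<Gamma> ?A)) (fa (ri (c_tp X) (p \<Gamma> ?A)) f)) (sh X (p \<Gamma> ?A) ?A (idn C (src C (p \<Gamma> ?A))))"
      using sh_nat(1)[of "p \<Gamma> ?A" f "idn C (src C (p \<Gamma> ?A))"] i 4 AB by simp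
    have v: "fo (ri (P_tm U X) (cmar X \<Gamma> f)) (n_var (P_ob U X) \<Gamma> ?B) =
      push (P_ob U X) (src C (p \<Gamma> ?A)) (fa (ri (c_tp X) (p \<Gamma> ?A)) f) (n_var (P_ob U X) \<Gamma> ?A)"
      using var_ri[OF ov] 4 AB n P_push[of "src C (p \<Gamma> ?A)" "fa (ri (c_tp X) (p \<Gamma> ?A)) f" "sh X (p \<Gamma> ?A) ?A (idn C (src C (p \<Gamma> ?A)))"] s
      by simp
    have "ext_map (P_ob U X) \<Gamma> f = cmar X \<Gamma> f"
      using 4 AB e v by - (rule N.ext_eqI[of \<Gamma> ?B]; simp del: P_ob_simps(6))
    then show ?case using 4 AB N.nm_comp_simps(2)[of \<Gamma> f] by simp
  next
    case (5 u A)
    let ?p = "p (tgt C u) A" and ?A = "fo (ri (c_tp X) u) A"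
    have o: "tgt C u \<in> obs C" "src C u \<in> obs C" "?A \<in> obs (TY (src C u))" using 5 by simp_all
    note e = N.ext_ps_simps(1-5)[of u A, unfolded P, OF 5]
    have ov: "over (cmp C u (pb C u ?p)) A (pt C u ?p)" "over (pb C u ?p) ?A (rho X u A)"
      using 5 by (simp_all add: over_def)
    \<comment> \<open>The pairing of the two projections of a pullback is its identity, so in
      \<open>sh_cmp\<close> for the second projection only \<open>rho\<close> is left.\<close>
    have "pb_pair C (pb C u ?p) (pt C u ?p) (pb C u ?p) (pt C u ?p) = idn C (src C (pb C u ?p))"
      by (rule B.pb_eqI[of ?p u]) (use 5 in simp_all)
    then have "sh X (cmp C u (pb C u ?p)) A (pt C u ?p) = sh X (pb C u ?p) ?A (rho X u A)"
      using sh_cmp[OF 5(1) _ _ 5(2) ov(1)] 5 by simp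
    then have v: "fo (ri (P_tm U X) (rho X u A)) (n_var (P_ob U X) (src C u) ?A) = fo (ri (P_tm U X) (pt C u ?p)) (n_var (P_ob U X) (tgt C u) A)"
      using var_ri[OF ov(1)] var_ri[OF ov(2)] 5 o by (simp add: T.ri_cmp del: P_ob_simps(6))
    have "ext_ps (P_ob U X) u A = rho X u A"
      using 5 o e v by - (rule N.ext_eqI[of "src C u" ?A]; simp del: P_ob_simps(6))
    then show ?case using 5 o N.nm_comp_simps(3)[of u A] by simp
  qed
qed

lemma C_ob_P_ob: "C_ob (P_ob U X) = X"
  by (rule precwa.equality) (simp_all add: C_ob_def nm_comp_P_ob)

end

section \<open>The explicit action of \<open>P_functor\<close> as the inverse of
  \<open>C_functor\<close>\<close>

locale cwa_mor = X: precwa U X + Y: precwa U Y for U :: "'u universe" and X Y +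
  fixes F :: "'u cwa_mor"
  assumes cwa_mor: "is_cwa_mor X Y F"
begin

interpretation N: prenm U "P_ob U X" by unfold_locales (rule X.is_prenm_P_ob)
interpretation M: prenm U "P_ob U Y" by unfold_locales (rule Y.is_prenm_P_ob)

lemma cwa_mor': "is_cwa_mor (C_ob (P_ob U X)) (C_ob (P_ob U Y)) F"
  using cwa_mor by (simp add: X.C_ob_P_ob Y.C_ob_P_ob)

interpretation W: comp_data U "P_ob U X" "P_ob U Y" "cm_base F" "cm_tp F" "tau_term (P_ob U Y) F"
  by (rule cwa_mor_comp_data(1)[OF N.prenm M.prenm cwa_mor'])

lemma tau_over:
  assumes "\<Gamma> \<in> obs X.C" "A \<in> obs (X.TY \<Gamma>)"
  shows "Y.over (fa (cm_base F) (X.p \<Gamma> A)) (fo (cp (cm_tp F) \<Gamma>) A) (und (cm_tau F \<Gamma> A))"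
proof -
  let ?A = "fo (cp (cm_tp F) \<Gamma>) A" and ?G = "fo (cm_base F) \<Gamma>"
  have 1: "cm_tau F \<Gamma> A = W.w_tau (tau_term (P_ob U Y) F) \<Gamma> A"
    using cwa_mor_comp_data(2)[OF N.prenm M.prenm cwa_mor'] assms by simp
  note D = W.D.map_simps[unfolded X.P_ob_simps Y.P_ob_simps(1-4)] and K = W.K.cp_simps(1)[unfolded X.P_ob_simps(1-4) Y.P_ob_simps(1-4)]
  have e: "und (cm_tau F \<Gamma> A) = ext_pair (P_ob U Y) ?G ?A (fa (cm_base F) (X.p \<Gamma> A)) (tau_term (P_ob U Y) F \<Gamma> A)"
    using assms by (simp add: 1)
  have G: "?G \<in> obs Y.C" "?A \<in> obs (Y.TY ?G)" using assms D K by simp_all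
  have w: "tau_term (P_ob U Y) F \<Gamma> A \<in> obs (Y.TM (fo (cm_base F) (src X.C (X.p \<Gamma> A))))"
    "fo (cp (P_proj U Y) (fo (cm_base F) (src X.C (X.p \<Gamma> A)))) (tau_term (P_ob U Y) F \<Gamma> A) = fo (ri (c_tp Y) (fa (cm_base F) (X.p \<Gamma> A))) ?A"
    using W.w_ob[of \<Gamma> A, OF _ _ refl] W.w_typ[of \<Gamma> A, OF _ _ refl] assms by simp_all
  have p: "X.p \<Gamma> A \<in> ars X.C" "tgt X.C (X.p \<Gamma> A) = \<Gamma>" using assms by simp_all
  show ?thesis
    unfolding Y.over_def e using M.ext_pair_simps(1-4)[of ?G ?A "fa (cm_base F) (X.p \<Gamma> A)" "tau_term (P_ob U Y) F \<Gamma> A"] G w p D by simp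
qed

text \<open>In a rebuilt model a coded section is classified by the section itself. Hence
  \<open>T_ob\<close> evaluates to the universal element reindexed along \<tau> after the image of
  \<open>s\<close>, which by \<open>var_ri\<close> and \<open>sh_idn\<close> is the code in
  \<open>P_tm_ob\<close>.\<close>

lemma T_ob_P:
  assumes "\<Gamma> \<in> obs X.C" "x \<in> obs (X.TM \<Gamma>)"
  shows "W.T_ob \<Gamma> x = P_tm_ob U X Y F \<Gamma> x"
proof -
  obtain A s where x: "x = enc U A s" "A \<in> obs (X.TY \<Gamma>)" "s \<in> X.sec \<Gamma> A" using assms by (elim X.P_obsE)
  let ?A = "fo (cp (cm_tp F) \<Gamma>) A" and ?G = "fo (cm_base F) \<Gamma>" and ?\<tau> = "und (cm_tau F \<Gamma> A)" and ?p = "X.p \<Gamma> A"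
  note s = X.sec_simps[OF x(3)]
  have ov: "X.over (idn X.C \<Gamma>) A s" using assms x(2) s by (simp add: X.over_def)
  have "fo (ri (P_tm U X) s) (n_var (P_ob U X) \<Gamma> A) = enc U A s"
    using X.var_ri[OF ov] X.sh_idn[OF assms(1) x(2,3)] assms x(2) by simp
  moreover note e = W.section_simps(1-5)[of \<Gamma> x A] 
  ultimately have sec: "ext_pair (P_ob U X) \<Gamma> A (idn X.C \<Gamma>) x = s"
    using assms x s by - (rule N.ext_eqI[of \<Gamma> A]; simp del: X.P_ob_simps(6))
  note D = W.D.map_simps[unfolded X.P_ob_simps(1-4) Y.P_ob_simps(1-4)] and K = W.K.cp_simps(1)[unfolded X.P_ob_simps(1-4) Y.P_ob_simps(1-4)]
  note t = Y.overD[OF tau_over[OF assms(1) x(2)]]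
  have p: "?p \<in> ars X.C" "tgt X.C ?p = \<Gamma>" "?A \<in> obs (Y.TY ?G)" "?G \<in> obs Y.C" using assms x(2) D K by simp_all
  have Fs: "fa (cm_base F) s \<in> ars Y.C" "src Y.C (fa (cm_base F) s) = ?G" "tgt Y.C (fa (cm_base F) s) = fo (cm_base F) (src X.C ?p)"
    "cmp Y.C (fa (cm_base F) ?p) (fa (cm_base F) s) = idn Y.C ?G"
    using s p assms D(2-4) by (simp_all flip: D(5,6))
  have ov2: "Y.over (idn Y.C ?G) ?A (cmp Y.C ?\<tau> (fa (cm_base F) s))"
    using t Fs p D(2-4)[OF p(1)] Y.B.cmp_pull[OF t(6), of "fa (cm_base F) s"] by (simp add: Y.over_def)
  then have sec2: "cmp Y.C ?\<tau> (fa (cm_base F) s) \<in> Y.sec ?G ?A" using Y.overD[OF ov2] p by (simp add: Y.sec_def)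
  have "W.T_ob \<Gamma> x = fo (ri (P_tm U Y) (fa (cm_base F) s)) (fo (ri (P_tm U Y) ?\<tau>) (n_var (P_ob U Y) ?G ?A))"
    using sec x assms by (simp add: W.T_ob_def tau_term_def del: Y.P_ob_simps(6))
  also have "\<dots> = fo (ri (P_tm U Y) (cmp Y.C ?\<tau> (fa (cm_base F) s))) (n_var (P_ob U Y) ?G ?A)"
    using M.Tm.ri_cmp(1)[of ?\<tau> "fa (cm_base F) s" "n_var (P_ob U Y) ?G ?A"] t Fs D(2-4)[OF p(1)] p M.ext_simps(3)[of ?G ?A, OF _ _ refl]
    by (simp del: Y.P_ob_simps(6))
  also have "\<dots> = enc U ?A (cmp Y.C ?\<tau> (fa (cm_base F) s))"
    using Y.var_ri[OF ov2] Y.sh_idn[OF p(4,3) sec2] p by (simp del: Y.P_ob_simps(6))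
  also have "\<dots> = P_tm_ob U X Y F \<Gamma> x"
    using x assms by (simp add: P_tm_ob_def enc_simps Let_def)
  finally show ?thesis .
qed

text \<open>Identifies the explicit formulas of \<open>P_mor\<close> with the abstract inverse, so
  that all facts about \<open>C_inv\<close> apply to them.\<close>

lemma P_mor_eq: "P_mor U X Y F = C_inv (P_ob U X) (P_ob U Y) F"
proof -
  have "nm_tm (P_mor U X Y F) = nm_tm W.T_mor"
  proof (rule ifun_eqI[of X.C "P_tm U X"], goal_cases)
    case 1 show ?case by (simp add: P_mor_def)
  next
    case 2 show ?case using W.T_tm_simps(6) by simp
  next
    case (3 \<Gamma> x) then show ?case using W.T_tm_simps(3)[of \<Gamma> x] T_ob_P[of \<Gamma> x] by (simp add: P_mor_def Let_def)
  next
    case (4 \<Gamma> k) then show ?case using W.T_tm_simps(4)[of \<Gamma> k] T_ob_P[of \<Gamma> "src (X.TM \<Gamma>) k"] N.Tm.fib_simps(1)[of \<Gamma> k]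
      by (simp add: P_mor_def Let_def)
  next
    case (5 u x) then show ?case using W.T_tm_simps(5)[of u x] T_ob_P[of "src X.C u" "fo (ri (P_tm U X) u) x"] N.Tm.ri_simps(1)[of u _ x, OF _ refl]
      by (simp add: P_mor_def Let_def)
  qed
  then show ?thesis
    unfolding C_inv_def by (rule_tac nm_mor.equality) (simp_all add: W.T_tm_simps P_mor_def)
qed

end

lemma P_cell_eq:
  assumes "is_universe U" "is_precwa U X" "is_precwa U Y" "is_cwa_cell X Y a"
  shows "P_cell U X Y a = C_inv_cell (P_ob U X) (P_ob U Y) a"
proof -
  interpret X: precwa U X using assms by (simp add: precwa_def precwa_axioms_def)
  interpret Y: precwa U Y using assms by (simp add: precwa_def precwa_axioms_def)
  have FG: "is_cwa_mor X Y (cc_src a)" "is_cwa_mor X Y (cc_tgt a)"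
    using assms(4) by (simp_all add: is_cwa_cell_def Let_def)
  interpret F: cwa_mor U X Y "cc_src a" by unfold_locales (rule FG)
  interpret G: cwa_mor U X Y "cc_tgt a" by unfold_locales (rule FG)
  have "nc_tm (P_cell U X Y a) = cell_tm (P_ob U X) (P_ob U Y) (C_inv (P_ob U X) (P_ob U Y) (cc_src a)) (cc_tp a)"
    unfolding F.P_mor_eq[symmetric] P_cell_def cell_tm_def
    by (simp, rule itrans_norm_cong) (simp add: P_mor_def Let_def)
  then show ?thesis
    by (simp add: P_cell_def C_inv_cell_def F.P_mor_eq G.P_mor_eq)
qed

section \<open>Transport of 2-categories\<close>

context strict_2category
begin

lemmas hom_simps = category.ars_simps[OF hom_cat]

lemma cmp_simps:
  assumes "X \<in> t_ob T" "Y \<in> t_ob T" "Z \<in> t_ob T"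
  shows "F \<in> obs (t_hom T X Y) \<Longrightarrow> G \<in> obs (t_hom T Y Z) \<Longrightarrow> t_cmp T X Y Z G F \<in> obs (t_hom T X Z)"
    "a \<in> ars (t_hom T X Y) \<Longrightarrow> b \<in> ars (t_hom T Y Z) \<Longrightarrow> t_cmp2 T X Y Z b a \<in> ars (t_hom T X Z)"
    "a \<in> ars (t_hom T X Y) \<Longrightarrow> b \<in> ars (t_hom T Y Z) \<Longrightarrow>
      src (t_hom T X Z) (t_cmp2 T X Y Z b a) = t_cmp T X Y Z (src (t_hom T Y Z) b) (src (t_hom T X Y) a)"
    "a \<in> ars (t_hom T X Y) \<Longrightarrow> b \<in> ars (t_hom T Y Z) \<Longrightarrow>
      tgt (t_hom T X Z) (t_cmp2 T X Y Z b a) = t_cmp T X Y Z (tgt (t_hom T Y Z) b) (tgt (t_hom T X Y) a)"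
    "F \<in> obs (t_hom T X Y) \<Longrightarrow> G \<in> obs (t_hom T Y Z) \<Longrightarrow>
      t_cmp2 T X Y Z (t_id2 T Y Z G) (t_id2 T X Y F) = t_id2 T X Z (t_cmp T X Y Z G F)"
    "a \<in> ars (t_hom T X Y) \<Longrightarrow> a' \<in> ars (t_hom T X Y) \<Longrightarrow> b \<in> ars (t_hom T Y Z) \<Longrightarrow> b' \<in> ars (t_hom T Y Z) \<Longrightarrow>
      src (t_hom T X Y) a' = tgt (t_hom T X Y) a \<Longrightarrow> src (t_hom T Y Z) b' = tgt (t_hom T Y Z) b \<Longrightarrow>
      t_cmp2 T X Y Z (cmp (t_hom T Y Z) b' b) (cmp (t_hom T X Y) a' a) =
      cmp (t_hom T X Z) (t_cmp2 T X Y Z b' a') (t_cmp2 T X Y Z b a)"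
proof -
  interpret is_functor "prod_cat (t_hom T Y Z) (t_hom T X Y)" "t_hom T X Z"
    "\<lparr>fo = (\<lambda>(G, F). t_cmp T X Y Z G F), fa = (\<lambda>(\<beta>, \<alpha>). t_cmp2 T X Y Z \<beta> \<alpha>)\<rparr>"
    by (rule cmp_functor[OF assms])
  show "F \<in> obs (t_hom T X Y) \<Longrightarrow> G \<in> obs (t_hom T Y Z) \<Longrightarrow> t_cmp T X Y Z G F \<in> obs (t_hom T X Z)"
    using map_simps(1)[of "(G, F)"] by simp
  show "a \<in> ars (t_hom T X Y) \<Longrightarrow> b \<in> ars (t_hom T Y Z) \<Longrightarrow> t_cmp2 T X Y Z b a \<in> ars (t_hom T X Z)"
    "a \<in> ars (t_hom T X Y) \<Longrightarrow> b \<in> ars (t_hom T Y Z) \<Longrightarrow>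
      src (t_hom T X Z) (t_cmp2 T X Y Z b a) = t_cmp T X Y Z (src (t_hom T Y Z) b) (src (t_hom T X Y) a)"
    "a \<in> ars (t_hom T X Y) \<Longrightarrow> b \<in> ars (t_hom T Y Z) \<Longrightarrow>
      tgt (t_hom T X Z) (t_cmp2 T X Y Z b a) = t_cmp T X Y Z (tgt (t_hom T Y Z) b) (tgt (t_hom T X Y) a)"
    using map_simps(2-4)[of "(b, a)"] by simp_all
  show "F \<in> obs (t_hom T X Y) \<Longrightarrow> G \<in> obs (t_hom T Y Z) \<Longrightarrow>
      t_cmp2 T X Y Z (t_id2 T Y Z G) (t_id2 T X Y F) = t_id2 T X Z (t_cmp T X Y Z G F)"
    using map_simps(5)[of "(G, F)"] by simp
  show "a \<in> ars (t_hom T X Y) \<Longrightarrow> a' \<in> ars (t_hom T X Y) \<Longrightarrow> b \<in> ars (t_hom T Y Z) \<Longrightarrow> b' \<in> ars (t_hom T Y Z) \<Longrightarrow>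
      src (t_hom T X Y) a' = tgt (t_hom T X Y) a \<Longrightarrow> src (t_hom T Y Z) b' = tgt (t_hom T Y Z) b \<Longrightarrow>
      t_cmp2 T X Y Z (cmp (t_hom T Y Z) b' b) (cmp (t_hom T X Y) a' a) =
      cmp (t_hom T X Z) (t_cmp2 T X Y Z b' a') (t_cmp2 T X Y Z b a)"
    using map_simps(6)[of "(b', a')" "(b, a)"] by simp
qed

end

lemma tf_id_simps [simp]: "tf_ob tf_id X = X" "tf_hom tf_id X Y = fid"
  by (simp_all add: tf_id_def)

lemma tf_comp_simps [simp]:
  "tf_ob (tf_comp Q P) X = tf_ob Q (tf_ob P X)"
  "tf_hom (tf_comp Q P) X Y = fcomp (tf_hom Q (tf_ob P X) (tf_ob P Y)) (tf_hom P X Y)"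
  by (simp_all add: tf_comp_def)

lemma strict_2functor_id: "strict_2category T \<Longrightarrow> strict_2functor T T tf_id"
  by (simp add: strict_2functor_def strict_2functor_axioms_def is_functor_fid strict_2category.hom_cat)

lemma strict_2functor_comp:
  assumes "strict_2functor T T' P" "strict_2functor T' T'' Q"
  shows "strict_2functor T T'' (tf_comp Q P)"
proof -
  interpret P: strict_2functor T T' P by fact
  interpret Q: strict_2functor T' T'' Q by fact
  note PF = is_functor.map_simps[OF P.map_hom]
  show ?thesis
    by (rule strict_2functor.intro[OF P.Dom.strict_2category_axioms Q.Cod.strict_2category_axioms strict_2functor_axioms.intro])
      (simp_all add: P.map_ob Q.map_ob P.map_id Q.map_id P.map_cmp Q.map_cmp P.map_cmp2 Q.map_cmp2 PF
        is_functor_fcomp[OF P.map_hom Q.map_hom])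
qed

text \<open>
  \<open>K\<close> is bijective on 1-cells and 2-cells and preserves all operations of \<open>T\<close>, while
  \<open>T'\<close> is not yet known to be a 2-category; \<open>\<epsilon>\<close> and \<open>\<epsilon>'\<close> are the
  unique 1-cells that \<open>K\<close> maps to identities.
\<close>

locale hom_bijection = T: strict_2category T for T :: "('o, 'm, 'c) tcat" +
  fixes T' :: "('p, 'n, 'd) tcat"
    and K :: "('o, 'm, 'c, 'p, 'n, 'd) tfun" and P :: "('p, 'n, 'd, 'o, 'm, 'c) tfun"
    and \<epsilon> \<epsilon>' :: "'o \<Rightarrow> 'm"
  assumes K_ob: "X \<in> t_ob T \<Longrightarrow> tf_ob K X \<in> t_ob T'"
    and P_ob: "x \<in> t_ob T' \<Longrightarrow> tf_ob P x \<in> t_ob T"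
    and KP_ob: "x \<in> t_ob T' \<Longrightarrow> tf_ob K (tf_ob P x) = x"
    and K_mor: "X \<in> t_ob T \<Longrightarrow> Y \<in> t_ob T \<Longrightarrow> F \<in> obs (t_hom T X Y) \<Longrightarrow>
      fo (tf_hom K X Y) F \<in> obs (t_hom T' (tf_ob K X) (tf_ob K Y))"
    and K_mor_inj: "X \<in> t_ob T \<Longrightarrow> Y \<in> t_ob T \<Longrightarrow> F \<in> obs (t_hom T X Y) \<Longrightarrow> G \<in> obs (t_hom T X Y) \<Longrightarrow>
      fo (tf_hom K X Y) F = fo (tf_hom K X Y) G \<Longrightarrow> F = G"
    and K_cell: "X \<in> t_ob T \<Longrightarrow> Y \<in> t_ob T \<Longrightarrow> a \<in> ars (t_hom T X Y) \<Longrightarrow>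
      fa (tf_hom K X Y) a \<in> ars (t_hom T' (tf_ob K X) (tf_ob K Y)) \<and>
      src (t_hom T' (tf_ob K X) (tf_ob K Y)) (fa (tf_hom K X Y) a) = fo (tf_hom K X Y) (src (t_hom T X Y) a) \<and>
      tgt (t_hom T' (tf_ob K X) (tf_ob K Y)) (fa (tf_hom K X Y) a) = fo (tf_hom K X Y) (tgt (t_hom T X Y) a)"
    and K_cell_inj: "X \<in> t_ob T \<Longrightarrow> Y \<in> t_ob T \<Longrightarrow> a \<in> ars (t_hom T X Y) \<Longrightarrow> b \<in> ars (t_hom T X Y) \<Longrightarrow>
      fa (tf_hom K X Y) a = fa (tf_hom K X Y) b \<Longrightarrow> a = b"
    and P_mor: "x \<in> t_ob T' \<Longrightarrow> y \<in> t_ob T' \<Longrightarrow> f \<in> obs (t_hom T' x y) \<Longrightarrow>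
      fo (tf_hom P x y) f \<in> obs (t_hom T (tf_ob P x) (tf_ob P y)) \<and>
      fo (tf_hom K (tf_ob P x) (tf_ob P y)) (fo (tf_hom P x y) f) = f"
    and P_cell: "x \<in> t_ob T' \<Longrightarrow> y \<in> t_ob T' \<Longrightarrow> c \<in> ars (t_hom T' x y) \<Longrightarrow>
      fa (tf_hom P x y) c \<in> ars (t_hom T (tf_ob P x) (tf_ob P y)) \<and>
      fa (tf_hom K (tf_ob P x) (tf_ob P y)) (fa (tf_hom P x y) c) = c"
    and K_idn: "X \<in> t_ob T \<Longrightarrow> Y \<in> t_ob T \<Longrightarrow> F \<in> obs (t_hom T X Y) \<Longrightarrow>
      fa (tf_hom K X Y) (idn (t_hom T X Y) F) = idn (t_hom T' (tf_ob K X) (tf_ob K Y)) (fo (tf_hom K X Y) F)"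
    and K_vcmp: "X \<in> t_ob T \<Longrightarrow> Y \<in> t_ob T \<Longrightarrow> a \<in> ars (t_hom T X Y) \<Longrightarrow> b \<in> ars (t_hom T X Y) \<Longrightarrow>
      src (t_hom T X Y) b = tgt (t_hom T X Y) a \<Longrightarrow>
      fa (tf_hom K X Y) (cmp (t_hom T X Y) b a) =
        cmp (t_hom T' (tf_ob K X) (tf_ob K Y)) (fa (tf_hom K X Y) b) (fa (tf_hom K X Y) a)"
    and K_id: "X \<in> t_ob T \<Longrightarrow> fo (tf_hom K X X) (t_id T X) = t_id T' (tf_ob K X)"
    and K_cmp: "X \<in> t_ob T \<Longrightarrow> Y \<in> t_ob T \<Longrightarrow> Z \<in> t_ob T \<Longrightarrow> F \<in> obs (t_hom T X Y) \<Longrightarrow> G \<in> obs (t_hom T Y Z) \<Longrightarrow>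
      fo (tf_hom K X Z) (t_cmp T X Y Z G F) =
        t_cmp T' (tf_ob K X) (tf_ob K Y) (tf_ob K Z) (fo (tf_hom K Y Z) G) (fo (tf_hom K X Y) F)"
    and K_cmp2: "X \<in> t_ob T \<Longrightarrow> Y \<in> t_ob T \<Longrightarrow> Z \<in> t_ob T \<Longrightarrow> a \<in> ars (t_hom T X Y) \<Longrightarrow> b \<in> ars (t_hom T Y Z) \<Longrightarrow>
      fa (tf_hom K X Z) (t_cmp2 T X Y Z b a) =
        t_cmp2 T' (tf_ob K X) (tf_ob K Y) (tf_ob K Z) (fa (tf_hom K Y Z) b) (fa (tf_hom K X Y) a)"
    and \<epsilon>: "X \<in> t_ob T \<Longrightarrow> \<epsilon> X \<in> obs (t_hom T (tf_ob P (tf_ob K X)) X) \<and>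
      fo (tf_hom K (tf_ob P (tf_ob K X)) X) (\<epsilon> X) = t_id T' (tf_ob K X)"
    and \<epsilon>': "X \<in> t_ob T \<Longrightarrow> \<epsilon>' X \<in> obs (t_hom T X (tf_ob P (tf_ob K X))) \<and>
      fo (tf_hom K X (tf_ob P (tf_ob K X))) (\<epsilon>' X) = t_id T' (tf_ob K X)"
begin

abbreviation "KM X Y \<equiv> fo (tf_hom K X Y)"
abbreviation "KC X Y \<equiv> fa (tf_hom K X Y)"
abbreviation "PM x y \<equiv> fo (tf_hom P x y)"
abbreviation "PC x y \<equiv> fa (tf_hom P x y)"
abbreviation "KO \<equiv> tf_ob K"
abbreviation "PO \<equiv> tf_ob P"
abbreviation "H \<equiv> t_hom T"
abbreviation "H' \<equiv> t_hom T'"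

lemma P_mor_simps [simp]:
  assumes "x \<in> t_ob T'" "y \<in> t_ob T'" "f \<in> obs (H' x y)"
  shows "PM x y f \<in> obs (H (PO x) (PO y))" "KM (PO x) (PO y) (PM x y f) = f"
  using P_mor assms by auto

lemma P_cell_simps [simp]:
  assumes "x \<in> t_ob T'" "y \<in> t_ob T'" "a \<in> ars (H' x y)"
  shows "PC x y a \<in> ars (H (PO x) (PO y))" "KC (PO x) (PO y) (PC x y a) = a"
  using P_cell assms by auto

declare K_ob [simp] P_ob [simp] KP_ob [simp] T.hom_simps [simp] T.cmp_simps [simp] T.id_ob [simp]

lemma K_mor' [simp]: "x \<in> t_ob T' \<Longrightarrow> y \<in> t_ob T' \<Longrightarrow> F \<in> obs (H (PO x) (PO y)) \<Longrightarrow> KM (PO x) (PO y) F \<in> obs (H' x y)"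
  using K_mor[of "PO x" "PO y" F] by simp

lemma K_cell' [simp]:
  assumes "x \<in> t_ob T'" "y \<in> t_ob T'" "a \<in> ars (H (PO x) (PO y))"
  shows "KC (PO x) (PO y) a \<in> ars (H' x y)"
    "src (H' x y) (KC (PO x) (PO y) a) = KM (PO x) (PO y) (src (H (PO x) (PO y)) a)"
    "tgt (H' x y) (KC (PO x) (PO y) a) = KM (PO x) (PO y) (tgt (H (PO x) (PO y)) a)"
  using K_cell[of "PO x" "PO y" a] assms by simp_all

lemma PK_mor [simp]: "x \<in> t_ob T' \<Longrightarrow> y \<in> t_ob T' \<Longrightarrow> F \<in> obs (H (PO x) (PO y)) \<Longrightarrow> PM x y (KM (PO x) (PO y) F) = F"
  by (rule K_mor_inj[of "PO x" "PO y"]) simp_all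

lemma PK_cell [simp]: "x \<in> t_ob T' \<Longrightarrow> y \<in> t_ob T' \<Longrightarrow> a \<in> ars (H (PO x) (PO y)) \<Longrightarrow> PC x y (KC (PO x) (PO y) a) = a"
  by (rule K_cell_inj[of "PO x" "PO y"]) simp_all

lemma P_cell_src [simp]:
  assumes "x \<in> t_ob T'" "y \<in> t_ob T'" "a \<in> ars (H' x y)"
  shows "src (H (PO x) (PO y)) (PC x y a) = PM x y (src (H' x y) a)"
    "tgt (H (PO x) (PO y)) (PC x y a) = PM x y (tgt (H' x y) a)"
    "src (H' x y) a \<in> obs (H' x y)" "tgt (H' x y) a \<in> obs (H' x y)"
proof -
  note b = P_cell_simps[OF assms]
  note c = K_cell'(2,3)[OF assms(1,2) b(1), unfolded b(2)]
  show "src (H' x y) a \<in> obs (H' x y)" "tgt (H' x y) a \<in> obs (H' x y)"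
    unfolding c using assms b(1) by simp_all
  show "src (H (PO x) (PO y)) (PC x y a) = PM x y (src (H' x y) a)"
    "tgt (H (PO x) (PO y)) (PC x y a) = PM x y (tgt (H' x y) a)"
    unfolding c using assms b(1) by simp_all
qed

text \<open>Every operation of \<open>T'\<close> is the image under \<open>K\<close> of the
  operation of \<open>T\<close> on the preimages; its typing and its compatibility with
  \<open>P\<close> follow. The lemmas on the other operations use the same argument.\<close>

lemma P_idn [simp]:
  assumes "x \<in> t_ob T'" "y \<in> t_ob T'" "f \<in> obs (H' x y)"
  shows "idn (H' x y) f \<in> ars (H' x y)" "PC x y (idn (H' x y) f) = idn (H (PO x) (PO y)) (PM x y f)"
    "src (H' x y) (idn (H' x y) f) = f" "tgt (H' x y) (idn (H' x y) f) = f"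
proof -
  have "idn (H' x y) f = KC (PO x) (PO y) (idn (H (PO x) (PO y)) (PM x y f))"
    using K_idn[of "PO x" "PO y" "PM x y f"] assms by simp
  then show "idn (H' x y) f \<in> ars (H' x y)" "PC x y (idn (H' x y) f) = idn (H (PO x) (PO y)) (PM x y f)"
    "src (H' x y) (idn (H' x y) f) = f" "tgt (H' x y) (idn (H' x y) f) = f"
    using assms by simp_all
qed

text \<open>Laws of \<open>T'\<close> are tested after applying \<open>P\<close>: the rewrite rules
  of this context turn each operation into the corresponding one of \<open>T\<close>, where the law
  is known.\<close>

lemma P_eq_iff:
  "x \<in> t_ob T' \<Longrightarrow> y \<in> t_ob T' \<Longrightarrow> f \<in> obs (H' x y) \<Longrightarrow> g \<in> obs (H' x y) \<Longrightarrow> PM x y f = PM x y g \<Longrightarrow> f = g"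
  "x \<in> t_ob T' \<Longrightarrow> y \<in> t_ob T' \<Longrightarrow> a \<in> ars (H' x y) \<Longrightarrow> b \<in> ars (H' x y) \<Longrightarrow> PC x y a = PC x y b \<Longrightarrow> a = b"
  by (metis P_mor_simps(2)) (metis P_cell_simps(2))

lemma P_vcmp [simp]:
  assumes "x \<in> t_ob T'" "y \<in> t_ob T'" "a \<in> ars (H' x y)" "b \<in> ars (H' x y)" "src (H' x y) b = tgt (H' x y) a"
  shows "cmp (H' x y) b a \<in> ars (H' x y)" "PC x y (cmp (H' x y) b a) = cmp (H (PO x) (PO y)) (PC x y b) (PC x y a)"
    "src (H' x y) (cmp (H' x y) b a) = src (H' x y) a" "tgt (H' x y) (cmp (H' x y) b a) = tgt (H' x y) b"
proof -
  have "cmp (H' x y) b a = KC (PO x) (PO y) (cmp (H (PO x) (PO y)) (PC x y b) (PC x y a))"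
    using K_vcmp[of "PO x" "PO y" "PC x y a" "PC x y b"] assms by simp
  then show "cmp (H' x y) b a \<in> ars (H' x y)" "PC x y (cmp (H' x y) b a) = cmp (H (PO x) (PO y)) (PC x y b) (PC x y a)"
    "src (H' x y) (cmp (H' x y) b a) = src (H' x y) a" "tgt (H' x y) (cmp (H' x y) b a) = tgt (H' x y) b"
    using assms by simp_all
qed

lemma P_id [simp]:
  assumes "x \<in> t_ob T'"
  shows "t_id T' x \<in> obs (H' x x)" "PM x x (t_id T' x) = t_id T (PO x)"
proof -
  have "t_id T' x = KM (PO x) (PO x) (t_id T (PO x))" using K_id[of "PO x"] assms by simp
  then show "t_id T' x \<in> obs (H' x x)" "PM x x (t_id T' x) = t_id T (PO x)" using assms by simp_all
qed

lemma P_cmp [simp]: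
  assumes "x \<in> t_ob T'" "y \<in> t_ob T'" "z \<in> t_ob T'" "f \<in> obs (H' x y)" "g \<in> obs (H' y z)"
  shows "t_cmp T' x y z g f \<in> obs (H' x z)" "PM x z (t_cmp T' x y z g f) = t_cmp T (PO x) (PO y) (PO z) (PM y z g) (PM x y f)"
proof -
  have "t_cmp T' x y z g f = KM (PO x) (PO z) (t_cmp T (PO x) (PO y) (PO z) (PM y z g) (PM x y f))"
    using K_cmp[of "PO x" "PO y" "PO z" "PM x y f" "PM y z g"] assms by simp
  then show "t_cmp T' x y z g f \<in> obs (H' x z)" "PM x z (t_cmp T' x y z g f) = t_cmp T (PO x) (PO y) (PO z) (PM y z g) (PM x y f)"
    using assms by simp_all
qed

lemma P_cmp2 [simp]:
  assumes "x \<in> t_ob T'" "y \<in> t_ob T'" "z \<in> t_ob T'" "a \<in> ars (H' x y)" "b \<in> ars (H' y z)"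
  shows "t_cmp2 T' x y z b a \<in> ars (H' x z)" "PC x z (t_cmp2 T' x y z b a) = t_cmp2 T (PO x) (PO y) (PO z) (PC y z b) (PC x y a)"
    "src (H' x z) (t_cmp2 T' x y z b a) = t_cmp T' x y z (src (H' y z) b) (src (H' x y) a)"
    "tgt (H' x z) (t_cmp2 T' x y z b a) = t_cmp T' x y z (tgt (H' y z) b) (tgt (H' x y) a)"
proof -
  have eq: "t_cmp2 T' x y z b a = KC (PO x) (PO z) (t_cmp2 T (PO x) (PO y) (PO z) (PC y z b) (PC x y a))"
    using K_cmp2[of "PO x" "PO y" "PO z" "PC x y a" "PC y z b"] assms by simp
  then show "t_cmp2 T' x y z b a \<in> ars (H' x z)" "PC x z (t_cmp2 T' x y z b a) = t_cmp2 T (PO x) (PO y) (PO z) (PC y z b) (PC x y a)"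
    using assms by simp_all
  show "src (H' x z) (t_cmp2 T' x y z b a) = t_cmp T' x y z (src (H' y z) b) (src (H' x y) a)"
    "tgt (H' x z) (t_cmp2 T' x y z b a) = t_cmp T' x y z (tgt (H' y z) b) (tgt (H' x y) a)"
    unfolding eq using assms by (auto intro!: P_eq_iff(1)[of x z])
qed

lemma hom_category':
  assumes "x \<in> t_ob T'" "y \<in> t_ob T'" shows "category (H' x y)"
proof (rule categoryI, goal_cases)
  case (5 a) show ?case by (rule P_eq_iff(2)[OF assms]) (use assms 5 in simp_all)
next
  case (6 a) show ?case by (rule P_eq_iff(2)[OF assms]) (use assms 6 in simp_all)
next
  case (7 a b c) show ?case by (rule P_eq_iff(2)[OF assms]) (use assms 7 in simp_all)
qed (use assms in simp_all)

lemma strict_2category': "strict_2category T'"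
proof (rule strict_2category.intro, goal_cases)
  case (1 x y) then show ?case by (rule hom_category')
next
  case (3 x y z)
  show ?case
  proof (rule is_functorI, goal_cases)
    case (3 gf) then show ?case using \<open>x \<in> t_ob T'\<close> \<open>y \<in> t_ob T'\<close> \<open>z \<in> t_ob T'\<close> by (cases gf) simp
  next
    case (4 ba) then show ?case using \<open>x \<in> t_ob T'\<close> \<open>y \<in> t_ob T'\<close> \<open>z \<in> t_ob T'\<close> by (cases ba) simp
  next
    case (5 gf)
    obtain g f where gf: "gf = (g, f)" by (cases gf)
    show ?case unfolding gf by (simp, rule P_eq_iff(2)[of x z]) (use 5 3 gf in simp_all)
  next
    case (6 ba ba')
    obtain b a b' a' where ba: "ba = (b, a)" "ba' = (b', a')" by (cases ba; cases ba')
    show ?case unfolding ba by (simp, rule P_eq_iff(2)[of x z]) (use 6 3 ba in simp_all)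
  qed (use 3 in \<open>simp_all add: category_prod hom_category'\<close>)
next
  case (4 x y f) show ?case by (rule P_eq_iff(1)[of x y]) (use 4 in \<open>simp_all add: T.unit_left\<close>)
next
  case (5 x y f) show ?case by (rule P_eq_iff(1)[of x y]) (use 5 in \<open>simp_all add: T.unit_right\<close>)
next
  case (6 w x y z f g h) show ?case by (rule P_eq_iff(1)[of w z]) (use 6 in \<open>simp_all add: T.assoc\<close>)
next
  case (7 x y a) show ?case by (rule P_eq_iff(2)[of x y]) (use 7 in \<open>simp_all add: T.unit2_left\<close>)
next
  case (8 x y a) show ?case by (rule P_eq_iff(2)[of x y]) (use 8 in \<open>simp_all add: T.unit2_right\<close>)
next
  case (9 w x y z a b c) show ?case by (rule P_eq_iff(2)[of w z]) (use 9 in \<open>simp_all add: T.assoc2\<close>)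
qed simp

lemma strict_2functor_P: "strict_2functor T' T P"
proof (rule strict_2functor.intro[OF strict_2category' T.strict_2category_axioms strict_2functor_axioms.intro], goal_cases)
  case (2 x y)
  then show ?case by (intro is_functorI) (simp_all add: hom_category' T.hom_cat)
qed simp_all

lemma strict_2functor_K: "strict_2functor T T' K"
proof (rule strict_2functor.intro[OF T.strict_2category_axioms strict_2category' strict_2functor_axioms.intro], goal_cases)
  case (2 X Y)
  then show ?case by (intro is_functorI) (simp_all add: hom_category' T.hom_cat K_mor K_cell K_idn K_vcmp)
qed (simp_all add: K_id K_cmp K_cmp2)

sublocale T': strict_2category T' by (rule strict_2category')

text \<open>\<open>tf_comp K P\<close> is the identity on objects, 1-cells and 2-cells, so
  identities can serve as components.\<close>

lemma unit: "strict_2nat_iso T' T' tf_id (tf_comp K P) (t_id T')"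
proof (intro strict_2nat_iso.intro strict_2nat.intro strict_2nat_axioms.intro strict_2nat_iso_axioms.intro, goal_cases)
  case 1 show ?case by (rule strict_2functor_id[OF strict_2category'])
next
  case 2 show ?case by (rule strict_2functor_comp[OF strict_2functor_P strict_2functor_K])
next
  case (4 x y f) then show ?case by (simp add: T'.unit_left T'.unit_right)
next
  case (5 x y a) then show ?case by (simp add: T'.unit2_left T'.unit2_right)
next
  case (6 x) then show ?case unfolding t_iso_def by (auto simp: T'.unit_left intro!: bexI[of _ "t_id T' x"])
qed simp

text \<open>Every equation is tested after \<open>K\<close>, which is injective on cells and sends
  \<open>\<epsilon>\<close> and \<open>\<epsilon>'\<close> to identities; what remains are unit laws
  of \<open>T'\<close>.\<close>

lemma counit: "strict_2nat_iso T T (tf_comp P K) tf_id \<epsilon>"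
proof -
  have e: "KM (PO (KO X)) (PO (KO X)) (t_id T (PO (KO X))) = t_id T' (KO X)" if "X \<in> t_ob T" for X
    using K_id[of "PO (KO X)"] that by simp
  show ?thesis
  proof (intro strict_2nat_iso.intro strict_2nat.intro strict_2nat_axioms.intro strict_2nat_iso_axioms.intro, goal_cases)
    case 1 show ?case by (rule strict_2functor_comp[OF strict_2functor_K strict_2functor_P])
  next
    case 2 show ?case by (rule strict_2functor_id[OF T.strict_2category_axioms])
  next
    case (3 X) then show ?case using \<epsilon> by simp
  next
    case (4 X Y F)
    show ?case
      by (rule K_mor_inj[of "PO (KO X)" Y])
        (use 4 \<epsilon>[of X] \<epsilon>[of Y] K_mor[of X Y F] in \<open>simp_all add: K_cmp T'.unit_left T'.unit_right\<close>)
  next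
    case (5 X Y a)
    show ?case
      by (rule K_cell_inj[of "PO (KO X)" Y])
        (use 5 \<epsilon>[of X] \<epsilon>[of Y] K_cell[of X Y a] in \<open>simp_all add: K_cmp2 K_idn T'.unit2_left T'.unit2_right\<close>)
  next
    case (6 X)
    have "t_cmp T (PO (KO X)) X (PO (KO X)) (\<epsilon>' X) (\<epsilon> X) = t_id T (PO (KO X))"
      by (rule K_mor_inj[of "PO (KO X)" "PO (KO X)"]) (use 6 \<epsilon>[of X] \<epsilon>'[of X] e in \<open>simp_all add: K_cmp T'.unit_left\<close>)
    moreover have "t_cmp T X (PO (KO X)) X (\<epsilon> X) (\<epsilon>' X) = t_id T X"
      by (rule K_mor_inj[of X X]) (use 6 \<epsilon>[of X] \<epsilon>'[of X] in \<open>simp_all add: K_cmp T'.unit_left K_id\<close>)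
    ultimately show ?case unfolding t_iso_def using 6 \<epsilon>[of X] \<epsilon>'[of X] by auto
  qed
qed

theorem strict_2equivalence: "strict_2equivalence T' T P K (t_id T') \<epsilon>"
  by (intro strict_2equivalence.intro strict_2equivalence_axioms.intro strict_2functor_P strict_2functor_K unit counit)

end

section \<open>Restriction to sub-2-categories\<close>

lemma sub_2cat_simps [simp]:
  "t_ob (sub_2cat T A B) = {X \<in> t_ob T. A X}" "t_hom (sub_2cat T A B) X Y = full_sub (t_hom T X Y) {F. B X Y F}"
  "t_id (sub_2cat T A B) = t_id T" "t_cmp (sub_2cat T A B) = t_cmp T" "t_cmp2 (sub_2cat T A B) = t_cmp2 T"
  by (simp_all add: sub_2cat_def)

lemma full_sub_simps [simp]:
  "obs (full_sub C S) = obs C \<inter> S" "ars (full_sub C S) = {f \<in> ars C. src C f \<in> S \<and> tgt C f \<in> S}"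
  "src (full_sub C S) = src C" "tgt (full_sub C S) = tgt C" "idn (full_sub C S) = idn C" "cmp (full_sub C S) = cmp C"
  by (simp_all add: full_sub_def)

lemma category_full_sub: "category C \<Longrightarrow> category (full_sub C S)"
  by (rule categoryI) (simp_all add: category.ars_simps)

lemma strict_2category_sub:
  assumes "strict_2category T" "\<And>X. X \<in> t_ob T \<Longrightarrow> A X \<Longrightarrow> B X X (t_id T X)"
    "\<And>X Y Z F G. X \<in> t_ob T \<Longrightarrow> Y \<in> t_ob T \<Longrightarrow> Z \<in> t_ob T \<Longrightarrow> A X \<Longrightarrow> A Y \<Longrightarrow> A Z \<Longrightarrow>
      F \<in> obs (t_hom T X Y) \<Longrightarrow> G \<in> obs (t_hom T Y Z) \<Longrightarrow> B X Y F \<Longrightarrow> B Y Z G \<Longrightarrow> B X Z (t_cmp T X Y Z G F)"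
  shows "strict_2category (sub_2cat T A B)"
proof -
  interpret strict_2category T by fact
  note S = hom_simps cmp_simps
  show ?thesis
  proof (rule strict_2category.intro, goal_cases)
    case (1 X Y) then show ?case by (simp add: category_full_sub hom_cat)
  next
    case (2 X) then show ?case by (simp add: id_ob assms(2))
  next
    case (3 X Y Z)
    show ?case
    proof (rule is_functorI, goal_cases)
      case (3 GF) then show ?case using \<open>X \<in> t_ob (sub_2cat T A B)\<close> \<open>Y \<in> t_ob (sub_2cat T A B)\<close> \<open>Z \<in> t_ob (sub_2cat T A B)\<close>
        by (cases GF) (simp add: S assms(3))
    next
      case (4 ba) then show ?case using \<open>X \<in> t_ob (sub_2cat T A B)\<close> \<open>Y \<in> t_ob (sub_2cat T A B)\<close> \<open>Z \<in> t_ob (sub_2cat T A B)\<close>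
        by (cases ba) (simp add: S assms(3))
    next
      case (5 GF) then show ?case using \<open>X \<in> t_ob (sub_2cat T A B)\<close> \<open>Y \<in> t_ob (sub_2cat T A B)\<close> \<open>Z \<in> t_ob (sub_2cat T A B)\<close>
        by (cases GF) (simp add: S)
    next
      case (6 ba ba') then show ?case using \<open>X \<in> t_ob (sub_2cat T A B)\<close> \<open>Y \<in> t_ob (sub_2cat T A B)\<close> \<open>Z \<in> t_ob (sub_2cat T A B)\<close>
        by (cases ba; cases ba') (simp add: S)
    qed (use 3 in \<open>simp_all add: category_prod category_full_sub hom_cat\<close>)
  qed (simp_all add: unit_left unit_right assoc unit2_left unit2_right assoc2)
qed

text \<open>The predicates match along \<open>K\<close>, so bijectivity restricts. The components of
  \<open>\<epsilon>\<close> and \<open>\<epsilon>'\<close> belong to the restriction because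
  \<open>K\<close> sends them to identities, which satisfy \<open>B'\<close>.\<close>

lemma hom_bijection_sub:
  assumes "hom_bijection T T' K P \<epsilon> \<epsilon>'" "strict_2category (sub_2cat T A B)"
    and A: "\<And>X. X \<in> t_ob T \<Longrightarrow> A X \<longleftrightarrow> A' (tf_ob K X)"
    and B: "\<And>X Y F. X \<in> t_ob T \<Longrightarrow> Y \<in> t_ob T \<Longrightarrow> F \<in> obs (t_hom T X Y) \<Longrightarrow>
      B X Y F \<longleftrightarrow> B' (tf_ob K X) (tf_ob K Y) (fo (tf_hom K X Y) F)"
    and id: "\<And>x. x \<in> t_ob T' \<Longrightarrow> A' x \<Longrightarrow> B' x x (t_id T' x)"
  shows "hom_bijection (sub_2cat T A B) (sub_2cat T' A' B') K P \<epsilon> \<epsilon>'"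
proof -
  interpret hom_bijection T T' K P \<epsilon> \<epsilon>' by fact
  have PB: "B (PO x) (PO y) (PM x y f) \<longleftrightarrow> B' x y f" if "x \<in> t_ob T'" "y \<in> t_ob T'" "f \<in> obs (H' x y)" for x y f
    using B[of "PO x" "PO y" "PM x y f"] that by simp
  show ?thesis
  proof (rule hom_bijection.intro[OF assms(2) hom_bijection_axioms.intro], goal_cases)
    case (15 X) then show ?case using \<epsilon>[of X] A[of "PO (KO X)"] A[of X] B[of "PO (KO X)" X "\<epsilon> X"] id[of "KO X"] by simp
  next
    case (16 X) then show ?case using \<epsilon>'[of X] A[of "PO (KO X)"] A[of X] B[of X "PO (KO X)" "\<epsilon>' X"] id[of "KO X"] by simp
  next
    case (1 X) then show ?case using A[of X] by simp
  next
    case (4 X Y F) then show ?case using B[of X Y F] K_mor[of X Y F] by simp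
  next
    case (5 X Y F G) then show ?case using K_mor_inj[of X Y F G] by simp
  next
    case (6 X Y a)
    then show ?case using B[of X Y "src (H X Y) a"] B[of X Y "tgt (H X Y) a"] K_cell[of X Y a] by simp
  next
    case (7 X Y a b) then show ?case using K_cell_inj[of X Y a b] by simp
  qed (simp_all add: A PB K_idn K_vcmp K_id K_cmp K_cmp2)
qed

section \<open>The equivalences\<close>

lemma PreCwA_simps [simp]:
  "t_ob (PreCwA U) = {X. is_precwa U X}" "t_hom (PreCwA U) = cwa_hom" "t_id (PreCwA U) = cwa_id"
  "t_cmp (PreCwA U) = cwa_cmp" "t_cmp2 (PreCwA U) = cwa_cmp2"
  by (simp_all add: PreCwA_def)

lemma cwa_hom_simps [simp]:
  "obs (cwa_hom X Y) = {F. is_cwa_mor X Y F}" "ars (cwa_hom X Y) = {a. is_cwa_cell X Y a}"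
  "src (cwa_hom X Y) = cc_src" "tgt (cwa_hom X Y) = cc_tgt"
  by (simp_all add: cwa_hom_def)

lemma functor_simps [simp]:
  "tf_ob C_functor = C_ob" "fo (tf_hom C_functor N M) = C_mor N M" "fa (tf_hom C_functor N M) = C_cell N M"
  "tf_ob (P_functor U) = P_ob U" "fo (tf_hom (P_functor U) X Y) = P_mor U X Y" "fa (tf_hom (P_functor U) X Y) = P_cell U X Y"
  by (simp_all add: C_functor_def P_functor_def)

text \<open>The identity of \<open>C_ob N\<close> can be lifted in both directions between
  \<open>N\<close> and \<open>P_ob U (C_ob N)\<close>, since \<open>C_ob\<close> takes both to the
  same pre-CwA; the two lifts are the counit and its inverse.\<close>

lemma hom_bijection_PreNM:
  assumes "is_universe U"
  shows "hom_bijection (PreNM U) (PreCwA U) C_functor (P_functor U)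
    (\<lambda>N. C_inv (P_ob U (C_ob N)) N (cwa_id (C_ob N))) (\<lambda>N. C_inv N (P_ob U (C_ob N)) (cwa_id (C_ob N)))"
proof -
  have pX: "precwa U X" if "is_precwa U X" for X using assms that by (simp add: precwa_def precwa_axioms_def)
  have P: "is_prenm U (P_ob U X)" "C_ob (P_ob U X) = X" if "is_precwa U X" for X
    using precwa.is_prenm_P_ob[OF pX[OF that]] precwa.C_ob_P_ob[OF pX[OF that]] by auto
  have pF: "P_mor U X Y F = C_inv (P_ob U X) (P_ob U Y) F" if "is_precwa U X" "is_precwa U Y" "is_cwa_mor X Y F" for X Y F
    using that pX by (intro cwa_mor.P_mor_eq) (simp add: cwa_mor_def cwa_mor_axioms_def)
  have id: "is_cwa_mor (C_ob N) (C_ob N) (cwa_id (C_ob N))" if "is_prenm U N" for N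
    using nm_mor.is_cwa_mor_C_mor[OF nm_mor_id[OF that]] prenm.C_mor_id[of U N] that by (simp add: prenm_def)
  show ?thesis
  proof (rule hom_bijection.intro[OF strict_2category_PreNM hom_bijection_axioms.intro], goal_cases)
    case (1 N) then show ?case by (simp add: is_precwa_C_ob)
  next
    case (2 X) then show ?case by (simp add: P)
  next
    case (3 X) then show ?case by (simp add: P)
  next
    case (4 N M F) then show ?case using nm_mor.is_cwa_mor_C_mor[of U N M F] by (simp add: nm_mor_iff)
  next
    case (5 N M F G) then show ?case using C_mor_inj[of U N M F G] by (simp add: nm_mor_iff)
  next
    case (6 N M a)
    then interpret nm_cell U N M a by (simp add: nm_cell_iff)
    show ?case using is_cwa_cell_C_cell by simp (simp add: C_cell_def)
  next
    case (7 N M a b) then show ?case using C_cell_inj[of U N M a b] by (simp add: nm_cell_iff)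
  next
    case (8 X Y F) then show ?case using C_inv[of U "P_ob U X" "P_ob U Y" F] by (simp add: P pF nm_mor_iff)
  next
    case (9 X Y a) then show ?case using C_inv_cell[of U "P_ob U X" "P_ob U Y" a] P_cell_eq[OF assms, of X Y a] by (simp add: P nm_cell_iff)
  next
    case (10 N M F) then show ?case by (simp add: C_cell_ops)
  next
    case (11 N M a b) then show ?case by (simp add: C_cell_ops)
  next
    case (12 N) then show ?case using prenm.C_mor_id[of U N] by (simp add: prenm_def)
  next
    case (13 N M L F G) then show ?case using C_mor_cmp[of U N M F L G] by (simp add: nm_mor_iff)
  next
    case (14 N M L a b) then show ?case using C_cell_hcmp[of U N M a L b] by (simp add: nm_cell_iff)
  next
    case (15 N) then show ?case using C_inv[of U "P_ob U (C_ob N)" N "cwa_id (C_ob N)"] id[of N]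
      by (simp add: P is_precwa_C_ob nm_mor_iff)
  next
    case (16 N) then show ?case using C_inv[of U N "P_ob U (C_ob N)" "cwa_id (C_ob N)"] id[of N]
      by (simp add: P is_precwa_C_ob nm_mor_iff)
  qed
qed

lemma nm_tau_invertible_iff: "nm_tau_invertible N M F \<longleftrightarrow> tau_invertible (C_ob N) (C_ob M) (C_mor N M F)"
  by (simp add: nm_tau_invertible_def tau_invertible_def tau_src_def tau_tgt_def C_mor_def)

lemma is_nm_iff: "is_nm N \<longleftrightarrow> is_cwa (C_ob N)"
  by (simp add: is_nm_def is_cwa_def)

text \<open>Makes invertibility a condition on components, so that closure under composition
  concerns isomorphisms in single fibres.\<close>

lemma tau_invertible_iff:
  assumes "is_cwa_mor X Y F"
  shows "tau_invertible X Y F \<longleftrightarrow> (\<forall>\<Gamma>\<in>obs (c_base X). \<forall>A\<in>obs (fib (c_tp X) \<Gamma>).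
    is_iso (dfib (c_base Y) (fo (cm_base F) \<Gamma>)) (cm_tau F \<Gamma> A))"
  using assms invertible_itransI[of "c_base X" "c_tp X" "bc (cm_base F) (dic (c_base Y))" "tau_src X Y (cm_base F)" "tau_tgt X Y (cm_base F) (cm_tp F)" "cm_tau F"]
    invertible_itrans_iso[of "c_base X" "c_tp X" "bc (cm_base F) (dic (c_base Y))" "tau_src X Y (cm_base F)" "tau_tgt X Y (cm_base F) (cm_tp F)" "cm_tau F"]
  unfolding tau_invertible_def is_cwa_mor_def by auto

lemma nm_tau_invertible_iff_iso:
  assumes "nm_mor U N M F"
  shows "nm_tau_invertible N M F \<longleftrightarrow> (\<forall>\<Gamma>\<in>obs (n_base N). \<forall>A\<in>obs (fib (n_tp N) \<Gamma>).
    is_iso (dfib (n_base M) (fo (nm_base F) \<Gamma>)) (cm_tau (C_mor N M F) \<Gamma> A))"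
  using tau_invertible_iff[OF nm_mor.is_cwa_mor_C_mor[OF assms]] by (simp add: nm_tau_invertible_iff) (simp add: C_mor_def)

lemma tau_invertible_id:
  assumes "is_prenm U N" shows "nm_tau_invertible N N (nm_id N)"
proof -
  interpret prenm U N by unfold_locales fact
  show ?thesis
    unfolding nm_tau_invertible_iff_iso[OF nm_mor_id[OF assms]] C_mor_id
    by (auto simp: cwa_id_def simp del: dfib_simps(5) intro!: category.is_iso_idn[OF B.category_dfib])
qed

text \<open>The component of \<tau> for the composite is a component for \<open>G\<close> after the
  image under \<open>G\<close> of a component for \<open>F\<close>; functors between fibres of
  displays preserve isomorphisms.\<close>

lemma tau_invertible_cmp:
  assumes "nm_mor U N M F" "nm_mor U M L G" "nm_tau_invertible N M F" "nm_tau_invertible M L G"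
  shows "nm_tau_invertible N L (nm_cmp N M L G F)"
proof -
  interpret F: nm_mor U N M F by fact
  interpret G: nm_mor U M L G by fact
  show ?thesis
    unfolding nm_tau_invertible_iff_iso[OF nm_mor_comp[OF assms(1,2)]] C_mor_cmp[OF assms(1,2)]
  proof (intro ballI)
    fix \<Gamma> A assume A: "\<Gamma> \<in> obs (n_base N)" "A \<in> obs (fib (n_tp N) \<Gamma>)"
    let ?X = "fo (nm_base F) \<Gamma>"
    have f: "is_iso (dfib (n_base M) ?X) (cm_tau (C_mor N M F) \<Gamma> A)"
      using assms(3) A nm_tau_invertible_iff_iso[OF assms(1)] by blast
    have g: "is_iso (dfib (n_base L) (fo (nm_base G) ?X)) (cm_tau (C_mor M L G) ?X (fo (cp (nm_tp F) \<Gamma>) A))"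
      using assms(4) A nm_tau_invertible_iff_iso[OF assms(2)] by simp
    have X: "?X \<in> obs (n_base M)" using A by simp
    have "is_iso (dfib (n_base L) (fo (nm_base G) ?X)) (fa (cp (dfun (n_base M) (n_base L) (nm_base G)) ?X) (cm_tau (C_mor N M F) \<Gamma> A))"
      using is_functor.map_iso[OF indexed_functor.cp_functor[OF G.base.indexed_functor_dfun X], of "cm_tau (C_mor N M F) \<Gamma> A"] f by simp
    then have "is_iso (dfib (n_base L) (fo (nm_base G) ?X)) (cmp (dfib (n_base L) (fo (nm_base G) ?X))
        (cm_tau (C_mor M L G) ?X (fo (cp (nm_tp F) \<Gamma>) A))
        (fa (cp (dfun (n_base M) (n_base L) (nm_base G)) ?X) (cm_tau (C_mor N M F) \<Gamma> A)))"
      using g A by (intro category.is_iso_cmp[OF G.M.B.category_dfib]) (simp_all add: C_mor_def F.nm_tau_simp G.nm_tau_simp)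
    then show "is_iso (dfib (n_base L) (fo (nm_base (nm_cmp N M L G F)) \<Gamma>))
        (cm_tau (cwa_cmp (C_ob N) (C_ob M) (C_ob L) (C_mor M L G) (C_mor N M F)) \<Gamma> A)"
      using A by (simp add: cwa_cmp_def Let_def) (simp add: C_mor_def)
  qed
qed

theorem theorem3p4p7:
  fixes U :: "'u universe"
  assumes "is_universe U"
  shows "\<exists>\<eta> \<epsilon>.
    strict_2equivalence (PreCwA U) (PreNM U) (P_functor U) C_functor \<eta> \<epsilon> \<and>
    strict_2equivalence (CwA U) (NM U) (P_functor U) C_functor \<eta> \<epsilon>"
proof -
  let ?\<epsilon> = "\<lambda>N. C_inv (P_ob U (C_ob N)) N (cwa_id (C_ob N))"
  note pre = hom_bijection_PreNM[OF assms]
  interpret hom_bijection "PreNM U" "PreCwA U" C_functor "P_functor U" ?\<epsilon> "\<lambda>N. C_inv N (P_ob U (C_ob N)) (cwa_id (C_ob N))"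
    by (rule pre)
  have NM: "strict_2category (sub_2cat (PreNM U) is_nm nm_tau_invertible)"
    by (rule strict_2category_sub[OF strict_2category_PreNM])
      (auto simp: nm_mor_iff intro: tau_invertible_id tau_invertible_cmp[of U])
  \<comment> \<open>Transferred from natural models: \<open>cwa_id X\<close> is the image under
    \<open>C_mor\<close> of the identity of \<open>P_ob U X\<close>.\<close>
  have id: "tau_invertible X X (cwa_id X)" if "is_precwa U X" for X
  proof -
    interpret X: precwa U X using assms that by (simp add: precwa_def precwa_axioms_def)
    interpret N: prenm U "P_ob U X" by unfold_locales (rule X.is_prenm_P_ob)
    show ?thesis using tau_invertible_id[OF N.prenm] N.C_mor_id by (simp add: nm_tau_invertible_iff X.C_ob_P_ob)
  qed
  have "hom_bijection (NM U) (CwA U) C_functor (P_functor U) ?\<epsilon> (\<lambda>N. C_inv N (P_ob U (C_ob N)) (cwa_id (C_ob N)))"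
    unfolding NM_def CwA_def
    by (rule hom_bijection_sub[OF pre NM]) (simp_all add: is_nm_iff nm_tau_invertible_iff id)
  \<comment> \<open>\<open>sub_2cat\<close> keeps the identity 1-cells, so \<open>t_id\<close> is
    the same for \<open>CwA U\<close> and \<open>PreCwA U\<close>, and both equivalences share their
    unit as well as their counit.\<close>
  from hom_bijection.strict_2equivalence[OF this] strict_2equivalence show ?thesis
    by (auto simp: CwA_def)
qed

end
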